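(* The metric space $(\Pi_K,d_{\Pi,K})$ is compact. The map \[(\mathcal D,d_\tau)\longrightarrow(\Pi_K,d_{\Pi,K}),\qquad X\longmapsto\mathcal P_{\mathsf C_\tau(X)}\] is a topological embedding with dense image.
   Context: A geometric data set is a triple $(X,F_X,\mu_X)$ where $F_X$ is a nonempty family of real-valued functions (features) on $X$ such that $d_X(x,x'):=\sup_{f\in F_X}|f(x)-f(x')|$ is a (finite) complete separable metric on $X$, and $\mu_X$ is a Borel probability measure on $(X,d_X)$ with full support. $\overline{F_X}$ denotes the closure of $F_X$ in the set of real-valued functions on $X$ under pointwise convergence. $X$ and $Y$ are isomorphic if there is a Borel map $\phi:X\to Y$ with $\phi_*\mu_X=\mu_Y$ and $\overline{F_Y}\circ\phi=\overline{F_X}$. Isomorphic geometric data sets are identified; $\mathcal D$ is the set of isomorphism classes. $\mathcal T(\mu,\nu)$ is the set of couplings of $\mu,\nu$ (Borel probability measures on the product with marginals $\mu,\nu$); $\mathrm{pr}_1,\mathrm{pr}_2$ are the coordinate projections; $(d)_H$ is the Hausdorff distance induced by $d$. Compactified observable distance. $\tau:\mathbb R\to(-1/2,1/2)$, $\tau(r)=\frac12\tanh r$. $\mathsf K_\tau(X)$ is the pointwise closure of $\{\tau\circ f\mid f\in F_X\}$. With $d_{1,\pi}(u,v)=\int|u-v|\,d\pi$, set $D_\tau^\pi(X,Y):=(d_{1,\pi})_H(\mathsf K_\tau(X)\circ\mathrm{pr}_1,\mathsf K_\tau(Y)\circ\mathrm{pr}_2)$ for $\pi\in\mathcal T(\mu_X,\mu_Y)$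 and $d_\tau(X,Y):=\inf_{\pi\in\mathcal T(\mu_X,\mu_Y)}D^\pi_\tau(X,Y)$; this is a metric on $\mathcal D$. Box distance. For a closed set $S\subset X\times Y$, $d_{\infty,S}(u,v):=\sup_{z\in S}|u(z)-v(z)|$ if $S\ne\varnothing$ and $d_{\infty,\varnothing}:=0$. Then \[\Box(X,Y):=\inf_{\pi\in\mathcal T(\mu_X,\mu_Y),\ S\subset X\times Y\text{ closed}}\max\{1-\pi(S),\,2(d_{\infty,S})_H(F_X\circ\mathrm{pr}_1,F_Y\circ\mathrm{pr}_2)\},\] which is a metric on $\mathcal D$. Compact screen. Let $K=[-1/2,1/2]$ and let $\mathcal D_K\subset\mathcal D$ be the set of classes whose features take values in $K$. For $X\in\mathcal D$ let $d_X^\tau(x,x'):=\sup_{f\in F_X}|\tau(f(x))-\tau(f(x'))|$, let $\widehat X^\tau$ be the completion of $(X,d_X^\tau)$ with canonical map $e_X^\tau:X\to\widehat X^\tau$, let $\widehat{\tau\circ f}$ be the unique continuous extension of $\tau\circ f$ to $\widehat X^\tau$, and $X^\tau:=\operatorname{supp}((e_X^\tau)_*\mu_X)$. The compact screen is $\mathsf C_\tau(X):=(X^\tau,\{\widehat{\tau\circ f}|_{X^\tau}\mid f\in F_X\},(e_X^\tau)_*\mu_X|_{X^\tau})\in\mathcal D_K$. Pyramids. Feature order: $Y\preceq X$ iff there is a Borel map $p:X\to Y$ with $p_*\mu_X=\mu_Y$ and $F_Y\circ p\subset\overline{F_X}$. A $K$-pyramid is a nonempty $\Box$-closed subset $\mathcal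 P\subset\mathcal D_K$ such that (1) if $X\in\mathcal P$, $Y\in\mathcal D_K$, $Y\preceq X$, then $Y\in\mathcal P$; (2) for $X,Y\in\mathcal P$ there is $Z\in\mathcal P$ with $X\preceq Z$ and $Y\preceq Z$. $\Pi_K$ is the set of $K$-pyramids. For $Z\in\mathcal D_K$, the principal pyramid is $\mathcal P_Z:=\{Y\in\mathcal D_K\mid Y\preceq Z\}\in\Pi_K$. For a positive integer $N$, $\mathcal{DM}_K(N)$ is the set of elements of $\mathcal D_K$ with at most $N$ features, and $\mathcal{DM}_K(\mathcal P;N):=\mathcal P\cap\mathcal{DM}_K(N)$. Finally \[d_{\Pi,K}(\mathcal P,\mathcal Q):=\sum_{N=1}^\infty\frac1{2N2^N}(\Box)_H(\mathcal{DM}_K(\mathcal P;N),\mathcal{DM}_K(\mathcal Q;N)).\] *)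

theory Defs
  imports "HOL-Probability.Probability"
begin

section \<open>Topological and metric preliminaries\<close>

definition borel_of :: "'a topology \<Rightarrow> 'a measure" where
  "borel_of T = sigma (topspace T) {U. openin T U}"

text \<open>Only meaningful for a measure on the Borel sets of the topology.\<close>

definition supp :: "'a topology \<Rightarrow> 'a measure \<Rightarrow> 'a set" where
  "supp T \<mu> = {x \<in> topspace T. \<forall>U. openin T U \<and> x \<in> U \<longrightarrow> emeasure \<mu> U > 0}"

text \<open>Functions on a carrier set X are represented by extensional functions, which are exactly
  the points of the product topology below; so sets of functions on X (and their cardinalities)
  are the genuine ones.\<close>

definition pointwise_closure :: "'a set \<Rightarrow> ('a \<Rightarrow> real) set \<Rightarrow> ('a \<Rightarrow> real) set" where
  "pointwise_closure X F = (product_topology (\<lambda>_. euclideanreal) X) closure_of F"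

text \<open>The values are extended because the distances between features may be infinite.\<close>

definition hausdorff :: "('a \<Rightarrow> 'a \<Rightarrow> ennreal) \<Rightarrow> 'a set \<Rightarrow> 'a set \<Rightarrow> ennreal" where
  "hausdorff d A B = max (SUP a\<in>A. INF b\<in>B. d a b) (SUP b\<in>B. INF a\<in>A. d a b)"

text \<open>The locale Metric_space also requires nonnegativity and symmetry off the carrier, hence
  the value 0 there (here and for the other metrics below).\<close>

definition feature_dist :: "'a set \<Rightarrow> ('a \<Rightarrow> real) set \<Rightarrow> 'a \<Rightarrow> 'a \<Rightarrow> real" where
  "feature_dist X F x y = (if x \<in> X \<and> y \<in> X then (SUP f\<in>F. \<bar>f x - f y\<bar>) else 0)"

text \<open>The completion of a metric space (M, d): Cauchy sequences modulo being at distance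
  tending to 0.\<close>

definition cauchy_rel ::
    "'a set \<Rightarrow> ('a \<Rightarrow> 'a \<Rightarrow> real) \<Rightarrow> ((nat \<Rightarrow> 'a) \<times> (nat \<Rightarrow> 'a)) set" where
  "cauchy_rel M d = {(s, t). Metric_space.MCauchy M d s \<and> Metric_space.MCauchy M d t
      \<and> (\<lambda>n. d (s n) (t n)) \<longlonglongrightarrow> 0}"

definition completion :: "'a set \<Rightarrow> ('a \<Rightarrow> 'a \<Rightarrow> real) \<Rightarrow> (nat \<Rightarrow> 'a) set set" where
  "completion M d = {s. Metric_space.MCauchy M d s} // cauchy_rel M d"

definition completion_dist ::
    "'a set \<Rightarrow> ('a \<Rightarrow> 'a \<Rightarrow> real) \<Rightarrow> (nat \<Rightarrow> 'a) set \<Rightarrow> (nat \<Rightarrow> 'a) set \<Rightarrow> real" where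
  "completion_dist M d A B =
     (if A \<in> completion M d \<and> B \<in> completion M d
      then lim (\<lambda>n. d ((SOME s. s \<in> A) n) ((SOME t. t \<in> B) n)) else 0)"

definition completion_map :: "'a set \<Rightarrow> ('a \<Rightarrow> 'a \<Rightarrow> real) \<Rightarrow> 'a \<Rightarrow> (nat \<Rightarrow> 'a) set" where
  "completion_map M d x = cauchy_rel M d `` {\<lambda>_. x}"

definition completion_topology ::
    "'a set \<Rightarrow> ('a \<Rightarrow> 'a \<Rightarrow> real) \<Rightarrow> (nat \<Rightarrow> 'a) set topology" where
  "completion_topology M d = Metric_space.mtopology (completion M d) (completion_dist M d)"


section \<open>Geometric data sets\<close>

record 'a dataset =
  points :: "'a set"
  features :: "('a \<Rightarrow> real) set"
  law :: "'a measure"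

definition data_dist :: "'a dataset \<Rightarrow> 'a \<Rightarrow> 'a \<Rightarrow> real" where
  "data_dist X = feature_dist (points X) (features X)"

definition data_topology :: "'a dataset \<Rightarrow> 'a topology" where
  "data_topology X = Metric_space.mtopology (points X) (data_dist X)"

text \<open>The boundedness clause says that the supremum defining the metric is finite.\<close>

definition geometric_dataset :: "'a dataset \<Rightarrow> bool" where
  "geometric_dataset X \<longleftrightarrow>
     features X \<noteq> {} \<and> features X \<subseteq> extensional (points X) \<and>
     (\<forall>x\<in>points X. \<forall>y\<in>points X. bdd_above ((\<lambda>f. \<bar>f x - f y\<bar>) ` features X)) \<and>
     Metric_space (points X) (data_dist X) \<and>
     Metric_space.mcomplete (points X) (data_dist X) \<and>
     separable_space (data_topology X) \<and>
     prob_space (law X) \<and>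
     space (law X) = points X \<and> sets (law X) = sets (borel_of (data_topology X)) \<and>
     supp (data_topology X) (law X) = points X"

definition feature_closure :: "'a dataset \<Rightarrow> ('a \<Rightarrow> real) set" where
  "feature_closure X = pointwise_closure (points X) (features X)"

definition isomorphic_data :: "'a dataset \<Rightarrow> 'b dataset \<Rightarrow> bool" where
  "isomorphic_data X Y \<longleftrightarrow>
     (\<exists>\<phi> \<in> measurable (law X) (law Y).
        distr (law X) (law Y) \<phi> = law Y \<and>
        (\<lambda>f. compose (points X) f \<phi>) ` feature_closure Y = feature_closure X)"

definition feature_le :: "'a dataset \<Rightarrow> 'b dataset \<Rightarrow> bool" where
  "feature_le Y X \<longleftrightarrow>
     (\<exists>p \<in> measurable (law X) (law Y).
        distr (law X) (law Y) p = law Y \<and>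
        (\<lambda>f. compose (points X) f p) ` features Y \<subseteq> feature_closure X)"

definition couplings :: "'a dataset \<Rightarrow> 'b dataset \<Rightarrow> ('a \<times> 'b) measure set" where
  "couplings X Y = {\<pi>. prob_space \<pi> \<and> space \<pi> = points X \<times> points Y \<and>
     sets \<pi> = sets (borel_of (prod_topology (data_topology X) (data_topology Y))) \<and>
     distr \<pi> (law X) fst = law X \<and> distr \<pi> (law Y) snd = law Y}"


section \<open>The compactified observable distance and the box distance\<close>

definition tau :: "real \<Rightarrow> real" where
  "tau r = tanh r / 2"

definition tau_features :: "'a dataset \<Rightarrow> ('a \<Rightarrow> real) set" where
  "tau_features X = (\<lambda>f. compose (points X) tau f) ` features X"

definition K_tau :: "'a dataset \<Rightarrow> ('a \<Rightarrow> real) set" where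
  "K_tau X = pointwise_closure (points X) (tau_features X)"

definition D_tau :: "('a \<times> 'b) measure \<Rightarrow> 'a dataset \<Rightarrow> 'b dataset \<Rightarrow> ennreal" where
  "D_tau \<pi> X Y =
     hausdorff (\<lambda>u v. \<integral>\<^sup>+z. ennreal \<bar>u z - v z\<bar> \<partial>\<pi>)
       ((\<lambda>f. f \<circ> fst) ` K_tau X) ((\<lambda>g. g \<circ> snd) ` K_tau Y)"

definition obs_dist :: "'a dataset \<Rightarrow> 'b dataset \<Rightarrow> ennreal" where
  "obs_dist X Y = (INF \<pi>\<in>couplings X Y. D_tau \<pi> X Y)"

text \<open>The supremum over the empty set is 0 in the extended nonnegative reals, as required.\<close>

definition sup_dist_on :: "'c set \<Rightarrow> ('c \<Rightarrow> real) \<Rightarrow> ('c \<Rightarrow> real) \<Rightarrow> ennreal" where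
  "sup_dist_on S u v = (SUP z\<in>S. ennreal \<bar>u z - v z\<bar>)"

definition box_dist :: "'a dataset \<Rightarrow> 'b dataset \<Rightarrow> ennreal" where
  "box_dist X Y =
     (INF \<pi>\<in>couplings X Y.
      INF S\<in>{S. closedin (prod_topology (data_topology X) (data_topology Y)) S}.
        max (ennreal (1 - measure \<pi> S))
            (2 * hausdorff (sup_dist_on S)
                   ((\<lambda>f. f \<circ> fst) ` features X) ((\<lambda>g. g \<circ> snd) ` features Y)))"


section \<open>The compact screen\<close>

definition tau_dist :: "'a dataset \<Rightarrow> 'a \<Rightarrow> 'a \<Rightarrow> real" where
  "tau_dist X = feature_dist (points X) (tau_features X)"

definition tau_completion_topology :: "'a dataset \<Rightarrow> (nat \<Rightarrow> 'a) set topology" where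
  "tau_completion_topology X = completion_topology (points X) (tau_dist X)"

definition tau_embedding :: "'a dataset \<Rightarrow> 'a \<Rightarrow> (nat \<Rightarrow> 'a) set" where
  "tau_embedding X = completion_map (points X) (tau_dist X)"

definition tau_pushforward :: "'a dataset \<Rightarrow> (nat \<Rightarrow> 'a) set measure" where
  "tau_pushforward X = distr (law X) (borel_of (tau_completion_topology X)) (tau_embedding X)"

definition tau_extension :: "'a dataset \<Rightarrow> ('a \<Rightarrow> real) \<Rightarrow> (nat \<Rightarrow> 'a) set \<Rightarrow> real" where
  "tau_extension X f =
     (THE g. g \<in> extensional (topspace (tau_completion_topology X)) \<and>
        continuous_map (tau_completion_topology X) euclideanreal g \<and>
        (\<forall>x\<in>points X. g (tau_embedding X x) = tau (f x)))"

definition screen_points :: "'a dataset \<Rightarrow> (nat \<Rightarrow> 'a) set set" where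
  "screen_points X = supp (tau_completion_topology X) (tau_pushforward X)"

definition compact_screen :: "'a dataset \<Rightarrow> (nat \<Rightarrow> 'a) set dataset" where
  "compact_screen X =
     \<lparr>points = screen_points X,
      features = (\<lambda>f. restrict (tau_extension X f) (screen_points X)) ` features X,
      law = restrict_space (tau_pushforward X) (screen_points X)\<rparr>"


section \<open>Isomorphism classes\<close>

text \<open>A separable metric space has at most the cardinality of the continuum, so every geometric
  data set is isomorphic to one whose points are real numbers (with an arbitrary metric,
  unrelated to that of the reals).  An isomorphism class is therefore represented by the set of
  its members with carrier contained in the type of real numbers; the data set X itself may live
  on any type.\<close>

type_synonym data_class = "real dataset set"

definition class_of :: "'a dataset \<Rightarrow> data_class" where
  "class_of X = {Y. geometric_dataset Y \<and> isomorphic_data X Y}"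

definition rep :: "data_class \<Rightarrow> real dataset" where
  "rep A = (SOME X. X \<in> A)"

definition DD :: "data_class set" where
  "DD = class_of ` {X :: real dataset. geometric_dataset X}"

definition K_valued :: "'a dataset \<Rightarrow> bool" where
  "K_valued X \<longleftrightarrow> (\<forall>f\<in>features X. \<forall>x\<in>points X. f x \<in> {-1/2..1/2})"

definition DD_K :: "data_class set" where
  "DD_K = class_of ` {X :: real dataset. geometric_dataset X \<and> K_valued X}"

definition DM_K :: "nat \<Rightarrow> data_class set" where
  "DM_K N = class_of ` {X :: real dataset. geometric_dataset X \<and> K_valued X \<and>
                          finite (features X) \<and> card (features X) \<le> N}"

definition d_tau :: "data_class \<Rightarrow> data_class \<Rightarrow> real" where
  "d_tau A B = (if A \<in> DD \<and> B \<in> DD then enn2real (obs_dist (rep A) (rep B)) else 0)"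

definition d_box :: "data_class \<Rightarrow> data_class \<Rightarrow> real" where
  "d_box A B = (if A \<in> DD \<and> B \<in> DD then enn2real (box_dist (rep A) (rep B)) else 0)"

definition class_le :: "data_class \<Rightarrow> data_class \<Rightarrow> bool" where
  "class_le A B \<longleftrightarrow> feature_le (rep A) (rep B)"

definition screen_class :: "data_class \<Rightarrow> data_class" where
  "screen_class A = class_of (compact_screen (rep A))"


section \<open>Pyramids\<close>

definition K_pyramid :: "data_class set \<Rightarrow> bool" where
  "K_pyramid P \<longleftrightarrow>
     P \<noteq> {} \<and> P \<subseteq> DD_K \<and> closedin (Metric_space.mtopology DD d_box) P \<and>
     (\<forall>A\<in>P. \<forall>B\<in>DD_K. class_le B A \<longrightarrow> B \<in> P) \<and>
     (\<forall>A\<in>P. \<forall>B\<in>P. \<exists>C\<in>P. class_le A C \<and> class_le B C)"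

definition Pi_K :: "data_class set set" where
  "Pi_K = {P. K_pyramid P}"

definition principal_pyramid :: "data_class \<Rightarrow> data_class set" where
  "principal_pyramid A = {B \<in> DD_K. class_le B A}"

text \<open>The sum over N from 1 to infinity is indexed by N = Suc n.\<close>

definition d_Pi :: "data_class set \<Rightarrow> data_class set \<Rightarrow> real" where
  "d_Pi P Q = enn2real (\<Sum>n. ennreal (1 / (2 * real (Suc n) * 2 ^ Suc n)) *
     hausdorff (\<lambda>A B. ennreal (d_box A B)) (P \<inter> DM_K (Suc n)) (Q \<inter> DM_K (Suc n)))"

end

theory Submission
  imports Defs
begin

text \<open>Countable tuples of features are compared through their laws, which are measures on sequences of
  reals: a data set is determined by the law of a dense tuple, the feature order becomes equality
  of laws of tuples, and both distances are controlled by couplings that bring tuples close in mean.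
  Laws on the Hilbert cube form a compact space, so the classes with at most N features form a
  box-compact set and a sequence of pyramids has a subsequence converging level by level; the limit
  is directed because two tuples can be interleaved into one before passing to the limit.
  Continuity of the embedding holds since tuples of the screen of X are tuples of compactified
  features of X. For the inverse, a maximal separated tuple of compactified features of X can
  be traced in any nearby pyramid. For density, a finite part of a pyramid lies below one of its
  members, whose features are compactified real features after shrinking them slightly.\<close>

text \<open>Two couplings with a common marginal are classically glued by disintegration. Here they
  are glued along a countable measurable label of the middle space, so that the middle points agree
  only up to the diameter of a label cell. Hence every composition of couplings costs an extra
  error, arbitrarily small, and all constants below leave room for it. Limits of features are taken
  by sequential compactness of bounded families of 1-Lipschitz functions on a separable space. Real
  features may run off to infinity, so isomorphism and the definiteness of both metrics are treated
  through the compactified features \<open>K_tau\<close>, from which real ones are recovered at the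
  end. A law on sequences comes from a data set only if it is concentrated on a set that is
  separable for the supremum distance, which is finer than the product topology; this has to be
  established for every limit law that is realised. Between closeness in mean and in the box
  distance stands Markov's inequality: a mean error t * t is an error t off a set of mass t. This is
  where the squares t * t come from.\<close>

abbreviation L1 :: "'a measure => ('a => real) => ('a => real) => ennreal" where
  "L1 M f g \<equiv> \<integral>\<^sup>+x. ennreal \<bar>f x - g x\<bar> \<partial>M"

abbreviation L1c :: "('a \<times> 'b) measure => ('a => real) => ('b => real) => ennreal" where
  "L1c q f g \<equiv> \<integral>\<^sup>+z. ennreal \<bar>f (fst z) - g (snd z)\<bar> \<partial>q"

section \<open>Couplings and their gluing along countable labels\<close>

definition coupling_of :: "'a measure => 'b measure => ('a \<times> 'b) measure => bool" where
  "coupling_of M M' q \<longleftrightarrow> prob_space q & sets q = sets (M \<Otimes>\<^sub>M M') &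
     distr q M fst = M & distr q M' snd = M'"

lemma coupling_ofD:
  assumes "coupling_of M M' q"
  shows "prob_space q" "sets q = sets (M \<Otimes>\<^sub>M M')" "distr q M fst = M" "distr q M' snd = M'"
    "fst : measurable q M" "snd : measurable q M'" "space q = space M \<times> space M'"
proof -
  show 1: "prob_space q" "sets q = sets (M \<Otimes>\<^sub>M M')" "distr q M fst = M" "distr q M' snd = M'"
    using assms by (auto simp: coupling_of_def)
  show "fst : measurable q M" "snd : measurable q M'"
    using measurable_cong_sets[OF 1(2) refl, of M] measurable_cong_sets[OF 1(2) refl, of M'] by auto
  show "space q = space M \<times> space M'" using sets_eq_imp_space_eq[OF 1(2)] by (simp add: space_pair_measure)
qed

lemma coupling_of_distr:
  assumes p: "prob_space P" and f: "f : measurable P M" and g: "g : measurable P M'"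
    and "distr P M f = M" "distr P M' g = M'"
  shows "coupling_of M M' (distr P (M \<Otimes>\<^sub>M M') (%z. (f z, g z)))"
proof -
  have fg: "(%z. (f z, g z)) : measurable P (M \<Otimes>\<^sub>M M')" using f g by measurable
  have "distr (distr P (M \<Otimes>\<^sub>M M') (%z. (f z, g z))) M fst = distr P M f"
    "distr (distr P (M \<Otimes>\<^sub>M M') (%z. (f z, g z))) M' snd = distr P M' g"
    by (subst distr_distr[OF _ fg]; simp add: comp_def)+
  thus ?thesis using assms prob_space.prob_space_distr[OF p fg] unfolding coupling_of_def by auto
qed

lemma coupling_of_swap:
  assumes "coupling_of M M' q"
  shows "coupling_of M' M (distr q (M' \<Otimes>\<^sub>M M) (%z. (snd z, fst z)))"
  by (rule coupling_of_distr) (use coupling_ofD[OF assms] in auto)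

lemma coupling_of_product:
  assumes "prob_space M" "prob_space M'"
  shows "coupling_of M M' (M \<Otimes>\<^sub>M M')"
proof -
  interpret M: prob_space M by fact
  interpret M': prob_space M' by fact
  interpret pair_prob_space M M' ..
  have "distr (M \<Otimes>\<^sub>M M') M fst = M" by (rule M'.distr_pair_fst)
  moreover have "distr (M \<Otimes>\<^sub>M M') M' snd = M'"
  proof (rule measure_eqI)
    fix A assume "A : sets (distr (M \<Otimes>\<^sub>M M') M' snd)"
    hence A: "A : sets M'" by simp
    have "snd -` A Int space (M \<Otimes>\<^sub>M M') = space M \<times> A"
      using sets.sets_into_space[OF A] by (auto simp: space_pair_measure)
    thus "emeasure (distr (M \<Otimes>\<^sub>M M') M' snd) A = emeasure M' A" using A M'.emeasure_pair_measure_Times[of "space M" M A]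
      by (simp add: emeasure_distr M.emeasure_space_1)
  qed simp
  ultimately show ?thesis unfolding coupling_of_def using prob_space_axioms by auto
qed

text \<open>The product measure, reweighted so as to charge only pairs with equal labels.\<close>

lemma coupling_by_label:
  fixes c :: "'a => nat" and c' :: "'b => nat"
  assumes P: "prob_space P" and Q: "prob_space Q"
    and c[measurable]: "c : measurable P (count_space UNIV)"
    and c'[measurable]: "c' : measurable Q (count_space UNIV)"
    and eq: "distr P (count_space UNIV) c = distr Q (count_space UNIV) c'"
  obtains R where "coupling_of P Q R" "AE z in R. c (fst z) = c' (snd z)"
proof -
  interpret P: prob_space P by fact
  interpret Q: prob_space Q by fact
  interpret PQ: pair_prob_space P Q by unfold_locales
  define a where "a k = emeasure P (c -` {k} Int space P)" for k
  have a': "a k = emeasure Q (c' -` {k} Int space Q)" for k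
    using arg_cong[OF eq, of "%m. emeasure m {k}"] by (simp add: a_def emeasure_distr)
  have atop: "a k ~= \<infinity>" for k by (simp add: a_def)
  have am: "emeasure P {x : space P. c x = k} = a k" for k unfolding a_def by (rule arg_cong[of _ _ "emeasure P"]) auto
  have am': "emeasure Q {x : space Q. c' x = k} = a k" for k unfolding a' by (rule arg_cong[of _ _ "emeasure Q"]) auto
  define b where "b x = inverse (a (c x))" for x
  \<comment> \<open>Dividing by the mass of the label makes the two points independent given their
    common label, and gives label k the mass \<open>a k\<close> again.\<close>
  define w where "w z = (if c (fst z) = c' (snd z) then inverse (a (c (fst z))) else 0)" for z
  have [measurable]: "b : borel_measurable P" unfolding b_def by (rule measurable_compose[OF c]) simp
  \<comment> \<open>Equality of the labels is split into countably many values, each of which is a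
    measurable condition.\<close>
  have "Measurable.pred (P \<Otimes>\<^sub>M Q) (%z. EX k. c (fst z) = k & c' (snd z) = k)" by measurable
  hence [measurable]: "Measurable.pred (P \<Otimes>\<^sub>M Q) (%z. c (fst z) = c' (snd z))"
    by (simp add: eq_commute cong: measurable_cong)
  have w[measurable]: "w : borel_measurable (P \<Otimes>\<^sub>M Q)" unfolding w_def b_def[symmetric] by measurable
  define R where "R = density (P \<Otimes>\<^sub>M Q) w"
  have sR: "sets R = sets (P \<Otimes>\<^sub>M Q)" by (simp add: R_def)
  \<comment> \<open>Labels of mass zero, where the weight is infinite, occur almost nowhere.\<close>
  have nzP: "AE x in P. a (c x) ~= 0"
  proof -
    have "AE x in P. ALL k. a k = 0 --> c x ~= k" unfolding AE_all_countable
    proof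
      fix k show "AE x in P. a k = 0 --> c x ~= k"
        by (cases "a k = 0") (use am[of k] in \<open>auto intro!: AE_I[of _ _ "{x : space P. c x = k}"]\<close>)
    qed
    thus ?thesis by auto
  qed
  have nzQ: "AE x in Q. a (c' x) ~= 0"
  proof -
    have "AE x in Q. ALL k. a k = 0 --> c' x ~= k" unfolding AE_all_countable
    proof
      fix k show "AE x in Q. a k = 0 --> c' x ~= k"
        by (cases "a k = 0") (use am'[of k] in \<open>auto intro!: AE_I[of _ _ "{x : space Q. c' x = k}"]\<close>)
    qed
    thus ?thesis by auto
  qed
  have I1: "(\<integral>\<^sup>+q. w (p, q) \<partial>Q) = 1" if "a (c p) ~= 0" for p
  proof -
    have "(\<integral>\<^sup>+q. w (p, q) \<partial>Q) = (\<integral>\<^sup>+q. inverse (a (c p)) * indicator {x : space Q. c' x = c p} q \<partial>Q)"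
      by (intro nn_integral_cong) (auto simp: w_def indicator_def)
    also have "\<dots> = inverse (a (c p)) * a (c p)" by (subst nn_integral_cmult_indicator) (auto simp: am')
    also have "\<dots> = 1" using that atop
      by (metis divide_ennreal_def ennreal_divide_self infinity_ennreal_def mult.commute top.not_eq_extremum)
    finally show ?thesis .
  qed
  have I2: "(\<integral>\<^sup>+p. w (p, q) \<partial>P) = 1" if "a (c' q) ~= 0" for q
  proof -
    have "(\<integral>\<^sup>+p. w (p, q) \<partial>P) = (\<integral>\<^sup>+p. inverse (a (c' q)) * indicator {x : space P. c x = c' q} p \<partial>P)"
      by (intro nn_integral_cong) (auto simp: w_def indicator_def)
    also have "\<dots> = inverse (a (c' q)) * a (c' q)" by (subst nn_integral_cmult_indicator) (auto simp: am)
    also have "\<dots> = 1" using that atop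
      by (metis divide_ennreal_def ennreal_divide_self infinity_ennreal_def mult.commute top.not_eq_extremum)
    finally show ?thesis .
  qed
  have D1: "distr R P fst = P"
  proof (rule measure_eqI)
    fix A assume "A : sets (distr R P fst)"
    hence A[measurable]: "A : sets P" by simp
    have "emeasure (distr R P fst) A = emeasure R (fst -` A Int space (P \<Otimes>\<^sub>M Q))"
      by (subst emeasure_distr) (auto simp: R_def)
    also have "\<dots> = (\<integral>\<^sup>+z. w z * indicator (fst -` A Int space (P \<Otimes>\<^sub>M Q)) z \<partial>(P \<Otimes>\<^sub>M Q))"
      unfolding R_def by (subst emeasure_density) auto
    also have "\<dots> = (\<integral>\<^sup>+z. w z * indicator A (fst z) \<partial>(P \<Otimes>\<^sub>M Q))"
      by (intro nn_integral_cong) (auto simp: indicator_def)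
    also have "\<dots> = (\<integral>\<^sup>+p. \<integral>\<^sup>+q. w (p, q) * indicator A p \<partial>Q \<partial>P)"
      by (subst Q.nn_integral_fst[symmetric]) auto
    also have "\<dots> = (\<integral>\<^sup>+p. indicator A p \<partial>P)"
    proof (rule nn_integral_cong_AE, use nzP in eventually_elim)
      fix p assume "a (c p) ~= 0"
      thus "(\<integral>\<^sup>+q. w (p, q) * indicator A p \<partial>Q) = indicator A p" using I1[of p] by (cases "p : A") auto
    qed
    finally show "emeasure (distr R P fst) A = emeasure P A" by simp
  qed simp
  have D2: "distr R Q snd = Q"
  proof (rule measure_eqI)
    fix A assume "A : sets (distr R Q snd)"
    hence A[measurable]: "A : sets Q" by simp
    have "emeasure (distr R Q snd) A = emeasure R (snd -` A Int space (P \<Otimes>\<^sub>M Q))"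
      by (subst emeasure_distr) (auto simp: R_def)
    also have "\<dots> = (\<integral>\<^sup>+z. w z * indicator (snd -` A Int space (P \<Otimes>\<^sub>M Q)) z \<partial>(P \<Otimes>\<^sub>M Q))"
      unfolding R_def by (subst emeasure_density) auto
    also have "\<dots> = (\<integral>\<^sup>+z. w z * indicator A (snd z) \<partial>(P \<Otimes>\<^sub>M Q))"
      by (intro nn_integral_cong) (auto simp: indicator_def)
    also have "\<dots> = (\<integral>\<^sup>+q. \<integral>\<^sup>+p. w (p, q) * indicator A q \<partial>P \<partial>Q)"
      by (subst PQ.nn_integral_snd[symmetric]) auto
    also have "\<dots> = (\<integral>\<^sup>+q. indicator A q \<partial>Q)"
    proof (rule nn_integral_cong_AE, use nzQ in eventually_elim)
      fix q assume "a (c' q) ~= 0"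
      thus "(\<integral>\<^sup>+p. w (p, q) * indicator A q \<partial>P) = indicator A q" using I2[of q] by (cases "q : A") auto
    qed
    finally show "emeasure (distr R Q snd) A = emeasure Q A" by simp
  qed simp
  have "emeasure R (space R) = emeasure (distr R P fst) (space P)"
    by (subst emeasure_distr) (auto simp: R_def space_pair_measure intro!: arg_cong2[of _ _ _ _ emeasure])
  hence "prob_space R" unfolding D1 by (intro prob_spaceI) (simp add: P.emeasure_space_1)
  hence "coupling_of P Q R" using sR D1 D2 unfolding coupling_of_def by auto
  moreover have "AE z in R. c (fst z) = c' (snd z)" unfolding R_def by (subst AE_density) (auto simp: w_def)
  ultimately show thesis by (rule that)
qed

text \<open>The couplings p and q are themselves coupled, along labels of their inner marginals B
  and C. These may be different spaces: only the laws of the labels have to agree, and the outer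
  marginals of R still couple A with D.\<close>

lemma coupling_glue:
  fixes c :: "'b => nat" and c' :: "'c => nat"
  assumes p: "coupling_of A B p" and q: "coupling_of C D q"
    and c: "c : measurable B (count_space UNIV)" and c': "c' : measurable C (count_space UNIV)"
    and eq: "distr B (count_space UNIV) c = distr C (count_space UNIV) c'"
  obtains R where "coupling_of p q R" "AE z in R. c (snd (fst z)) = c' (fst (snd z))"
    "coupling_of A D (distr R (A \<Otimes>\<^sub>M D) (%z. (fst (fst z), snd (snd z))))"
proof -
  note p' = coupling_ofD[OF p] and q' = coupling_ofD[OF q]
  have "distr p (count_space UNIV) (c \<circ> snd) = distr (distr p B snd) (count_space UNIV) c"
    by (rule distr_distr[symmetric]) (use c p' in auto)
  moreover have "distr q (count_space UNIV) (c' \<circ> fst) = distr (distr q C fst) (count_space UNIV) c'"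
    by (rule distr_distr[symmetric]) (use c' q' in auto)
  ultimately have "distr p (count_space UNIV) (c \<circ> snd) = distr q (count_space UNIV) (c' \<circ> fst)" using p' q' eq by simp
  from coupling_by_label[OF p'(1) q'(1) measurable_comp[OF p'(6) c] measurable_comp[OF q'(5) c'] this]
  obtain R where R: "coupling_of p q R" "AE z in R. c (snd (fst z)) = c' (fst (snd z))" unfolding comp_def by blast
  note R' = coupling_ofD[OF R(1)]
  have "coupling_of A D (distr R (A \<Otimes>\<^sub>M D) (%z. (fst (fst z), snd (snd z))))"
  proof (rule coupling_of_distr)
    show "(%z. fst (fst z)) : measurable R A" using measurable_compose[OF R'(5) p'(5)] .
    show "(%z. snd (snd z)) : measurable R D" using measurable_compose[OF R'(6) q'(6)] .
    show "distr R A (%z. fst (fst z)) = A" using distr_distr[OF p'(5) R'(5)] p' R' by (simp add: comp_def)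
    show "distr R D (%z. snd (snd z)) = D" using distr_distr[OF q'(6) R'(6)] q' R' by (simp add: comp_def)
  qed (fact R')
  with R show thesis using that by simp
qed

section \<open>Tuples coupled in mean, and the laws that they determine\<close>

definition coupled ::
  "nat => real => 'a measure => (nat => 'a => real) => 'b measure => (nat => 'b => real) => bool" where
  "coupled N e M F M' G \<longleftrightarrow> (EX q. coupling_of M M' q &
     (ALL i<N. (L1c q (F i) (G i)) <= ennreal e))"

definition seq_law :: "'a measure => (nat => 'a => real) => (nat => real) measure" where
  "seq_law M F = distr M borel (%x i. F i x)"

lemma seq_measurable:
  assumes "!!i. F i : borel_measurable M"
  shows "(%x (i::nat). (F i x :: real)) : borel_measurable M" using assms by (rule measurable_coordinatewise_then_product)

lemma coord_measurable [measurable]: "(%x :: nat => real. x i) : borel_measurable borel"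
  by (rule measurable_product_then_coordinatewise) simp

lemma prob_seq_law:
  assumes "prob_space M" "!!i. F i : borel_measurable M"
  shows "prob_space (seq_law M F)" unfolding seq_law_def by (rule prob_space.prob_space_distr[OF assms(1) seq_measurable[OF assms(2)]])

lemma sets_seq_law [simp]: "sets (seq_law M F) = sets borel"
  and space_seq_law [simp]: "space (seq_law M F) = UNIV" by (auto simp: seq_law_def)

lemma seq_law_distr:
  assumes "h : measurable M M'" "!!i. F i : borel_measurable M'"
  shows "seq_law (distr M M' h) F = seq_law M (%i x. F i (h x))"
  unfolding seq_law_def by (subst distr_distr[OF seq_measurable[OF assms(2)] assms(1)]) (simp add: comp_def)

lemma seq_law_coords: "sets m = sets borel ==> seq_law m (%i x. x i) = m"
  unfolding seq_law_def by (rule distr_id2) simp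

lemma coupled_mono: "coupled N e M F M' G ==> K <= N ==> e <= e' ==> coupled K e' M F M' G"
  unfolding coupled_def by (meson ennreal_leI less_le_trans order_trans)

lemma coupled_sym:
  assumes "coupled N e M F M' G" and [measurable]: "!!i. F i : borel_measurable M" "!!i. G i : borel_measurable M'"
  shows "coupled N e M' G M F"
proof -
  obtain q where q: "coupling_of M M' q"
    "!!i. i < N ==> (L1c q (F i) (G i)) <= ennreal e" using assms unfolding coupled_def by auto
  note [measurable] = coupling_ofD(5,6)[OF q(1)]
  have "(L1c ((distr q (M' \<Otimes>\<^sub>M M) (%z. (snd z, fst z)))) (G i) (F i))
    = (L1c q (F i) (G i))" for i by (subst nn_integral_distr) (auto simp: abs_minus_commute)
  thus ?thesis using coupling_of_swap[OF q(1)] q(2) unfolding coupled_def by auto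
qed

lemma coupled_same:
  assumes "prob_space M" and [measurable]: "!!i. F i : borel_measurable M" "!!i. G i : borel_measurable M"
    and le: "!!i. i < N ==> (L1 M (F i) (G i)) <= ennreal e"
  shows "coupled N e M F M G"
proof -
  have "coupling_of M M (distr M (M \<Otimes>\<^sub>M M) (%z. (z, z)))"
    by (rule coupling_of_distr) (use assms in \<open>auto simp: distr_id2\<close>)
  moreover have "(L1c ((distr M (M \<Otimes>\<^sub>M M) (%z. (z, z)))) (F i) (G i))
     = (L1 M (F i) (G i))" for i by (subst nn_integral_distr) auto
  ultimately show ?thesis unfolding coupled_def using le by auto
qed

text \<open>Cells of a grid of mesh d in the first N coordinates, numbered by naturals. They serve
  as labels for \<open>coupling_glue\<close>.\<close>

lemma coord_label:
  assumes "d > 0"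
  obtains c :: "(nat => real) => nat" where "c : measurable borel (count_space UNIV)"
    "!!x y i. c x = c y ==> i < N ==> \<bar>x i - y i\<bar> <= d"
proof -
  have "EX c : measurable borel (count_space UNIV). ALL (x :: nat => real) y. (c x :: nat) = c y --> (ALL i<N. \<bar>x i - y i\<bar> <= d)"
  proof (induction N)
    case 0
    show ?case by (rule bexI[of _ "%_. 0"]) auto
  next
    case (Suc N)
    then obtain c where c[measurable]: "c : measurable borel (count_space UNIV)"
      and cN: "!!(x :: nat => real) y i. (c x :: nat) = c y ==> i < N ==> \<bar>x i - y i\<bar> <= d" by blast
    define c' where "c' x = prod_encode (c x, int_encode \<lfloor>x N / d\<rfloor>)" for x
    have "c' : measurable borel (count_space UNIV)" unfolding c'_def by measurable
    moreover have "\<bar>x i - y i\<bar> <= d" if "c' x = c' y" "i < Suc N" for x y i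
    proof (cases "i < N")
      case False
      hence "i = N" using that by simp
      have "\<lfloor>x N / d\<rfloor> = \<lfloor>y N / d\<rfloor>"
        using that(1) unfolding c'_def by (metis int_encode_inverse prod.inject prod_encode_eq)
      hence "\<bar>x N / d - y N / d\<bar> <= 1" by linarith
      thus ?thesis using \<open>d > 0\<close> \<open>i = N\<close> by (simp add: field_simps abs_le_iff flip: diff_divide_distrib)
    qed (use that cN in \<open>auto simp: c'_def\<close>)
    ultimately show ?case by blast
  qed
  thus thesis using that by blast
qed

text \<open>The middle tuples may live on different spaces, since only their joint law enters:
  gluing along grid cells makes them agree up to d, which is the third summand of the error.\<close>

lemma coupled_trans:
  fixes M :: "'a measure" and M1 :: "'b measure" and M2 :: "'c measure" and M3 :: "'d measure"
  assumes FG: "coupled N a M F M1 G" and GH: "coupled N b M2 G' M3 H"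
    and eq: "seq_law M1 G = seq_law M2 G'" and "d > 0" "0 <= a" "0 <= b"
    and [measurable]: "!!i. F i : borel_measurable M" "!!i. G i : borel_measurable M1"
      "!!i. G' i : borel_measurable M2" "!!i. H i : borel_measurable M3"
  shows "coupled N (a + b + d) M F M3 H"
proof -
  obtain p where p: "coupling_of M M1 p"
    "!!i. i < N ==> (L1c p (F i) (G i)) <= ennreal a" using FG unfolding coupled_def by auto
  obtain q where q: "coupling_of M2 M3 q"
    "!!i. i < N ==> (L1c q (G' i) (H i)) <= ennreal b" using GH unfolding coupled_def by auto
  obtain c where c[measurable]: "c : measurable borel (count_space UNIV)"
    and cN: "!!(x :: nat => real) y i. (c x :: nat) = c y ==> i < N ==> \<bar>x i - y i\<bar> <= d"
    using coord_label[OF \<open>d > 0\<close>] by blast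
  have mG[measurable]: "(%x i. G i x) : borel_measurable M1" "(%x i. G' i x) : borel_measurable M2"
    by (auto intro!: seq_measurable)
  have "distr M1 (count_space UNIV) (%x. c (%i. G i x)) = distr (seq_law M1 G) (count_space UNIV) c"
    unfolding seq_law_def by (subst distr_distr) (auto simp: comp_def)
  also have "\<dots> = distr M2 (count_space UNIV) (%x. c (%i. G' i x))"
    unfolding eq unfolding seq_law_def by (subst distr_distr) (auto simp: comp_def)
  finally have eq': "distr M1 (count_space UNIV) (%x. c (%i. G i x)) = distr M2 (count_space UNIV) (%x. c (%i. G' i x))" .
  have m: "(%x. c (%i. G i x)) : measurable M1 (count_space UNIV)"
     "(%x. c (%i. G' i x)) : measurable M2 (count_space UNIV)" by measurable
  obtain R where R: "coupling_of p q R"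
     "AE z in R. c (%i. G i (snd (fst z))) = c (%i. G' i (fst (snd z)))"
     "coupling_of M M3 (distr R (M \<Otimes>\<^sub>M M3) (%z. (fst (fst z), snd (snd z))))"
    using coupling_glue[OF p(1) q(1) m eq'] by blast
  note [measurable] = coupling_ofD(5,6)[OF R(1)] coupling_ofD(5,6)[OF p(1)] coupling_ofD(5,6)[OF q(1)]
  interpret R: prob_space R using coupling_ofD(1)[OF R(1)] .
  have "(L1c ((distr R (M \<Otimes>\<^sub>M M3) (%z. (fst (fst z), snd (snd z))))) (F i) (H i)) <= ennreal (a + b + d)"
    if i: "i < N" for i
  proof -
    have "(L1c ((distr R (M \<Otimes>\<^sub>M M3) (%z. (fst (fst z), snd (snd z))))) (F i) (H i))
      = (\<integral>\<^sup>+z. ennreal \<bar>F i (fst (fst z)) - H i (snd (snd z))\<bar> \<partial>R)" by (subst nn_integral_distr) auto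
    also have "\<dots> <= (\<integral>\<^sup>+z. ennreal \<bar>F i (fst (fst z)) - G i (snd (fst z))\<bar> + ennreal \<bar>G' i (fst (snd z)) - H i (snd (snd z))\<bar> + ennreal d \<partial>R)"
    proof (rule nn_integral_mono_AE, use R(2) in eventually_elim)
      fix z :: "('a \<times> 'b) \<times> 'c \<times> 'd"
      assume "c (%i. G i (snd (fst z))) = c (%i. G' i (fst (snd z)))"
      from cN[OF this i] \<open>d > 0\<close> show "ennreal \<bar>F i (fst (fst z)) - H i (snd (snd z))\<bar> <= ennreal \<bar>F i (fst (fst z)) - G i (snd (fst z))\<bar> + ennreal \<bar>G' i (fst (snd z)) - H i (snd (snd z))\<bar> + ennreal d"
        by (subst ennreal_plus[symmetric], simp, simp)+ (rule ennreal_leI, linarith)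
    qed
    also have "\<dots> = (\<integral>\<^sup>+z. ennreal \<bar>F i (fst (fst z)) - G i (snd (fst z))\<bar> \<partial>R) + (\<integral>\<^sup>+z. ennreal \<bar>G' i (fst (snd z)) - H i (snd (snd z))\<bar> \<partial>R) + ennreal d"
      by (subst nn_integral_add; simp add: nn_integral_add R.emeasure_space_1)
    also have "(\<integral>\<^sup>+z. ennreal \<bar>F i (fst (fst z)) - G i (snd (fst z))\<bar> \<partial>R) = (L1c ((distr R p fst)) (F i) (G i))"
      by (subst nn_integral_distr) auto
    also have "\<dots> <= a" using p(2)[OF i] coupling_ofD(3)[OF R(1)] by simp
    also have "(\<integral>\<^sup>+z. ennreal \<bar>G' i (fst (snd z)) - H i (snd (snd z))\<bar> \<partial>R) = (L1c ((distr R q snd)) (G' i) (H i))"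
      by (subst nn_integral_distr) auto
    also have "\<dots> <= b" using q(2)[OF i] coupling_ofD(4)[OF R(1)] by simp
    finally show ?thesis using assms(4-6) by (simp add: add_mono ennreal_plus)
  qed
  with R(3) show ?thesis unfolding coupled_def by blast
qed

text \<open>The second coupling is the trivial one of cost 0, so exchanging a tuple for another of
  the same law costs only the mesh d.\<close>

lemma coupled_law_right:
  assumes "coupled N a M F M1 G" "seq_law M1 G = seq_law M2 G'" "d > 0" "0 <= a" "prob_space M2"
    "!!i. F i : borel_measurable M" "!!i. G i : borel_measurable M1" "!!i. G' i : borel_measurable M2"
  shows "coupled N (a + d) M F M2 G'"
proof -
  have "coupled N 0 M2 G' M2 G'" by (rule coupled_same) (simp_all add: assms(5,8))
  from coupled_trans[OF assms(1) this assms(2,3,4) order_refl] show ?thesis using assms(6-8) by (simp only: add_0_right)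
qed

lemma coupled_law_left:
  assumes "coupled N a M1 G M F" "seq_law M2 G' = seq_law M1 G" "d > 0" "0 <= a" "prob_space M2"
    "!!i. F i : borel_measurable M" "!!i. G i : borel_measurable M1" "!!i. G' i : borel_measurable M2"
  shows "coupled N (a + d) M2 G' M F"
proof -
  have "coupled N 0 M2 G' M2 G'" by (rule coupled_same) (simp_all add: assms(5,8))
  from coupled_trans[OF this assms(1-3) order_refl assms(4)] show ?thesis using assms(6-8) by (simp only: add_0_left)
qed

text \<open>Markov's inequality bounds the distribution functions of one tuple by those of the other
  at a point shifted by d. Letting first the mean error and then the shift tend to 0, by right
  continuity, gives equality on orthants, which form an intersection-stable generator.\<close>

lemma seq_law_eqI:
  assumes cp: "!!N e. e > 0 ==> coupled N e M F M' G" and p: "prob_space M" "prob_space M'"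
    and [measurable]: "!!i. F i : borel_measurable M" "!!i. G i : borel_measurable M'"
  shows "seq_law M F = seq_law M' G"
proof -
  interpret m: prob_space "seq_law M F" by (rule prob_seq_law) (use p in auto)
  interpret m': prob_space "seq_law M' G" by (rule prob_seq_law) (use p in auto)
  let ?B = "%J (a :: nat => real). {x. ALL i:J. x i <= a i}"
  define E where "E = {?B J a | J a. finite J}"
  have EI: "?B J a : E" if "finite J" for J a using that unfolding E_def by (intro CollectI exI conjI) auto
  have Bm[measurable]: "?B J a : sets borel" if "finite J" for J a
  proof -
    have "closed (\<Inter>i\<in>J. {x :: nat => real. x i <= a i})"
      by (intro closed_INT ballI closed_Collect_le) (auto intro!: continuous_on_product_coordinates)
    also have "(\<Inter>i\<in>J. {x. x i <= a i}) = ?B J a" by auto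
    finally show ?thesis by (rule borel_closed)
  qed
  \<comment> \<open>Stated for arbitrary spaces, as it is applied in both directions at the
    end.\<close>
  have key: "measure (seq_law M F) (?B J a) <= measure (seq_law M' G) (?B J a)"
    if cp: "!!N e. e > 0 ==> coupled N e M F M' G" and p: "prob_space M" "prob_space M'"
      and mF[measurable]: "!!i. F i : borel_measurable M" and mG[measurable]: "!!i. G i : borel_measurable M'" and "finite J"
    for M :: "'x measure" and M' :: "'y measure" and F G J a
  proof -
    interpret n: prob_space "seq_law M F" by (rule prob_seq_law) (use p in auto)
    interpret n': prob_space "seq_law M' G" by (rule prob_seq_law) (use p in auto)
    obtain N where N: "!!i. i : J ==> i < N" using \<open>finite J\<close> finite_nat_set_iff_bounded by auto
    have step: "measure (seq_law M F) (?B J a) <= measure (seq_law M' G) (?B J (%i. a i + d)) + real (card J) * (e / d)"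
      if "e > 0" "d > 0" for e d
    proof -
      obtain q where q: "coupling_of M M' q"
        "!!i. i < N ==> (L1c q (F i) (G i)) <= ennreal e"
        using cp[OF \<open>e > 0\<close>] unfolding coupled_def by auto
      note [measurable] = coupling_ofD(5,6)[OF q(1)]
      interpret q: prob_space q using coupling_ofD(1)[OF q(1)] .
      have q1: "seq_law M F = seq_law q (%i z. F i (fst z))" "seq_law M' G = seq_law q (%i z. G i (snd z))"
        using seq_law_distr[OF coupling_ofD(5)[OF q(1)], of F] seq_law_distr[OF coupling_ofD(6)[OF q(1)], of G]
          coupling_ofD(3,4)[OF q(1)] by auto
      have mm: "(%z i. F i (fst z)) : borel_measurable q" "(%z i. G i (snd z)) : borel_measurable q"
        by (rule seq_measurable[OF measurable_compose[OF coupling_ofD(5)[OF q(1)] mF]],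
            rule seq_measurable[OF measurable_compose[OF coupling_ofD(6)[OF q(1)] mG]])
      have A: "measure (seq_law M F) (?B J b) = measure q {z\<in>space q. ALL i:J. F i (fst z) <= b i}"
        "measure (seq_law M' G) (?B J b) = measure q {z\<in>space q. ALL i:J. G i (snd z) <= b i}" for b
        unfolding q1 unfolding seq_law_def measure_distr[OF mm(1) Bm[OF \<open>finite J\<close>, of b]] measure_distr[OF mm(2) Bm[OF \<open>finite J\<close>, of b]]
        by (auto intro!: arg_cong[of _ _ "measure q"])
      have mk: "measure q {z : space q. d <= \<bar>F i (fst z) - G i (snd z)\<bar>} <= e / d" if "i < N" for i
      proof -
        have "emeasure q {z : space q. 1 <= ennreal (1/d) * ennreal \<bar>F i (fst z) - G i (snd z)\<bar>}
            <= ennreal (1/d) * (\<integral>\<^sup>+z. ennreal \<bar>F i (fst z) - G i (snd z)\<bar> * indicator (space q) z \<partial>q)"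
          by (rule nn_integral_Markov_inequality) auto
        also have "\<dots> <= ennreal (1/d) * ennreal e"
          by (intro mult_left_mono order_trans[OF _ q(2)[OF that]] nn_integral_mono) (auto simp: indicator_def)
        also have "\<dots> = ennreal (e / d)" using \<open>e > 0\<close> \<open>d > 0\<close> by (simp flip: ennreal_mult)
        also have "{z : space q. 1 <= ennreal (1/d) * ennreal \<bar>F i (fst z) - G i (snd z)\<bar>} = {z : space q. d <= \<bar>F i (fst z) - G i (snd z)\<bar>}"
          using \<open>d > 0\<close> by (auto simp: field_simps simp flip: ennreal_mult)
        finally show ?thesis using \<open>e > 0\<close> \<open>d > 0\<close> by (simp add: q.emeasure_eq_measure)
      qed
      have "measure (seq_law M F) (?B J a) <= measure q ({z\<in>space q. ALL i:J. G i (snd z) <= a i + d} \<union> (\<Union>i\<in>J. {z : space q. d <= \<bar>F i (fst z) - G i (snd z)\<bar>}))"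
        unfolding A using \<open>finite J\<close> by (intro q.finite_measure_mono) (auto, force)
      also have "\<dots> <= measure q {z\<in>space q. ALL i:J. G i (snd z) <= a i + d} + measure q (\<Union>i\<in>J. {z : space q. d <= \<bar>F i (fst z) - G i (snd z)\<bar>})"
        using \<open>finite J\<close> by (intro measure_Un_le) auto
      also have "measure q (\<Union>i\<in>J. {z : space q. d <= \<bar>F i (fst z) - G i (snd z)\<bar>}) <= (\<Sum>i\<in>J. measure q {z : space q. d <= \<bar>F i (fst z) - G i (snd z)\<bar>})"
        using \<open>finite J\<close> by (intro measure_UNION_le) auto
      also have "\<dots> <= real (card J) * (e / d)" using mk N by (intro sum_bounded_above) auto
      finally show ?thesis unfolding A by simp
    qed
    have step2: "measure (seq_law M F) (?B J a) <= measure (seq_law M' G) (?B J (%i. a i + d))" if "d > 0" for d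
    proof (rule field_le_epsilon)
      fix e :: real assume "e > 0"
      \<comment> \<open>The mean error is so small against d that the Markov terms add up to at most
        e; the added 1 covers an empty J.\<close>
      have "real (card J) * (e * d / (card J + 1) / d) = e * (card J / (card J + 1))" using \<open>d > 0\<close> by simp
      also have "\<dots> <= e * 1" using \<open>e > 0\<close> by (intro mult_left_mono) auto
      finally show "measure (seq_law M F) (?B J a) <= measure (seq_law M' G) (?B J (%i. a i + d)) + e"
        using step[of "e * d / (card J + 1)" d] \<open>e > 0\<close> \<open>d > 0\<close> by auto
    qed
    have "(%n. measure (seq_law M' G) (?B J (%i. a i + 1 / real (Suc n)))) \<longlonglongrightarrow> measure (seq_law M' G) (\<Inter>n. ?B J (%i. a i + 1 / real (Suc n)))"
    proof (rule n'.finite_Lim_measure_decseq)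
      show "decseq (%n. ?B J (%i. a i + 1 / real (Suc n)))" unfolding decseq_def
      proof safe
        fix m n :: nat and x i assume "m <= n" "ALL i:J. x i <= a i + 1 / real (Suc n)" "i : J"
        moreover have "1 / real (Suc n) <= 1 / real (Suc m)" using \<open>m <= n\<close> by (simp add: frac_le)
        ultimately show "x i <= a i + 1 / real (Suc m)" by (meson add_left_mono order_trans)
      qed
    qed (use Bm[OF \<open>finite J\<close>] in auto)
    moreover have "(\<Inter>n. ?B J (%i. a i + 1 / real (Suc n))) = ?B J a"
    proof (intro antisym subsetI)
      fix x assume x: "x : (\<Inter>n. ?B J (%i. a i + 1 / real (Suc n)))"
      have "x i <= a i" if "i : J" for i
      proof (rule field_le_epsilon)
        fix e :: real assume "e > 0"
        then obtain n where "1 / real (Suc n) < e" using nat_approx_posE by blast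
        thus "x i <= a i + e" using x that by (auto dest!: spec[of _ n] bspec)
      qed
      thus "x : ?B J a" by auto
    qed (auto intro: order_trans)
    ultimately show ?thesis by (auto intro!: LIMSEQ_le_const step2)
  qed
  have cp': "coupled N e M' G M F" if "e > 0" for N e using cp[OF that] by (rule coupled_sym) auto
  have "sigma_sets UNIV E = sets borel"
  proof
    show "sigma_sets UNIV E <= sets borel" using sets.sigma_sets_subset[of E borel] Bm unfolding space_borel by (force simp: E_def)
    have sg: "sets (sigma UNIV E) = sigma_sets UNIV E" by simp
    have "(%x i. x i) : borel_measurable (sigma UNIV E)"
    proof (rule seq_measurable, rule borel_measurableI_le)
      fix i :: nat and y :: real
      have "{x. x i <= y} : E" using EI[of "{i}" "%_. y"] by simp
      thus "{x : space (sigma UNIV E). x i <= y} : sets (sigma UNIV E)" by auto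
    qed
    thus "sets borel <= sigma_sets UNIV E" using measurable_sets[of "%x i. x i" "sigma UNIV E" borel] by auto
  qed
  thus ?thesis
  proof (intro measure_eqI_generator_eq[of E UNIV "seq_law M F" "seq_law M' G" "%_. UNIV"])
    show "Int_stable E"
    proof (rule Int_stableI)
      fix X Y assume "X : E" "Y : E"
      then obtain J a J' a' where *: "finite J" "finite J'" "X = ?B J a" "Y = ?B J' a'" unfolding E_def by blast
      have "X Int Y = ?B (J \<union> J') (%i. if i : J then if i : J' then min (a i) (a' i) else a i else a' i)"
        unfolding * by (auto split: if_splits)
      thus "X Int Y : E" using EI[OF finite_UnI[OF *(1,2)]] by simp
    qed
    fix X assume "X : E"
    then obtain J a where "finite J" "X = ?B J a" unfolding E_def by blast
    thus "emeasure (seq_law M F) X = emeasure (seq_law M' G) X" using key[of M F M' G J a] key[of M' G M F J a] cp cp' p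
      by (simp add: m.emeasure_eq_measure m'.emeasure_eq_measure)
  next
    show "range (%_. UNIV) <= E" using EI[of "{}"] by auto
  qed auto
qed


subsection \<open>Compactness of the laws on the Hilbert cube\<close>

text \<open>The partial sums are the dyadic truncations of y: passing from \<open>2 ^ n * y\<close>
  to its double appends one binary digit to the floor.\<close>

lemma binary_expansion_sums:
  fixes y :: real assumes "0 <= y" "y < 1"
  shows "(%j. of_bool (odd \<lfloor>2 ^ Suc j * y\<rfloor>) / 2 ^ Suc j) sums y"
proof -
  have *: "(\<Sum>j<n. of_bool (odd \<lfloor>2 ^ Suc j * y\<rfloor>) / 2 ^ Suc j) = of_int \<lfloor>2 ^ n * y\<rfloor> / (2 ^ n :: real)" for n
  proof (induction n)
    case 0
    have "\<lfloor>y\<rfloor> = 0" using assms by (simp add: floor_eq_iff)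
    thus ?case by simp
  next
    case (Suc n)
    have "\<lfloor>2 ^ Suc n * y\<rfloor> div 2 = \<lfloor>(2 ^ Suc n * y) / real_of_int 2\<rfloor>"
      by (rule floor_divide_real_eq_div[symmetric]) simp
    hence "\<lfloor>2 ^ Suc n * y\<rfloor> = 2 * \<lfloor>2 ^ n * y\<rfloor> + of_bool (odd \<lfloor>2 ^ Suc n * y\<rfloor>)"
      using div_mult_mod_eq[of "\<lfloor>2 ^ Suc n * y\<rfloor>" 2] by (simp add: mod_2_eq_odd)
    hence "real_of_int \<lfloor>2 ^ Suc n * y\<rfloor> = 2 * \<lfloor>2 ^ n * y\<rfloor> + of_bool (odd \<lfloor>2 ^ Suc n * y\<rfloor>)"
      by (metis of_int_add of_int_mult of_int_numeral of_int_of_bool)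
    thus ?case unfolding sum.lessThan_Suc Suc by (simp add: field_simps)
  qed
  have "(%n. of_int \<lfloor>2 ^ n * y\<rfloor> / (2 ^ n :: real)) \<longlonglongrightarrow> y"
  proof (rule tendsto_sandwich[OF always_eventually always_eventually])
    show "ALL n. y - (1/2) ^ n <= of_int \<lfloor>2 ^ n * y\<rfloor> / (2 ^ n :: real)"
    proof
      fix n
      have "2 ^ n * y - 1 <= of_int \<lfloor>2 ^ n * y\<rfloor>" by linarith
      thus "y - (1/2) ^ n <= of_int \<lfloor>2 ^ n * y\<rfloor> / (2 ^ n :: real)"
        using divide_right_mono[of "2 ^ n * y - 1" "of_int \<lfloor>2 ^ n * y\<rfloor>" "2 ^ n"] by (simp add: diff_divide_distrib power_divide)
    qed
    show "ALL n. of_int \<lfloor>2 ^ n * y\<rfloor> / (2 ^ n :: real) <= y" by (simp add: field_simps)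
    show "(%n. y - (1 / 2) ^ n) \<longlonglongrightarrow> y"
      using tendsto_diff[OF tendsto_const LIMSEQ_realpow_zero[of "1/2::real"], of y] by simp
  qed auto
  thus ?thesis unfolding sums_def * .
qed

text \<open>The values form a Cantor set: with only the digits 0 and 1, everything after a digit
  adds up to at most a third of its unit, so each digit can be read off with a margin.\<close>

definition base4 :: "(nat => bool) => real" where
  "base4 b = (\<Sum>n. of_bool (b n) / 4 ^ Suc n)"

lemma base4_summable: "summable (%n. of_bool (b n) / 4 ^ Suc n :: real)"
proof (rule summable_comparison_test'[of "%n. (1/4) ^ Suc n" 0])
  show "summable (%n. (1/4) ^ Suc n :: real)" unfolding summable_Suc_iff by (rule summable_geometric) simp
qed (auto simp: power_divide)

lemma base4_bounds: "0 <= base4 b" "base4 b <= 1/3"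
proof -
  show "0 <= base4 b" unfolding base4_def by (rule suminf_nonneg[OF base4_summable]) auto
  have g: "(%n. (1/4) ^ Suc n) sums (1/3 :: real)" using sums_mult[OF geometric_sums[of "1/4::real"], of "1/4"] by simp
  have "base4 b <= (\<Sum>n. (1/4) ^ Suc n)"
    unfolding base4_def by (rule suminf_le[OF _ base4_summable sums_summable[OF g]]) (auto simp: power_divide)
  thus "base4 b <= 1/3" using sums_unique[OF g] by simp
qed

lemma base4_rec: "4 * base4 b = of_bool (b 0) + base4 (%n. b (Suc n))"
proof -
  have "base4 b = of_bool (b 0) / 4 + (\<Sum>n. of_bool (b (Suc n)) / 4 ^ Suc (Suc n))"
    unfolding base4_def using suminf_split_head[OF base4_summable[of b]] by simp
  also have "(\<Sum>n. of_bool (b (Suc n)) / 4 ^ Suc (Suc n)) = (\<Sum>n. (1/4) * (of_bool (b (Suc n)) / 4 ^ Suc n :: real))" by (simp add: field_simps)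
  also have "\<dots> = (1/4) * base4 (%n. b (Suc n))" unfolding base4_def by (rule suminf_mult[OF base4_summable])
  finally show ?thesis by simp
qed

text \<open>The higher digits contribute multiples of 4 and the lower ones at most 1/3, so the
  parity of the floor is digit k.\<close>

lemma base4_digit:
  obtains r where "4 ^ Suc k * base4 b = of_int \<lfloor>4 ^ Suc k * base4 b\<rfloor> + r" "0 <= r" "r <= 1/3"
    "odd \<lfloor>4 ^ Suc k * base4 b\<rfloor> \<longleftrightarrow> b k"
proof -
  have "EX (m::int) (r::real). 4 ^ Suc k * base4 b = real_of_int m + r & 0 <= r & r <= 1/3 & (odd m \<longleftrightarrow> b k)"
  proof (induction k arbitrary: b)
    case 0
    define m :: int where "m = (if b 0 then 1 else 0)"
    have "4 ^ Suc 0 * base4 b = m + base4 (%n. b (Suc n))" using base4_rec[of b] by (simp add: m_def)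
    moreover have "odd m \<longleftrightarrow> b 0" by (simp add: m_def)
    ultimately show ?case using base4_bounds[of "%n. b (Suc n)"] by blast
  next
    case (Suc k)
    obtain m :: int and r :: real where *: "4 ^ Suc k * base4 (%n. b (Suc n)) = real_of_int m + r" "0 <= r" "r <= 1/3" "odd m \<longleftrightarrow> b (Suc k)"
      using Suc.IH[of "%n. b (Suc n)"] by blast
    have "4 ^ Suc (Suc k) * base4 b = 4 ^ Suc k * (4 * base4 b)" by simp
    also have "\<dots> = 4 ^ Suc k * of_bool (b 0) + 4 ^ Suc k * base4 (%n. b (Suc n))" unfolding base4_rec by (rule distrib_left)
    also have "\<dots> = of_int (4 ^ Suc k * of_bool (b 0) + m) + r" unfolding * by simp
    finally show ?case using * by (intro exI[of _ "4 ^ Suc k * of_bool (b 0) + m"] exI[of _ r]) auto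
  qed
  then obtain m :: int and r :: real where *: "4 ^ Suc k * base4 b = real_of_int m + r" "0 <= r" "r <= 1/3" "odd m \<longleftrightarrow> b k" by blast
  hence "\<lfloor>4 ^ Suc k * base4 b\<rfloor> = m" by linarith
  thus thesis using that[of r] * by simp
qed

text \<open>After scaling, numbers with fractional parts in [0, 1/3] and different floors are at
  least 2/3 apart, more than the tolerance 1/2.\<close>

lemma base4_near:
  assumes "\<bar>base4 b - base4 b'\<bar> < (1/2) / 4 ^ Suc k"
  shows "b k = b' k"
proof -
  obtain r where r: "4 ^ Suc k * base4 b = of_int \<lfloor>4 ^ Suc k * base4 b\<rfloor> + r" "0 <= r" "r <= 1/3"
    "odd \<lfloor>4 ^ Suc k * base4 b\<rfloor> \<longleftrightarrow> b k" by (rule base4_digit)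
  obtain s where s: "4 ^ Suc k * base4 b' = of_int \<lfloor>4 ^ Suc k * base4 b'\<rfloor> + s" "0 <= s" "s <= 1/3"
    "odd \<lfloor>4 ^ Suc k * base4 b'\<rfloor> \<longleftrightarrow> b' k" by (rule base4_digit)
  have "\<bar>4 ^ Suc k * base4 b - 4 ^ Suc k * base4 b'\<bar> = 4 ^ Suc k * \<bar>base4 b - base4 b'\<bar>"
    by (simp add: abs_mult flip: right_diff_distrib)
  also have "\<dots> < 1/2" using assms by (simp add: field_simps)
  finally have "\<lfloor>4 ^ Suc k * base4 b\<rfloor> = \<lfloor>4 ^ Suc k * base4 b'\<rfloor>" using r(1-3) s(1-3) by linarith
  thus ?thesis using r(4) s(4) by simp
qed

text \<open>All binary digits of all coordinates, interleaved by \<open>prod_decode\<close>. The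
  interval is scaled to [0, 1/2] so that its right end stays below 1, as the expansion
  requires.\<close>

definition cube_bits :: "(nat => real) => nat => bool" where
  "cube_bits x k = (case prod_decode k of (i, j) => odd \<lfloor>2 ^ Suc j * ((x i + 1/2) / 2)\<rfloor>)"

definition bits_cube :: "(nat => bool) => nat => real" where
  "bits_cube b i = 2 * (\<Sum>j. of_bool (b (prod_encode (i, j))) / 2 ^ Suc j) - 1/2"

definition real_bits :: "real => nat => bool" where
  "real_bits t k = odd \<lfloor>4 ^ Suc k * t\<rfloor>"

lemma real_bits_base4: "real_bits (base4 b) = b"
proof
  fix k show "real_bits (base4 b) k = b k" unfolding real_bits_def by (rule base4_digit[of k b]) simp
qed

lemma bits_cube_bits: "\<bar>x i\<bar> <= 1/2 ==> bits_cube (cube_bits x) i = x i"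
proof -
  assume "\<bar>x i\<bar> <= 1/2"
  hence "0 <= (x i + 1/2) / 2" "(x i + 1/2) / 2 < 1" by (auto simp: abs_le_iff)
  from sums_unique[OF binary_expansion_sums[OF this]] show ?thesis
    unfolding bits_cube_def cube_bits_def prod_encode_inverse prod.case by simp
qed

lemma measurable_bits_cube [measurable]: "(%t. bits_cube (real_bits t) i) : borel_measurable borel"
  unfolding bits_cube_def real_bits_def by measurable

lemma measurable_base4_cube [measurable]: "(%x. base4 (cube_bits x)) : borel_measurable borel"
  unfolding base4_def cube_bits_def case_prod_beta by measurable

text \<open>Along a convergent sequence of codes each digit is eventually constant by
  \<open>base4_near\<close>; Tannery's theorem exchanges the limit with the sum of the
  expansion.\<close>

lemma convergent_bits_cube:
  assumes "convergent t" "!!n. base4 (real_bits (t n)) = t n"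
  shows "convergent (%n. bits_cube (real_bits (t n)) i)"
proof -
  have ev: "EX v. \<forall>\<^sub>F n in sequentially. real_bits (t n) k = v" for k
  proof -
    have "Cauchy t" using assms by (simp add: Cauchy_convergent_iff)
    then obtain M where M: "!!m n. m >= M ==> n >= M ==> \<bar>t m - t n\<bar> < (1/2) / 4 ^ Suc k"
      unfolding Cauchy_def dist_real_def using zero_less_divide_iff[of "1/2::real" "4 ^ Suc k"] by (metis half_gt_zero zero_less_numeral zero_less_one zero_less_power)
    have "real_bits (t n) k = real_bits (t M) k" if "n >= M" for n by (rule base4_near) (use M[of n M] that assms in simp)
    thus ?thesis by (auto simp: eventually_sequentially)
  qed
  then obtain v where v: "!!k. \<forall>\<^sub>F n in sequentially. real_bits (t n) k = v k" by metis
  have "((%n. \<Sum>j. of_bool (real_bits (t n) (prod_encode (i, j))) / 2 ^ Suc j :: real) \<longlongrightarrow> (\<Sum>j. of_bool (v (prod_encode (i, j))) / 2 ^ Suc j)) sequentially"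
  proof (rule tannerys_theorem[THEN conjunct2, THEN conjunct2])
    show "((%n. of_bool (real_bits (t n) (prod_encode (i, k))) / 2 ^ Suc k :: real) \<longlongrightarrow> of_bool (v (prod_encode (i, k))) / 2 ^ Suc k) sequentially" for k
      by (rule tendsto_eventually) (use v[of "prod_encode (i, k)"] in \<open>auto elim: eventually_mono\<close>)
    show "\<forall>\<^sub>F (k, n) in sequentially \<times>\<^sub>F sequentially. norm (of_bool (real_bits (t n) (prod_encode (i, k))) / 2 ^ Suc k :: real) <= (1/2) ^ Suc k"
      by (auto simp: power_divide intro!: always_eventually)
    show "summable (%k. (1/2) ^ Suc k :: real)" unfolding summable_Suc_iff by (rule summable_geometric) simp
  qed auto
  thus ?thesis unfolding bits_cube_def using convergentI[OF tendsto_diff[OF tendsto_mult[OF tendsto_const] tendsto_const]] by blast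
qed

text \<open>The cube is encoded in the line by base 4 expansions, which are so sparse that the digits
  are continuous on the image; the case of the line is due to Helly and Skorokhod.\<close>

lemma cube_laws_compact:
  fixes m :: "nat => (nat => real) measure"
  assumes p: "!!n. prob_space (m n)" and s: "!!n. sets (m n) = sets borel"
    and K: "!!n. AE x in m n. ALL i. \<bar>x i\<bar> <= 1/2"
  obtains r L where "strict_mono r" "prob_space L" "sets L = sets borel" "AE x in L. ALL i. \<bar>x i\<bar> <= 1/2"
    "ALL N. ALL e>0. \<forall>\<^sub>F n in sequentially. coupled N e (m (r n)) (%i x. x i) L (%i x. x i)"
proof -
  let ?h = "%x. base4 (cube_bits x)" and ?D = "%t i. bits_cube (real_bits t) i"
  note [measurable_cong] = s
  have D[measurable]: "?D : borel_measurable borel" by (intro seq_measurable) measurable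
  define \<nu> where "\<nu> n = distr (m n) borel ?h" for n
  have hm[measurable]: "?h : borel_measurable (m n)" for n by measurable
  have rd: "real_distribution (\<nu> n)" for n unfolding \<nu>_def using prob_space.real_distribution_distr[OF p hm] .
  \<comment> \<open>All codes lie in [0, 1/3], so no mass can escape.\<close>
  have "tight \<nu>" unfolding tight_def
  proof (intro conjI allI impI rd)
    fix e :: real assume "e > 0"
    have "measure (\<nu> n) {-1<..1} = 1" for n
    proof -
      interpret prob_space "m n" by (rule p)
      have "?h -` {-1<..1} Int space (m n) = space (m n)"
      proof -
        have "-1 < ?h x & ?h x <= 1" for x using base4_bounds[of "cube_bits x"] by linarith
        thus ?thesis by auto
      qed
      thus ?thesis unfolding \<nu>_def by (simp add: measure_distr prob_space)
    qed
    thus "EX a b. a < b & (ALL n. measure (\<nu> n) {a<..b} > 1 - e)"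
      using \<open>e > 0\<close> by (intro exI[of _ "-1"] exI[of _ 1]) auto
  qed
  from tight_imp_convergent_subsubsequence[OF this strict_mono_id]
  obtain r M where r: "strict_mono (r :: nat => nat)" and M: "real_distribution M" "weak_conv_m (\<nu> \<circ> id \<circ> r) M" by blast
  have M2: "weak_conv_m (%n. \<nu> (r n)) M" using M(2) by (simp add: comp_def)
  obtain \<Omega> :: "real measure" and Y :: "nat => real => real" and Z
    where P: "prob_space \<Omega>" and Y[measurable]: "!!n. Y n : borel_measurable \<Omega>"
      and dY: "!!n. distr \<Omega> borel (Y n) = \<nu> (r n)" and cY: "!!x. x : space \<Omega> ==> (%n. Y n x) \<longlonglongrightarrow> Z x"
    using Skorohod[OF rd M(1) M2] by blast
  interpret P: prob_space \<Omega> by fact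
  define X where "X n w = ?D (Y n w)" for n w
  have X[measurable]: "(%w. X n w i) : borel_measurable \<Omega>" for n i unfolding X_def by measurable
  \<comment> \<open>The limit is taken after decoding, because the digits are discontinuous on the
    line and settle only along convergent sequences of codes.\<close>
  define X' where "X' w i = lim (%n. X n w i)" for w i
  have X'[measurable]: "(%w. X' w i) : borel_measurable \<Omega>" for i unfolding X'_def by measurable
  have Xm[measurable]: "X n : borel_measurable \<Omega>" for n using seq_measurable[of "%i w. X n w i", OF X] .
  have X'm[measurable]: "X' : borel_measurable \<Omega>" using seq_measurable[of "%i w. X' w i", OF X'] .
  \<comment> \<open>Almost surely Y n is a genuine code of a point of the cube; this is a property
    of its law and so passes from \<open>m (r n)\<close> to the Skorohod space.\<close>
  have good: "AE w in \<Omega>. ALL n. base4 (real_bits (Y n w)) = Y n w & (ALL i. \<bar>X n w i\<bar> <= 1/2)"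
    unfolding AE_all_countable
  proof
    fix n
    let ?P = "%t. base4 (real_bits t) = t & (ALL i. \<bar>?D t i\<bar> <= 1/2)"
    have [measurable]: "(%t. base4 (real_bits t)) : borel_measurable borel" unfolding base4_def real_bits_def by measurable
    have "AE x in m (r n). ?P (?h x)" using K[of "r n"] by eventually_elim (simp add: real_bits_base4 bits_cube_bits)
    hence "AE t in \<nu> (r n). ?P t" unfolding \<nu>_def by (subst AE_distr_iff) auto
    hence "AE t in distr \<Omega> borel (Y n). ?P t" by (simp only: dY)
    thus "AE w in \<Omega>. base4 (real_bits (Y n w)) = Y n w & (ALL i. \<bar>X n w i\<bar> <= 1/2)"
      unfolding X_def by (subst (asm) AE_distr_iff) auto
  qed
  have conv: "AE w in \<Omega>. ALL i. (%n. X n w i) \<longlonglongrightarrow> X' w i" using good AE_space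
  proof eventually_elim
    fix w assume w: "ALL n. base4 (real_bits (Y n w)) = Y n w & (ALL i. \<bar>X n w i\<bar> <= 1/2)" "w : space \<Omega>"
    have "convergent (%n. Y n w)" using cY[OF w(2)] convergentI by blast
    hence "convergent (%n. X n w i)" for i unfolding X_def by (rule convergent_bits_cube) (use w in auto)
    thus "ALL i. (%n. X n w i) \<longlonglongrightarrow> X' w i" unfolding X'_def by (simp add: convergent_LIMSEQ_iff)
  qed
  have X'K: "AE w in \<Omega>. ALL i. \<bar>X' w i\<bar> <= 1/2" using good conv
  proof eventually_elim
    fix w assume "ALL n. base4 (real_bits (Y n w)) = Y n w & (ALL i. \<bar>X n w i\<bar> <= 1/2)" "ALL i. (%n. X n w i) \<longlonglongrightarrow> X' w i"
    hence "(%n. \<bar>X n w i\<bar>) \<longlonglongrightarrow> \<bar>X' w i\<bar>" "ALL n>=0. \<bar>X n w i\<bar> <= 1/2" for i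
      by (auto intro: tendsto_rabs)
    thus "ALL i. \<bar>X' w i\<bar> <= 1/2" using Lim_bounded by blast
  qed
  have law: "distr \<Omega> borel (X n) = m (r n)" for n
  proof -
    have "distr \<Omega> borel (X n) = distr (distr \<Omega> borel (Y n)) borel ?D"
      by (subst distr_distr) (auto simp: comp_def X_def[abs_def])
    also have "\<dots> = distr (m (r n)) borel (%x. ?D (?h x))" unfolding dY \<nu>_def by (subst distr_distr) (auto simp: comp_def)
    also have "\<dots> = distr (m (r n)) borel (%x. x)"
    proof (rule distr_cong_AE)
      have "?D (?h x) = x" if "ALL i. \<bar>x i\<bar> <= 1/2" for x
        using that by (simp add: real_bits_base4 bits_cube_bits fun_eq_iff)
      thus "AE x in m (r n). ?D (?h x) = x" using K[of "r n"] by auto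
    qed (use s in auto)
    also have "\<dots> = m (r n)" using s by (intro distr_id2) auto
    finally show ?thesis .
  qed
  let ?L = "distr \<Omega> borel X'"
  show thesis
  proof (rule that[OF r, of ?L]; (intro allI impI)?)
    show "prob_space ?L" by (rule P.prob_space_distr) measurable
    show "AE x in ?L. ALL i. \<bar>x i\<bar> <= 1/2" using X'K by (subst AE_distr_iff) auto
    fix N and e :: real assume "e > 0"
    have lim0: "(%n. \<integral>\<^sup>+w. ennreal \<bar>X n w i - X' w i\<bar> \<partial>\<Omega>) \<longlonglongrightarrow> (\<integral>\<^sup>+w. 0 \<partial>\<Omega>)" for i
    proof (rule nn_integral_dominated_convergence[where w = "%_. 1"])
      show "AE w in \<Omega>. ennreal \<bar>X n w i - X' w i\<bar> <= 1" for n using good X'K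
      proof eventually_elim
        fix w assume "ALL n. base4 (real_bits (Y n w)) = Y n w & (ALL i. \<bar>X n w i\<bar> <= 1/2)" "ALL i. \<bar>X' w i\<bar> <= 1/2"
        hence "\<bar>X n w i\<bar> <= 1/2" "\<bar>X' w i\<bar> <= 1/2" by auto
        thus "ennreal \<bar>X n w i - X' w i\<bar> <= 1" by simp
      qed
      show "AE w in \<Omega>. (%n. ennreal \<bar>X n w i - X' w i\<bar>) \<longlonglongrightarrow> 0" using conv
      proof eventually_elim
        fix w assume "ALL i. (%n. X n w i) \<longlonglongrightarrow> X' w i"
        hence "(%n. \<bar>X n w i - X' w i\<bar>) \<longlonglongrightarrow> 0"
          by (intro tendsto_rabs_zero) (auto simp: LIM_zero_iff)
        thus "(%n. ennreal \<bar>X n w i - X' w i\<bar>) \<longlonglongrightarrow> 0" using tendsto_ennrealI by fastforce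
      qed
    qed (auto simp: P.emeasure_space_1)
    have "\<forall>\<^sub>F n in sequentially. ALL i:{..<N}. (\<integral>\<^sup>+w. ennreal \<bar>X n w i - X' w i\<bar> \<partial>\<Omega>) < ennreal e"
      using lim0 \<open>e > 0\<close> by (intro eventually_ball_finite ballI order_tendstoD(2)[of _ 0]) auto
    thus "\<forall>\<^sub>F n in sequentially. coupled N e (m (r n)) (%i x. x i) ?L (%i x. x i)"
    proof eventually_elim
      case (elim n)
      have Xn: "X n : measurable \<Omega> (m (r n))" "X' : measurable \<Omega> ?L" by measurable
      have "coupling_of (m (r n)) ?L (distr \<Omega> (m (r n) \<Otimes>\<^sub>M ?L) (%w. (X n w, X' w)))"
      proof (rule coupling_of_distr[OF P Xn])
        have "distr \<Omega> (m (r n)) (X n) = distr \<Omega> borel (X n)" by (rule distr_cong) (auto simp: s)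
        thus "distr \<Omega> (m (r n)) (X n) = m (r n)" using law by simp
        show "distr \<Omega> ?L X' = ?L" by (rule distr_cong) auto
      qed
      moreover have "(\<integral>\<^sup>+z. ennreal \<bar>fst z i - snd z i\<bar> \<partial>(distr \<Omega> (m (r n) \<Otimes>\<^sub>M ?L) (%w. (X n w, X' w)))) <= ennreal e" if "i < N" for i
      proof -
        have "(\<integral>\<^sup>+z. ennreal \<bar>fst z i - snd z i\<bar> \<partial>(distr \<Omega> (m (r n) \<Otimes>\<^sub>M ?L) (%w. (X n w, X' w)))) = (\<integral>\<^sup>+w. ennreal \<bar>X n w i - X' w i\<bar> \<partial>\<Omega>)"
        proof -
          have [measurable]: "(%x. x i) : borel_measurable (m (r n))" "(%x. x i) : borel_measurable ?L" by measurable
          have 1: "(%z. ennreal \<bar>fst z i - snd z i\<bar>) : borel_measurable (m (r n) \<Otimes>\<^sub>M ?L)" by measurable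
          have 2: "(%w. (X n w, X' w)) : measurable \<Omega> (m (r n) \<Otimes>\<^sub>M ?L)" using Xn by measurable
          show ?thesis using 1 2 by (subst nn_integral_distr) simp_all
        qed
        thus ?thesis using elim that by (simp add: less_imp_le)
      qed
      ultimately show ?case unfolding coupled_def by blast
    qed
  qed auto
qed

section \<open>Sets of functions and pointwise closure\<close>

lemma pointwise_closure_iff:
  assumes "H <= extensional X"
  shows "f : pointwise_closure X H \<longleftrightarrow> f : extensional X &
    (ALL S e. finite S & S <= X & e > 0 --> (EX h:H. ALL s:S. \<bar>f s - h s\<bar> < e))" (is "?L \<longleftrightarrow> ?R")
proof
  let ?T = "product_topology (%_. euclideanreal) X"
  assume L: ?L
  hence ext: "f : extensional X" unfolding pointwise_closure_def using closure_of_subset_topspace[of ?T H] by (auto simp: PiE_def)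
  moreover have "EX h:H. ALL s:S. \<bar>f s - h s\<bar> < e" if S: "finite S" "S <= X" "e > 0" for S e
  proof -
    let ?U = "PiE X (%x. if x : S then ball (f x) e else UNIV)"
    have "openin ?T ?U" by (rule openin_PiE_gen[THEN iffD2]) (use S in \<open>auto intro: finite_subset[of _ S]\<close>)
    moreover have "f : ?U" using ext S by (auto simp: PiE_iff)
    ultimately obtain h where "h : H" "h : ?U" using L unfolding pointwise_closure_def in_closure_of by blast
    thus ?thesis using S by (auto simp: PiE_iff dist_real_def subset_eq split: if_splits intro!: bexI[of _ h])
  qed
  ultimately show ?R by blast
next
  let ?T = "product_topology (%_. euclideanreal) X"
  assume R: ?R
  show ?L unfolding pointwise_closure_def in_closure_of
  proof (intro conjI allI impI)
    show "f : topspace ?T" using R by (auto simp: PiE_def)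
    fix U assume U: "f : U & openin ?T U"
    then obtain W where W: "finite {i\<in>X. W i ~= UNIV}" "!!i. i : X ==> open (W i)" "f : PiE X W" "PiE X W <= U"
      unfolding openin_product_topology_alt by (auto simp: )
    let ?S = "{i\<in>X. W i ~= UNIV}"
    have "EX e>0. ALL i:?S. ball (f i) e <= W i"
    proof -
      have "ALL i:?S. EX e>0. ball (f i) e <= W i" using W by (auto simp: PiE_iff open_contains_ball)
      then obtain e where e: "!!i. i : ?S ==> e i > 0 & ball (f i) (e i) <= W i" by metis
      \<comment> \<open>The inserted 1 covers the case that no coordinate is restricted.\<close>
      have "0 < Min (insert 1 (e ` ?S))" using W(1) e by (subst Min_gr_iff) auto
      moreover have "ball (f i) (Min (insert 1 (e ` ?S))) <= W i" if i: "i : ?S" for i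
      proof -
        have "Min (insert 1 (e ` ?S)) <= e i" using W(1) i by (intro Min_le) auto
        thus ?thesis using e[OF i] subset_ball by blast
      qed
      ultimately show ?thesis by blast
    qed
    then obtain e where e: "e > 0" "!!i. i : ?S ==> ball (f i) e <= W i" by blast
    obtain h where h: "h : H" "!!s. s : ?S ==> \<bar>f s - h s\<bar> < e"
      using R W(1) e(1) by (metis (no_types, lifting) mem_Collect_eq subsetI)
    have "h i : W i" if "i : X" for i
    proof (cases "W i = UNIV")
      case False
      hence "i : ?S" using that by simp
      thus ?thesis using e(2) h(2) by (auto simp: dist_real_def subset_eq)
    qed simp
    hence "h : PiE X W" using h(1) assms by (auto simp: PiE_iff)
    thus "EX y. y : H & y : U" using h W by blast
  qed
qed

lemma pointwise_closureE:
  assumes "f : pointwise_closure X H" "H <= extensional X" "finite S" "S <= X" "e > 0"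
  obtains h where "h : H" "!!s. s : S ==> \<bar>f s - h s\<bar> < e"
proof -
  have "ALL S e. finite S & S <= X & e > 0 --> (EX h:H. ALL s:S. \<bar>f s - h s\<bar> < e)"
    using assms(1) pointwise_closure_iff[OF assms(2)] by simp
  from this[THEN spec, THEN spec, of S e] assms(3-5) show thesis using that by auto
qed

lemma pointwise_closure_ext: "f : pointwise_closure X H ==> f : extensional X"
  unfolding pointwise_closure_def using closure_of_subset_topspace[of "product_topology (%_. euclideanreal) X" H]
  by (auto simp: PiE_def)

lemma pointwise_closure_superset: "H <= extensional X ==> H <= pointwise_closure X H"
  unfolding pointwise_closure_def by (rule closure_of_subset) (auto simp: PiE_def)

lemma pointwise_closure_mono: "H <= H' ==> pointwise_closure X H <= pointwise_closure X H'"
  unfolding pointwise_closure_def by (rule closure_of_mono)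

lemma pointwise_closure_idem [simp]: "pointwise_closure X (pointwise_closure X H) = pointwise_closure X H"
  unfolding pointwise_closure_def by simp

lemma pointwise_closure_minimal: "H <= pointwise_closure X H' ==> pointwise_closure X H <= pointwise_closure X H'"
  using pointwise_closure_mono[of H "pointwise_closure X H'" X] by simp

lemma pointwise_closure_finite: "finite H ==> H <= extensional X ==> pointwise_closure X H = H"
  unfolding pointwise_closure_def
  by (intro closure_of_closedin closedin_Hausdorff_finite) (auto simp: PiE_def Hausdorff_space_product_topology)

lemma pointwise_closure_limit:
  assumes "!!n. h n : pointwise_closure X H" "f : extensional X" "!!x. x : X ==> (%n. h n x) \<longlonglongrightarrow> f x"
  shows "f : pointwise_closure X H"
proof -
  have "f : pointwise_closure X (range h)"
  proof (subst pointwise_closure_iff, use assms pointwise_closure_ext in blast, intro conjI allI impI assms)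
    fix S e assume S: "finite S & S <= X & (0::real) < e"
    hence "\<forall>\<^sub>F n in sequentially. ALL s:S. \<bar>f s - h n s\<bar> < e"
      using assms(3) by (intro eventually_ball_finite) (auto simp: tendsto_iff dist_real_def abs_minus_commute)
    thus "EX g:range h. ALL s:S. \<bar>f s - g s\<bar> < e" by (auto simp: eventually_sequentially)
  qed
  thus ?thesis using pointwise_closure_minimal[of "range h" X H] assms(1) by blast
qed

lemma pointwise_closure_compose:
  assumes f: "f : pointwise_closure Y H" and H: "H <= extensional Y" and p: "p : X \<rightarrow> Y"
  shows "compose X f p : pointwise_closure X ((%h. compose X h p) ` H)"
proof (subst pointwise_closure_iff, force, intro conjI allI impI)
  show "compose X f p : extensional X" by simp
  fix S e assume S: "finite S & S <= X & (0::real) < e"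
  hence "finite (p ` S)" "p ` S <= Y" "0 < e" using p by auto
  then obtain h where "h : H" "!!s. s : p ` S ==> \<bar>f s - h s\<bar> < e"
    using pointwise_closureE[OF f H] by blast
  thus "EX h:(%h. compose X h p) ` H. ALL s:S. \<bar>compose X f p s - h s\<bar> < e"
    using S by (intro bexI[of _ "compose X h p"]) (auto simp: compose_def subset_eq)
qed

lemma pointwise_closure_bound:
  assumes f: "f : pointwise_closure X H" and H: "H <= extensional X"
    and "!!h. h : H ==> \<bar>h x - h y\<bar> <= c" "x : X" "y : X"
  shows "\<bar>f x - f y\<bar> <= c"
proof (rule field_le_epsilon)
  fix e :: real assume "e > 0"
  then obtain h where "h : H" "!!s. s : {x,y} ==> \<bar>f s - h s\<bar> < e/2"
    using assms(4,5) pointwise_closureE[OF f H, of "{x,y}" "e/2"] by auto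
  hence "h : H" "\<bar>f x - h x\<bar> < e/2" "\<bar>f y - h y\<bar> < e/2" by auto
  thus "\<bar>f x - f y\<bar> <= c + e" using assms(3)[of h] by linarith
qed

lemma pointwise_closure_bound1:
  assumes f: "f : pointwise_closure X H" and H: "H <= extensional X"
    and "!!h. h : H ==> \<bar>h x\<bar> <= c" "x : X"
  shows "\<bar>f x\<bar> <= c"
proof (rule field_le_epsilon)
  fix e :: real assume "e > 0"
  then obtain h where "h : H" "!!s. s : {x} ==> \<bar>f s - h s\<bar> < e"
    using assms(4) pointwise_closureE[OF f H, of "{x}" e] by auto
  thus "\<bar>f x\<bar> <= c + e" using assms(3)[of h] by auto
qed

text \<open>For uniformly bounded families the closure is compact, so its image under composition is closed.\<close>

lemma pointwise_closure_compose_image: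
  assumes H: "H <= extensional Y" and p: "p : X \<rightarrow> Y" and b: "!!h y. h : H ==> y : Y ==> \<bar>h y\<bar> <= c"
  shows "pointwise_closure X ((%h. compose X h p) ` H) = (%h. compose X h p) ` pointwise_closure Y H"
proof
  let ?T = "%X. product_topology (%_. euclideanreal) X"
  show "(%h. compose X h p) ` pointwise_closure Y H <= pointwise_closure X ((%h. compose X h p) ` H)"
    using pointwise_closure_compose[OF _ H p] by blast
  have "compactin (?T Y) (PiE Y (%_. {-c..c}))" by (subst compactin_PiE) auto
  moreover have "pointwise_closure Y H <= PiE Y (%_. {-c..c})"
  proof
    fix f assume f: "f : pointwise_closure Y H"
    have "\<bar>f y\<bar> <= c" if "y : Y" for y by (rule pointwise_closure_bound1[OF f H]) (use b that in auto)
    hence "f y : {-c..c}" if "y : Y" for y using that by (simp add: abs_le_iff minus_le_iff)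
    thus "f : PiE Y (%_. {-c..c})" using pointwise_closure_ext[OF f] by (simp add: PiE_iff)
  qed
  ultimately have "compactin (?T Y) (pointwise_closure Y H)" unfolding pointwise_closure_def by (meson closed_compactin closedin_closure_of)
  moreover have "continuous_map (?T Y) (?T X) (%h. compose X h p)" unfolding continuous_map_componentwise
    using p by (auto simp: compose_def intro!: continuous_map_product_projection)
  ultimately have "compactin (?T X) ((%h. compose X h p) ` pointwise_closure Y H)" by (rule image_compactin)
  hence "closedin (?T X) ((%h. compose X h p) ` pointwise_closure Y H)"
    by (rule compactin_imp_closedin[rotated]) (simp add: Hausdorff_space_product_topology)
  thus "pointwise_closure X ((%h. compose X h p) ` H) <= (%h. compose X h p) ` pointwise_closure Y H"
    unfolding pointwise_closure_def[of X] using pointwise_closure_superset[OF H] by (intro closure_of_minimal) auto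
qed

section \<open>Geometric data sets\<close>

lemma space_borel_of [simp]: "space (borel_of T) = topspace T" by (simp add: borel_of_def space_measure_of_conv)

lemma sets_borel_of: "sets (borel_of T) = sigma_sets (topspace T) {U. openin T U}"
  unfolding borel_of_def by (rule sets_measure_of) (auto dest: openin_subset)

lemma openin_borel_of: "openin T U ==> U : sets (borel_of T)" unfolding sets_borel_of by auto

lemma closedin_borel_of:
  assumes "closedin T C" shows "C : sets (borel_of T)"
proof -
  have "topspace T - (topspace T - C) : sets (borel_of T)"
    using assms openin_borel_of[of T "topspace T - C"] sets.compl_sets[of "topspace T - C" "borel_of T"] by (auto simp: closedin_def)
  thus ?thesis using closedin_subset[OF assms] by (simp add: double_diff)
qed

lemma measurable_borel_ofI:
  assumes "!!x. x : space M ==> f x : topspace T" "!!U. openin T U ==> f -` U Int space M : sets M"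
  shows "f : measurable M (borel_of T)" by (rule measurable_sigma_sets[OF sets_borel_of]) (use assms openin_subset[of T] in blast)+

lemma continuous_map_measurable:
  "continuous_map T T' f ==> f : measurable (borel_of T) (borel_of T')" by (rule measurable_borel_ofI)
    (auto simp: continuous_map_def Pi_iff intro!: openin_borel_of arg_cong2[of _ _ _ _ openin] elim!: back_subst[of "openin _"])

lemma continuous_map_measurable_real:
  assumes "continuous_map T euclideanreal f" shows "f : borel_measurable (borel_of T)"
proof (rule borel_measurableI)
  fix S :: "real set" assume "open S"
  hence "openin T {x : topspace T. f x : S}" using assms openin_continuous_map_preimage by fastforce
  hence "{x : topspace T. f x : S} : sets (borel_of T)" by (rule openin_borel_of)
  also have "{x : topspace T. f x : S} = f -` S Int space (borel_of T)" by auto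
  finally show "f -` S Int space (borel_of T) : sets (borel_of T)" .
qed

locale geom_data =
  fixes X :: "'a dataset"
  assumes geometric: "geometric_dataset X"
begin

sublocale Metric_space "points X" "data_dist X" using geometric by (simp add: geometric_dataset_def)

sublocale law: prob_space "law X" using geometric by (simp add: geometric_dataset_def)

lemma data_topology_eq: "data_topology X = mtopology" by (simp add: data_topology_def)

lemma space_law [simp]: "space (law X) = points X"
  and sets_law: "sets (law X) = sets (borel_of mtopology)"
  and features_ne: "features X ~= {}"
  and features_ext: "features X <= extensional (points X)"
  and complete: mcomplete
  and separable: "separable_space mtopology" using geometric by (auto simp: geometric_dataset_def data_topology_eq)

lemma points_ne: "points X ~= {}" using law.not_empty by simp

lemma measurable_law_cong: "measurable (law X) N = measurable (borel_of mtopology) N" by (rule measurable_cong_sets) (auto simp: sets_law)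

lemma mball_sets [measurable]: "mball x r : sets (law X)" "mcball x r : sets (law X)"
  unfolding sets_law by (auto intro: openin_borel_of closedin_borel_of)

lemma mball_pos: "x : points X ==> r > 0 ==> emeasure (law X) (mball x r) > 0"
  using geometric unfolding geometric_dataset_def data_topology_eq supp_def
  by (metis (mono_tags, lifting) centre_in_mball_iff mem_Collect_eq openin_mball)

lemma feature_dist_le: "f : features X ==> x : points X ==> y : points X ==> \<bar>f x - f y\<bar> <= data_dist X x y"
  using geometric unfolding geometric_dataset_def data_dist_def feature_dist_def by (auto intro!: cSUP_upper)

lemma data_dist_le:
  "x : points X ==> y : points X ==> (!!f. f : features X ==> \<bar>f x - f y\<bar> <= c) ==> data_dist X x y <= c"
  unfolding data_dist_def feature_dist_def using features_ne by (auto intro!: cSUP_least)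

text \<open>Features are 1-Lipschitz by the choice of the metric. This survives pointwise limits,
  unlike continuity, and so makes the functions in the closures measurable.\<close>

definition lip :: "('a => real) => bool" where
  "lip f \<longleftrightarrow> (ALL x:points X. ALL y:points X. \<bar>f x - f y\<bar> <= data_dist X x y)"

lemma lip_continuous: assumes "lip f" shows "continuous_map mtopology euclideanreal f"
proof -
  have "dist (f a) (f x) < \<epsilon>" if "a : points X" "x : points X" "data_dist X a x < \<epsilon>" for a x \<epsilon>
    using assms that unfolding lip_def dist_real_def by (meson le_less_trans)
  hence "ALL a:points X. \<forall>\<epsilon>>0. \<exists>\<delta>>0. ALL x. x : points X & data_dist X a x < \<delta> --> dist (f a) (f x) < \<epsilon>"
    by blast
  hence "continuous_map mtopology Met_TC.mtopology f" by (subst metric_continuous_map[OF Met_TC.Metric_space_axioms]) auto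
  thus ?thesis by simp
qed

lemma lip_measurable [measurable]: "lip f ==> f : borel_measurable (law X)"
  unfolding measurable_law_cong by (intro continuous_map_measurable_real lip_continuous)

lemma closure_lip:
  assumes "H <= extensional (points X)" "!!h. h : H ==> lip h" "f : pointwise_closure (points X) H"
  shows "lip f" using pointwise_closure_bound[OF assms(3,1)] assms(2) unfolding lip_def by blast

lemma feature_closure_lip: "f : feature_closure X ==> lip f" unfolding feature_closure_def
  by (erule closure_lip[OF features_ext, rotated]) (auto simp: lip_def feature_dist_le)

lemma features_closure: "f : features X ==> f : feature_closure X"
  unfolding feature_closure_def using pointwise_closure_superset[OF features_ext] by blast

lemma feature_closure_ext: "f : feature_closure X ==> f : extensional (points X)"
  unfolding feature_closure_def by (rule pointwise_closure_ext)

lemma feature_closure_ne: "feature_closure X ~= {}" using features_ne features_closure by blast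

definition dense_points :: "(nat => 'a) => bool" where
  "dense_points D \<longleftrightarrow> (ALL n. D n : points X) & (ALL x:points X. ALL r>0. EX n. data_dist X x (D n) < r)"

lemma dense_pointsD:
  assumes "dense_points D"
  shows "D n : points X" "x : points X ==> r > 0 ==> EX n. data_dist X x (D n) < r"
  using assms unfolding dense_points_def by auto

lemma dense_seq: obtains D where "dense_points D"
proof -
  obtain C where C: "countable C" "C <= points X" "mtopology closure_of C = points X"
    using separable unfolding separable_space_def by auto
  have "C ~= {}" using C points_ne by auto
  hence r: "range (from_nat_into C) = C" using C by (simp add: range_from_nat_into)
  show thesis
  proof (rule that, unfold dense_points_def, intro conjI allI ballI impI)
    show "from_nat_into C n : points X" for n using r C by blast
    fix x r assume "x : points X" "(r::real) > 0"
    then obtain y where "y : C" "data_dist X x y < r" using C(3) unfolding metric_closure_of by auto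
    thus "EX n. data_dist X x (from_nat_into C n) < r" using r by (metis rangeE)
  qed
qed

text \<open>Each point is labelled by the first ball of radius e/2 about a dense sequence that
  contains it. These labels are used to glue couplings of data sets.\<close>

lemma label:
  assumes "e > 0"
  obtains c :: "'a => nat" where "c : measurable (law X) (count_space UNIV)"
    "ALL x:points X. ALL y:points X. c x = c y --> data_dist X x y <= e"
proof -
  obtain D where "dense_points D" by (rule dense_seq)
  note D = dense_pointsD[OF this]
  let ?c = "%x. LEAST n::nat. x : mball (D n) (e/2)"
  show thesis
  proof (rule that; (intro ballI impI)?)
    show "?c : measurable (law X) (count_space UNIV)" by measurable
    fix x y assume xy: "x : points X" "y : points X" "?c x = ?c y"
    have *: "x : mball (D (?c x)) (e/2)" if xP: "x : points X" for x
    proof (rule LeastI_ex)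
      obtain n where "data_dist X x (D n) < e/2" using D(2)[OF xP half_gt_zero[OF assms]] by blast
      thus "EX n. x : mball (D n) (e/2)" using D(1) xP commute[of x "D n"] by (intro exI[of _ n]) simp
    qed
    have "data_dist X (D (?c x)) x < e/2" "data_dist X (D (?c x)) y < e/2" using *[OF xy(1)] *[OF xy(2)] xy(3) by auto
    thus "data_dist X x y <= e" using triangle''[of x "D (?c x)" y] D(1)[of "?c x"] xy by simp
  qed
qed

text \<open>Full support: if the functions differed at x, they would differ on a ball about x, which
  has positive mass.\<close>

lemma lip_eq_of_AE:
  assumes f: "lip f" and g: "lip g" and ae: "AE x in law X. f x = g x" and x: "x : points X"
  shows "f x = g x"
proof (rule ccontr)
  assume ne: "f x ~= g x"
  define r where "r = \<bar>f x - g x\<bar> / 2"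
  have "r > 0" using ne by (simp add: r_def)
  have "f y ~= g y" if "y : mball x r" for y
  proof
    assume "f y = g y"
    have "data_dist X x y < r" "y : points X" using that by auto
    hence "\<bar>f x - f y\<bar> < r" "\<bar>g x - g y\<bar> < r" using f g x unfolding lip_def by (meson le_less_trans)+
    thus False using \<open>f y = g y\<close> unfolding r_def by (smt (verit) field_sum_of_halves)
  qed
  hence "AE y in law X. y \<notin> mball x r" using ae by (auto elim: eventually_mono)
  hence "emeasure (law X) (mball x r) = 0" by (subst (asm) AE_iff_measurable[of "mball x r"]) auto
  thus False using mball_pos[OF x \<open>r > 0\<close>] by simp
qed

lemma lip_dense_tendsto:
  assumes D: "!!n. D n : points X" "!!x r. x : points X ==> r > 0 ==> EX n. data_dist X x (D n) < r"
    and h: "!!n. lip (h n)" and c: "!!j. convergent (%n. h n (D j))" and x: "x : points X"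
  shows "convergent (%n. h n x)"
proof -
  have "Cauchy (%n. h n x)"
  proof (rule CauchyI)
    fix e :: real assume "e > 0"
    then obtain j where j: "data_dist X x (D j) < e/3" using D(2)[OF x, of "e/3"] by auto
    obtain M where M: "!!m n. m >= M ==> n >= M ==> \<bar>h m (D j) - h n (D j)\<bar> < e/3"
      using c[of j] \<open>e > 0\<close> unfolding Cauchy_convergent_iff[symmetric] Cauchy_def dist_real_def
      by (meson divide_pos_pos zero_less_numeral)
    have "norm (h m x - h n x) < e" if "m >= M" "n >= M" for m n
    proof -
      have "\<bar>h m x - h m (D j)\<bar> < e/3" "\<bar>h n x - h n (D j)\<bar> < e/3"
        using h j x D(1) unfolding lip_def by (meson le_less_trans)+
      thus ?thesis using M[OF that] unfolding real_norm_def by linarith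
    qed
    thus "EX M. ALL m>=M. ALL n>=M. norm (h m x - h n x) < e" by blast
  qed
  thus ?thesis by (simp add: Cauchy_convergent_iff)
qed

text \<open>On an uncountable set the pointwise closure can exceed the set of sequential limits. For
  1-Lipschitz functions, approximation on a countable dense set already forces convergence
  everywhere.\<close>

lemma closure_range_seq:
  assumes H: "range h <= extensional (points X)" and L: "!!i. lip (h i)"
    and f: "f : pointwise_closure (points X) (range h)"
  obtains r :: "nat => nat" where "!!x. x : points X ==> (%n. h (r n) x) \<longlonglongrightarrow> f x"
proof -
  obtain D where "dense_points D" by (rule dense_seq)
  note D = dense_pointsD[OF this]
  have "EX i. ALL j<=n. \<bar>f (D j) - h i (D j)\<bar> < 1 / Suc n" for n
  proof -
    have "finite (D ` {..n})" "D ` {..n} <= points X" "1 / real (Suc n) > 0" using D by auto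
    then obtain g where "g : range h" "!!s. s : D ` {..n} ==> \<bar>f s - g s\<bar> < 1 / real (Suc n)"
      using pointwise_closureE[OF f H] by blast
    thus ?thesis by auto
  qed
  then obtain r where r: "!!n j. j <= n ==> \<bar>f (D j) - h (r n) (D j)\<bar> < 1 / Suc n" by metis
  have lf: "lip f" by (rule closure_lip[OF H _ f]) (use L in auto)
  have Dj: "(%n. h (r n) (D j)) \<longlonglongrightarrow> f (D j)" for j
  proof (rule LIM_zero_cancel, rule Lim_null_comparison)
    show "(%n. 1 / real (Suc n)) \<longlonglongrightarrow> 0" using LIMSEQ_inverse_real_of_nat by (simp add: inverse_eq_divide)
    show "\<forall>\<^sub>F n in sequentially. norm (h (r n) (D j) - f (D j)) <= 1 / real (Suc n)"
      using eventually_ge_at_top[of j] by eventually_elim (use r in \<open>auto simp: abs_minus_commute less_imp_le\<close>)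
  qed
  show thesis
  proof
    fix x assume x: "x : points X"
    have "convergent (%n. h (r n) x)"
      by (rule lip_dense_tendsto[OF D, where h="%n. h (r n)"]) (use L Dj x convergentI in blast)+
    then obtain l where l: "(%n. h (r n) x) \<longlonglongrightarrow> l" unfolding convergent_def by blast
    have "\<bar>f x - l\<bar> <= e" if e: "e > 0" for e
    proof -
      obtain j where j: "data_dist X x (D j) < e/2" using D(2)[OF x half_gt_zero[OF e]] by blast
      have "\<bar>h (r n) x - h (r n) (D j)\<bar> <= e/2" for n using L j x D(1) unfolding lip_def by (meson less_imp_le order_trans)
      hence "\<bar>l - f (D j)\<bar> <= e/2" by (intro LIMSEQ_le_const2[OF tendsto_rabs[OF tendsto_diff[OF l Dj]]]) auto
      moreover have "\<bar>f x - f (D j)\<bar> <= e/2" using lf j x D(1) unfolding lip_def by (meson less_imp_le order_trans)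
      ultimately show ?thesis by linarith
    qed
    hence "f x = l" by (metis abs_le_zero_iff dense_ge eq_iff_diff_eq_0 less_imp_le)
    thus "(%n. h (r n) x) \<longlonglongrightarrow> f x" using l by simp
  qed
qed

text \<open>Restriction to a dense sequence of points maps H into sequences of reals, a space in
  which every set has a countable dense subset; the Lipschitz bound carries the approximation over
  to all points.\<close>

lemma countable_dense_family:
  assumes H: "H <= extensional (points X)" "H ~= {}" and L: "!!h. h : H ==> lip h"
  obtains h :: "nat => 'a => real" where "range h <= H" "H <= pointwise_closure (points X) (range h)"
proof -
  obtain D where "dense_points D" by (rule dense_seq)
  note D = dense_pointsD[OF this]
  define e where "e f = (%i. f (D i))" for f :: "'a => real"
  obtain T where T: "countable T" "T <= e ` H" "e ` H <= closure T" using Topology_Euclidean_Space.separable[of "e ` H"] by blast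
  hence "T ~= {}" using H by auto
  obtain g where g: "!!t. t : T ==> g t : H & e (g t) = t" using T(2) by (metis (no_types, lifting) f_inv_into_f inv_into_into subsetD)
  define h where "h n = g (from_nat_into T n)" for n
  have rT: "range (from_nat_into T) = T" using T \<open>T ~= {}\<close> by (simp add: range_from_nat_into)
  have hH: "range h <= H" using g rT unfolding h_def by (metis image_subsetI rangeI)
  moreover have "f : pointwise_closure (points X) (range h)" if f: "f : H" for f
  proof (subst pointwise_closure_iff, use hH H in blast, intro conjI allI impI)
    show "f : extensional (points X)" using f H by blast
    fix S \<epsilon> assume S: "finite S & S <= points X & (0::real) < \<epsilon>"
    hence "ALL s:S. EX j. data_dist X s (D j) < \<epsilon>/3" by (intro ballI D(2)) auto
    then obtain j where j: "!!s. s : S ==> data_dist X s (D (j s)) < \<epsilon>/3" by metis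
    let ?U = "\<Inter>i\<in>j ` S. (%y. y i) -` ball (f (D i)) (\<epsilon>/3)"
    have "open ((%y :: nat => real. y i) -` ball a r)" for i a r
      by (rule open_vimage[OF open_ball continuous_on_product_coordinates])
    hence "open ?U" using S by (intro open_INT) auto
    moreover have "e f : ?U" using S by (auto simp: e_def)
    moreover have "e f : closure T" using T f by blast
    ultimately have "?U Int T ~= {}" using open_Int_closure_eq_empty[of ?U T] by blast
    then obtain t where t: "t : T" "t : ?U" by blast
    then obtain n where n: "t = from_nat_into T n" using rT by blast
    have "\<bar>f s - h n s\<bar> < \<epsilon>" if s: "s : S" for s
    proof -
      have "h n (D (j s)) = t (j s)" using g[OF t(1)] unfolding h_def n e_def by (metis)
      moreover have "\<bar>f (D (j s)) - t (j s)\<bar> < \<epsilon>/3" using t(2) s by (auto simp: dist_real_def)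
      moreover have "\<bar>f s - f (D (j s))\<bar> < \<epsilon>/3" "\<bar>h n s - h n (D (j s))\<bar> < \<epsilon>/3"
        using L f hH j[OF s] s S D(1) unfolding lip_def by (meson le_less_trans rangeI subsetD)+
      ultimately show ?thesis by linarith
    qed
    thus "EX h:range h. ALL s:S. \<bar>f s - h s\<bar> < \<epsilon>" by blast
  qed
  ultimately show thesis using that by blast
qed

text \<open>All values F n i (D j) are listed as one point of a compact cube, so that a single
  subsequence works for all i at once.\<close>

lemma closure_seq_compact:
  assumes H: "H <= extensional (points X)" and L: "!!h. h : H ==> lip h"
    and b: "!!h x. h : H ==> x : points X ==> \<bar>h x\<bar> <= c"
    and F: "!!n i. F n i : pointwise_closure (points X) H"
  obtains r :: "nat => nat" and G :: "nat => 'a => real" where "strict_mono r"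
    "!!i. G i : pointwise_closure (points X) H"
    "!!i x. x : points X ==> (%n. F (r n) i x) \<longlonglongrightarrow> G i x"
proof -
  obtain D where "dense_points D" by (rule dense_seq)
  note D = dense_pointsD[OF this]
  define y where "y n = (%k. case prod_decode k of (i, j) => F n i (D j))" for n
  have "compactin (product_topology (%_. euclideanreal) UNIV) (PiE (UNIV :: nat set) (%_. {-c..c}))"
    by (subst compactin_PiE) auto
  hence "compact (PiE (UNIV :: nat set) (%_. {-c..c}))" by (simp add: euclidean_product_topology)
  hence sc: "seq_compact (PiE (UNIV :: nat set) (%_. {-c..c}))" by (rule compact_imp_seq_compact)
  have "y n : PiE UNIV (%_. {-c..c})" for n
  proof (rule PiE_I)
    fix k
    obtain i j where k: "prod_decode k = (i, j)" by (cases "prod_decode k")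
    have "\<bar>F n i (D j)\<bar> <= c" by (rule pointwise_closure_bound1[OF F H]) (use b D(1) in auto)
    thus "y n k : {-c..c}" by (simp add: y_def k abs_le_iff)
  qed simp
  then obtain l r where r: "strict_mono r" "(y \<circ> r) \<longlonglongrightarrow> l" using seq_compactE[OF sc, of y] by blast
  have lF: "lip (F n i)" for n i by (rule closure_lip[OF H L F])
  have Dc: "convergent (%n. F (r n) i (D j))" for i j
  proof -
    have "(%n. (y \<circ> r) n (prod_encode (i, j))) \<longlonglongrightarrow> l (prod_encode (i, j))"
      by (rule continuous_on_tendsto_compose[OF continuous_on_product_coordinates r(2)]) auto
    thus ?thesis by (auto simp: y_def convergent_def)
  qed
  have cv: "convergent (%n. F (r n) i x)" if "x : points X" for x i
    by (rule lip_dense_tendsto[OF D, where h="%n. F (r n) i"]) (use lF Dc that in auto)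
  define G where "G i = restrict (%x. lim (%n. F (r n) i x)) (points X)" for i
  have G: "(%n. F (r n) i x) \<longlonglongrightarrow> G i x" if "x : points X" for i x
    using cv[OF that, of i] that by (simp add: G_def convergent_LIMSEQ_iff)
  show thesis
  proof (rule that[OF r(1) _ G])
    show "G i : pointwise_closure (points X) H" for i
      by (rule pointwise_closure_limit[where h="%n. F (r n) i"]) (use F G in \<open>auto simp: G_def\<close>)
  qed
qed

end

lemma pointwise_closure_postcompose:
  assumes g: "g : pointwise_closure X H" and t: "continuous_on UNIV t"
  shows "compose X t g : pointwise_closure X ((%h. compose X t h) ` H)"
proof -
  let ?T = "product_topology (%_. euclideanreal) X"
  have "continuous_map euclideanreal euclideanreal t" using t by simp
  hence "continuous_map ?T euclideanreal (%h. t (h x))" if "x : X" for x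
    using continuous_map_compose[OF continuous_map_product_projection[OF that], of "%_. euclideanreal" euclideanreal t]
    by (simp add: comp_def)
  hence "continuous_map ?T ?T (%h. compose X t h)" unfolding continuous_map_componentwise by (auto simp: compose_def)
  from continuous_map_image_closure_subset[OF this, of H] g show ?thesis unfolding pointwise_closure_def by blast
qed

section \<open>Frames and the support of the law of a frame\<close>

text \<open>The entries may lie in the closure rather than in the family itself: isomorphisms
  preserve only closures, so this is the notion that can be transported.\<close>

definition frame :: "'a dataset => (nat => 'a => real) => bool" where
  "frame X f \<longleftrightarrow> (ALL i. f i : feature_closure X) & features X <= pointwise_closure (points X) (range f)"

text \<open>Closed balls of the supremum distance, for which frames are isometries. They are Borel
  sets of the product topology but not neighbourhoods in it.\<close>

definition supball :: "(nat => real) => real => (nat => real) set" where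
  "supball x r = {y. ALL i. \<bar>y i - x i\<bar> <= r}"

text \<open>Support with respect to the supremum distance; it is contained in the support for the
  product topology and can be much smaller.\<close>

definition sup_support :: "(nat => real) measure => (nat => real) set" where
  "sup_support m = {x. ALL r>0. emeasure m (supball x r) > 0}"

lemma supball_borel [measurable]: "supball x r : sets borel"
proof -
  have "Measurable.pred borel (%y :: nat => real. ALL i. \<bar>y i - x i\<bar> <= r)" by measurable
  thus ?thesis unfolding supball_def by (simp add: pred_def)
qed

context geom_data
begin

lemma closure_seq_measurable:
  "(!!i. f i : feature_closure X) ==> f i : borel_measurable (law X)"
  by (intro lip_measurable feature_closure_lip)

lemma frame_closure: "frame X f ==> f i : feature_closure X" by (auto simp: frame_def)

lemma frame_lip: "frame X f ==> lip (f i)" by (auto simp: frame_def intro: feature_closure_lip)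

lemma frame_measurable: "frame X f ==> f i : borel_measurable (law X)" by (rule lip_measurable[OF frame_lip])

lemma frame_ext: "frame X f ==> range f <= extensional (points X)"
  using feature_closure_ext unfolding frame_def by blast

lemma frame_dist:
  assumes "frame X f" "x : points X" "y : points X" "!!i. \<bar>f i x - f i y\<bar> <= c"
  shows "data_dist X x y <= c"
proof (rule data_dist_le[OF assms(2,3)])
  fix g assume "g : features X"
  hence "g : pointwise_closure (points X) (range f)" using assms(1) by (auto simp: frame_def)
  thus "\<bar>g x - g y\<bar> <= c" by (rule pointwise_closure_bound[OF _ frame_ext[OF assms(1)]]) (use assms in auto)
qed

lemma frame_feature_closure: "frame X f ==> feature_closure X = pointwise_closure (points X) (range f)"
  unfolding feature_closure_def frame_def by (intro equalityI pointwise_closure_minimal) auto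

lemma ex_frame: obtains f where "frame X f" "range f <= features X"
proof -
  obtain h :: "nat => 'a => real" where h: "range h <= features X" "features X <= pointwise_closure (points X) (range h)"
    by (rule countable_dense_family[OF features_ext features_ne]) (auto simp: lip_def feature_dist_le)
  hence "frame X h" unfolding frame_def using features_closure by blast
  with h(1) show thesis by (rule that[rotated])
qed

lemma lip_seq_in_support:
  assumes "!!i. lip (g i)" "z : points X"
  shows "(%i. g i z) : sup_support (seq_law (law X) g)" unfolding sup_support_def
proof (intro CollectI allI impI)
  fix r :: real assume r: "r > 0"
  have m: "(%x i. g i x) : borel_measurable (law X)" by (rule seq_measurable) (rule lip_measurable[OF assms(1)])
  have "0 < emeasure (law X) (mball z r)" by (rule mball_pos[OF assms(2) r])
  also have "\<dots> <= emeasure (law X) ((%x i. g i x) -` supball (%i. g i z) r Int space (law X))"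
  proof (rule emeasure_mono)
    show "mball z r <= (%x i. g i x) -` supball (%i. g i z) r Int space (law X)"
    proof
      fix y assume y: "y : mball z r"
      have "\<bar>g i y - g i z\<bar> <= r" for i
      proof -
        have "\<bar>g i y - g i z\<bar> <= data_dist X y z" using assms y unfolding lip_def by auto
        thus ?thesis using y commute[of y z] by simp
      qed
      thus "y : (%x i. g i x) -` supball (%i. g i z) r Int space (law X)" using y by (simp add: supball_def)
    qed
    show "(%x i. g i x) -` supball (%i. g i z) r Int space (law X) : sets (law X)"
      using measurable_sets[OF m supball_borel] .
  qed
  also have "\<dots> = emeasure (seq_law (law X) g) (supball (%i. g i z) r)"
    unfolding seq_law_def by (rule emeasure_distr[symmetric, OF m supball_borel])
  finally show "0 < emeasure (seq_law (law X) g) (supball (%i. g i z) r)" .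
qed

text \<open>A data set is recovered from the law of a frame, which is an isometry onto this support.
  It is onto because points whose tuples approach s uniformly form a Cauchy sequence, and X is
  complete.\<close>

lemma range_frame:
  assumes f: "frame X f"
  shows "(%x i. f i x) ` points X = sup_support (seq_law (law X) f)"
proof (intro equalityI subsetI)
  fix s assume "s : (%x i. f i x) ` points X"
  thus "s : sup_support (seq_law (law X) f)" using lip_seq_in_support[of f] frame_lip[OF f] by auto
next
  fix s assume s: "s : sup_support (seq_law (law X) f)"
  have m: "(%x i. f i x) : borel_measurable (law X)" by (rule seq_measurable) (rule frame_measurable[OF f])
  have "EX x:points X. ALL i. \<bar>f i x - s i\<bar> <= 1 / Suc n" for n
  proof (rule ccontr)
    assume "\<not> ?thesis"
    hence "(%x i. f i x) -` supball s (1 / Suc n) Int space (law X) = {}" by (auto simp: supball_def)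
    hence "emeasure (seq_law (law X) f) (supball s (1 / Suc n)) = 0" unfolding seq_law_def emeasure_distr[OF m supball_borel] by simp
    thus False using s by (auto simp: sup_support_def dest!: spec[of _ "1 / Suc n"])
  qed
  then obtain a where a: "!!n. a n : points X" "!!n i. \<bar>f i (a n) - s i\<bar> <= 1 / Suc n" by metis
  have "MCauchy a" unfolding MCauchy_def
  proof (intro conjI allI impI)
    show "range a <= points X" using a by auto
    fix e :: real assume "e > 0"
    then obtain N where N: "1 / real (Suc N) < e / 3" using nat_approx_posE[of "e/3"] by auto
    have "data_dist X (a n) (a n') < e" if "N <= n" "N <= n'" for n n'
    proof -
      have "1 / real (Suc n) <= 1 / Suc N" "1 / real (Suc n') <= 1 / Suc N" using that by (auto intro!: divide_left_mono)
      hence "\<bar>f i (a n) - f i (a n')\<bar> <= 2 * (e/3)" for i using a(2)[of i n] a(2)[of i n'] N by linarith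
      hence "data_dist X (a n) (a n') <= 2 * (e/3)" by (intro frame_dist[OF f]) (use a in auto)
      thus ?thesis using \<open>e > 0\<close> by simp
    qed
    thus "EX N. ALL n n'. N <= n --> N <= n' --> data_dist X (a n) (a n') < e" by blast
  qed
  then obtain x where x: "limitin mtopology a x sequentially" using complete unfolding mcomplete_def by blast
  hence xP: "x : points X" by (rule limitin_mspace)
  have "f i x = s i" for i
  proof -
    have "limitin euclideanreal (f i \<circ> a) (f i x) sequentially"
      by (rule continuous_map_limit[OF lip_continuous[OF frame_lip[OF f]] x])
    hence "(%n. f i (a n)) \<longlonglongrightarrow> f i x" by (simp add: comp_def)
    moreover have "(%n. f i (a n)) \<longlonglongrightarrow> s i"
    proof (rule LIM_zero_cancel, rule Lim_null_comparison)
      show "(%n. 1 / real (Suc n)) \<longlonglongrightarrow> 0" using LIMSEQ_inverse_real_of_nat by (simp add: inverse_eq_divide)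
    qed (use a in auto)
    ultimately show ?thesis by (rule LIMSEQ_unique)
  qed
  thus "s : (%x i. f i x) ` points X" using xP by (intro image_eqI[of _ _ x]) auto
qed

text \<open>Closed balls are preimages of \<open>supball\<close>, and by separability every open set
  is a countable union of closed balls; so the frame generates all Borel sets.\<close>

lemma frame_sets:
  assumes f: "frame X f" and A: "A : sets (law X)"
  obtains C where "C : sets borel" "A = (%x i. f i x) -` C Int points X"
proof -
  let ?V = "vimage_algebra (points X) (%x i. f i x) (borel :: (nat => real) measure)"
  have ball: "mcball x r : sets ?V" if "x : points X" for x r
  proof -
    have "mcball x r = (%x i. f i x) -` supball (%i. f i x) r Int points X"
    proof (intro equalityI subsetI)
      fix y assume "y : mcball x r"
      hence y: "y : points X" "data_dist X y x <= r" by (auto simp: commute)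
      hence "\<bar>f i y - f i x\<bar> <= r" for i using frame_lip[OF f, of i] that unfolding lip_def by (meson order_trans)
      thus "y : (%x i. f i x) -` supball (%i. f i x) r Int points X" using y by (simp add: supball_def)
    next
      fix y assume "y : (%x i. f i x) -` supball (%i. f i x) r Int points X"
      hence "y : points X" "!!i. \<bar>f i x - f i y\<bar> <= r" by (auto simp: supball_def abs_minus_commute)
      thus "y : mcball x r" using frame_dist[OF f that, of y r] that by simp
    qed
    thus ?thesis by (simp add: in_vimage_algebra)
  qed
  obtain D where "dense_points D" by (rule dense_seq)
  note D = dense_pointsD[OF this]
  have "U : sets ?V" if U: "openin mtopology U" for U
  proof -
    let ?I = "{(n, k). mcball (D n) (1 / Suc k) <= U}"
    have "U = (\<Union>(n, k)\<in>?I. mcball (D n) (1 / real (Suc k)))"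
    proof (intro equalityI subsetI)
      fix x assume x: "x : U"
      then obtain r where r: "r > 0" "mball x r <= U" using U unfolding openin_mtopology by blast
      have xP: "x : points X" using x U openin_subset by fastforce
      obtain k where k: "1 / real (Suc k) < r / 2" using nat_approx_posE[of "r/2"] r by auto
      obtain n where n: "data_dist X x (D n) < 1 / Suc k" using D(2)[OF xP, of "1 / Suc k"] by auto
      have "mcball (D n) (1 / Suc k) <= mball x r" by (rule mcball_subset_mball) (use n k D(1) xP commute[of x "D n"] in auto)
      moreover have "x : mcball (D n) (1 / Suc k)" using n D(1) xP commute[of x "D n"] by simp
      ultimately show "x : (\<Union>(n, k)\<in>?I. mcball (D n) (1 / real (Suc k)))" using r by blast
    qed auto
    moreover have "(\<Union>(n, k)\<in>?I. mcball (D n) (1 / real (Suc k))) : sets ?V"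
      by (intro sets.countable_UN'') (auto intro: ball D)
    ultimately show ?thesis by simp
  qed
  hence "sigma_sets (points X) {U. openin mtopology U} <= sets ?V"
    using sets.sigma_sets_subset[of "{U. openin mtopology U}" ?V] by auto
  hence "A : sets ?V" using A unfolding sets_law sets_borel_of by auto
  thus thesis using that sets_vimage_algebra2[of "%x i. f i x" "points X" borel] by auto
qed

end

text \<open>Every point of a data set lies in the support of the law, so equality of laws lifts to a
  map that is defined everywhere and not just almost everywhere.\<close>

lemma frame_map:
  assumes "geometric_dataset Y" "geometric_dataset Z" and f: "frame Y f"
    and g: "!!i. g i : feature_closure Z" and eq: "seq_law (law Y) f = seq_law (law Z) g"
  obtains p where "p : measurable (law Z) (law Y)" "distr (law Z) (law Y) p = law Y"
    "ALL z:points Z. ALL i. f i (p z) = g i z"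
proof -
  interpret Y: geom_data Y by unfold_locales fact
  interpret Z: geom_data Z by unfold_locales fact
  let ?\<Phi> = "%x i. f i x"
  have "EX y:points Y. ALL i. f i y = g i z" if "z : points Z" for z
  proof -
    have "(%i. g i z) : sup_support (seq_law (law Z) g)" by (rule Z.lip_seq_in_support[OF Z.feature_closure_lip[OF g] that])
    hence "(%i. g i z) : ?\<Phi> ` points Y" unfolding Y.range_frame[OF f] eq .
    thus ?thesis by (auto simp: fun_eq_iff)
  qed
  then obtain p where p: "!!z. z : points Z ==> p z : points Y" "!!z i. z : points Z ==> f i (p z) = g i z" by metis
  have pre: "p -` ((%x i. f i x) -` C Int points Y) Int space (law Z) = (%x i. g i x) -` C Int space (law Z)" for C
    using p by auto
  have mf: "?\<Phi> : borel_measurable (law Y)" by (rule seq_measurable) (rule Y.frame_measurable[OF f])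
  have mg: "(%x i. g i x) : borel_measurable (law Z)" by (rule seq_measurable) (rule Z.closure_seq_measurable[OF g])
  have pm: "p : measurable (law Z) (law Y)"
  proof (rule measurableI)
    fix A assume "A : sets (law Y)"
    then obtain C where "C : sets borel" "A = ?\<Phi> -` C Int points Y" by (rule Y.frame_sets[OF f])
    thus "p -` A Int space (law Z) : sets (law Z)" using pre measurable_sets[OF mg] by simp
  qed (use p in auto)
  have "distr (law Z) (law Y) p = law Y"
  proof (rule measure_eqI)
    fix A assume "A : sets (distr (law Z) (law Y) p)"
    hence A: "A : sets (law Y)" by simp
    then obtain C where C: "C : sets borel" "A = ?\<Phi> -` C Int points Y" by (rule Y.frame_sets[OF f])
    have "emeasure (distr (law Z) (law Y) p) A = emeasure (law Z) ((%x i. g i x) -` C Int space (law Z))"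
      unfolding emeasure_distr[OF pm A] unfolding C pre ..
    also have "\<dots> = emeasure (seq_law (law Z) g) C" unfolding seq_law_def by (rule emeasure_distr[symmetric, OF mg C(1)])
    also have "\<dots> = emeasure (law Y) A" unfolding eq[symmetric] unfolding seq_law_def emeasure_distr[OF mf C(1)] C(2) by simp
    finally show "emeasure (distr (law Z) (law Y) p) A = emeasure (law Y) A" .
  qed simp
  with pm p(2) show thesis using that by blast
qed

section \<open>The feature order\<close>

lemma isCont_tau: "isCont tau x" unfolding tau_def by (intro continuous_intros) auto

lemma continuous_tau: "continuous_on UNIV tau" using isCont_tau by (simp add: continuous_at_imp_continuous_on)

lemma tau_strict_mono: "strict_mono tau" unfolding tau_def by (auto simp: strict_mono_def)

lemma tau_bound: "\<bar>tau x\<bar> < 1/2" using tanh_real_bounds[of x] by (simp add: tau_def abs_less_iff)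

definition tau_inv :: "real => real" where "tau_inv y = artanh (2 * y)"

lemma tau_inv_tau [simp]: "tau_inv (tau x) = x" by (simp add: tau_inv_def tau_def artanh_tanh_real)

lemma tau_tau_inv: "\<bar>y\<bar> < 1/2 ==> tau (tau_inv y) = y"
proof -
  assume "\<bar>y\<bar> < 1/2"
  hence y: "-1 < 2 * y" "2 * y < 1" by (auto simp: abs_less_iff)
  have "exp (- 2 * artanh (2 * y)) = inverse (exp (ln ((1 + 2 * y) / (1 - 2 * y))))" by (simp add: artanh_def exp_minus)
  also have "\<dots> = (1 - 2 * y) / (1 + 2 * y)" using y by (subst exp_ln) auto
  finally have "tanh (artanh (2 * y)) = (1 - (1 - 2 * y) / (1 + 2 * y)) / (1 + (1 - 2 * y) / (1 + 2 * y))"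
    unfolding tanh_real_altdef by simp
  also have "\<dots> = 2 * y" using y by (simp add: field_simps)
  finally show ?thesis by (simp add: tau_inv_def tau_def)
qed

lemma isCont_tau_inv: "\<bar>y\<bar> < 1/2 ==> isCont tau_inv y"
  unfolding tau_inv_def by (intro continuous_intros) (auto simp: abs_less_iff)

lemma tau_inv_measurable [measurable]: "tau_inv : borel_measurable borel" unfolding tau_inv_def artanh_def by measurable

lemma tau_contract: "\<bar>tau x - tau y\<bar> <= \<bar>x - y\<bar> / 2"
proof -
  have *: "\<bar>tau x - tau y\<bar> <= (y - x) / 2" if "x < y" for x y
  proof -
    have "EX z>x. z < y & tanh y - tanh x = (y - x) * (1 - tanh z ^ 2)"
      by (rule MVT2[OF that]) (auto intro!: derivative_eq_intros)
    then obtain z where z: "tanh y - tanh x = (y - x) * (1 - tanh z ^ 2)" by blast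
    have "(y - x) * (1 - tanh z ^ 2) <= (y - x) * 1" using that by (intro mult_left_mono) auto
    moreover have "tanh x < tanh y" using that by simp
    ultimately show ?thesis using z by (simp add: tau_def)
  qed
  show ?thesis using *[of x y] *[of y x] by (cases x y rule: linorder_cases) (auto simp: abs_minus_commute)
qed

section \<open>Compactified features of a data set\<close>

context geom_data
begin

lemma tau_features_ext: "tau_features X <= extensional (points X)" by (auto simp: tau_features_def)

lemma lip_tau: assumes "lip f" shows "lip (compose (points X) tau f)" unfolding lip_def
proof (intro ballI)
  fix x y assume xy: "x : points X" "y : points X"
  have "\<bar>tau (f x) - tau (f y)\<bar> <= \<bar>f x - f y\<bar> / 2" by (rule tau_contract)
  also have "\<dots> <= data_dist X x y" using assms xy unfolding lip_def by (smt (verit) field_sum_of_halves)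
  finally show "\<bar>compose (points X) tau f x - compose (points X) tau f y\<bar> <= data_dist X x y" using xy by (simp add: compose_def)
qed

lemma tau_features_lip: "h : tau_features X ==> lip h"
  unfolding tau_features_def using lip_tau feature_closure_lip features_closure by blast

lemma tau_features_bound: "h : tau_features X ==> x : points X ==> \<bar>h x\<bar> <= 1/2"
  unfolding tau_features_def using tau_bound by (auto simp: compose_def less_imp_le)

lemma K_tau_lip: "g : K_tau X ==> lip g"
  unfolding K_tau_def using closure_lip[OF tau_features_ext tau_features_lip] by blast

lemma K_tau_bound: "g : K_tau X ==> x : points X ==> \<bar>g x\<bar> <= 1/2"
  unfolding K_tau_def by (erule pointwise_closure_bound1[OF _ tau_features_ext]) (use tau_features_bound in auto)

lemma K_tau_ext: "g : K_tau X ==> g : extensional (points X)" unfolding K_tau_def by (rule pointwise_closure_ext)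

lemma K_tau_measurable: "g : K_tau X ==> g : borel_measurable (law X)" by (intro lip_measurable K_tau_lip)

lemma tau_features_ne: "tau_features X ~= {}" using features_ne by (simp add: tau_features_def)

lemma K_tau_ne: "K_tau X ~= {}" unfolding K_tau_def using pointwise_closure_superset[OF tau_features_ext] tau_features_ne by blast

lemma tau_features_K: "f : features X ==> compose (points X) tau f : K_tau X"
  unfolding K_tau_def using pointwise_closure_superset[OF tau_features_ext] by (auto simp: tau_features_def)

lemma tau_closure: "f : feature_closure X ==> compose (points X) tau f : K_tau X"
  using pointwise_closure_postcompose[OF _ continuous_tau] unfolding feature_closure_def K_tau_def tau_features_def by blast

lemma K_tau_limit:
  assumes "g : K_tau X"
  obtains h where "ALL n. h n : features X" "ALL x:points X. (%n. tau (h n x)) \<longlonglongrightarrow> g x"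
proof -
  obtain t :: "nat => 'a => real" where t: "range t <= tau_features X" "tau_features X <= pointwise_closure (points X) (range t)"
    by (rule countable_dense_family[OF tau_features_ext tau_features_ne tau_features_lip])
  have "g : pointwise_closure (points X) (range t)" using assms pointwise_closure_minimal[OF t(2)] unfolding K_tau_def by blast
  then obtain r :: "nat => nat" where r: "!!x. x : points X ==> (%n. t (r n) x) \<longlonglongrightarrow> g x"
    using closure_range_seq[of t g] t(1) tau_features_ext tau_features_lip by blast
  have "ALL i. EX h:features X. t i = compose (points X) tau h" using t(1) unfolding tau_features_def by blast
  then obtain h where h: "!!i. h i : features X" "!!i. t i = compose (points X) tau (h i)" by metis
  show thesis by (rule that[of "%n. h (r n)"]) (use h r in \<open>auto simp: compose_def\<close>)
qed

text \<open>A limit of the compactified features is either finite everywhere or constantly infinite.\<close>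

lemma K_tau_finite:
  assumes g: "g : K_tau X" and x: "x : points X" "\<bar>g x\<bar> < 1/2"
  obtains k where "k : feature_closure X" "g = compose (points X) tau k"
proof -
  obtain h where "ALL n. h n : features X" "ALL x:points X. (%n. tau (h n x)) \<longlonglongrightarrow> g x"
    by (rule K_tau_limit[OF g])
  hence h: "!!n. h n : features X" "!!x. x : points X ==> (%n. tau (h n x)) \<longlonglongrightarrow> g x" by auto
  have conv: "(%n. h n y) \<longlonglongrightarrow> tau_inv (g y)" if "y : points X" "\<bar>g y\<bar> < 1/2" for y
    using isCont_tendsto_compose[OF isCont_tau_inv[OF that(2)] h(2)[OF that(1)]] by simp
  have fin: "\<bar>g y\<bar> < 1/2" if y: "y : points X" for y
  proof -
    have "Bseq (%n. h n x)" using conv[OF x] convergent_imp_Bseq convergentI by blast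
    then obtain B where B: "!!n. \<bar>h n x\<bar> <= B" unfolding Bseq_def by auto
    \<comment> \<open>The finite distance between x and y turns a bound at x, uniform in n, into one
      at y.\<close>
    let ?C = "B + data_dist X y x"
    have hb: "\<bar>h n y\<bar> <= ?C" for n using B[of n] feature_dist_le[OF h(1)[of n] y x(1)] by linarith
    hence "- ?C <= h n y" "h n y <= ?C" for n using hb[of n] by linarith+
    hence "tau (-?C) <= tau (h n y)" "tau (h n y) <= tau ?C" for n unfolding strict_mono_less_eq[OF tau_strict_mono] by blast+
    hence "tau (-?C) <= g y" "g y <= tau ?C" using h(2)[OF y] by (auto intro: LIMSEQ_le_const LIMSEQ_le_const2)
    thus ?thesis using tau_bound[of ?C] tau_bound[of "-?C"] by linarith
  qed
  let ?k = "restrict (%y. tau_inv (g y)) (points X)"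
  have "?k : feature_closure X" unfolding feature_closure_def
    by (rule pointwise_closure_limit[of h]) (use h(1) features_closure conv fin in \<open>auto simp: feature_closure_def\<close>)
  moreover have "g = compose (points X) tau ?k" using K_tau_ext[OF g] fin by (auto simp: compose_def fun_eq_iff tau_tau_inv extensional_def)
  ultimately show thesis by (rule that)
qed

end

section \<open>Order and isomorphism through laws of tuples\<close>

lemma measure_preserving_AE_compose:
  assumes "p : measurable M N" "distr M N p = N" "f : borel_measurable N" "g : borel_measurable N"
  shows "(\<integral>\<^sup>+x. ennreal \<bar>f (p x) - g (p x)\<bar> \<partial>M) = (L1 N f g)"
proof -
  have "(L1 N f g) = (L1 ((distr M N p)) f g)" using assms by simp
  also have "\<dots> = (\<integral>\<^sup>+x. ennreal \<bar>f (p x) - g (p x)\<bar> \<partial>M)" using assms by (subst nn_integral_distr) auto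
  finally show ?thesis by simp
qed

lemma feature_leE:
  assumes "geometric_dataset Y" "geometric_dataset Z" "feature_le Y Z"
  obtains p where "p : measurable (law Z) (law Y)" "distr (law Z) (law Y) p = law Y"
    "(%f. compose (points Z) f p) ` feature_closure Y <= feature_closure Z"
    "(%f. compose (points Z) f p) ` K_tau Y <= K_tau Z"
    "p : points Z \<rightarrow> points Y"
proof -
  interpret Y: geom_data Y by unfold_locales fact
  interpret Z: geom_data Z by unfold_locales fact
  obtain p where p: "p : measurable (law Z) (law Y)" "distr (law Z) (law Y) p = law Y"
    "(%f. compose (points Z) f p) ` features Y <= feature_closure Z" using assms unfolding feature_le_def by blast
  have pp: "p : points Z \<rightarrow> points Y" using measurable_space[OF p(1)] by auto
  show thesis
  proof (rule that[OF p(1,2) _ _ pp]; clarify)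
    fix f assume f: "f : feature_closure Y"
    show "compose (points Z) f p : feature_closure Z"
      using pointwise_closure_compose[OF f[unfolded feature_closure_def] Y.features_ext pp]
        pointwise_closure_minimal[OF p(3)[unfolded feature_closure_def]] unfolding feature_closure_def by blast
  next
    fix f assume f: "f : K_tau Y"
    have "(%h. compose (points Z) h p) ` tau_features Y <= K_tau Z"
    proof clarify
      fix h assume "h : tau_features Y"
      then obtain k where k: "k : features Y" "h = compose (points Y) tau k" by (auto simp: tau_features_def)
      have "compose (points Z) h p = compose (points Z) tau (compose (points Z) k p)" using pp by (auto simp: compose_def k fun_eq_iff)
      thus "compose (points Z) h p : K_tau Z" using Z.tau_closure p(3) k(1) by auto
    qed
    thus "compose (points Z) f p : K_tau Z" using pointwise_closure_compose[OF f[unfolded K_tau_def] Y.tau_features_ext pp]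
        pointwise_closure_minimal[of "(%h. compose (points Z) h p) ` tau_features Y" "points Z" "tau_features Z"]
      unfolding K_tau_def by blast
  qed
qed

lemma seq_law_compose:
  assumes "p : measurable M N" "distr M N p = N" "!!i. f i : borel_measurable N" "space M = P"
  shows "seq_law M (%i. compose P (f i) p) = seq_law N f"
proof -
  have "seq_law N f = seq_law M (%i x. f i (p x))" using seq_law_distr[OF assms(1,3)] assms(2) by simp
  also have "\<dots> = seq_law M (%i. compose P (f i) p)"
    unfolding seq_law_def by (rule distr_cong) (auto simp: compose_def assms(4))
  finally show ?thesis by simp
qed

lemma feature_le_refl: assumes "geometric_dataset X" shows "feature_le X X"
proof -
  interpret geom_data X by unfold_locales fact
  have "(%f. compose (points X) f (%x. x)) ` features X <= feature_closure X"
  proof clarify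
    fix f assume f: "f : features X"
    have "compose (points X) f (%x. x) = f"
      using feature_closure_ext[OF features_closure[OF f]] by (auto simp: compose_def fun_eq_iff extensional_def)
    thus "compose (points X) f (%x. x) : feature_closure X" using f features_closure by simp
  qed
  thus ?thesis unfolding feature_le_def by (intro bexI[of _ "%x. x"]) (auto simp: distr_id2)
qed

lemma feature_le_trans:
  assumes geo: "geometric_dataset X" "geometric_dataset Y" "geometric_dataset Z" and le: "feature_le X Y" "feature_le Y Z"
  shows "feature_le X Z"
proof -
  interpret X: geom_data X by unfold_locales fact
  interpret Z: geom_data Z by unfold_locales fact
  obtain p where p: "p : measurable (law Y) (law X)" "distr (law Y) (law X) p = law X"
    "(%f. compose (points Y) f p) ` feature_closure X <= feature_closure Y"
    "(%f. compose (points Y) f p) ` K_tau X <= K_tau Y" "p : points Y \<rightarrow> points X"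
    by (rule feature_leE[OF geo(1,2) le(1)])
  obtain q where q: "q : measurable (law Z) (law Y)" "distr (law Z) (law Y) q = law Y"
    "(%f. compose (points Z) f q) ` feature_closure Y <= feature_closure Z"
    "(%f. compose (points Z) f q) ` K_tau Y <= K_tau Z" "q : points Z \<rightarrow> points Y"
    by (rule feature_leE[OF geo(2,3) le(2)])
  have "compose (points Z) f (p \<circ> q) = compose (points Z) (compose (points Y) f p) q" for f :: "'a => real"
    using q(5) by (auto simp: compose_def fun_eq_iff)
  moreover have "compose (points Z) (compose (points Y) f p) q : feature_closure Z" if "f : features X" for f
    using p(3) q(3) X.features_closure[OF that] by blast
  ultimately have "(%f. compose (points Z) f (p \<circ> q)) ` features X <= feature_closure Z" by auto
  moreover have "distr (law Z) (law X) (p \<circ> q) = law X" using distr_distr[OF p(1) q(1)] p(2) q(2) by simp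
  ultimately show ?thesis unfolding feature_le_def using measurable_comp[OF q(1) p(1)] by blast
qed

text \<open>The order becomes an equality of laws: \<open>frame_map\<close> gives p with
  \<open>f i (p z) = g i z\<close>, and since f generates the closure, all features of Y go into the
  closure of Z.\<close>

lemma feature_leI:
  assumes geo: "geometric_dataset Y" "geometric_dataset Z" and f: "frame Y f"
    and g: "!!i. g i : feature_closure Z" and eq: "seq_law (law Y) f = seq_law (law Z) g"
  shows "feature_le Y Z"
proof -
  interpret Y: geom_data Y by unfold_locales fact
  interpret Z: geom_data Z by unfold_locales fact
  obtain p where p: "p : measurable (law Z) (law Y)" "distr (law Z) (law Y) p = law Y"
    "ALL z:points Z. ALL i. f i (p z) = g i z" using frame_map[OF geo f g eq] by blast
  have pp: "p : points Z \<rightarrow> points Y" using measurable_space[OF p(1)] by auto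
  have fg: "compose (points Z) (f i) p = g i" for i
    using p(3) Z.feature_closure_ext[OF g[of i]] by (auto simp: compose_def fun_eq_iff extensional_def)
  have "(%h. compose (points Z) h p) ` range f = range g" by (simp add: image_image fg)
  hence "compose (points Z) h p : pointwise_closure (points Z) (range g)" if "h : features Y" for h
    using pointwise_closure_compose[OF _ Y.frame_ext[OF f] pp, of h] f that unfolding frame_def by auto
  moreover have "pointwise_closure (points Z) (range g) <= feature_closure Z"
    unfolding feature_closure_def by (rule pointwise_closure_minimal) (use g in \<open>auto simp: feature_closure_def\<close>)
  ultimately show ?thesis unfolding feature_le_def using p(1,2) by blast
qed

text \<open>Compactified real features stay strictly inside (-1/2, 1/2), hence so does g almost
  surely. One such point per entry lets \<open>K_tau_finite\<close> write g as tau of real functions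
  in the closure, and applying \<open>tau_inv\<close> to both laws reduces to
  \<open>feature_leI\<close>.\<close>

lemma feature_le_tauI:
  assumes geo: "geometric_dataset Y" "geometric_dataset Z" and f: "frame Y f"
    and g: "!!i. g i : K_tau Z" and eq: "seq_law (law Y) (%i. compose (points Y) tau (f i)) = seq_law (law Z) g"
  shows "feature_le Y Z"
proof -
  interpret Y: geom_data Y by unfold_locales fact
  interpret Z: geom_data Z by unfold_locales fact
  have mf: "compose (points Y) tau (f i) : borel_measurable (law Y)" for i
    by (intro Y.K_tau_measurable Y.tau_closure Y.frame_closure[OF f])
  have mg: "g i : borel_measurable (law Z)" for i by (rule Z.K_tau_measurable[OF g])
  note mF = seq_measurable[of "%i. compose (points Y) tau (f i)", OF mf] and mG = seq_measurable[of g, OF mg]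
  have "EX k:feature_closure Z. g i = compose (points Z) tau k" for i
  proof -
    have [measurable]: "{x :: nat => real. \<bar>x i\<bar> < 1/2} : sets borel"
      using borel_measurable_less[of "%x. \<bar>x i\<bar>" borel "%_. 1/2"] by simp
    have "AE x in law Y. \<bar>compose (points Y) tau (f i) x\<bar> < 1/2"
      by (rule AE_I2) (use tau_bound in \<open>simp add: compose_def\<close>)
    hence "AE x in seq_law (law Y) (%i. compose (points Y) tau (f i)). \<bar>x i\<bar> < 1/2"
      unfolding seq_law_def by (subst AE_distr_iff[OF mF]) auto
    hence ae: "AE z in law Z. \<bar>g i z\<bar> < 1/2" unfolding eq unfolding seq_law_def by (subst (asm) AE_distr_iff[OF mG]) auto
    have "EX z:points Z. \<bar>g i z\<bar> < 1/2"
    proof (rule ccontr)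
      assume n: "\<not> ?thesis"
      have "AE z in law Z. False" using ae AE_space by eventually_elim (use n in auto)
      thus False by (simp add: Z.law.AE_False)
    qed
    then obtain z where "z : points Z" "\<bar>g i z\<bar> < 1/2" by blast
    thus ?thesis using Z.K_tau_finite[OF g[of i]] by blast
  qed
  then obtain k where k: "!!i. k i : feature_closure Z" "!!i. g i = compose (points Z) tau (k i)" by metis
  have tm: "(%x i. tau_inv (x i)) : borel_measurable (borel :: (nat => real) measure)"
    by (rule seq_measurable) measurable
  have 1: "seq_law (law Y) f = distr (seq_law (law Y) (%i. compose (points Y) tau (f i))) borel (%x i. tau_inv (x i))"
    unfolding seq_law_def by (subst distr_distr[OF tm mF]) (auto simp: compose_def intro!: distr_cong)
  have 2: "seq_law (law Z) k = distr (seq_law (law Z) g) borel (%x i. tau_inv (x i))"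
    unfolding seq_law_def by (subst distr_distr[OF tm mG]) (auto simp: compose_def k(2) intro!: distr_cong)
  show ?thesis by (rule feature_leI[where g = k, OF geo f k(1)]) (simp add: 1 2 eq)
qed


text \<open>A measure preserving map acts on the compactified features as an isometry of a compact
  space into itself, which is onto: an element returns arbitrarily close to itself under iteration.\<close>

lemma (in geom_data) K_tau_onto:
  assumes s: "s : measurable (law X) (law X)" "distr (law X) (law X) s = law X"
    and inv: "(%k. compose (points X) k s) ` K_tau X <= K_tau X" and h: "h : K_tau X"
  obtains k where "k : K_tau X" "h = compose (points X) k s"
proof -
  let ?T = "%k. compose (points X) k s" and ?I = "%f g. (L1 (law X) f g)"
  have sP: "s x : points X" if "x : points X" for x using measurable_space[OF s(1)] that by simp
  have TK: "?T k : K_tau X" if "k : K_tau X" for k using inv that by blast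
  have TI: "?I (?T k) (?T k') = ?I k k'" if "k : K_tau X" "k' : K_tau X" for k k'
  proof -
    have "?I (?T k) (?T k') = (\<integral>\<^sup>+x. ennreal \<bar>k (s x) - k' (s x)\<bar> \<partial>law X)"
      by (rule nn_integral_cong) (simp add: compose_def)
    also have "\<dots> = ?I k k'" by (rule measure_preserving_AE_compose[OF s]) (use that K_tau_measurable in auto)
    finally show ?thesis .
  qed
  \<comment> \<open>The orbit of h. Composition with s preserves mean distances because s preserves
    the law.\<close>
  define H where "H n = (?T ^^ n) h" for n
  have HK: "H n : K_tau X" for n by (induction n) (auto simp: H_def h TK)
  have HS: "H (Suc n) = ?T (H n)" for n by (simp add: H_def)
  have HI: "?I (H (n + m)) (H n) = ?I (H m) h" for n m by (induction n) (simp_all add: HS TI HK, simp add: H_def)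
  have dom: "(%n. ?I (f n) (g n)) \<longlonglongrightarrow> ?I f' g'"
    if "!!n. f n : K_tau X" "!!n. g n : K_tau X" "f' : K_tau X" "g' : K_tau X"
      "!!x. x : points X ==> (%n. f n x) \<longlonglongrightarrow> f' x" "!!x. x : points X ==> (%n. g n x) \<longlonglongrightarrow> g' x" for f g f' g'
  proof (rule nn_integral_dominated_convergence[where w = "%_. 1"])
    have [measurable]: "f n : borel_measurable (law X)" "g n : borel_measurable (law X)"
      "f' : borel_measurable (law X)" "g' : borel_measurable (law X)" for n using that(1-4) K_tau_measurable by auto
    show "(%x. ennreal \<bar>f n x - g n x\<bar>) : borel_measurable (law X)" for n by measurable
    show "(%x. ennreal \<bar>f' x - g' x\<bar>) : borel_measurable (law X)" by measurable
    show "AE x in law X. ennreal \<bar>f n x - g n x\<bar> <= 1" for n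
    proof (rule AE_I2)
      fix x assume "x : space (law X)"
      hence "\<bar>f n x\<bar> <= 1/2" "\<bar>g n x\<bar> <= 1/2" using K_tau_bound that(1,2) by auto
      thus "ennreal \<bar>f n x - g n x\<bar> <= 1" by simp
    qed
    show "AE x in law X. (%n. ennreal \<bar>f n x - g n x\<bar>) \<longlonglongrightarrow> ennreal \<bar>f' x - g' x\<bar>"
      by (rule AE_I2) (auto intro!: tendsto_ennrealI tendsto_rabs tendsto_diff that(5,6))
  qed (use law.emeasure_space_1 in auto)
  have sc: "EX r G. strict_mono (r :: nat => nat) & G : K_tau X & (ALL x:points X. (%n. f (r n) x) \<longlonglongrightarrow> G x)"
    if f: "!!n. f n : K_tau X" for f
  proof -
    have F: "(%_::nat. f n) i : pointwise_closure (points X) (tau_features X)" for n i using f by (simp add: K_tau_def)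
    obtain r G where "strict_mono (r :: nat => nat)" "!!i. G i : pointwise_closure (points X) (tau_features X)"
      "!!(i::nat) x. x : points X ==> (%n. (%_::nat. f (r n)) i x) \<longlonglongrightarrow> G i x"
      by (rule closure_seq_compact[where F = "%n _. f n" and H = "tau_features X" and c = "1/2"])
        (use F tau_features_ext tau_features_lip tau_features_bound in auto)
    thus ?thesis by (intro exI[of _ r] exI[of _ "G 0"]) (auto simp: K_tau_def)
  qed
  have ret: "EX k. k : K_tau X & ?I h (?T k) < ennreal e" if e: "e > 0" for e :: real
  proof -
    obtain r G where r: "strict_mono (r :: nat => nat)" "G : K_tau X" "ALL x:points X. (%n. H (r n) x) \<longlonglongrightarrow> G x"
      using sc[of H] HK by blast
    have "(%n. ?I (H (r (Suc n))) (H (r n))) \<longlonglongrightarrow> ?I G G"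
      by (rule dom) (use HK r in \<open>auto intro: LIMSEQ_Suc\<close>)
    hence "\<forall>\<^sub>F n in sequentially. ?I (H (r (Suc n))) (H (r n)) < ennreal e"
      using e by (intro order_tendstoD(2)[of _ "?I G G"]) auto
    then obtain n where n: "?I (H (r (Suc n))) (H (r n)) < ennreal e" by (auto simp: eventually_sequentially)
    have "r n < r (Suc n)" using r(1) by (simp add: strict_mono_Suc_iff)
    \<comment> \<open>By the isometry r n iterations cancel: two close iterates show that h itself
      is close to an iterate with at least one application of s.\<close>
    then obtain j where j: "r (Suc n) = r n + Suc j" by (metis less_imp_Suc_add add_Suc_right)
    have "?I (?T (H j)) h < ennreal e" using n unfolding j HI unfolding HS .
    moreover have "?I (?T (H j)) h = ?I h (?T (H j))" by (rule nn_integral_cong) (simp add: abs_minus_commute)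
    ultimately show ?thesis using HK by auto
  qed
  have "ALL n. EX k. k : K_tau X & ?I h (?T k) < ennreal (1 / Suc n)" by (intro allI ret) auto
  then obtain k where k: "!!n. k n : K_tau X" "!!n. ?I h (?T (k n)) < ennreal (1 / Suc n)" by metis
  obtain r G where r: "strict_mono (r :: nat => nat)" "G : K_tau X" "ALL x:points X. (%n. k (r n) x) \<longlonglongrightarrow> G x"
    using sc[of k] k(1) by blast
  have lim: "(%n. ?T (k (r n)) x) \<longlonglongrightarrow> ?T G x" if "x : points X" for x
    using r(3) sP that by (simp add: compose_def)
  have "(%n. ?I h (?T (k (r n)))) \<longlonglongrightarrow> ?I h (?T G)" by (rule dom) (use h k(1) r TK lim in auto)
  moreover have "(%n. ?I h (?T (k (r n)))) \<longlonglongrightarrow> 0"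
  proof (rule tendsto_sandwich[OF always_eventually always_eventually tendsto_const])
    show "ALL n. ?I h (?T (k (r n))) <= ennreal (1 / Suc n)"
    proof
      fix n have "?I h (?T (k (r n))) <= ennreal (1 / Suc (r n))" using k(2)[of "r n"] by (simp add: less_imp_le)
      also have "\<dots> <= ennreal (1 / Suc n)" using seq_suble[OF r(1), of n] by (intro ennreal_leI divide_left_mono) auto
      finally show "?I h (?T (k (r n))) <= ennreal (1 / Suc n)" .
    qed
    have "(%n. 1 / real (Suc n)) \<longlonglongrightarrow> 0" using LIMSEQ_inverse_real_of_nat by (simp add: inverse_eq_divide)
    thus "(%n. ennreal (1 / real (Suc n))) \<longlonglongrightarrow> 0" using tendsto_ennrealI by fastforce
  qed auto
  ultimately have I0: "?I h (?T G) = 0" by (rule LIMSEQ_unique)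
  have [measurable]: "h : borel_measurable (law X)" "?T G : borel_measurable (law X)" by (intro K_tau_measurable h TK r(2))+
  have "AE x in law X. h x = ?T G x"
  proof -
    have m: "(%x. ennreal \<bar>h x - ?T G x\<bar>) : borel_measurable (law X)" by measurable
    show ?thesis using iffD1[OF nn_integral_0_iff_AE[OF m] I0] by (rule eventually_mono) simp
  qed
  hence "h x = ?T G x" if "x : points X" for x by (intro lip_eq_of_AE K_tau_lip h TK r(2) that)
  hence "h = ?T G" using K_tau_ext[OF h] by (auto simp: fun_eq_iff compose_def extensional_def)
  with r(2) show thesis by (rule that)
qed

text \<open>Antisymmetry is the difficult direction. Maps p and q both ways compose to a measure
  preserving self-map of X, which is onto on \<open>K_tau\<close> by \<open>K_tau_onto\<close>; so
  composition with p is onto as well. Compactified features supply the compactness that the feature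
  closure lacks, and \<open>K_tau_finite\<close> leads back to real ones.\<close>

lemma isomorphic_iff_feature_le:
  assumes geo: "geometric_dataset X" "geometric_dataset Y"
  shows "isomorphic_data X Y \<longleftrightarrow> feature_le X Y & feature_le Y X"
proof
  interpret X: geom_data X by unfold_locales fact
  interpret Y: geom_data Y by unfold_locales fact
  assume "isomorphic_data X Y"
  then obtain \<phi> where \<phi>: "\<phi> : measurable (law X) (law Y)" "distr (law X) (law Y) \<phi> = law Y"
    "(%f. compose (points X) f \<phi>) ` feature_closure Y = feature_closure X" unfolding isomorphic_data_def by blast
  have "features Y <= feature_closure Y" using Y.features_closure by blast
  hence "feature_le Y X" unfolding feature_le_def using \<phi> by blast
  moreover have "feature_le X Y"
  proof -
    obtain f where f: "frame X f" "range f <= features X" by (rule X.ex_frame)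
    have "ALL i. EX g:feature_closure Y. f i = compose (points X) g \<phi>" using \<phi>(3) X.frame_closure[OF f(1)] by blast
    then obtain g where g: "!!i. g i : feature_closure Y" "!!i. f i = compose (points X) (g i) \<phi>" by metis
    have "f = (%i. compose (points X) (g i) \<phi>)" by (rule ext) (rule g(2))
    hence "seq_law (law X) f = seq_law (law X) (%i. compose (points X) (g i) \<phi>)" by simp
    also have "\<dots> = seq_law (law Y) g" by (rule seq_law_compose[OF \<phi>(1,2)]) (use Y.closure_seq_measurable[OF g(1)] in auto)
    finally show ?thesis by (rule feature_leI[OF geo f(1) g(1)])
  qed
  ultimately show "feature_le X Y & feature_le Y X" by simp
next
  interpret X: geom_data X by unfold_locales fact
  interpret Y: geom_data Y by unfold_locales fact
  assume le: "feature_le X Y & feature_le Y X"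
  obtain p where p: "p : measurable (law X) (law Y)" "distr (law X) (law Y) p = law Y"
    "(%f. compose (points X) f p) ` feature_closure Y <= feature_closure X"
    "(%f. compose (points X) f p) ` K_tau Y <= K_tau X" "p : points X \<rightarrow> points Y"
    by (rule feature_leE[OF geo(2,1) conjunct2[OF le]])
  obtain q where q: "q : measurable (law Y) (law X)" "distr (law Y) (law X) q = law X"
    "(%f. compose (points Y) f q) ` feature_closure X <= feature_closure Y"
    "(%f. compose (points Y) f q) ` K_tau X <= K_tau Y" "q : points Y \<rightarrow> points X"
    by (rule feature_leE[OF geo(1,2) conjunct1[OF le]])
  have cc: "compose (points X) k (q \<circ> p) = compose (points X) (compose (points Y) k q) p" for k :: "'a => real"
    using p(5) by (auto simp: compose_def fun_eq_iff)
  have s: "q \<circ> p : measurable (law X) (law X)" "distr (law X) (law X) (q \<circ> p) = law X"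
    using measurable_comp[OF p(1) q(1)] distr_distr[OF q(1) p(1)] p(2) q(2) by auto
  have inv: "(%k. compose (points X) k (q \<circ> p)) ` K_tau X <= K_tau X" unfolding cc using p(4) q(4) by blast
  have "h : (%f. compose (points X) f p) ` feature_closure Y" if h: "h : feature_closure X" for h
  proof -
    obtain k where k: "k : K_tau X" "compose (points X) tau h = compose (points X) k (q \<circ> p)"
      using X.K_tau_onto[OF s inv X.tau_closure[OF h]] .
    have kq: "k (q (p x)) = tau (h x)" if "x : points X" for x using fun_cong[OF k(2), of x] that by (simp add: compose_def)
    obtain x where x: "x : points X" using X.points_ne by blast
    have "q (p x) : points X" using p(5) q(5) x by auto
    then obtain k0 where k0: "k0 : feature_closure X" "k = compose (points X) tau k0"
      using X.K_tau_finite[OF k(1), of "q (p x)"] kq[OF x] tau_bound by metis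
    have "h y = k0 (q (p y))" if y: "y : points X" for y
    proof -
      have "q (p y) : points X" using p(5) q(5) y by auto
      hence "tau (k0 (q (p y))) = tau (h y)" using kq[OF y] by (simp add: k0(2) compose_def)
      thus ?thesis by (metis tau_inv_tau)
    qed
    hence "h = compose (points X) (compose (points Y) k0 q) p"
      using X.feature_closure_ext[OF h] p(5) by (auto simp: compose_def fun_eq_iff extensional_def)
    thus ?thesis using q(3) k0(1) by blast
  qed
  hence "(%f. compose (points X) f p) ` feature_closure Y = feature_closure X" using p(3) by blast
  thus "isomorphic_data X Y" unfolding isomorphic_data_def using p(1,2) by blast
qed

section \<open>Data sets with a prescribed law\<close>

lemma abs_le_half_iff: "\<bar>x\<bar> <= 1/2 \<longleftrightarrow> x : {-1/2..1/2}" for x :: real by auto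

text \<open>Dedekind cuts written as base 4 digits. Points of a data set only need distinct names
  among the reals; metric and Borel sets are defined separately.\<close>

definition real_code :: "(nat => real) => real" where
  "real_code x = base4 (%k. case prod_decode k of (i, j) => from_nat_into \<rat> j < x i)"

lemma inj_real_code: "inj real_code"
proof (rule injI, rule ext)
  fix x y i assume eq: "real_code x = real_code y"
  have R: "range (from_nat_into \<rat>) = (\<rat> :: real set)" by (rule range_from_nat_into) (auto simp: countable_rat intro: Rats_0)
  have *: "from_nat_into \<rat> j < x i \<longleftrightarrow> from_nat_into \<rat> j < y i" for j
    using fun_cong[OF arg_cong[OF eq, of real_bits], of "prod_encode (i, j)"] by (simp add: real_code_def real_bits_base4)
  have q: "q < x i \<longleftrightarrow> q < y i" if "q : \<rat>" for q using * that R by (metis rangeE)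
  show "x i = y i" using q Rats_dense_in_real[of "x i" "y i"] Rats_dense_in_real[of "y i" "x i"] by (metis less_asym linorder_cases)
qed

lemma sup_support_AE:
  assumes s: "s : sup_support m" "r > 0" and m: "sets m = sets borel" and P: "AE x in m. P x"
  obtains x where "x : supball s r" "P x"
proof -
  have "EX x:supball s r. P x"
  proof (rule ccontr)
    assume "\<not> ?thesis"
    hence "AE x in m. x \<notin> supball s r" using P by (auto elim: eventually_mono)
    hence "emeasure m (supball s r) = 0" using m sets_eq_imp_space_eq[OF m] by (subst (asm) AE_iff_measurable[of "supball s r"]) auto
    thus False using s by (auto simp: sup_support_def)
  qed
  thus thesis using that by blast
qed

lemma (in Metric_space) open_eq_UN_mcball:
  assumes C: "!!x r. x : M ==> r > 0 ==> EX c:C. c : M & d x c < r" and U: "openin mtopology U"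
  shows "U = (\<Union>(c, k)\<in>{(c, k). c : C & mcball c (1 / Suc k) <= U}. mcball c (1 / Suc k))"
proof (intro equalityI subsetI)
  fix x assume x: "x : U"
  then obtain r where r: "r > 0" "mball x r <= U" using U unfolding openin_mtopology by blast
  have xP: "x : M" using x U openin_subset by fastforce
  obtain k where k: "1 / real (Suc k) < r / 2" using nat_approx_posE[of "r/2"] r by auto
  obtain c where c: "c : C" "c : M" "d x c < 1 / Suc k" using C[OF xP, of "1 / Suc k"] by auto
  have "mcball c (1 / Suc k) <= mball x r" by (rule mcball_subset_mball) (use c k xP commute[of x c] in auto)
  moreover have "x : mcball c (1 / Suc k)" using c xP commute[of x c] by simp
  ultimately show "x : (\<Union>(c, k)\<in>{(c, k). c : C & mcball c (1 / Suc k) <= U}. mcball c (1 / Suc k))" using r c by blast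
qed auto

text \<open>Converse of \<open>range_frame\<close>: the points are the sequences in the sup support
  of m, and the coordinates form the frame. The set D makes the supremum distance finite and
  separable there. For independent uniform coordinates, by contrast, the sup support is
  empty.\<close>

lemma ex_dataset_with_law:
  assumes p: "prob_space m" and sm: "sets m = sets borel" and cD: "countable D"
    and fin: "!!d d'. d : D ==> d' : D ==> EX c. ALL i. \<bar>d i - d' i\<bar> <= c"
    and ae: "AE x in m. ALL r>0. EX d:D. x : supball d r"
  obtains X :: "real dataset" and f where "geometric_dataset X" "frame X f" "features X = range f"
    "seq_law (law X) f = m" "ALL x:points X. (%i. f i x) : sup_support m"
proof -
  interpret m: prob_space m by fact
  have spm [simp]: "space m = UNIV" using sets_eq_imp_space_eq[OF sm] by simp
  have sb[measurable]: "supball x r : sets m" for x r using sm by simp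
  let ?S = "sup_support m" and ?J = real_code
  define K where "K = inv ?J"
  have KJ [simp]: "K (?J x) = x" for x unfolding K_def by (rule inv_f_f[OF inj_real_code])
  let ?P = "?J ` ?S"
  have JK: "?J (K t) = t" "K t : ?S" if "t : ?P" for t using that by auto
  have near: "EX d:D. s : supball d r" if s: "s : ?S" "r > 0" for s r
  proof -
    obtain x where x: "x : supball s (r/2)" "ALL r>0. EX d:D. x : supball d r"
      by (rule sup_support_AE[OF s(1) half_gt_zero[OF s(2)] sm ae])
    then obtain d where d: "d : D" "x : supball d (r/2)" using s(2) half_gt_zero by blast
    have "\<bar>s i - d i\<bar> <= r" for i
    proof -
      have "\<bar>x i - s i\<bar> <= r/2" "\<bar>x i - d i\<bar> <= r/2" using x d by (auto simp: supball_def)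
      thus ?thesis by linarith
    qed
    thus ?thesis using d(1) by (auto simp: supball_def)
  qed
  define f where "f i = restrict (%t. K t i) ?P" for i :: nat
  let ?d = "feature_dist ?P (range f)"
  have bdd: "bdd_above ((%g. \<bar>g t - g t'\<bar>) ` range f)" if t: "t : ?P" "t' : ?P" for t t'
  proof -
    obtain a where a: "a : D" "K t : supball a 1" using near[OF JK(2)[OF t(1)], of 1] by auto
    obtain b where b: "b : D" "K t' : supball b 1" using near[OF JK(2)[OF t(2)], of 1] by auto
    obtain c where c: "!!i. \<bar>a i - b i\<bar> <= c" using fin[OF a(1) b(1)] by blast
    have "\<bar>K t i - K t' i\<bar> <= 1 + c + 1" for i
    proof -
      have "\<bar>K t i - a i\<bar> <= 1" "\<bar>K t' i - b i\<bar> <= 1" using a b by (auto simp: supball_def)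
      thus ?thesis using c[of i] by linarith
    qed
    thus ?thesis using t by (intro bdd_aboveI[of _ "1 + c + 1"]) (auto simp: f_def)
  qed
  have d1: "\<bar>K t i - K t' i\<bar> <= ?d t t'" if t: "t : ?P" "t' : ?P" for t t' i
  proof -
    have "\<bar>f i t - f i t'\<bar> <= (SUP g\<in>range f. \<bar>g t - g t'\<bar>)" by (rule cSUP_upper[OF _ bdd[OF t]]) simp
    thus ?thesis using t by (simp add: feature_dist_def f_def)
  qed
  have d2: "?d t t' <= c" if t: "t : ?P" "t' : ?P" "!!i. \<bar>K t i - K t' i\<bar> <= c" for t t' c
  proof -
    have "(SUP g\<in>range f. \<bar>g t - g t'\<bar>) <= c" by (rule cSUP_least) (use t in \<open>auto simp: f_def\<close>)
    thus ?thesis using t by (simp add: feature_dist_def)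
  qed
  interpret Metric_space ?P ?d
  proof
    fix t t'
    show "0 <= ?d t t'"
    proof (cases "t : ?P & t' : ?P")
      case True thus ?thesis using d1[of t t' 0] by (meson abs_ge_zero order_trans)
    qed (auto simp: feature_dist_def)
    show "?d t t' = ?d t' t" by (simp add: feature_dist_def abs_minus_commute)
    fix t'' assume t: "t : ?P" "t' : ?P"
    show "?d t t' = 0 \<longleftrightarrow> t = t'"
    proof
      assume "?d t t' = 0"
      hence "K t = K t'" using d1[OF t] by (auto simp: fun_eq_iff)
      thus "t = t'" using JK t by metis
    next
      assume "t = t'"
      hence "?d t t' <= 0" by (intro d2[OF t]) auto
      thus "?d t t' = 0" using d1[OF t, of 0] by (meson abs_ge_zero order_antisym order_trans)
    qed
    assume t'': "t'' : ?P"
    show "?d t t'' <= ?d t t' + ?d t' t''"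
    proof (rule d2[OF t(1) t''])
      fix i show "\<bar>K t i - K t'' i\<bar> <= ?d t t' + ?d t' t''" using d1[OF t, of i] d1[OF t(2) t'', of i] by linarith
    qed
  qed
  have ballS: "mcball (?J s) r = ?J ` (supball s r Int ?S)" if "s : ?S" for s r
  proof (intro equalityI subsetI)
    fix t assume t: "t : mcball (?J s) r"
    hence tP: "t : ?P" "?J s : ?P" and le: "?d (?J s) t <= r" by auto
    have "\<bar>K t i - s i\<bar> <= r" for i using d1[OF tP(2,1), of i] le by (simp add: abs_minus_commute)
    hence "K t : supball s r Int ?S" using JK(2)[OF tP(1)] by (simp add: supball_def)
    thus "t : ?J ` (supball s r Int ?S)" using JK(1)[OF tP(1)] by (metis image_eqI)
  next
    fix t assume "t : ?J ` (supball s r Int ?S)"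
    then obtain u where u: "t = ?J u" "u : supball s r" "u : ?S" by blast
    have "?d (?J s) (?J u) <= r" by (rule d2) (use u that in \<open>auto simp: supball_def abs_minus_commute\<close>)
    thus "t : mcball (?J s) r" using u that by simp
  qed
  have comp: mcomplete unfolding mcomplete_def
  proof (intro allI impI)
    fix \<sigma> assume \<sigma>: "MCauchy \<sigma>"
    hence \<sigma>P: "!!n. \<sigma> n : ?P" unfolding MCauchy_def by blast
    have C: "EX N. ALL n n' i. N <= n --> N <= n' --> \<bar>K (\<sigma> n) i - K (\<sigma> n') i\<bar> < e" if "e > 0" for e
    proof -
      obtain N where "ALL n n'. N <= n --> N <= n' --> ?d (\<sigma> n) (\<sigma> n') < e" using \<sigma> \<open>e > 0\<close> unfolding MCauchy_def by blast
      thus ?thesis using d1[OF \<sigma>P \<sigma>P] by (meson le_less_trans)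
    qed
    have "Cauchy (%n. K (\<sigma> n) i)" for i unfolding Cauchy_def dist_real_def using C by blast
    hence "ALL i. EX l. (%n. K (\<sigma> n) i) \<longlonglongrightarrow> l" by (simp add: Cauchy_convergent_iff convergent_def)
    then obtain s where s: "!!i. (%n. K (\<sigma> n) i) \<longlonglongrightarrow> s i" by metis
    have U: "EX N. ALL n i. N <= n --> \<bar>K (\<sigma> n) i - s i\<bar> <= e" if e: "e > 0" for e
    proof -
      obtain N where N: "!!n n' i. N <= n ==> N <= n' ==> \<bar>K (\<sigma> n) i - K (\<sigma> n') i\<bar> < e" using C[OF e] by blast
      have "\<bar>K (\<sigma> n) i - s i\<bar> <= e" if "N <= n" for n i
        by (rule LIMSEQ_le_const2[OF tendsto_rabs[OF tendsto_diff[OF tendsto_const s]]])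
          (use N that in \<open>auto intro!: exI[of _ N] less_imp_le\<close>)
      thus ?thesis by blast
    qed
    have sS: "s : ?S" unfolding sup_support_def
    proof (intro CollectI allI impI)
      fix r :: real assume r: "r > 0"
      then obtain N where N: "!!n i. N <= n ==> \<bar>K (\<sigma> n) i - s i\<bar> <= r/2" using U[of "r/2"] by auto
      have "supball (K (\<sigma> N)) (r/2) <= supball s r"
      proof
        fix y assume y: "y : supball (K (\<sigma> N)) (r/2)"
        have "\<bar>y i - s i\<bar> <= r" for i
        proof -
          have "\<bar>y i - K (\<sigma> N) i\<bar> <= r/2" using y by (simp add: supball_def)
          thus ?thesis using N[of N i] by linarith
        qed
        thus "y : supball s r" by (simp add: supball_def)
      qed
      hence "emeasure m (supball (K (\<sigma> N)) (r/2)) <= emeasure m (supball s r)" by (intro emeasure_mono) auto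
      moreover have "0 < emeasure m (supball (K (\<sigma> N)) (r/2))" using JK(2)[OF \<sigma>P[of N]] r by (auto simp: sup_support_def)
      ultimately show "0 < emeasure m (supball s r)" by (rule less_le_trans[rotated])
    qed
    have "limitin mtopology \<sigma> (?J s) sequentially" unfolding limit_metric_sequentially
    proof (intro conjI allI impI)
      fix e :: real assume "e > 0"
      then obtain N where N: "!!n i. N <= n ==> \<bar>K (\<sigma> n) i - s i\<bar> <= e/2" using U[of "e/2"] by auto
      have "?d (\<sigma> n) (?J s) < e" if "N <= n" for n
      proof -
        have "?d (\<sigma> n) (?J s) <= e/2" by (rule d2) (use \<sigma>P sS N that in auto)
        thus ?thesis using \<open>e > 0\<close> by linarith
      qed
      thus "EX N. ALL n>=N. \<sigma> n : ?P & ?d (\<sigma> n) (?J s) < e" using \<sigma>P by blast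
    qed (use sS in simp)
    thus "EX x. limitin mtopology \<sigma> x sequentially" by blast
  qed
  \<comment> \<open>Elements of D need not lie in the support, so each is replaced by a nearby
    support point where there is one; these give the countable dense set C.\<close>
  define ch where "ch dn = (SOME s. s : ?S & s : supball (fst dn) (1 / Suc (snd dn)))" for dn :: "(nat => real) \<times> nat"
  define C where "C = ?J ` ch ` (D \<times> UNIV) Int ?P"
  have cC: "countable C" unfolding C_def using cD by (intro countable_Int1 countable_image countable_SIGMA) auto
  have CC: "EX c:C. c : ?P & ?d t c < r" if t: "t : ?P" "r > 0" for t r
  proof -
    obtain n where n: "1 / real (Suc n) < r / 3" using nat_approx_posE[of "r/3"] t by auto
    obtain a where a: "a : D" "K t : supball a (1 / Suc n)" using near[OF JK(2)[OF t(1)], of "1 / Suc n"] by auto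
    have "ch (a, n) : ?S & ch (a, n) : supball a (1 / Suc n)"
      unfolding ch_def fst_conv snd_conv by (rule someI[of _ "K t"]) (use a JK(2)[OF t(1)] in auto)
    hence c: "ch (a, n) : ?S" "ch (a, n) : supball a (1 / Suc n)" by auto
    have "?d t (?J (ch (a, n))) <= 2 * (r/3)"
    proof (rule d2[OF t(1)])
      fix i
      have "\<bar>K t i - a i\<bar> <= 1 / Suc n" "\<bar>ch (a, n) i - a i\<bar> <= 1 / Suc n" using a c by (auto simp: supball_def)
      thus "\<bar>K t i - K (?J (ch (a, n))) i\<bar> <= 2 * (r/3)" using n unfolding KJ by linarith
    qed (use c in simp)
    hence "?d t (?J (ch (a, n))) < r" using t by simp
    moreover have "?J (ch (a, n)) : C" unfolding C_def using a c by auto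
    ultimately show ?thesis unfolding C_def by blast
  qed
  have sep: "separable_space mtopology" unfolding separable_space_def
  proof (intro exI[of _ C] conjI cC)
    show "C <= topspace mtopology" by (auto simp: C_def)
    show "mtopology closure_of C = topspace mtopology" unfolding metric_closure_of using CC by auto
  qed
  \<comment> \<open>Open balls. Removing from A the countably many null ones about D of radius 1 /
    Suc n leaves exactly the support, which is therefore measurable and of full mass.\<close>
  define ob where "ob a r = (\<Union>k. supball a (r - 1 / Suc k))" for a :: "nat => real" and r
  have ob[measurable]: "ob a r : sets m" for a r unfolding ob_def by measurable
  define A where "A = (\<Inter>n. \<Union>d\<in>D. supball d (1 / real (Suc n)))"
  have A[measurable]: "A : sets m" unfolding A_def using cD by (intro sets.countable_INT sets.countable_UN'') auto
  define Nul where "Nul = (\<Union>(d, n)\<in>{(d, n). d : D & emeasure m (ob d (1 / Suc n)) = 0}. ob d (1 / real (Suc n)))"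
  have "countable {(d, n :: nat). d : D & emeasure m (ob d (1 / Suc n)) = 0}"
    by (rule countable_subset[OF _ countable_SIGMA[OF cD, of "%_. UNIV"]]) auto
  hence N0: "Nul : null_sets m" unfolding Nul_def by (intro null_sets_UN') (auto intro!: null_setsI)
  have Seq: "?S = A - Nul"
  proof (intro equalityI subsetI)
    fix s assume s: "s : ?S"
    have "s : A" unfolding A_def using near[OF s] by (auto intro!: zero_less_divide_1_iff[THEN iffD2])
    moreover have "emeasure m (ob d r) > 0" if "s : ob d r" for d r
    proof -
      obtain k where k: "s : supball d (r - 1 / Suc k)" using \<open>s : ob d r\<close> unfolding ob_def by blast
      have "supball s (1 / (2 * Suc k)) <= ob d r"
      proof
        fix y assume y: "y : supball s (1 / (2 * Suc k))"
        \<comment> \<open>The gap 1 / Suc k is halved: one half is used by the ball about s, the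
          other remains and has index 2 * k + 1.\<close>
        have "\<bar>y i - d i\<bar> <= r - 1 / Suc (2 * k + 1)" for i
        proof -
          have "\<bar>y i - s i\<bar> <= 1 / (2 * Suc k)" "\<bar>s i - d i\<bar> <= r - 1 / Suc k" using y k by (auto simp: supball_def)
          moreover have "1 / real (Suc k) = 1 / (2 * Suc k) + 1 / Suc (2 * k + 1)" by (simp add: field_simps)
          ultimately show ?thesis by linarith
        qed
        thus "y : ob d r" unfolding ob_def supball_def by blast
      qed
      hence "emeasure m (supball s (1 / (2 * Suc k))) <= emeasure m (ob d r)" by (intro emeasure_mono) auto
      moreover have "0 < emeasure m (supball s (1 / (2 * Suc k)))" using s by (auto simp: sup_support_def)
      ultimately show ?thesis by (rule less_le_trans[rotated])
    qed
    ultimately show "s : A - Nul" unfolding Nul_def by fastforce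
  next
    fix x assume x: "x : A - Nul"
    show "x : ?S" unfolding sup_support_def
    proof (intro CollectI allI impI)
      fix r :: real assume "r > 0"
      then obtain n where n: "1 / real (Suc n) < r / 2" using nat_approx_posE[of "r/2"] by auto
      obtain d where d: "d : D" "x : supball d (1 / real (Suc (Suc n)))" using x unfolding A_def by blast
      \<comment> \<open>1 / (n + 1) - 1 / ((n + 1) * (n + 2)) = 1 / (n + 2), so this index places x
        in the open ball of radius 1 / Suc n.\<close>
      have xb: "x : supball d (1 / Suc n - 1 / Suc ((Suc n) * (Suc (Suc n)) - 1))"
      proof -
        have "1 / real (Suc (Suc n)) <= 1 / Suc n - 1 / Suc ((Suc n) * (Suc (Suc n)) - 1)" by (simp add: field_simps)
        thus ?thesis using d(2) unfolding supball_def by (auto intro: order_trans)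
      qed
      hence "x : ob d (1 / Suc n)" unfolding ob_def by blast
      hence "emeasure m (ob d (1 / Suc n)) ~= 0" using x d(1) unfolding Nul_def by blast
      moreover have "ob d (1 / Suc n) <= supball x r"
      proof
        fix y assume "y : ob d (1 / Suc n)"
        then obtain k where k: "y : supball d (1 / Suc n - 1 / Suc k)" unfolding ob_def by blast
        have "\<bar>y i - x i\<bar> <= r" for i
        proof -
          have "\<bar>y i - d i\<bar> <= 1 / Suc n - 1 / Suc k" "\<bar>x i - d i\<bar> <= 1 / Suc (Suc n)" using k d by (auto simp: supball_def)
          moreover have "1 / real (Suc (Suc n)) <= 1 / Suc n" "0 <= 1 / real (Suc k)" by (auto simp: field_simps)
          ultimately show ?thesis using n by linarith
        qed
        thus "y : supball x r" by (simp add: supball_def)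
      qed
      hence "emeasure m (ob d (1 / Suc n)) <= emeasure m (supball x r)" by (intro emeasure_mono) auto
      ultimately show "0 < emeasure m (supball x r)" by (metis le_zero_eq zero_less_iff_neq_zero)
    qed
  qed
  have S[measurable]: "?S : sets m" unfolding Seq using N0 by auto
  have "AE x in m. x : A" using ae by eventually_elim (auto simp: A_def)
  hence aeS: "AE x in m. x : ?S" unfolding Seq using AE_not_in[OF N0] by eventually_elim simp
  let ?R = "restrict_space m ?S"
  have eR: "emeasure ?R (B Int ?S) = emeasure m B" if "B : sets m" for B
  proof -
    have "emeasure ?R (B Int ?S) = emeasure m (B Int ?S)" by (rule emeasure_restrict_space) auto
    also have "\<dots> = emeasure m B" by (rule emeasure_eq_AE) (use aeS that in auto)
    finally show ?thesis .
  qed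
  have pR: "prob_space ?R" using eR[of "UNIV"] m.emeasure_space_1 sm by (intro prob_spaceI) (simp add: space_restrict_space)
  have spR: "space ?R = ?S" by (simp add: space_restrict_space)
  have Jm: "?J : measurable ?R (borel_of mtopology)"
  proof (rule measurable_borel_ofI)
    fix U assume U: "openin mtopology U"
    let ?I = "{(c, k). c : C & mcball c (1 / real (Suc k)) <= U}"
    have "U = (\<Union>(c, k)\<in>?I. mcball c (1 / Suc k))" using open_eq_UN_mcball[OF CC U] by blast
    hence "?J -` U Int space ?R = ?J -` (\<Union>(c, k)\<in>?I. mcball c (1 / Suc k)) Int space ?R" by (rule arg_cong)
    also have "\<dots> = (\<Union>(c, k)\<in>?I. ?J -` mcball c (1 / Suc k) Int space ?R)" by blast
    also have "\<dots> : sets ?R"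
    proof (rule sets.countable_UN'')
      show "countable ?I" by (rule countable_subset[OF _ countable_SIGMA[OF cC, of "%_. UNIV"]]) auto
      fix z assume z: "z : ?I"
      obtain c k where ck: "z = (c, k)" "c : C" using z by (cases z) auto
      then obtain s where s: "c = ?J s" "s : ?S" unfolding C_def by blast
      have "?J -` mcball c (1 / Suc k) Int space ?R = supball s (1 / Suc k) Int ?S"
        unfolding s(1) ballS[OF s(2)] spR using inj_real_code by (auto simp: inj_eq)
      also have "\<dots> : sets ?R" by (subst sets_restrict_space_iff) (use sb[of s "1 / Suc k"] S in auto)
      finally show "(case z of (c, k) => ?J -` mcball c (1 / Suc k) Int space ?R) : sets ?R" by (simp add: ck)
    qed
    finally show "?J -` U Int space ?R : sets ?R" .
  qed (simp add: spR)
  define X where "X = \<lparr>points = ?P, features = range f, law = distr ?R (borel_of mtopology) ?J\<rparr>"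
  have dX: "data_dist X = ?d" by (simp add: data_dist_def X_def)
  have tX: "data_topology X = mtopology" by (simp add: data_topology_def dX) (simp add: X_def)
  have supp: "supp mtopology (law X) = ?P"
  proof -
    have "emeasure (law X) U > 0" if U: "openin mtopology U" "x : U" for U x
    proof -
      obtain r where r: "r > 0" "mcball x r <= U" using U unfolding openin_mtopology_mcball by blast
      obtain s where s: "x = ?J s" "s : ?S" using U openin_subset[OF U(1)] by auto
      have "0 < emeasure m (supball s r)" using s r by (auto simp: sup_support_def)
      also have "\<dots> = emeasure ?R (supball s r Int ?S)" using eR[of "supball s r"] by simp
      also have "supball s r Int ?S = ?J -` mcball x r Int space ?R"
        unfolding s(1) ballS[OF s(2)] spR using inj_real_code by (auto simp: inj_eq)
      also have "emeasure ?R \<dots> = emeasure (law X) (mcball x r)" by (simp add: X_def emeasure_distr[OF Jm] closedin_borel_of)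
      also have "\<dots> <= emeasure (law X) U" using r U by (intro emeasure_mono) (auto simp: X_def intro: openin_borel_of)
      finally show ?thesis .
    qed
    thus ?thesis unfolding supp_def by auto
  qed
  have fext: "range f <= extensional ?P" by (auto simp: f_def)
  have geo: "geometric_dataset X" unfolding geometric_dataset_def tX dX
  proof (intro conjI ballI)
    show "prob_space (law X)" using prob_space.prob_space_distr[OF pR Jm] by (simp add: X_def)
    show "supp mtopology (law X) = points X" unfolding supp by (simp add: X_def)
  qed (use fext bdd Metric_space_axioms comp sep in \<open>auto simp: X_def\<close>)
  have fr: "frame X f" unfolding frame_def feature_closure_def using pointwise_closure_superset[OF fext] by (auto simp: X_def)
  have fm: "f i : borel_measurable (law X)" for i using geom_data.frame_measurable[OF geom_data.intro[OF geo] fr] .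
  have "seq_law (law X) f = seq_law ?R (%i s. f i (?J s))" using seq_law_distr[OF Jm, of f] fm by (simp add: X_def)
  also have "\<dots> = distr ?R borel (%s. s)" unfolding seq_law_def by (rule distr_cong) (auto simp: spR f_def)
  also have "\<dots> = m"
  proof (rule measure_eqI)
    fix B assume "B : sets (distr ?R borel (%s. s))"
    hence B: "B : sets borel" by simp
    have "(%s. s) : measurable ?R borel" using sm by (intro measurable_restrict_space1 measurable_ident_sets) simp
    thus "emeasure (distr ?R borel (%s. s)) B = emeasure m B" using B sm eR[of B] by (simp add: emeasure_distr spR)
  qed (simp add: sm)
  finally have law: "seq_law (law X) f = m" .
  have "ALL x:points X. (%i. f i x) : ?S" by (auto simp: X_def f_def)
  with geo fr law show thesis using that[of X f] by (simp add: X_def)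
qed

section \<open>Isomorphism classes\<close>

lemma class_of_eqI:
  assumes "geometric_dataset X" "geometric_dataset Y" "feature_le X Y" "feature_le Y X"
  shows "class_of X = class_of Y"
proof -
  have "isomorphic_data X Z \<longleftrightarrow> isomorphic_data Y Z" if Z: "geometric_dataset Z" for Z :: "real dataset"
    unfolding isomorphic_iff_feature_le[OF assms(1) Z] isomorphic_iff_feature_le[OF assms(2) Z]
    using feature_le_trans[OF assms(2,1) Z assms(4)] feature_le_trans[OF assms(1,2) Z assms(3)]
      feature_le_trans[OF Z assms(1,2) _ assms(3)] feature_le_trans[OF Z assms(2,1) _ assms(4)] by blast
  thus ?thesis unfolding class_of_def by blast
qed

lemma isomorphic_refl: "geometric_dataset X ==> isomorphic_data X X" by (simp add: isomorphic_iff_feature_le feature_le_refl)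

text \<open>X may live on another type; the real data set Y witnesses that its class is nonempty, so
  that \<open>rep\<close> really chooses a member.\<close>

lemma rep_class_of:
  fixes X :: "'a dataset" and Y :: "real dataset"
  assumes X: "geometric_dataset X" and Y: "geometric_dataset Y" "isomorphic_data X Y"
  shows "geometric_dataset (rep (class_of X))" "isomorphic_data X (rep (class_of X))"
    "isomorphic_data (rep (class_of X)) X"
proof -
  have "Y : class_of X" using Y by (simp add: class_of_def)
  hence "rep (class_of X) : class_of X" unfolding rep_def by (rule someI)
  thus 1: "geometric_dataset (rep (class_of X))" "isomorphic_data X (rep (class_of X))" by (auto simp: class_of_def)
  thus "isomorphic_data (rep (class_of X)) X" using isomorphic_iff_feature_le[OF X 1(1)] isomorphic_iff_feature_le[OF 1(1) X] by blast
qed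

lemma geometric_rep: assumes "A : DD" shows "geometric_dataset (rep A)" "class_of (rep A) = A"
proof -
  obtain X :: "real dataset" where X: "geometric_dataset X" "A = class_of X" using assms unfolding DD_def by blast
  note r = rep_class_of[OF X(1) X(1) isomorphic_refl[OF X(1)], folded X(2)]
  show "geometric_dataset (rep A)" by (rule r)
  show "class_of (rep A) = A" unfolding X(2) using r(2) X(1) r(1) isomorphic_iff_feature_le[OF X(1) r(1)] X(2) by (intro class_of_eqI) auto
qed

lemma class_of_in_DD: "geometric_dataset (X :: real dataset) ==> class_of X : DD" by (auto simp: DD_def)

lemma class_le_antisym: "A : DD ==> B : DD ==> class_le A B ==> class_le B A ==> A = B"
  using class_of_eqI[of "rep A" "rep B"] geometric_rep by (metis class_le_def)

lemma class_le_refl: "A : DD ==> class_le A A" by (simp add: class_le_def feature_le_refl geometric_rep)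

lemma class_le_trans: "A : DD ==> B : DD ==> C : DD ==> class_le A B ==> class_le B C ==> class_le A C"
  unfolding class_le_def using feature_le_trans geometric_rep by metis

lemma rep_closure:
  assumes "geometric_dataset (X :: real dataset)"
  obtains \<psi> where "\<psi> : measurable (law (rep (class_of X))) (law X)"
    "distr (law (rep (class_of X))) (law X) \<psi> = law X"
    "(%f. compose (points (rep (class_of X))) f \<psi>) ` feature_closure X = feature_closure (rep (class_of X))"
    "\<psi> : points (rep (class_of X)) \<rightarrow> points X"
proof -
  note r = rep_class_of[OF assms assms isomorphic_refl[OF assms]]
  interpret X: geom_data X by unfold_locales fact
  interpret R: geom_data "rep (class_of X)" by unfold_locales (rule r)
  obtain \<psi> where \<psi>: "\<psi> : measurable (law (rep (class_of X))) (law X)"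
    "distr (law (rep (class_of X))) (law X) \<psi> = law X"
    "(%f. compose (points (rep (class_of X))) f \<psi>) ` feature_closure X = feature_closure (rep (class_of X))"
    using r(3) unfolding isomorphic_data_def by blast
  have "\<psi> : points (rep (class_of X)) \<rightarrow> points X" using measurable_space[OF \<psi>(1)] by auto
  with \<psi> show thesis by (rule that)
qed

lemma K_valued_closure:
  assumes X: "geometric_dataset X" and K: "K_valued X" and f: "f : feature_closure X" and x: "x : points X"
  shows "\<bar>f x\<bar> <= 1/2"
proof -
  interpret geom_data X by unfold_locales fact
  have "\<bar>h x\<bar> <= 1/2" if "h : features X" for h using K x that unfolding K_valued_def abs_le_half_iff by blast
  thus ?thesis using pointwise_closure_bound1[OF f[unfolded feature_closure_def] features_ext _ x] by blast
qed

text \<open>Isomorphism preserves only the closures of the families, so the bound on the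
  representative is deduced from the closure.\<close>

lemma DD_K_rep: assumes "A : DD_K" shows "A : DD" "K_valued (rep A)"
proof -
  obtain X :: "real dataset" where X: "geometric_dataset X" "K_valued X" "A = class_of X" using assms unfolding DD_K_def by blast
  thus AD: "A : DD" by (auto simp: DD_def)
  obtain \<psi> where "\<psi> : measurable (law (rep A)) (law X)" "distr (law (rep A)) (law X) \<psi> = law X"
    and \<psi>: "(%f. compose (points (rep A)) f \<psi>) ` feature_closure X = feature_closure (rep A)" "\<psi> : points (rep A) \<rightarrow> points X"
    by (rule rep_closure[OF X(1), folded X(3)])
  interpret R: geom_data "rep A" by unfold_locales (rule geometric_rep[OF AD])
  show "K_valued (rep A)" unfolding K_valued_def
  proof (intro ballI)
    fix f x assume "f : features (rep A)" and x: "x : points (rep A)"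
    then obtain g where g: "g : feature_closure X" "f = compose (points (rep A)) g \<psi>" using \<psi>(1) R.features_closure by blast
    have "\<bar>g (\<psi> x)\<bar> <= 1/2" by (rule K_valued_closure[OF X(1,2) g(1)]) (use x \<psi>(2) in auto)
    thus "f x : {-1/2..1/2}" using x unfolding abs_le_half_iff by (simp add: g(2) compose_def)
  qed
qed

lemma class_of_in_DD_K: "geometric_dataset (X :: real dataset) ==> K_valued X ==> class_of X : DD_K"
  by (auto simp: DD_K_def)

lemma DM_K_subset: "DM_K N <= DD_K" by (auto simp: DM_K_def DD_K_def)

lemma DM_K_mono: "N <= N' ==> DM_K N <= DM_K N'" by (fastforce simp: DM_K_def)

text \<open>Repetitions and a constant tail turn any family of at most N features into one sequence,
  so that families of varying size are handled by laws on a single space.\<close>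

definition enum :: "nat => data_class => (nat => real => real) => bool" where
  "enum N A F \<longleftrightarrow> features (rep A) = F ` {..<N} & (ALL i>=N. F i = F (N - 1))"

text \<open>Membership in \<open>DM_K\<close> concerns some member of the class. The bound passes to
  the representative because a finite family is its own closure and the closures correspond.\<close>

lemma ex_enum:
  assumes A: "A : DM_K N" and N: "N >= 1"
  obtains F where "enum N A F"
proof -
  obtain X :: "real dataset" where X: "geometric_dataset X" "K_valued X" "finite (features X)" "card (features X) <= N" "A = class_of X"
    using A unfolding DM_K_def by blast
  have AD: "A : DD" using X class_of_in_DD by blast
  interpret X: geom_data X by unfold_locales fact
  interpret R: geom_data "rep A" by unfold_locales (rule geometric_rep[OF AD])
  obtain \<psi> where "\<psi> : measurable (law (rep A)) (law X)" "distr (law (rep A)) (law X) \<psi> = law X"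
    and \<psi>: "(%f. compose (points (rep A)) f \<psi>) ` feature_closure X = feature_closure (rep A)" "\<psi> : points (rep A) \<rightarrow> points X"
    by (rule rep_closure[OF X(1), folded X(5)])
  have "feature_closure X = features X" unfolding feature_closure_def by (rule pointwise_closure_finite[OF X(3) X.features_ext])
  hence fin: "finite (feature_closure (rep A))" "card (feature_closure (rep A)) <= N"
    using X(3,4) \<psi> by (metis finite_imageI, metis card_image_le order_trans)
  have sub: "features (rep A) <= feature_closure (rep A)" using R.features_closure by blast
  hence f: "finite (features (rep A))" "card (features (rep A)) <= N" using fin by (auto intro: finite_subset order_trans[OF card_mono])
  obtain g where g: "bij_betw g {0..<card (features (rep A))} (features (rep A))" using ex_bij_betw_nat_finite[OF f(1)] by blast
  have c0: "card (features (rep A)) > 0" using f(1) R.features_ne by (simp add: card_gt_0_iff)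
  let ?F = "%i. g (min i (card (features (rep A)) - 1))"
  have "?F ` {..<N} = g ` {0..<card (features (rep A))}"
  proof (intro equalityI subsetI)
    fix h assume "h : g ` {0..<card (features (rep A))}"
    then obtain i where i: "i < card (features (rep A))" "h = g i" by auto
    hence "h = ?F i" "i < N" using f(2) by (auto simp: min_def)
    thus "h : ?F ` {..<N}" by blast
  qed (use c0 in \<open>auto intro!: imageI\<close>)
  also have "\<dots> = features (rep A)" using g by (simp add: bij_betw_def)
  finally have "enum N A ?F" unfolding enum_def using f(2) N by (auto simp: min_def intro!: arg_cong[of _ _ g])
  thus thesis by (rule that)
qed

lemma enum_frame: assumes "A : DD" "enum N A F" "N >= 1" shows "frame (rep A) F" "F i : features (rep A)"
proof -
  interpret R: geom_data "rep A" by unfold_locales (rule geometric_rep[OF assms(1)])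
  have F: "F i : features (rep A)" for i using assms(2,3) unfolding enum_def by (cases "i < N") auto
  thus "F i : features (rep A)" .
  have "features (rep A) <= range F" using assms(2) unfolding enum_def by auto
  also have "\<dots> <= pointwise_closure (points (rep A)) (range F)"
    by (rule pointwise_closure_superset) (use F R.features_ext in blast)
  finally show "frame (rep A) F" unfolding frame_def using F R.features_closure by blast
qed

text \<open>\<open>ex_dataset_with_law\<close> carried over to the representative. The last two
  clauses read bounds and a constant tail off the law; these extend from almost all sequences to all
  points, as the points lie in the support.\<close>

lemma ex_class_with_law:
  assumes p: "prob_space m" and sm: "sets m = sets borel" and cD: "countable D"
    and fin: "!!d d'. d : D ==> d' : D ==> EX c. ALL i. \<bar>d i - d' i\<bar> <= c"
    and ae: "AE x in m. ALL r>0. EX d:D. x : supball d r"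
  obtains A F where "A : DD" "frame (rep A) F" "seq_law (law (rep A)) F = m"
    "(AE x in m. ALL i. \<bar>x i\<bar> <= 1/2) --> A : DD_K"
    "ALL N>=1. (AE x in m. ALL i. \<bar>x i\<bar> <= 1/2) & (AE x in m. ALL i>=N. x i = x (N - 1)) --> A : DM_K N & enum N A F"
proof -
  obtain X :: "real dataset" and f where X: "geometric_dataset X" "frame X f" "features X = range f"
    "seq_law (law X) f = m" "ALL x:points X. (%i. f i x) : sup_support m" by (rule ex_dataset_with_law[OF assms])
  let ?A = "class_of X"
  have AD: "?A : DD" using X(1) by (rule class_of_in_DD)
  interpret X: geom_data X by unfold_locales fact
  interpret R: geom_data "rep ?A" by unfold_locales (rule geometric_rep[OF AD])
  obtain \<psi> where \<psi>: "\<psi> : measurable (law (rep ?A)) (law X)" "distr (law (rep ?A)) (law X) \<psi> = law X"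
    "(%f. compose (points (rep ?A)) f \<psi>) ` feature_closure X = feature_closure (rep ?A)" "\<psi> : points (rep ?A) \<rightarrow> points X"
    by (rule rep_closure[OF X(1)])
  define F where "F i = compose (points (rep ?A)) (f i) \<psi>" for i
  have "seq_law (law (rep ?A)) F = m"
    unfolding F_def X(4)[symmetric] by (rule seq_law_compose[OF \<psi>(1,2)]) (use X.frame_measurable[OF X(2)] in auto)
  moreover have rF: "range F = (%f. compose (points (rep ?A)) f \<psi>) ` range f" by (auto simp: F_def)
  have Fc: "F i : feature_closure (rep ?A)" for i using \<psi>(3) X.frame_closure[OF X(2), of i] unfolding F_def by blast
  have "feature_closure (rep ?A) <= pointwise_closure (points (rep ?A)) (range F)"
    unfolding \<psi>(3)[symmetric] rF X.frame_feature_closure[OF X(2)]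
    using pointwise_closure_compose[OF _ X.frame_ext[OF X(2)] \<psi>(4)] by blast
  hence "frame (rep ?A) F" unfolding frame_def using Fc R.features_closure by blast
  moreover have K: "K_valued X" if K: "AE x in m. ALL i. \<bar>x i\<bar> <= 1/2" unfolding K_valued_def X(3)
  proof clarify
    fix i x assume x: "x : points X"
    have "\<bar>f i x\<bar> <= 1/2"
    proof (rule field_le_epsilon)
      fix e :: real assume "e > 0"
      obtain y where y: "y : supball (%i. f i x) e" "ALL i. \<bar>y i\<bar> <= 1/2"
        by (rule sup_support_AE[OF _ \<open>e > 0\<close> sm K]) (use X(5) x in auto)
      have "\<bar>y i - f i x\<bar> <= e" "\<bar>y i\<bar> <= 1/2" using y by (auto simp: supball_def)
      thus "\<bar>f i x\<bar> <= 1/2 + e" by linarith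
    qed
    thus "f i x : {-1/2..1/2}" unfolding abs_le_half_iff .
  qed
  moreover have "?A : DM_K N & enum N ?A F"
    if N: "N >= 1" and a: "AE x in m. ALL i. \<bar>x i\<bar> <= 1/2" and b: "AE x in m. ALL i>=N. x i = x (N - 1)" for N
  proof -
    have tl: "f i = f (N - 1)" if i: "i >= N" for i
    proof
      fix x show "f i x = f (N - 1) x"
      proof (cases "x : points X")
        case True
        have "\<bar>f i x - f (N - 1) x\<bar> <= 0"
        proof (rule field_le_epsilon)
          fix e :: real assume "e > 0"
          hence e2: "e/2 > 0" by simp
          obtain y where y: "y : supball (%i. f i x) (e/2)" "ALL i>=N. y i = y (N - 1)"
            by (rule sup_support_AE[OF _ e2 sm b]) (use X(5) True in auto)
          have "\<bar>y i - f i x\<bar> <= e/2" "\<bar>y (N - 1) - f (N - 1) x\<bar> <= e/2" "y i = y (N - 1)"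
            using y(1) y(2)[rule_format, OF i] unfolding supball_def by blast+
          thus "\<bar>f i x - f (N - 1) x\<bar> <= 0 + e" by linarith
        qed
        thus ?thesis by simp
      next
        case False
        thus ?thesis using X.frame_ext[OF X(2)] by (metis extensional_arb rangeI subsetD)
      qed
    qed
    have "f i : f ` {..<N}" for i using tl[of i] N by (cases "i < N") auto
    hence fN: "range f = f ` {..<N}" by blast
    have FN: "ALL i>=N. F i = F (N - 1)" unfolding F_def using tl by simp
    have "finite (features X)" "card (features X) <= N" unfolding X(3) fN using card_image_le[of "{..<N}" f] by auto
    hence "?A : DM_K N" unfolding DM_K_def using X(1) K[OF a] by blast
    moreover have "features (rep ?A) = F ` {..<N}"
    proof -
      have "feature_closure X = range f" unfolding feature_closure_def X(3)
        by (rule pointwise_closure_finite) (use fN X.frame_ext[OF X(2)] in auto)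
      hence fc: "feature_closure (rep ?A) = F ` {..<N}" using \<psi>(3) fN by (auto simp: F_def image_image)
      have "finite (features (rep ?A))" by (rule finite_subset[of _ "F ` {..<N}"]) (use fc R.features_closure in auto)
      hence "feature_closure (rep ?A) = features (rep ?A)"
        unfolding feature_closure_def by (rule pointwise_closure_finite[OF _ R.features_ext])
      thus ?thesis using fc by simp
    qed
    ultimately show ?thesis using FN by (simp add: enum_def)
  qed
  ultimately show thesis using that[of ?A F] AD class_of_in_DD_K[OF X(1)] by blast
qed

lemma ex_DM_K_with_law:
  assumes p: "prob_space m" and sm: "sets m = sets borel" and N: "N >= 1"
    and K: "AE x in m. ALL i. \<bar>x i\<bar> <= 1/2" and tail: "AE x in m. ALL i>=N. x i = x (N - 1)"
  obtains A F where "A : DM_K N" "enum N A F" "seq_law (law (rep A)) F = m"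
proof -
  \<comment> \<open>Rational N-tuples continued by their last entry: a countable set that is dense,
    for the supremum distance, among sequences with constant tail.\<close>
  define D where "D = range (%(qs :: rat list) (i :: nat). real_of_rat (qs ! min i (N - 1)))"
  have 1: "countable D" unfolding D_def by simp
  have 2: "EX c. ALL i. \<bar>d i - d' i\<bar> <= c" if dD: "d : D" "d' : D" for d d'
  proof -
    obtain q q' where q: "d = (%i. real_of_rat (q ! min i (N - 1)))" "d' = (%i. real_of_rat (q' ! min i (N - 1)))" using dD unfolding D_def by blast
    have "\<bar>d i - d' i\<bar> <= (\<Sum>j<N. \<bar>d j - d' j\<bar>)" for i
    proof -
      have "\<bar>d i - d' i\<bar> = \<bar>d (min i (N - 1)) - d' (min i (N - 1))\<bar>" by (simp add: q)
      also have "\<dots> <= (\<Sum>j<N. \<bar>d j - d' j\<bar>)" using N by (intro member_le_sum) auto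
      finally show ?thesis .
    qed
    thus ?thesis by blast
  qed
  have 3: "AE x in m. ALL r>0. EX d:D. x : supball d r" using tail
  proof eventually_elim
    fix x :: "nat => real" assume x: "ALL i>=N. x i = x (N - 1)"
    show "ALL r>0. EX d:D. x : supball d r"
    proof (intro allI impI)
      fix r :: real assume r: "r > 0"
      have "EX q. \<bar>x i - real_of_rat q\<bar> <= r" for i
      proof -
        obtain q where "x i < real_of_rat q" "real_of_rat q < x i + r" using of_rat_dense[of "x i" "x i + r"] r by auto
        thus ?thesis by (intro exI[of _ q]) simp
      qed
      then obtain q where q: "!!i. \<bar>x i - real_of_rat (q i)\<bar> <= r" by metis
      let ?d = "%i. real_of_rat (map q [0..<N] ! min i (N - 1))"
      have "\<bar>x i - ?d i\<bar> <= r" for i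
      proof -
        have "x i = x (min i (N - 1))" using x N by (auto simp: min_def)
        moreover have "?d i = real_of_rat (q (min i (N - 1)))" using N by (subst nth_map) auto
        ultimately show ?thesis using q by simp
      qed
      hence "x : supball ?d r" by (simp add: supball_def)
      moreover have "?d : D" unfolding D_def by (rule image_eqI[of _ _ "map q [0..<N]"]) auto
      ultimately show "EX d:D. x : supball d r" by (rule bexI)
    qed
  qed
  obtain A F where AF: "A : DD" "frame (rep A) F" "seq_law (law (rep A)) F = m"
    "(AE x in m. ALL i. \<bar>x i\<bar> <= 1/2) --> A : DD_K"
    "ALL N>=1. (AE x in m. ALL i. \<bar>x i\<bar> <= 1/2) & (AE x in m. ALL i>=N. x i = x (N - 1)) --> A : DM_K N & enum N A F"
    by (rule ex_class_with_law[OF p sm 1 2 3])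
  thus thesis using that[of A F] N K tail by blast
qed

section \<open>Couplings of data sets\<close>

text \<open>By separability open sets of the product are countable unions of rectangles of balls.
  This identifies the topological couplings with those of \<open>coupling_of\<close>.\<close>

lemma sets_borel_of_prod:
  assumes "geometric_dataset X" "geometric_dataset Y"
  shows "sets (borel_of (prod_topology (data_topology X) (data_topology Y))) = sets (law X \<Otimes>\<^sub>M law Y)"
proof -
  interpret X: geom_data X by unfold_locales fact
  interpret Y: geom_data Y by unfold_locales fact
  let ?T = "prod_topology X.mtopology Y.mtopology"
  have sp: "space (law X \<Otimes>\<^sub>M law Y) = points X \<times> points Y" by (simp add: space_pair_measure)
  have "sets (borel_of ?T) <= sets (law X \<Otimes>\<^sub>M law Y)"
  proof -
    obtain D where "X.dense_points D" by (rule X.dense_seq)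
    note D = X.dense_pointsD[OF this]
    obtain E where "Y.dense_points E" by (rule Y.dense_seq)
    note E = Y.dense_pointsD[OF this]
    have "U : sets (law X \<Otimes>\<^sub>M law Y)" if U: "openin ?T U" for U
    proof -
      let ?B = "%n m k. X.mball (D n) (1 / real (Suc k)) \<times> Y.mball (E m) (1 / real (Suc k))"
      let ?I = "{(n, m, k). ?B n m k <= U}"
      have "U = (\<Union>(n, m, k)\<in>?I. ?B n m k)"
      proof (intro equalityI subsetI)
        fix z assume z: "z : U"
        obtain x y where xy: "z = (x, y)" by (cases z)
        obtain V W where VW: "openin X.mtopology V" "openin Y.mtopology W" "x : V" "y : W" "V \<times> W <= U"
          using iffD1[OF openin_prod_topology_alt U, rule_format, OF z[unfolded xy]] by blast
        obtain r where r: "r > 0" "X.mball x r <= V" using VW(1,3) unfolding X.openin_mtopology by blast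
        obtain s where s: "s > 0" "Y.mball y s <= W" using VW(2,4) unfolding Y.openin_mtopology by blast
        obtain k where k: "1 / real (Suc k) < min r s / 2" using nat_approx_posE[of "min r s / 2"] r s by auto
        have xP: "x : points X" "y : points Y" using VW openin_subset by fastforce+
        obtain n where n: "data_dist X x (D n) < 1 / Suc k" using D(2)[OF xP(1), of "1 / Suc k"] by auto
        obtain m where m: "data_dist Y y (E m) < 1 / Suc k" using E(2)[OF xP(2), of "1 / Suc k"] by auto
        have "X.mball (D n) (1 / Suc k) <= X.mball x r" by (rule X.mball_subset) (use n k D(1) xP X.commute[of x "D n"] in auto)
        moreover have "Y.mball (E m) (1 / Suc k) <= Y.mball y s"
          by (rule Y.mball_subset) (use m k E(1) xP Y.commute[of y "E m"] in auto)
        ultimately have "?B n m k <= U" using r(2) s(2) VW(5) by blast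
        moreover have "z : ?B n m k" using n m D(1) E(1) xP X.commute[of x "D n"] Y.commute[of y "E m"] unfolding xy by simp
        ultimately show "z : (\<Union>(n, m, k)\<in>?I. ?B n m k)" by blast
      qed auto
      moreover have "(\<Union>(n, m, k)\<in>?I. ?B n m k) : sets (law X \<Otimes>\<^sub>M law Y)" by (intro sets.countable_UN'') auto
      ultimately show ?thesis by simp
    qed
    thus ?thesis unfolding sets_borel_of using sets.sigma_sets_subset[of "{U. openin ?T U}" "law X \<Otimes>\<^sub>M law Y"] sp by auto
  qed
  moreover have "sets (law X \<Otimes>\<^sub>M law Y) <= sets (borel_of ?T)"
  proof -
    have f: "fst : measurable (borel_of ?T) (law X)" using continuous_map_measurable[OF continuous_map_fst, of X.mtopology Y.mtopology]
      by (subst measurable_cong_sets[OF refl X.sets_law])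
    have s: "snd : measurable (borel_of ?T) (law Y)" using continuous_map_measurable[OF continuous_map_snd, of X.mtopology Y.mtopology]
      by (subst measurable_cong_sets[OF refl Y.sets_law])
    have id: "(%z. z) : measurable (borel_of ?T) (law X \<Otimes>\<^sub>M law Y)" using measurable_Pair[OF f s] by simp
    have "A Int space (borel_of ?T) : sets (borel_of ?T)" if "A : sets (law X \<Otimes>\<^sub>M law Y)" for A
      using measurable_sets[OF id that] by simp
    moreover have "A Int space (borel_of ?T) = A" if "A : sets (law X \<Otimes>\<^sub>M law Y)" for A
      using sets.sets_into_space[OF that] by (auto simp: sp)
    ultimately show ?thesis by (metis subsetI)
  qed
  ultimately show ?thesis unfolding X.data_topology_eq Y.data_topology_eq by (rule equalityI)
qed

lemma couplings_eq:
  assumes "geometric_dataset X" "geometric_dataset Y"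
  shows "couplings X Y = {\<pi>. coupling_of (law X) (law Y) \<pi>}"
proof -
  interpret X: geom_data X by unfold_locales fact
  interpret Y: geom_data Y by unfold_locales fact
  have "space \<pi> = points X \<times> points Y" if "sets \<pi> = sets (law X \<Otimes>\<^sub>M law Y)" for \<pi>
    using sets_eq_imp_space_eq[OF that] by (simp add: space_pair_measure)
  thus ?thesis unfolding couplings_def coupling_of_def sets_borel_of_prod[OF assms] by auto
qed

definition cost :: "('a \<times> 'b) measure => ('a => real) => ('b => real) => ennreal" where
  "cost \<pi> f g = (\<integral>\<^sup>+z. ennreal \<bar>f (fst z) - g (snd z)\<bar> \<partial>\<pi>)"

lemma cost_swap:
  assumes "coupling_of M N \<pi>" and [measurable]: "f : borel_measurable M" "g : borel_measurable N"
  shows "cost (distr \<pi> (N \<Otimes>\<^sub>M M) (%z. (snd z, fst z))) g f = cost \<pi> f g"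
proof -
  note [measurable] = coupling_ofD(5,6)[OF assms(1)]
  show ?thesis unfolding cost_def by (subst nn_integral_distr) (auto simp: abs_minus_commute)
qed

lemma cost_shift:
  assumes c: "coupling_of M N \<pi>" and [measurable]: "f : borel_measurable M" "g : borel_measurable N" "h : borel_measurable N"
  shows "cost \<pi> f h <= cost \<pi> f g + (L1 N g h)"
proof -
  note [measurable] = coupling_ofD(5,6)[OF c]
  have "cost \<pi> f h <= (\<integral>\<^sup>+z. ennreal \<bar>f (fst z) - g (snd z)\<bar> + ennreal \<bar>g (snd z) - h (snd z)\<bar> \<partial>\<pi>)"
    unfolding cost_def by (intro nn_integral_mono) (auto simp flip: ennreal_plus intro!: ennreal_leI)
  also have "\<dots> = cost \<pi> f g + (\<integral>\<^sup>+z. ennreal \<bar>g (snd z) - h (snd z)\<bar> \<partial>\<pi>)"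
    unfolding cost_def by (rule nn_integral_add) measurable
  also have "(\<integral>\<^sup>+z. ennreal \<bar>g (snd z) - h (snd z)\<bar> \<partial>\<pi>) = (L1 ((distr \<pi> N snd)) g h)"
    by (subst nn_integral_distr) auto
  finally show ?thesis using coupling_ofD(4)[OF c] by simp
qed

lemma cost_shift_left:
  assumes c: "coupling_of M N \<pi>" and [measurable]: "f : borel_measurable M" "k : borel_measurable M" "g : borel_measurable N"
  shows "cost \<pi> k g <= (L1 M k f) + cost \<pi> f g"
proof -
  have "cost \<pi> k g = cost (distr \<pi> (N \<Otimes>\<^sub>M M) (%z. (snd z, fst z))) g k" by (rule cost_swap[symmetric, OF c]) fact+
  also have "\<dots> <= cost (distr \<pi> (N \<Otimes>\<^sub>M M) (%z. (snd z, fst z))) g f + (L1 M f k)"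
    by (rule cost_shift[OF coupling_of_swap[OF c]]) fact+
  also have "cost (distr \<pi> (N \<Otimes>\<^sub>M M) (%z. (snd z, fst z))) g f = cost \<pi> f g" by (rule cost_swap[OF c]) fact+
  finally show ?thesis by (simp add: add.commute abs_minus_commute)
qed

lemma L1_limit:
  assumes M: "prob_space M" and [measurable]: "!!n. h n : borel_measurable M" "k : borel_measurable M"
    and b: "!!n x. x : space M ==> \<bar>h n x\<bar> <= 1/2" "!!x. x : space M ==> \<bar>k x\<bar> <= 1/2"
    and l: "!!x. x : space M ==> (%n. h n x) \<longlonglongrightarrow> k x"
  shows "(%n. \<integral>\<^sup>+x. ennreal \<bar>k x - h n x\<bar> \<partial>M) \<longlonglongrightarrow> 0"
proof -
  interpret prob_space M by fact
  have "(%n. \<integral>\<^sup>+x. ennreal \<bar>k x - h n x\<bar> \<partial>M) \<longlonglongrightarrow> (\<integral>\<^sup>+x. 0 \<partial>M)"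
  proof (rule nn_integral_dominated_convergence[where w = "%_. 1"])
    show "AE x in M. ennreal \<bar>k x - h n x\<bar> <= 1" for n
    proof (rule AE_I2)
      fix x assume "x : space M"
      hence "\<bar>h n x\<bar> <= 1/2" "\<bar>k x\<bar> <= 1/2" using b by auto
      thus "ennreal \<bar>k x - h n x\<bar> <= 1" by simp
    qed
    show "AE x in M. (%n. ennreal \<bar>k x - h n x\<bar>) \<longlonglongrightarrow> 0"
    proof (rule AE_I2)
      fix x assume "x : space M"
      hence "(%n. ennreal \<bar>k x - h n x\<bar>) \<longlonglongrightarrow> ennreal \<bar>k x - k x\<bar>"
        by (intro tendsto_ennrealI tendsto_rabs tendsto_diff tendsto_const l)
      thus "(%n. ennreal \<bar>k x - h n x\<bar>) \<longlonglongrightarrow> 0" by simp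
    qed
  qed (auto simp: emeasure_space_1)
  thus ?thesis by simp
qed

text \<open>Gluing along the cells of \<open>label\<close>: the two middle points agree up to e, and
  so do the values of 1-Lipschitz functions at them.\<close>

lemma couplings_glue:
  assumes geo: "geometric_dataset X" "geometric_dataset Y" "geometric_dataset Z"
    and p: "coupling_of (law X) (law Y) p" and q: "coupling_of (law Y) (law Z) q" and e: "e > 0"
  obtains R where "coupling_of p q R" "AE z in R. data_dist Y (snd (fst z)) (fst (snd z)) <= e"
    "coupling_of (law X) (law Z) (distr R (law X \<Otimes>\<^sub>M law Z) (%z. (fst (fst z), snd (snd z))))"
proof -
  interpret Y: geom_data Y by unfold_locales fact
  obtain c :: "_ => nat" where c: "c : measurable (law Y) (count_space UNIV)"
    "ALL x:points Y. ALL y:points Y. c x = c y --> data_dist Y x y <= e" by (rule Y.label[OF e])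
  obtain R where R: "coupling_of p q R" "AE z in R. c (snd (fst z)) = c (fst (snd z))"
    "coupling_of (law X) (law Z) (distr R (law X \<Otimes>\<^sub>M law Z) (%z. (fst (fst z), snd (snd z))))"
    using coupling_glue[OF p q c(1) c(1) refl] by blast
  have "AE z in R. data_dist Y (snd (fst z)) (fst (snd z)) <= e" using R(2) AE_space
  proof eventually_elim
    fix z assume *: "c (snd (fst z)) = c (fst (snd z))" "z : space R"
    hence "snd (fst z) : points Y" "fst (snd z) : points Y"
      using coupling_ofD(7)[OF R(1)] coupling_ofD(7)[OF p] coupling_ofD(7)[OF q] by auto
    thus "data_dist Y (snd (fst z)) (fst (snd z)) <= e" using c(2) * by blast
  qed
  with R(1,3) show thesis using that by blast
qed

section \<open>The metric of the compactified observable distance\<close>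

lemma hausdorff_leI:
  assumes "!!a. a : A ==> EX b:B. d a b <= e" "!!b. b : B ==> EX a:A. d a b <= e"
  shows "hausdorff d A B <= e" unfolding hausdorff_def by (intro max.boundedI SUP_least) (meson assms INF_lower order_trans)+

lemma hausdorff_lessD:
  assumes "hausdorff d A B < e"
  shows "a : A ==> EX b:B. d a b < e" "b : B ==> EX a:A. d a b < e"
proof -
  have *: "(SUP a\<in>A. INF b\<in>B. d a b) < e" "(SUP b\<in>B. INF a\<in>A. d a b) < e" using assms by (auto simp: hausdorff_def)
  show "EX b:B. d a b < e" if "a : A" using le_less_trans[OF SUP_upper[OF that] *(1)] by (simp add: INF_less_iff)
  show "EX a:A. d a b < e" if "b : B" using le_less_trans[OF SUP_upper[OF that] *(2)] by (simp add: INF_less_iff)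
qed

lemma D_tau_alt: "D_tau \<pi> X Y = max (SUP f\<in>K_tau X. INF g\<in>K_tau Y. cost \<pi> f g) (SUP g\<in>K_tau Y. INF f\<in>K_tau X. cost \<pi> f g)"
  unfolding D_tau_def hausdorff_def cost_def by (simp add: image_image)

lemma obs_dist_leI:
  assumes geo: "geometric_dataset X" "geometric_dataset Y" and \<pi>: "coupling_of (law X) (law Y) \<pi>"
    and "!!f. f : K_tau X ==> EX g:K_tau Y. cost \<pi> f g <= e" "!!g. g : K_tau Y ==> EX f:K_tau X. cost \<pi> f g <= e"
  shows "obs_dist X Y <= e"
proof -
  have "D_tau \<pi> X Y <= e" unfolding D_tau_alt by (intro max.boundedI SUP_least) (meson assms(4,5) INF_lower order_trans)+
  moreover have "obs_dist X Y <= D_tau \<pi> X Y" unfolding obs_dist_def couplings_eq[OF geo] by (rule INF_lower) (use \<pi> in simp)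
  ultimately show ?thesis by simp
qed

lemma obs_dist_lessE:
  assumes geo: "geometric_dataset X" "geometric_dataset Y" and l: "obs_dist X Y < e"
  obtains \<pi> where "coupling_of (law X) (law Y) \<pi>" "ALL f:K_tau X. EX g:K_tau Y. cost \<pi> f g < e"
    "ALL g:K_tau Y. EX f:K_tau X. cost \<pi> f g < e"
proof -
  obtain \<pi> where \<pi>: "coupling_of (law X) (law Y) \<pi>" "D_tau \<pi> X Y < e"
    using l unfolding obs_dist_def couplings_eq[OF geo] INF_less_iff by blast
  hence *: "(SUP f\<in>K_tau X. INF g\<in>K_tau Y. cost \<pi> f g) < e" "(SUP g\<in>K_tau Y. INF f\<in>K_tau X. cost \<pi> f g) < e"
    unfolding D_tau_alt by auto
  have "EX g:K_tau Y. cost \<pi> f g < e" if "f : K_tau X" for f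
    using le_less_trans[OF SUP_upper[OF that] *(1)] by (simp add: INF_less_iff)
  moreover have "EX f:K_tau X. cost \<pi> f g < e" if "g : K_tau Y" for g
    using le_less_trans[OF SUP_upper[OF that] *(2)] by (simp add: INF_less_iff)
  ultimately show thesis using that \<pi>(1) by blast
qed

lemma cost_bound:
  assumes \<pi>: "coupling_of M N \<pi>" and "!!x. x : space M ==> \<bar>f x\<bar> <= 1/2" "!!y. y : space N ==> \<bar>g y\<bar> <= 1/2"
  shows "cost \<pi> f g <= 1"
proof -
  interpret prob_space \<pi> using coupling_ofD(1)[OF \<pi>] .
  have "cost \<pi> f g <= (\<integral>\<^sup>+z. 1 \<partial>\<pi>)" unfolding cost_def
  proof (rule nn_integral_mono)
    fix z assume "z : space \<pi>"
    hence "\<bar>f (fst z)\<bar> <= 1/2" "\<bar>g (snd z)\<bar> <= 1/2" using assms coupling_ofD(7)[OF \<pi>] by auto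
    thus "ennreal \<bar>f (fst z) - g (snd z)\<bar> <= 1" by simp
  qed
  thus ?thesis by (simp add: emeasure_space_1)
qed

lemma obs_dist_le_1:
  assumes geo: "geometric_dataset X" "geometric_dataset Y"
  shows "obs_dist X Y <= 1"
proof -
  interpret X: geom_data X by unfold_locales fact
  interpret Y: geom_data Y by unfold_locales fact
  have c: "coupling_of (law X) (law Y) (law X \<Otimes>\<^sub>M law Y)" by (rule coupling_of_product) unfold_locales
  have "cost (law X \<Otimes>\<^sub>M law Y) f g <= 1" if "f : K_tau X" "g : K_tau Y" for f g
    by (rule cost_bound[OF c]) (use that X.K_tau_bound Y.K_tau_bound in auto)
  thus ?thesis using X.K_tau_ne Y.K_tau_ne by (intro obs_dist_leI[OF geo c]) blast+
qed

lemma obs_dist_commute_le: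
  assumes geo: "geometric_dataset X" "geometric_dataset Y"
  shows "obs_dist Y X <= obs_dist X Y"
proof (rule ennreal_le_epsilon)
  interpret X: geom_data X by unfold_locales fact
  interpret Y: geom_data Y by unfold_locales fact
  fix e :: real assume e: "e > 0" and fin: "obs_dist X Y < top"
  hence "obs_dist X Y < obs_dist X Y + ennreal e" by (simp add: ennreal_add_left_cancel_less[of _ 0, simplified])
  then obtain \<pi> where \<pi>: "coupling_of (law X) (law Y) \<pi>" "ALL f:K_tau X. EX g:K_tau Y. cost \<pi> f g < obs_dist X Y + ennreal e"
    "ALL g:K_tau Y. EX f:K_tau X. cost \<pi> f g < obs_dist X Y + ennreal e" by (rule obs_dist_lessE[OF geo])
  have sw: "cost (distr \<pi> (law Y \<Otimes>\<^sub>M law X) (%z. (snd z, fst z))) g f = cost \<pi> f g" if "f : K_tau X" "g : K_tau Y" for f g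
    by (rule cost_swap[OF \<pi>(1)]) (use that X.K_tau_measurable Y.K_tau_measurable in auto)
  show "obs_dist Y X <= obs_dist X Y + ennreal e"
  proof (rule obs_dist_leI[OF geo(2,1) coupling_of_swap[OF \<pi>(1)]])
    fix g assume g: "g : K_tau Y"
    then obtain f where "f : K_tau X" "cost \<pi> f g < obs_dist X Y + ennreal e" using \<pi>(3) by blast
    thus "EX f:K_tau X. cost (distr \<pi> (law Y \<Otimes>\<^sub>M law X) (%z. (snd z, fst z))) g f <= obs_dist X Y + ennreal e"
      using sw g by (intro bexI[of _ f]) (auto simp: less_imp_le)
  next
    fix f assume f: "f : K_tau X"
    then obtain g where "g : K_tau Y" "cost \<pi> f g < obs_dist X Y + ennreal e" using \<pi>(2) by blast
    thus "EX g:K_tau Y. cost (distr \<pi> (law Y \<Otimes>\<^sub>M law X) (%z. (snd z, fst z))) g f <= obs_dist X Y + ennreal e"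
      using sw f by (intro bexI[of _ g]) (auto simp: less_imp_le)
  qed
qed

lemma obs_dist_commute:
  "geometric_dataset X ==> geometric_dataset Y ==> obs_dist X Y = obs_dist Y X"
  by (intro antisym obs_dist_commute_le)

lemma cost_glue:
  assumes Y: "geometric_dataset Y" and p: "coupling_of L (law Y) p" and q: "coupling_of (law Y) N q"
    and R: "coupling_of p q R" "AE z in R. data_dist Y (snd (fst z)) (fst (snd z)) <= e" and e: "e >= 0"
    and [measurable]: "f : borel_measurable L" "h : borel_measurable N" and g: "geom_data.lip Y g"
  shows "cost (distr R (L \<Otimes>\<^sub>M N) (%z. (fst (fst z), snd (snd z)))) f h <= cost p f g + cost q g h + ennreal e"
proof -
  interpret Y: geom_data Y by unfold_locales fact
  note [measurable] = coupling_ofD(5,6)[OF R(1)] coupling_ofD(5,6)[OF p] coupling_ofD(5,6)[OF q] Y.lip_measurable[OF g]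
  interpret R: prob_space R using coupling_ofD(1)[OF R(1)] .
  have "cost (distr R (L \<Otimes>\<^sub>M N) (%z. (fst (fst z), snd (snd z)))) f h = (\<integral>\<^sup>+z. ennreal \<bar>f (fst (fst z)) - h (snd (snd z))\<bar> \<partial>R)"
    unfolding cost_def by (subst nn_integral_distr) auto
  also have "\<dots> <= (\<integral>\<^sup>+z. ennreal \<bar>f (fst (fst z)) - g (snd (fst z))\<bar> + ennreal \<bar>g (fst (snd z)) - h (snd (snd z))\<bar> + ennreal e \<partial>R)"
  proof (rule nn_integral_mono_AE, use R(2) AE_space in eventually_elim)
    fix z assume *: "data_dist Y (snd (fst z)) (fst (snd z)) <= e" "z : space R"
    hence "snd (fst z) : points Y" "fst (snd z) : points Y"
      using coupling_ofD(7)[OF R(1)] coupling_ofD(7)[OF p] coupling_ofD(7)[OF q] by auto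
    hence "\<bar>g (snd (fst z)) - g (fst (snd z))\<bar> <= e" using g * unfolding Y.lip_def by (meson order_trans)
    thus "ennreal \<bar>f (fst (fst z)) - h (snd (snd z))\<bar> <= ennreal \<bar>f (fst (fst z)) - g (snd (fst z))\<bar> + ennreal \<bar>g (fst (snd z)) - h (snd (snd z))\<bar> + ennreal e"
      using e by (subst ennreal_plus[symmetric], simp, simp)+ (rule ennreal_leI, linarith)
  qed
  also have "\<dots> = (\<integral>\<^sup>+z. ennreal \<bar>f (fst (fst z)) - g (snd (fst z))\<bar> \<partial>R) + (\<integral>\<^sup>+z. ennreal \<bar>g (fst (snd z)) - h (snd (snd z))\<bar> \<partial>R) + ennreal e"
    by (subst nn_integral_add; simp add: nn_integral_add R.emeasure_space_1)
  also have "(\<integral>\<^sup>+z. ennreal \<bar>f (fst (fst z)) - g (snd (fst z))\<bar> \<partial>R) = (L1c ((distr R p fst)) f g)"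
    by (subst nn_integral_distr) auto
  also have "\<dots> = cost p f g" using coupling_ofD(3)[OF R(1)] by (simp add: cost_def)
  also have "(\<integral>\<^sup>+z. ennreal \<bar>g (fst (snd z)) - h (snd (snd z))\<bar> \<partial>R) = (L1c ((distr R q snd)) g h)"
    by (subst nn_integral_distr) auto
  also have "\<dots> = cost q g h" using coupling_ofD(4)[OF R(1)] by (simp add: cost_def)
  finally show ?thesis .
qed

lemma less_add_eps: "x < top ==> e > 0 ==> x < x + ennreal e" for x :: ennreal
  by (simp add: ennreal_add_left_cancel_less[of _ 0, simplified])

lemma obs_dist_triangle:
  assumes geo: "geometric_dataset X" "geometric_dataset Y" "geometric_dataset Z"
  shows "obs_dist X Z <= obs_dist X Y + obs_dist Y Z"
proof (rule ennreal_le_epsilon)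
  interpret X: geom_data X by unfold_locales fact
  interpret Y: geom_data Y by unfold_locales fact
  interpret Z: geom_data Z by unfold_locales fact
  fix e :: real assume e: "e > 0"
  have fin: "obs_dist X Y < top" "obs_dist Y Z < top"
    using obs_dist_le_1[OF geo(1,2)] obs_dist_le_1[OF geo(2,3)] by (auto intro: le_less_trans)
  let ?a = "obs_dist X Y + ennreal (e/3)" and ?b = "obs_dist Y Z + ennreal (e/3)"
  have lt: "obs_dist X Y < ?a" "obs_dist Y Z < ?b" using fin e by (auto intro: less_add_eps)
  obtain p where p: "coupling_of (law X) (law Y) p" "ALL f:K_tau X. EX g:K_tau Y. cost p f g < ?a"
    "ALL g:K_tau Y. EX f:K_tau X. cost p f g < ?a" by (rule obs_dist_lessE[OF geo(1,2) lt(1)])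
  obtain q where q: "coupling_of (law Y) (law Z) q" "ALL f:K_tau Y. EX g:K_tau Z. cost q f g < ?b"
    "ALL g:K_tau Z. EX f:K_tau Y. cost q f g < ?b" by (rule obs_dist_lessE[OF geo(2,3) lt(2)])
  have e3: "e/3 > 0" using e by simp
  obtain R where R: "coupling_of p q R" "AE z in R. data_dist Y (snd (fst z)) (fst (snd z)) <= e/3"
    "coupling_of (law X) (law Z) (distr R (law X \<Otimes>\<^sub>M law Z) (%z. (fst (fst z), snd (snd z))))"
    by (rule couplings_glue[OF geo p(1) q(1) e3])
  let ?s = "distr R (law X \<Otimes>\<^sub>M law Z) (%z. (fst (fst z), snd (snd z)))"
  have eq: "?a + ?b + ennreal (e/3) = obs_dist X Y + obs_dist Y Z + ennreal e"
  proof -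
    have "ennreal e = ennreal (e/3) + ennreal (e/3) + ennreal (e/3)" using e by (simp flip: ennreal_plus)
    thus ?thesis by (simp add: ac_simps)
  qed
  have cs: "cost ?s f h <= obs_dist X Y + obs_dist Y Z + ennreal e"
    if "f : K_tau X" "g : K_tau Y" "h : K_tau Z" "cost p f g < ?a" "cost q g h < ?b" for f g h
  proof -
    have "cost ?s f h <= cost p f g + cost q g h + ennreal (e/3)" by (rule cost_glue[OF geo(2) p(1) q(1) R(1,2)])
        (use e that X.K_tau_measurable Z.K_tau_measurable Y.K_tau_lip in auto)
    also have "\<dots> <= ?a + ?b + ennreal (e/3)" using that by (intro add_mono) auto
    finally show ?thesis unfolding eq .
  qed
  show "obs_dist X Z <= obs_dist X Y + obs_dist Y Z + ennreal e"
  proof (rule obs_dist_leI[OF geo(1,3) R(3)])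
    fix f assume f: "f : K_tau X"
    then obtain g where g: "g : K_tau Y" "cost p f g < ?a" using p(2) by blast
    then obtain h where "h : K_tau Z" "cost q g h < ?b" using q(2) by blast
    thus "EX h:K_tau Z. cost ?s f h <= obs_dist X Y + obs_dist Y Z + ennreal e" using cs f g by blast
  next
    fix h assume h: "h : K_tau Z"
    then obtain g where g: "g : K_tau Y" "cost q g h < ?b" using q(3) by blast
    then obtain f where "f : K_tau X" "cost p f g < ?a" using p(3) by blast
    thus "EX f:K_tau X. cost ?s f h <= obs_dist X Y + obs_dist Y Z + ennreal e" using cs h g by blast
  qed
qed

lemma obs_dist_refl: assumes "geometric_dataset X" shows "obs_dist X X = 0"
proof -
  interpret X: geom_data X by unfold_locales fact
  let ?d = "distr (law X) (law X \<Otimes>\<^sub>M law X) (%z. (z, z))"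
  have c: "coupling_of (law X) (law X) ?d" by (rule coupling_of_distr[OF X.law.prob_space_axioms]) (auto simp: distr_id2)
  have "cost ?d f f = 0" if "f : K_tau X" for f
  proof -
    have [measurable]: "f : borel_measurable (law X)" using that by (rule X.K_tau_measurable)
    show ?thesis unfolding cost_def by (subst nn_integral_distr) auto
  qed
  hence "obs_dist X X <= 0" by (intro obs_dist_leI[OF assms assms c]) auto
  thus ?thesis by simp
qed

text \<open>The near-optimal couplings vary with n and no limit of them is taken. Only the partners
  of the frame converge, by compactness of \<open>K_tau Y\<close>; as the frame is coupled with
  their limit up to every error, the laws agree.\<close>

lemma feature_le_of_obs_dist_0:
  assumes geo: "geometric_dataset X" "geometric_dataset Y" and z: "obs_dist X Y = 0"
  shows "feature_le X Y"
proof -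
  interpret X: geom_data X by unfold_locales fact
  interpret Y: geom_data Y by unfold_locales fact
  obtain f where f: "frame X f" "range f <= features X" by (rule X.ex_frame)
  let ?F = "%i. compose (points X) tau (f i)"
  have FK: "?F i : K_tau X" for i by (intro X.tau_closure X.frame_closure[OF f(1)])
  have "\<exists>\<pi> G. coupling_of (law X) (law Y) \<pi> & (ALL i. G i : K_tau Y & cost \<pi> (?F i) (G i) < ennreal (1 / Suc n))" for n
  proof -
    have "obs_dist X Y < ennreal (1 / Suc n)" using z by simp
    then obtain \<pi> where \<pi>: "coupling_of (law X) (law Y) \<pi>" "ALL f:K_tau X. EX g:K_tau Y. cost \<pi> f g < ennreal (1 / Suc n)"
      "ALL g:K_tau Y. EX f:K_tau X. cost \<pi> f g < ennreal (1 / Suc n)" by (rule obs_dist_lessE[OF geo])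
    have "ALL i. EX g. g : K_tau Y & cost \<pi> (?F i) g < ennreal (1 / Suc n)" using \<pi>(2) FK by blast
    from choice[OF this] \<pi>(1) show ?thesis by blast
  qed
  hence "ALL n. \<exists>\<pi>G. coupling_of (law X) (law Y) (fst \<pi>G) & (ALL i. snd \<pi>G i : K_tau Y & cost (fst \<pi>G) (?F i) (snd \<pi>G i) < ennreal (1 / Suc n))"
    by simp
  from choice[OF this] obtain \<pi>G where \<pi>G: "!!n. coupling_of (law X) (law Y) (fst (\<pi>G n))"
    "!!n i. snd (\<pi>G n) i : K_tau Y" "!!n i. cost (fst (\<pi>G n)) (?F i) (snd (\<pi>G n) i) < ennreal (1 / Suc n)" by blast
  define \<pi> where "\<pi> n = fst (\<pi>G n)" for n
  define G where "G n = snd (\<pi>G n)" for n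
  note pG = \<pi>G[folded \<pi>_def G_def]
  have GK: "G n i : pointwise_closure (points Y) (tau_features Y)" for n i using pG(2) by (simp add: K_tau_def)
  obtain r g where r: "strict_mono (r :: nat => nat)" and g0: "!!i. g i : pointwise_closure (points Y) (tau_features Y)"
    and gl: "!!i x. x : points Y ==> (%n. G (r n) i x) \<longlonglongrightarrow> g i x"
    by (rule Y.closure_seq_compact[where F = G and H = "tau_features Y" and c = "1/2"])
      (use GK Y.tau_features_ext Y.tau_features_lip Y.tau_features_bound in auto)
  have g: "g i : K_tau Y" for i using g0 by (simp add: K_tau_def)
  have Fm: "?F i : borel_measurable (law X)" and gm: "g i : borel_measurable (law Y)" and Gm: "G n i : borel_measurable (law Y)" for i n
    using FK g pG(2) X.K_tau_measurable Y.K_tau_measurable by auto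
  have "seq_law (law X) ?F = seq_law (law Y) g"
  proof (rule seq_law_eqI)
    fix N and e :: real assume e: "e > 0"
    have l0: "(%n. ennreal (1 / Suc (r n)) + (L1 (law Y) (g i) (G (r n) i))) \<longlonglongrightarrow> ennreal 0 + 0" for i
    proof (rule tendsto_add[OF tendsto_ennrealI])
      have "(%n. 1 / real (Suc n)) \<longlonglongrightarrow> 0" using LIMSEQ_inverse_real_of_nat by (simp add: inverse_eq_divide)
      from LIMSEQ_subseq_LIMSEQ[OF this r] show "(%n. 1 / real (Suc (r n))) \<longlonglongrightarrow> 0" by (simp add: comp_def)
      show "(%n. \<integral>\<^sup>+y. ennreal \<bar>g i y - G (r n) i y\<bar> \<partial>law Y) \<longlonglongrightarrow> 0"
        by (rule L1_limit) (use gm Gm gl Y.law.prob_space_axioms Y.K_tau_bound[OF g] Y.K_tau_bound[OF pG(2)] in auto)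
    qed
    have "\<forall>\<^sub>F n in sequentially. ALL i:{..<N}. ennreal (1 / Suc (r n)) + (L1 (law Y) (g i) (G (r n) i)) < ennreal e"
      using e by (intro eventually_ball_finite ballI order_tendstoD(2)[OF l0]) auto
    then obtain n where n: "!!i. i < N ==> ennreal (1 / Suc (r n)) + (L1 (law Y) (g i) (G (r n) i)) < ennreal e"
      by (auto simp: eventually_sequentially)
    have "cost (\<pi> (r n)) (?F i) (g i) <= ennreal e" if "i < N" for i
    proof -
      have "cost (\<pi> (r n)) (?F i) (g i) <= cost (\<pi> (r n)) (?F i) (G (r n) i) + (L1 (law Y) (G (r n) i) (g i))"
        by (rule cost_shift[OF pG(1) Fm Gm gm])
      also have "\<dots> <= ennreal (1 / Suc (r n)) + (L1 (law Y) (g i) (G (r n) i))"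
        using pG(3)[of "r n" i] by (intro add_mono) (auto simp: abs_minus_commute less_imp_le)
      also have "\<dots> <= ennreal e" using n[OF that] by simp
      finally show ?thesis .
    qed
    thus "coupled N e (law X) ?F (law Y) g" unfolding coupled_def using pG(1)[of "r n"] by (auto simp: cost_def)
  qed (use Fm gm X.law.prob_space_axioms Y.law.prob_space_axioms in auto)
  thus ?thesis by (rule feature_le_tauI[where g = g, OF geo f(1) g])
qed

lemma ennreal_d_tau: "A : DD ==> B : DD ==> ennreal (d_tau A B) = obs_dist (rep A) (rep B)"
  using obs_dist_le_1[of "rep A" "rep B"] geometric_rep by (simp add: d_tau_def) (metis ennreal_enn2real ennreal_one_less_top le_less_trans)

theorem Metric_space_d_tau: "Metric_space DD d_tau"
proof
  fix A B
  show "0 <= d_tau A B" by (simp add: d_tau_def)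
  show "d_tau A B = d_tau B A" using obs_dist_commute[OF geometric_rep(1) geometric_rep(1), of A B] by (auto simp: d_tau_def)
  assume A: "A : DD" and B: "B : DD"
  note gA = geometric_rep(1)[OF A] and gB = geometric_rep(1)[OF B]
  show "d_tau A B = 0 \<longleftrightarrow> A = B"
  proof
    assume "d_tau A B = 0"
    hence z: "obs_dist (rep A) (rep B) = 0" using ennreal_d_tau[OF A B] by simp
    hence "obs_dist (rep B) (rep A) = 0" using obs_dist_commute[OF gA gB] by simp
    thus "A = B" using feature_le_of_obs_dist_0[OF gA gB z] feature_le_of_obs_dist_0[OF gB gA]
      by (intro class_le_antisym A B) (auto simp: class_le_def)
  qed (use obs_dist_refl[OF gA] A in \<open>simp add: d_tau_def\<close>)
  fix C assume C: "C : DD"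
  have nn: "0 <= d_tau A B" "0 <= d_tau B C" by (auto simp: d_tau_def)
  have "ennreal (d_tau A C) <= ennreal (d_tau A B + d_tau B C)"
    using obs_dist_triangle[OF gA gB geometric_rep(1)[OF C]] nn by (simp add: ennreal_d_tau A B C ennreal_plus)
  thus "d_tau A C <= d_tau A B + d_tau B C" by (subst (asm) ennreal_le_iff) (auto simp: d_tau_def)
qed


section \<open>The box metric\<close>

abbreviation prod_data :: "'a dataset => 'b dataset => ('a \<times> 'b) topology" where
  "prod_data X Y \<equiv> prod_topology (data_topology X) (data_topology Y)"

definition near_on :: "('a \<times> 'b) set => real => ('a => real) => ('b => real) => bool" where
  "near_on S c f g \<longleftrightarrow> (ALL z:S. \<bar>f (fst z) - g (snd z)\<bar> <= c)"

lemma box_dist_leI: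
  fixes X :: "'a dataset" and Y :: "'b dataset"
  assumes geo: "geometric_dataset X" "geometric_dataset Y" and \<pi>: "coupling_of (law X) (law Y) \<pi>"
    and S: "closedin (prod_data X Y) S" "measure \<pi> S >= 1 - e" and e: "e >= 0"
    and f: "!!f. f : features X ==> EX g:features Y. near_on S (e/2) f g" "!!g. g : features Y ==> EX f:features X. near_on S (e/2) f g"
  shows "box_dist X Y <= ennreal e"
proof -
  have *: "sup_dist_on S (f \<circ> fst) (g \<circ> snd) <= ennreal (e/2)" if "near_on S (e/2) f g" for f g
    using that unfolding sup_dist_on_def near_on_def by (intro SUP_least ennreal_leI) auto
  have "hausdorff (sup_dist_on S) ((%f. f \<circ> fst) ` features X) ((%g. g \<circ> snd) ` features Y) <= ennreal (e/2)"
  proof (rule hausdorff_leI)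
    fix u :: "'a \<times> 'b => real" assume "u : (%f. f \<circ> fst) ` features X"
    then obtain f where "f : features X" and u: "u = f \<circ> fst" by blast
    then obtain g where "g : features Y" "near_on S (e/2) f g" using assms(7) by blast
    thus "EX v:(%g. g \<circ> snd) ` features Y. sup_dist_on S u v <= ennreal (e/2)" using * u by blast
  next
    fix v :: "'a \<times> 'b => real" assume "v : (%g. g \<circ> snd) ` features Y"
    then obtain g where "g : features Y" and v: "v = g \<circ> snd" by blast
    then obtain f where "f : features X" "near_on S (e/2) f g" using assms(8) by blast
    thus "EX u:(%f. f \<circ> fst) ` features X. sup_dist_on S u v <= ennreal (e/2)" using * v by blast
  qed
  hence "2 * hausdorff (sup_dist_on S) ((%f. f \<circ> fst) ` features X) ((%g. g \<circ> snd) ` features Y) <= 2 * ennreal (e/2)"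
    by (rule mult_left_mono) simp
  also have "2 * ennreal (e/2) = ennreal (2 * (e/2))" using e by (subst ennreal_mult) auto
  finally have "max (ennreal (1 - measure \<pi> S)) (2 * hausdorff (sup_dist_on S) ((%f. f \<circ> fst) ` features X) ((%g. g \<circ> snd) ` features Y)) <= ennreal e"
    using S(2) by (auto intro: ennreal_leI)
  thus ?thesis unfolding box_dist_def couplings_eq[OF geo] by (intro INF_lower2[of \<pi>] INF_lower2[of S]) (use \<pi> S in auto)
qed

lemma box_dist_lessE:
  assumes geo: "geometric_dataset X" "geometric_dataset Y" and l: "box_dist X Y < ennreal e"
  obtains \<pi> S where "coupling_of (law X) (law Y) \<pi>" "closedin (prod_data X Y) S" "measure \<pi> S >= 1 - e"
    "ALL f:features X. EX g:features Y. near_on S (e/2) f g" "ALL g:features Y. EX f:features X. near_on S (e/2) f g"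
proof -
  obtain \<pi> S where \<pi>: "coupling_of (law X) (law Y) \<pi>" and S: "closedin (prod_data X Y) S"
    and m: "max (ennreal (1 - measure \<pi> S)) (2 * hausdorff (sup_dist_on S) ((%f. f \<circ> fst) ` features X) ((%g. g \<circ> snd) ` features Y)) < ennreal e"
    using l unfolding box_dist_def couplings_eq[OF geo] INF_less_iff by blast
  have e: "e > 0" using m by (auto simp: ennreal_eq_0_iff not_less dest: gr_implies_not_zero intro: ccontr)
  have m1: "measure \<pi> S >= 1 - e" using m ennreal_leI[of e "1 - measure \<pi> S"] by (force simp: not_less)
  have h: "hausdorff (sup_dist_on S) ((%f. f \<circ> fst) ` features X) ((%g. g \<circ> snd) ` features Y) < ennreal (e/2)" (is "?H < _")
  proof (rule ccontr)
    assume "\<not> ?thesis"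
    hence "2 * ennreal (e/2) <= 2 * ?H" by (intro mult_left_mono) (auto simp: not_less)
    moreover have "2 * ennreal (e/2) = ennreal (2 * (e/2))" using e by (subst ennreal_mult) auto
    ultimately show False using m by (auto simp: not_less)
  qed
  have *: "near_on S (e/2) f g" if "sup_dist_on S (f \<circ> fst) (g \<circ> snd) < ennreal (e/2)" for f g unfolding near_on_def
  proof
    fix z assume "z : S"
    hence "ennreal \<bar>(f \<circ> fst) z - (g \<circ> snd) z\<bar> <= sup_dist_on S (f \<circ> fst) (g \<circ> snd)"
      unfolding sup_dist_on_def by (rule SUP_upper)
    also note that
    finally show "\<bar>f (fst z) - g (snd z)\<bar> <= e/2" using e by (simp add: ennreal_less_iff)
  qed
  have 1: "EX g:features Y. near_on S (e/2) f g" if "f : features X" for f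
    using hausdorff_lessD(1)[OF h, of "f \<circ> fst"] that * by auto
  have 2: "EX f:features X. near_on S (e/2) f g" if "g : features Y" for g
    using hausdorff_lessD(2)[OF h, of "g \<circ> snd"] that * by auto
  show thesis using that[OF \<pi> S m1] 1 2 by blast
qed

text \<open>Taking S empty costs mass 1 and makes all features close.\<close>

lemma box_dist_le_1:
  assumes geo: "geometric_dataset X" "geometric_dataset Y"
  shows "box_dist X Y <= ennreal 1"
proof -
  interpret X: geom_data X by unfold_locales fact
  interpret Y: geom_data Y by unfold_locales fact
  have c: "coupling_of (law X) (law Y) (law X \<Otimes>\<^sub>M law Y)" by (rule coupling_of_product) unfold_locales
  show ?thesis by (rule box_dist_leI[OF geo c, where S = "{}"]) (use X.features_ne Y.features_ne in \<open>auto simp: near_on_def\<close>)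
qed

lemma closedin_sets_coupling:
  assumes geo: "geometric_dataset X" "geometric_dataset Y" and \<pi>: "coupling_of (law X) (law Y) \<pi>"
    and S: "closedin (prod_data X Y) S"
  shows "S : sets \<pi>" using closedin_borel_of[OF S] coupling_ofD(2)[OF \<pi>] sets_borel_of_prod[OF geo] by simp

lemma box_dist_commute_le:
  assumes geo: "geometric_dataset X" "geometric_dataset Y"
  shows "box_dist Y X <= box_dist X Y"
proof (rule ennreal_le_epsilon)
  fix e :: real assume e: "e > 0" and fin: "box_dist X Y < top"
  then obtain b where b: "box_dist X Y = ennreal b" "b >= 0" by (cases "box_dist X Y") auto
  hence "box_dist X Y < ennreal (b + e)" using e by (simp add: ennreal_less_iff)
  then obtain \<pi> S where \<pi>: "coupling_of (law X) (law Y) \<pi>" "closedin (prod_data X Y) S" "measure \<pi> S >= 1 - (b + e)"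
    "ALL f:features X. EX g:features Y. near_on S ((b + e)/2) f g" "ALL g:features Y. EX f:features X. near_on S ((b + e)/2) f g"
    by (rule box_dist_lessE[OF geo])
  let ?sw = "%z. (snd z, fst z)" 
  let ?S = "{w : topspace (prod_data Y X). ?sw w : S}"
  have cS: "closedin (prod_data Y X) ?S"
  proof (rule closedin_continuous_map_preimage[OF _ \<pi>(2)])
    show "continuous_map (prod_data Y X) (prod_data X Y) ?sw" by (intro continuous_map_pairedI continuous_map_fst continuous_map_snd)
  qed
  note c = coupling_of_swap[OF \<pi>(1)]
  have sm: "?sw : measurable \<pi> (law Y \<Otimes>\<^sub>M law X)" using coupling_ofD(5,6)[OF \<pi>(1)] by measurable
  have "?sw -` ?S Int space \<pi> = S"
    using closedin_subset[OF \<pi>(2)] sets.sets_into_space[OF closedin_sets_coupling[OF geo \<pi>(1,2)]] by auto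
  hence m: "measure (distr \<pi> (law Y \<Otimes>\<^sub>M law X) ?sw) ?S = measure \<pi> S"
    using closedin_sets_coupling[OF geo(2,1) c cS] by (subst measure_distr[OF sm]) auto
  have nr: "near_on ?S d g f" if "near_on S d f g" for d f g using that unfolding near_on_def by (auto simp: abs_minus_commute)
  have "box_dist Y X <= ennreal (b + e)"
  proof (rule box_dist_leI[OF geo(2,1) c cS])
    fix g assume "g : features Y" thus "EX f:features X. near_on ?S ((b + e)/2) g f" using \<pi>(5) nr by blast
  next
    fix f assume "f : features X" thus "EX g:features Y. near_on ?S ((b + e)/2) g f" using \<pi>(4) nr by blast
  qed (use m \<pi>(3) b(2) e in auto)
  thus "box_dist Y X <= box_dist X Y + ennreal e" using b e by (simp add: ennreal_plus)
qed

lemma box_dist_commute: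
  "geometric_dataset X ==> geometric_dataset Y ==> box_dist X Y = box_dist Y X"
  by (intro antisym box_dist_commute_le)

lemma closedin_near:
  assumes geo: "geometric_dataset X" "geometric_dataset Y" and f: "geom_data.lip X f" and g: "geom_data.lip Y g"
  shows "closedin (prod_data X Y) {z : topspace (prod_data X Y). \<bar>f (fst z) - g (snd z)\<bar> <= c}"
proof -
  interpret X: geom_data X by unfold_locales fact
  interpret Y: geom_data Y by unfold_locales fact
  have "continuous_map (prod_data X Y) euclideanreal (%z. f (fst z))"
    using continuous_map_compose[OF continuous_map_fst X.lip_continuous[OF f], of "data_topology Y"]
    by (simp add: X.data_topology_eq comp_def)
  moreover have "continuous_map (prod_data X Y) euclideanreal (%z. g (snd z))"
    using continuous_map_compose[OF continuous_map_snd Y.lip_continuous[OF g], of "data_topology X"]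
    by (simp add: Y.data_topology_eq comp_def)
  ultimately have "continuous_map (prod_data X Y) euclideanreal (%z. \<bar>f (fst z) - g (snd z)\<bar>)"
    by (intro continuous_intros)
  from closedin_continuous_map_preimage[OF this, of "{..c}"] show ?thesis by simp
qed

text \<open>Points joined through e-close middle points form V, where features differ by at most the
  two given errors plus e. V is replaced by its closure because S must be closed, and
  \<open>closedin_near\<close> keeps the estimate.\<close>

lemma box_dist_triangle:
  fixes X :: "'a dataset" and Y :: "'b dataset" and Z :: "'c dataset"
  assumes geo: "geometric_dataset X" "geometric_dataset Y" "geometric_dataset Z"
  shows "box_dist X Z <= box_dist X Y + box_dist Y Z"
proof (rule ennreal_le_epsilon)
  interpret X: geom_data X by unfold_locales fact
  interpret Y: geom_data Y by unfold_locales fact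
  interpret Z: geom_data Z by unfold_locales fact
  fix e0 :: real assume e0: "e0 > 0"
  \<comment> \<open>One e each makes the two bounds strict, and the error e at the middle point
    counts twice in the box distance.\<close>
  define e where "e = e0 / 4"
  have e: "e > 0" "e + e + 2 * e = e0" using e0 by (auto simp: e_def)
  obtain a0 where a0: "box_dist X Y = ennreal a0" "a0 >= 0"
    using box_dist_le_1[OF geo(1,2)] by (cases "box_dist X Y") (auto simp: top_unique)
  obtain b0 where b0: "box_dist Y Z = ennreal b0" "b0 >= 0"
    using box_dist_le_1[OF geo(2,3)] by (cases "box_dist Y Z") (auto simp: top_unique)
  define a b where "a = a0 + e" and "b = b0 + e"
  have lt: "box_dist X Y < ennreal a" "box_dist Y Z < ennreal b" and ab: "a > 0" "b > 0"
    using a0 b0 e by (auto simp: a_def b_def ennreal_less_iff)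
  obtain p S where p: "coupling_of (law X) (law Y) p" "closedin (prod_data X Y) S" "measure p S >= 1 - a"
    "ALL f:features X. EX g:features Y. near_on S (a/2) f g" "ALL g:features Y. EX f:features X. near_on S (a/2) f g"
    by (rule box_dist_lessE[OF geo(1,2) lt(1)])
  obtain q S' where q: "coupling_of (law Y) (law Z) q" "closedin (prod_data Y Z) S'" "measure q S' >= 1 - b"
    "ALL f:features Y. EX g:features Z. near_on S' (b/2) f g" "ALL g:features Z. EX f:features Y. near_on S' (b/2) f g"
    by (rule box_dist_lessE[OF geo(2,3) lt(2)])
  obtain R where R: "coupling_of p q R" "AE z in R. data_dist Y (snd (fst z)) (fst (snd z)) <= e"
    "coupling_of (law X) (law Z) (distr R (law X \<Otimes>\<^sub>M law Z) (%z. (fst (fst z), snd (snd z))))"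
    by (rule couplings_glue[OF geo p(1) q(1) e(1)])
  let ?\<sigma> = "distr R (law X \<Otimes>\<^sub>M law Z) (%z. (fst (fst z), snd (snd z)))"
  interpret R: prob_space R using coupling_ofD(1)[OF R(1)] .
  note [measurable] = coupling_ofD(5,6)[OF R(1)] coupling_ofD(5,6)[OF p(1)] coupling_ofD(5,6)[OF q(1)]
  have Sm[measurable]: "S : sets p" "S' : sets q"
    using closedin_sets_coupling[OF geo(1,2) p(1,2)] closedin_sets_coupling[OF geo(2,3) q(1,2)] .
  define V where "V = {(x, z). EX y y'. (x, y) : S & (y', z) : S' & data_dist Y y y' <= e}"
  define W where "W = prod_data X Z closure_of V"
  have W: "closedin (prod_data X Z) W" by (simp add: W_def)
  have SP: "S <= points X \<times> points Y" "S' <= points Y \<times> points Z"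
    using closedin_subset[OF p(2)] closedin_subset[OF q(2)] by (auto simp: X.data_topology_eq Y.data_topology_eq Z.data_topology_eq)
  hence VW: "V <= W" unfolding W_def by (intro closure_of_subset) (auto simp: V_def X.data_topology_eq Z.data_topology_eq)
  have ms: "(%z. (fst (fst z), snd (snd z))) : measurable R (law X \<Otimes>\<^sub>M law Z)" by measurable
  have Wm: "W : sets ?\<sigma>" by (rule closedin_sets_coupling[OF geo(1,3) R(3) W])
  have A1: "measure R (fst -` S Int space R) = measure p S"
    using measure_distr[OF coupling_ofD(5)[OF R(1)] Sm(1)] coupling_ofD(3)[OF R(1)] by simp
  have A2: "measure R (snd -` S' Int space R) = measure q S'"
    using measure_distr[OF coupling_ofD(6)[OF R(1)] Sm(2)] coupling_ofD(4)[OF R(1)] by simp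
  \<comment> \<open>Inclusion-exclusion: the preimages of S and S' overlap in mass at least 1 - (a +
    b).\<close>
  have "1 - (a + b) <= measure R (fst -` S Int space R) + measure R (snd -` S' Int space R) - 1"
    unfolding A1 A2 using p(3) q(3) by linarith
  also have "\<dots> <= measure R ((fst -` S Int space R) Int (snd -` S' Int space R))"
  proof -
    have m: "fst -` S Int space R : sets R" "snd -` S' Int space R : sets R" by measurable
    have "measure R ((fst -` S Int space R) \<union> (snd -` S' Int space R)) <= 1" by (rule R.prob_le_1)
    moreover have "measure R ((fst -` S Int space R) \<union> (snd -` S' Int space R)) = measure R (fst -` S Int space R) + measure R (snd -` S' Int space R) - measure R ((fst -` S Int space R) Int (snd -` S' Int space R))"
      using m by (intro measure_Un3) (auto simp: fmeasurable_def less_top[symmetric])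
    ultimately show ?thesis by linarith
  qed
  also have "\<dots> <= measure R ((%z. (fst (fst z), snd (snd z))) -` W Int space R)"
  proof (rule R.finite_measure_mono_AE)
    show "AE z in R. z : (fst -` S Int space R) Int (snd -` S' Int space R) --> z : (%z. (fst (fst z), snd (snd z))) -` W Int space R"
      using R(2)
    proof eventually_elim
      fix z :: "('a \<times> 'b) \<times> 'b \<times> 'c" assume d: "data_dist Y (snd (fst z)) (fst (snd z)) <= e"
      show "z : (fst -` S Int space R) Int (snd -` S' Int space R) --> z : (%z. (fst (fst z), snd (snd z))) -` W Int space R"
      proof
        assume z: "z : (fst -` S Int space R) Int (snd -` S' Int space R)"
        hence "(fst (fst z), snd (fst z)) : S" "(fst (snd z), snd (snd z)) : S'" by auto
        hence "(fst (fst z), snd (snd z)) : V" unfolding V_def using d by blast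
        thus "z : (%z. (fst (fst z), snd (snd z))) -` W Int space R" using VW z by auto
      qed
    qed
    show "(%z. (fst (fst z), snd (snd z))) -` W Int space R : sets R" using measurable_sets[OF ms, of W] Wm by simp
  qed
  also have "\<dots> = measure ?\<sigma> W" using Wm by (subst measure_distr[OF ms]) auto
  finally have mW: "1 - (a + b) <= measure ?\<sigma> W" .
  have nr: "near_on W ((a + b + 2 * e)/2) f h"
    if fgh: "f : features X" "g : features Y" "h : features Z" "near_on S (a/2) f g" "near_on S' (b/2) g h" for f g h
  proof -
    have "V <= {z : topspace (prod_data X Z). \<bar>f (fst z) - h (snd z)\<bar> <= (a + b + 2 * e)/2}"
    proof clarify
      fix x z assume "(x, z) : V"
      then obtain y y' where y: "(x, y) : S" "(y', z) : S'" "data_dist Y y y' <= e" unfolding V_def by blast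
      have P: "x : points X" "y : points Y" "y' : points Y" "z : points Z" using y SP by auto
      have "\<bar>f x - g y\<bar> <= a/2" "\<bar>g y' - h z\<bar> <= b/2" using y fgh(4,5) unfolding near_on_def by fastforce+
      moreover have "\<bar>g y - g y'\<bar> <= e" using Y.feature_dist_le[OF fgh(2) P(2,3)] y(3) by linarith
      moreover have "(a + b + 2 * e)/2 = a/2 + b/2 + e" by (simp add: field_simps)
      ultimately have "\<bar>f x - h z\<bar> <= (a + b + 2 * e)/2" by linarith
      thus "(x, z) : topspace (prod_data X Z) & \<bar>f (fst (x, z)) - h (snd (x, z))\<bar> <= (a + b + 2 * e)/2"
        using P by (simp add: X.data_topology_eq Z.data_topology_eq)
    qed
    hence "W <= {z : topspace (prod_data X Z). \<bar>f (fst z) - h (snd z)\<bar> <= (a + b + 2 * e)/2}" unfolding W_def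
      by (rule closure_of_minimal)
        (intro closedin_near geo X.feature_closure_lip Z.feature_closure_lip X.features_closure Z.features_closure fgh)
    thus ?thesis unfolding near_on_def by blast
  qed
  have "box_dist X Z <= ennreal (a + b + 2 * e)"
  proof (rule box_dist_leI[OF geo(1,3) R(3) W])
    fix f assume f: "f : features X"
    then obtain g where g: "g : features Y" "near_on S (a/2) f g" using p(4) by blast
    then obtain h where "h : features Z" "near_on S' (b/2) g h" using q(4) by blast
    thus "EX h:features Z. near_on W ((a + b + 2 * e)/2) f h" using nr f g by blast
  next
    fix h assume h: "h : features Z"
    then obtain g where g: "g : features Y" "near_on S' (b/2) g h" using q(5) by blast
    then obtain f where "f : features X" "near_on S (a/2) f g" using p(5) by blast
    thus "EX f:features X. near_on W ((a + b + 2 * e)/2) f h" using nr h g by blast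
  qed (use mW ab e in auto)
  also have "a + b + 2 * e = a0 + b0 + e0" using e(2) by (simp add: a_def b_def)
  finally show "box_dist X Z <= box_dist X Y + box_dist Y Z + ennreal e0" using a0 b0 e0 by (simp add: ennreal_plus)
qed

text \<open>Off S, a set of mass at most e, the functions differ by at most 1.\<close>

lemma cost_near_on:
  assumes geo: "geometric_dataset X" "geometric_dataset Y" and \<pi>: "coupling_of (law X) (law Y) \<pi>"
    and S: "S : sets \<pi>" "measure \<pi> S >= 1 - e" and n: "near_on S c f g" and c: "c >= 0" "e >= 0"
    and b: "!!x. x : points X ==> \<bar>f x\<bar> <= 1/2" "!!y. y : points Y ==> \<bar>g y\<bar> <= 1/2"
  shows "cost \<pi> f g <= ennreal (c + e)"
proof -
  interpret X: geom_data X by unfold_locales fact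
  interpret Y: geom_data Y by unfold_locales fact
  interpret prob_space \<pi> using coupling_ofD(1)[OF \<pi>] .
  have "cost \<pi> f g <= (\<integral>\<^sup>+z. ennreal c + indicator (space \<pi> - S) z \<partial>\<pi>)" unfolding cost_def
  proof (rule nn_integral_mono)
    fix z assume z: "z : space \<pi>"
    show "ennreal \<bar>f (fst z) - g (snd z)\<bar> <= ennreal c + indicator (space \<pi> - S) z"
    proof (cases "z : S")
      case True
      thus ?thesis using n unfolding near_on_def by (auto intro: ennreal_leI)
    next
      case False
      have "\<bar>f (fst z)\<bar> <= 1/2" "\<bar>g (snd z)\<bar> <= 1/2" using b z coupling_ofD(7)[OF \<pi>] by auto
      hence "ennreal \<bar>f (fst z) - g (snd z)\<bar> <= ennreal (c + 1)" using c by (intro ennreal_leI) linarith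
      thus ?thesis using False z c by (simp add: ennreal_plus)
    qed
  qed
  also have "\<dots> = ennreal c + emeasure \<pi> (space \<pi> - S)" using S(1) by (subst nn_integral_add) (auto simp: emeasure_space_1)
  also have "emeasure \<pi> (space \<pi> - S) <= ennreal e" using S prob_compl[OF S(1)] by (simp add: emeasure_eq_measure ennreal_leI)
  finally show ?thesis using c by (simp add: ennreal_plus add_left_mono)
qed

lemma closure_limit_frame:
  assumes geo: "geometric_dataset X" and K: "f : feature_closure X"
  obtains h where "ALL n. h n : features X" "ALL x:points X. (%n. h n x) \<longlonglongrightarrow> f x"
proof -
  interpret X: geom_data X by unfold_locales fact
  obtain k where k: "frame X k" "range k <= features X" by (rule X.ex_frame)
  obtain r :: "nat => nat" where "!!x. x : points X ==> (%n. k (r n) x) \<longlonglongrightarrow> f x"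
    by (rule X.closure_range_seq[OF X.frame_ext[OF k(1)] X.frame_lip[OF k(1)]])
      (use K X.frame_feature_closure[OF k(1)] in auto)
  thus thesis using that[of "%n. k (r n)"] k(2) by auto
qed

lemma near_on_tau: "near_on S c f g ==> S <= points X \<times> points Y ==> c >= 0 ==> near_on S c (compose (points X) tau f) (compose (points Y) tau g)"
  unfolding near_on_def
proof
  fix z assume *: "ALL z:S. \<bar>f (fst z) - g (snd z)\<bar> <= c" "S <= points X \<times> points Y" "z : S"
  hence "fst z : points X" "snd z : points Y" by auto
  moreover have "\<bar>tau (f (fst z)) - tau (g (snd z))\<bar> <= \<bar>f (fst z) - g (snd z)\<bar>"
    by (rule order_trans[OF tau_contract]) simp
  ultimately show "\<bar>compose (points X) tau f (fst z) - compose (points Y) tau g (snd z)\<bar> <= c"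
    using * by (auto simp: compose_def intro: order_trans)
qed

lemma cost_closure:
  assumes geo: "geometric_dataset X" "geometric_dataset Y" and \<pi>: "coupling_of (law X) (law Y) \<pi>"
    and m: "!!n. h n : borel_measurable (law X)" "k : borel_measurable (law X)" "!!n. g n : borel_measurable (law Y)"
    and b: "!!n x. x : points X ==> \<bar>h n x\<bar> <= 1/2" "!!x. x : points X ==> \<bar>k x\<bar> <= 1/2"
    and l: "!!x. x : points X ==> (%n. h n x) \<longlonglongrightarrow> k x" and c: "!!n. cost \<pi> (h n) (g n) <= ennreal c" and cd: "0 <= c" "c < d"
  shows "EX n. cost \<pi> k (g n) <= ennreal d"
proof -
  interpret X: geom_data X by unfold_locales fact
  have "(%n. \<integral>\<^sup>+x. ennreal \<bar>k x - h n x\<bar> \<partial>law X) \<longlonglongrightarrow> 0"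
    by (rule L1_limit) (use m b l X.law.prob_space_axioms in auto)
  hence "\<forall>\<^sub>F n in sequentially. (L1 (law X) k (h n)) < ennreal (d - c)" using cd by (intro order_tendstoD(2)) auto
  then obtain n where n: "(L1 (law X) k (h n)) < ennreal (d - c)" by (auto simp: eventually_sequentially)
  have "cost \<pi> k (g n) <= (L1 (law X) k (h n)) + cost \<pi> (h n) (g n)" by (rule cost_shift_left[OF \<pi>]) (use m in auto)
  also have "\<dots> <= ennreal (d - c) + ennreal c" using n c by (intro add_mono) auto
  also have "\<dots> = ennreal d" using cd by (simp flip: ennreal_plus)
  finally show ?thesis by blast
qed

text \<open>Features e/2-close on a set of mass at least 1 - e are e/2 + e close in mean; the strict
  room up to 2 * e pays for passing from features to limits of features. For K-valued data the
  features themselves replace their compactifications.\<close>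

lemma box_to_cost:
  assumes geo: "geometric_dataset X" "geometric_dataset Y" and l: "box_dist X Y < ennreal e"
  obtains \<pi> where "coupling_of (law X) (law Y) \<pi>" "ALL k:K_tau X. EX g:K_tau Y. cost \<pi> k g <= ennreal (2 * e)"
    "K_valued X & K_valued Y --> (ALL k:feature_closure X. EX g:features Y. cost \<pi> k g <= ennreal (2 * e))"
    "ALL g:K_tau Y. EX k:K_tau X. cost \<pi> k g <= ennreal (2 * e)"
proof -
  \<comment> \<open>The one-sided estimate, stated for arbitrary data sets because the last clause
    applies it to the swapped coupling.\<close>
  have *: "(ALL k:K_tau X. EX g:K_tau Y. cost \<pi> k g <= ennreal (2 * e)) &
    (K_valued X --> K_valued Y --> (ALL k:feature_closure X. EX g:features Y. cost \<pi> k g <= ennreal (2 * e)))"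
    if geo: "geometric_dataset X" "geometric_dataset Y"
      and \<pi>: "coupling_of (law X) (law Y) \<pi>" and S: "S : sets \<pi>" "measure \<pi> S >= 1 - e" and e: "e > 0"
      and n: "ALL f:features X. EX g:features Y. near_on S (e/2) f g"
    for X :: "'x dataset" and Y :: "'y dataset" and \<pi> S
  proof -
    interpret X: geom_data X by unfold_locales fact
    interpret Y: geom_data Y by unfold_locales fact
    have SP: "S <= points X \<times> points Y" using sets.sets_into_space[OF S(1)] coupling_ofD(7)[OF \<pi>] by simp
    obtain G where G: "!!f. f : features X ==> G f : features Y & near_on S (e/2) f (G f)" using n by metis
    have ee: "e/2 + e < 2 * e" "0 <= e/2 + e" "e/2 >= 0" "e >= 0" using e by auto
    have "EX g:K_tau Y. cost \<pi> k g <= ennreal (2 * e)" if k: "k : K_tau X" for k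
    proof -
      obtain h where "ALL n. h n : features X" "ALL x:points X. (%n. tau (h n x)) \<longlonglongrightarrow> k x"
        by (rule X.K_tau_limit[OF k])
      hence h: "!!n. h n : features X" "!!x. x : points X ==> (%n. tau (h n x)) \<longlonglongrightarrow> k x" by auto
      let ?h = "%n. compose (points X) tau (h n)" and ?g = "%n. compose (points Y) tau (G (h n))"
      have hk: "?h n : K_tau X" and gk: "?g n : K_tau Y" for n using X.tau_features_K Y.tau_features_K h(1) G by auto
      have "EX n. cost \<pi> k (?g n) <= ennreal (2 * e)"
      proof (rule cost_closure[OF geo \<pi>, where h = ?h and c = "e/2 + e"])
        show "cost \<pi> (?h n) (?g n) <= ennreal (e/2 + e)" for n
          by (rule cost_near_on[OF geo \<pi> S near_on_tau[OF _ SP]]) (use G[OF h(1)] ee X.K_tau_bound[OF hk] Y.K_tau_bound[OF gk] in auto)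
        show "(%n. ?h n x) \<longlonglongrightarrow> k x" if "x : points X" for x using h(2)[OF that] that by (simp add: compose_def)
      qed (use hk gk k X.K_tau_measurable Y.K_tau_measurable X.K_tau_bound[OF hk] X.K_tau_bound[OF k] ee in auto)
      thus ?thesis using gk by blast
    qed
    moreover have "EX g:features Y. cost \<pi> k g <= ennreal (2 * e)" if K: "K_valued X" "K_valued Y" and k: "k : feature_closure X" for k
    proof -
      obtain h where "ALL n. h n : features X" "ALL x:points X. (%n. h n x) \<longlonglongrightarrow> k x"
        by (rule closure_limit_frame[OF geo(1) k])
      hence h: "!!n. h n : features X" "!!x. x : points X ==> (%n. h n x) \<longlonglongrightarrow> k x" by auto
      have hk: "h n : feature_closure X" and gk: "G (h n) : feature_closure Y" for n using X.features_closure Y.features_closure h(1) G by auto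
      have "EX n. cost \<pi> k (G (h n)) <= ennreal (2 * e)"
      proof (rule cost_closure[OF geo \<pi>, where h = h and c = "e/2 + e"])
        show "cost \<pi> (h n) (G (h n)) <= ennreal (e/2 + e)" for n
          by (rule cost_near_on[OF geo \<pi> S]) (use G[OF h(1)] ee K_valued_closure[OF geo(1) K(1) hk] K_valued_closure[OF geo(2) K(2) gk] in auto)
      qed (use hk gk k h(2) X.lip_measurable Y.lip_measurable X.feature_closure_lip Y.feature_closure_lip
            K_valued_closure[OF geo(1) K(1) hk] K_valued_closure[OF geo(1) K(1) k] ee in auto)
      thus ?thesis using G[OF h(1)] by blast
    qed
    ultimately show ?thesis by blast
  qed
  interpret X: geom_data X by unfold_locales fact
  interpret Y: geom_data Y by unfold_locales fact
  obtain \<pi> S where \<pi>: "coupling_of (law X) (law Y) \<pi>" and S: "closedin (prod_data X Y) S" "measure \<pi> S >= 1 - e"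
    and n: "ALL f:features X. EX g:features Y. near_on S (e/2) f g" "ALL g:features Y. EX f:features X. near_on S (e/2) f g"
    by (rule box_dist_lessE[OF geo l])
  have e: "e > 0" using l by (auto simp: not_less ennreal_neg intro: ccontr)
  note Sm = closedin_sets_coupling[OF geo \<pi> S(1)]
  let ?sw = "%z. (snd z, fst z)"
  let ?\<rho> = "distr \<pi> (law Y \<Otimes>\<^sub>M law X) ?sw" and ?S = "?sw -` S Int space (law Y \<Otimes>\<^sub>M law X)"
  have "?sw : measurable (law Y \<Otimes>\<^sub>M law X) (law X \<Otimes>\<^sub>M law Y)" by measurable
  hence Sm': "?S : sets (law Y \<Otimes>\<^sub>M law X)" using Sm coupling_ofD(2)[OF \<pi>] by (auto intro: measurable_sets)
  have sm: "?sw : measurable \<pi> (law Y \<Otimes>\<^sub>M law X)" using coupling_ofD(5,6)[OF \<pi>] by measurable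
  have "?sw -` ?S Int space \<pi> = S" using sets.sets_into_space[OF Sm] coupling_ofD(7)[OF \<pi>] by (auto simp: space_pair_measure)
  hence mS: "measure ?\<rho> ?S = measure \<pi> S" using measure_distr[OF sm Sm'] by simp
  have n': "ALL g:features Y. EX f:features X. near_on ?S (e/2) g f"
    using n(2) unfolding near_on_def by (fastforce simp: abs_minus_commute)
  have 1: "ALL k:K_tau Y. EX g:K_tau X. cost ?\<rho> k g <= ennreal (2 * e)"
    using *[OF geo(2,1) coupling_of_swap[OF \<pi>] _ _ e n'] Sm' mS S(2) by simp
  have "EX k:K_tau X. cost \<pi> k g <= ennreal (2 * e)" if g: "g : K_tau Y" for g
  proof -
    obtain k where k: "k : K_tau X" "cost ?\<rho> g k <= ennreal (2 * e)" using 1 g by blast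
    moreover have "cost ?\<rho> g k = cost \<pi> k g" by (rule cost_swap[OF \<pi>]) (use k g X.K_tau_measurable Y.K_tau_measurable in auto)
    ultimately show ?thesis by auto
  qed
  thus thesis using that[OF \<pi>] *[OF geo \<pi> Sm S(2) e n(1)] by blast
qed

text \<open>S is the diagonal, described by equality of all features, which exhibits it as
  closed.\<close>

lemma box_dist_refl: assumes "geometric_dataset X" shows "box_dist X X = 0"
proof -
  interpret X: geom_data X by unfold_locales fact
  let ?d = "distr (law X) (law X \<Otimes>\<^sub>M law X) (%z. (z, z))"
  have c: "coupling_of (law X) (law X) ?d" by (rule coupling_of_distr[OF X.law.prob_space_axioms]) (auto simp: distr_id2)
  let ?S = "{z : topspace (prod_data X X). ALL f:features X. \<bar>f (fst z) - f (snd z)\<bar> <= 0}"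
  have eq: "?S = (\<Inter>f\<in>features X. {z : topspace (prod_data X X). \<bar>f (fst z) - f (snd z)\<bar> <= 0})"
    using X.features_ne by auto
  have cl: "closedin (prod_data X X) ?S"
    unfolding eq by (intro closedin_INT X.features_ne closedin_near assms X.feature_closure_lip X.features_closure)
  have m: "(%z. (z, z)) : measurable (law X) (law X \<Otimes>\<^sub>M law X)" by measurable
  have "(%z. (z, z)) -` ?S Int space (law X) = space (law X)" by (auto simp: X.data_topology_eq)
  hence "measure ?d ?S = 1" using closedin_sets_coupling[OF assms assms c cl] X.law.prob_space by (subst measure_distr[OF m]) auto
  moreover have nr: "near_on ?S (0/2) f f" if "f : features X" for f using that by (auto simp: near_on_def)
  ultimately have "box_dist X X <= ennreal 0" using nr by (intro box_dist_leI[OF assms assms c cl]) (auto intro!: bexI)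
  thus ?thesis by simp
qed

lemma ennreal_d_box: "A : DD ==> B : DD ==> ennreal (d_box A B) = box_dist (rep A) (rep B)"
  using box_dist_le_1[of "rep A" "rep B"] geometric_rep by (simp add: d_box_def) (metis ennreal_enn2real ennreal_one_less_top le_less_trans)

lemma d_box_le_1: "d_box A B <= 1" using box_dist_le_1[of "rep A" "rep B"] geometric_rep by (auto simp: d_box_def intro: enn2real_leI)

lemma d_box_nonneg [simp]: "0 <= d_box A B" by (simp add: d_box_def)

lemma d_box_commute: "d_box A B = d_box B A" using box_dist_commute[OF geometric_rep(1) geometric_rep(1), of A B] by (auto simp: d_box_def)

theorem Metric_space_d_box: "Metric_space DD d_box"
proof
  fix A B
  show "0 <= d_box A B" "d_box A B = d_box B A" by (auto intro: d_box_commute)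
  assume A: "A : DD" and B: "B : DD"
  note gA = geometric_rep(1)[OF A] and gB = geometric_rep(1)[OF B]
  show "d_box A B = 0 \<longleftrightarrow> A = B"
  proof
    assume "d_box A B = 0"
    hence z: "box_dist (rep A) (rep B) = 0" using ennreal_d_box[OF A B] by simp
    \<comment> \<open>Definiteness is inherited: box closeness implies closeness in mean, so box
      distance 0 forces \<open>d_tau\<close> to be 0.\<close>
    have "d_tau A B <= e" if e: "e > 0" for e :: real
    proof -
      have "box_dist (rep A) (rep B) < ennreal (e/2)" using z e by simp
      then obtain \<pi> where \<pi>: "coupling_of (law (rep A)) (law (rep B)) \<pi>"
        "ALL k:K_tau (rep A). EX g:K_tau (rep B). cost \<pi> k g <= ennreal (2 * (e/2))"
        "K_valued (rep A) & K_valued (rep B) --> (ALL k:feature_closure (rep A). EX g:features (rep B). cost \<pi> k g <= ennreal (2 * (e/2)))"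
        "ALL g:K_tau (rep B). EX k:K_tau (rep A). cost \<pi> k g <= ennreal (2 * (e/2))"
        by (rule box_to_cost[OF gA gB])
      hence "obs_dist (rep A) (rep B) <= ennreal e" by (intro obs_dist_leI[OF gA gB]) auto
      thus ?thesis using e unfolding ennreal_d_tau[OF A B, symmetric] by simp
    qed
    hence "d_tau A B <= 0" by (rule dense_ge)
    thus "A = B" using Metric_space.zero[OF Metric_space_d_tau A B] Metric_space.nonneg[OF Metric_space_d_tau, of A B] by simp
  qed (use box_dist_refl[OF gA] A in \<open>simp add: d_box_def\<close>)
  fix C assume C: "C : DD"
  have "ennreal (d_box A C) <= ennreal (d_box A B + d_box B C)"
    using box_dist_triangle[OF gA gB geometric_rep(1)[OF C]] by (simp add: ennreal_d_box A B C ennreal_plus)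
  thus "d_box A C <= d_box A B + d_box B C" by (subst (asm) ennreal_le_iff) auto
qed

section \<open>Classes with finitely many features\<close>

abbreviation rlaw :: "data_class => real measure" where "rlaw A \<equiv> law (rep A)"
abbreviation rclosure :: "data_class => (real => real) set" where "rclosure A \<equiv> feature_closure (rep A)"

lemma geom_data_rep: "A : DD ==> geom_data (rep A)" by (rule geom_data.intro[OF geometric_rep(1)])

lemma DM_K_DD: "A : DM_K N ==> A : DD" and DM_K_DD_K: "A : DM_K N ==> A : DD_K"
  using DM_K_subset DD_K_rep(1) by blast+

lemma rlaw_prob: "A : DD ==> prob_space (rlaw A)" using geometric_rep(1) by (auto simp: geometric_dataset_def)

lemma rclosure_measurable: "A : DD ==> f : rclosure A ==> f : borel_measurable (rlaw A)"
  using geom_data.lip_measurable geom_data.feature_closure_lip geom_data_rep by blast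

text \<open>T is composition with one map, so it acts on all tuples at once and keeps the joint law
  of several tuples.\<close>

lemma class_leD:
  assumes "A : DD" "C : DD" "class_le A C"
  obtains T where "ALL f:rclosure A. T f : rclosure C"
    "ALL F. (ALL i. F i : rclosure A) --> seq_law (rlaw A) F = seq_law (rlaw C) (%i. T (F i))"
proof -
  interpret A: geom_data "rep A" by (rule geom_data_rep[OF assms(1)])
  interpret C: geom_data "rep C" by (rule geom_data_rep[OF assms(2)])
  obtain p where p: "p : measurable (rlaw C) (rlaw A)" "distr (rlaw C) (rlaw A) p = rlaw A"
    "(%f. compose (points (rep C)) f p) ` rclosure A <= rclosure C"
    "(%f. compose (points (rep C)) f p) ` K_tau (rep A) <= K_tau (rep C)"
    "p : points (rep C) \<rightarrow> points (rep A)" by (rule feature_leE[OF A.geometric C.geometric assms(3)[unfolded class_le_def]])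
  have 1: "ALL f:rclosure A. compose (points (rep C)) f p : rclosure C" using p(3) by blast
  have 2: "seq_law (rlaw A) F = seq_law (rlaw C) (%i. compose (points (rep C)) (F i) p)" if "ALL i. F i : rclosure A" for F
  proof -
    have "F i : borel_measurable (rlaw A)" for i using A.closure_seq_measurable[of F i] that by auto
    from seq_law_compose[OF p(1,2) this, of "points (rep C)"] show ?thesis by simp
  qed
  show thesis by (rule that[of "%f. compose (points (rep C)) f p"]) (use 1 2 in auto)
qed

lemma class_leI:
  assumes "A : DD" "C : DD" "frame (rep A) F" "!!i. G i : rclosure C" "seq_law (rlaw A) F = seq_law (rlaw C) G"
  shows "class_le A C"
  unfolding class_le_def using feature_leI[OF geometric_rep(1)[OF assms(1)] geometric_rep(1)[OF assms(2)] assms(3,4,5)] .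

lemma rclosure_bound: "A : DD_K ==> f : rclosure A ==> x : points (rep A) ==> \<bar>f x\<bar> <= 1/2"
  using K_valued_closure[of "rep A"] DD_K_rep geometric_rep(1) by blast

lemma AE_seq_law:
  assumes "!!i. F i : borel_measurable M" "Measurable.pred borel P" "!!x. x : space M ==> P (%i. F i x)"
  shows "AE x in seq_law M F. P x"
proof -
  have "{x : space borel. P x} : sets borel" using assms(2) by (simp add: pred_def)
  thus ?thesis unfolding seq_law_def using assms(3) by (subst AE_distr_iff[OF seq_measurable[OF assms(1)]]) (auto intro: AE_I2)
qed

lemma pred_const_tail: "Measurable.pred borel (%x :: nat => real. ALL i>=N. x i = x (N - 1))"
proof -
  have "closed (\<Inter>i\<in>{N..}. {x :: nat => real. x i = x (N - 1)})"
    by (intro closed_INT ballI closed_Collect_eq continuous_on_product_coordinates)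
  also have "(\<Inter>i\<in>{N..}. {x :: nat => real. x i = x (N - 1)}) = {x. ALL i>=N. x i = x (N - 1)}" by auto
  finally show ?thesis by (rule Collect_closed_imp_pred_borel)
qed

lemma AE_seq_law_bound:
  assumes "C : DD_K" "!!i. G i : rclosure C"
  shows "AE x in seq_law (rlaw C) G. ALL i. \<bar>x i\<bar> <= 1/2"
proof (rule AE_seq_law)
  interpret C: geom_data "rep C" by (rule geom_data_rep[OF DD_K_rep(1)[OF assms(1)]])
  show "G i : borel_measurable (rlaw C)" for i by (rule rclosure_measurable[OF DD_K_rep(1)[OF assms(1)] assms(2)])
  show "ALL i. \<bar>G i x\<bar> <= 1/2" if "x : space (rlaw C)" for x using rclosure_bound[OF assms] that by simp
qed measurable

text \<open>The quotient of C generated by N functions in its closure, obtained abstractly from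
  their joint law.\<close>

lemma ex_quotient:
  assumes C: "C : DD_K" and N: "N >= 1" and G: "!!i. G i : rclosure C" and tail: "ALL i>=N. G i = G (N - 1)"
  obtains A F where "A : DM_K N" "class_le A C" "enum N A F" "seq_law (rlaw A) F = seq_law (rlaw C) G"
proof -
  note CD = DD_K_rep(1)[OF C]
  note Gm = rclosure_measurable[OF CD G]
  have 1: "prob_space (seq_law (rlaw C) G)" by (rule prob_seq_law[OF rlaw_prob[OF CD] Gm])
  have 2: "AE x in seq_law (rlaw C) G. ALL i>=N. x i = x (N - 1)"
  proof (rule AE_seq_law[where P = "%x. ALL i>=N. x i = x (N - 1)", OF Gm])
    show "ALL i>=N. G i x = G (N - 1) x" for x using tail by simp
  qed (rule pred_const_tail)
  obtain A F where AF: "A : DM_K N" "enum N A F" "seq_law (rlaw A) F = seq_law (rlaw C) G"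
    by (rule ex_DM_K_with_law[OF 1 _ N AE_seq_law_bound[OF C G] 2]) simp
  have "class_le A C" by (rule class_leI[OF DM_K_DD[OF AF(1)] CD enum_frame(1)[OF DM_K_DD[OF AF(1)] AF(2) N] G AF(3)])
  with AF show thesis using that by blast
qed

lemma cost_Markov:
  assumes \<pi>: "coupling_of M M' \<pi>" and [measurable]: "f : borel_measurable M" "g : borel_measurable M'"
    and c: "cost \<pi> f g <= ennreal (t * t)" and t: "t > 0"
  shows "measure \<pi> {z : space \<pi>. t < \<bar>f (fst z) - g (snd z)\<bar>} <= t" (is "measure \<pi> ?B <= t")
proof -
  interpret prob_space \<pi> using coupling_ofD(1)[OF \<pi>] .
  note [measurable] = coupling_ofD(5,6)[OF \<pi>]
  have B: "?B : sets \<pi>" by measurable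
  have "ennreal t * emeasure \<pi> ?B = (\<integral>\<^sup>+z. ennreal t * indicator ?B z \<partial>\<pi>)"
    using B by (simp add: nn_integral_cmult_indicator)
  also have "\<dots> <= cost \<pi> f g" unfolding cost_def by (intro nn_integral_mono) (auto simp: indicator_def intro!: ennreal_leI)
  also note c
  finally have "ennreal (t * measure \<pi> ?B) <= ennreal (t * t)" using t by (simp add: emeasure_eq_measure ennreal_mult)
  thus ?thesis using t by (simp add: ennreal_le_iff)
qed

text \<open>Each of the N features deviates by more than t on mass at most t, so S misses mass at
  most N * t, while the uniform error t counts twice in the box distance; (N + 2) * t dominates
  both.\<close>

lemma d_box_le_enum:
  assumes A: "A : DM_K N" "enum N A F" and B: "B : DM_K N" "enum N B G" and N: "N >= 1"
    and c: "coupled N (t * t) (rlaw A) F (rlaw B) G" and t: "t > 0"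
  shows "d_box A B <= (real N + 2) * t"
proof -
  note AD = DM_K_DD[OF A(1)] and BD = DM_K_DD[OF B(1)]
  interpret A: geom_data "rep A" by (rule geom_data_rep[OF AD])
  interpret B: geom_data "rep B" by (rule geom_data_rep[OF BD])
  note F = enum_frame(2)[OF AD A(2) N] and G = enum_frame(2)[OF BD B(2) N]
  have lF: "A.lip (F i)" and lG: "B.lip (G i)" for i
    using F G A.feature_closure_lip A.features_closure B.feature_closure_lip B.features_closure by auto
  obtain \<pi> where \<pi>: "coupling_of (rlaw A) (rlaw B) \<pi>" and co: "!!i. i < N ==> cost \<pi> (F i) (G i) <= ennreal (t * t)"
    using c unfolding coupled_def cost_def by blast
  interpret prob_space \<pi> using coupling_ofD(1)[OF \<pi>] .
  let ?T = "prod_data (rep A) (rep B)"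
  define S where "S = (\<Inter>i\<in>{..<N}. {z : topspace ?T. \<bar>F i (fst z) - G i (snd z)\<bar> <= t})"
  have cS: "closedin ?T S" unfolding S_def
    by (intro closedin_INT closedin_near A.geometric B.geometric lF lG) (use N in \<open>auto simp: lessThan_empty_iff\<close>)
  note Sm = closedin_sets_coupling[OF A.geometric B.geometric \<pi> cS]
  let ?B = "%i. {z : space \<pi>. t < \<bar>F i (fst z) - G i (snd z)\<bar>}"
  have [measurable]: "F i : borel_measurable (rlaw A)" "G i : borel_measurable (rlaw B)" for i
    using lF lG A.lip_measurable B.lip_measurable by auto
  note [measurable] = coupling_ofD(5,6)[OF \<pi>]
  have "space \<pi> - S <= (\<Union>i<N. ?B i)"
    using coupling_ofD(7)[OF \<pi>] by (auto simp: S_def A.data_topology_eq B.data_topology_eq not_le)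
  hence "measure \<pi> (space \<pi> - S) <= measure \<pi> (\<Union>i<N. ?B i)" by (intro finite_measure_mono) auto
  also have "\<dots> <= (\<Sum>i<N. measure \<pi> (?B i))" by (intro measure_UNION_le) auto
  also have "\<dots> <= real (card {..<N}) * t"
    by (intro sum_bounded_above cost_Markov[OF \<pi>] co t) (auto intro: A.lip_measurable B.lip_measurable lF lG)
  finally have mS: "measure \<pi> S >= 1 - real N * t" using prob_compl[OF Sm] by simp
  let ?e = "(real N + 2) * t"
  have te: "t <= ?e / 2" using t by (simp add: field_simps)
  have nr: "near_on S (?e / 2) (F i) (G i)" if "i < N" for i unfolding near_on_def
  proof
    fix z assume "z : S"
    hence "\<bar>F i (fst z) - G i (snd z)\<bar> <= t" using that by (auto simp: S_def)
    thus "\<bar>F i (fst z) - G i (snd z)\<bar> <= ?e / 2" using te by linarith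
  qed
  have "box_dist (rep A) (rep B) <= ennreal ?e"
  proof (rule box_dist_leI[OF A.geometric B.geometric \<pi> cS])
    show "1 - ?e <= measure \<pi> S" using mS t by (simp add: field_simps)
    fix f assume "f : features (rep A)"
    then obtain i where "i < N" "f = F i" using A(2) unfolding enum_def by blast
    thus "EX g:features (rep B). near_on S (?e / 2) f g" using nr G by blast
  next
    fix g assume "g : features (rep B)"
    then obtain i where "i < N" "g = G i" using B(2) unfolding enum_def by blast
    thus "EX f:features (rep A). near_on S (?e / 2) f g" using nr F by blast
  qed (use t in simp)
  thus ?thesis using t unfolding ennreal_d_box[OF AD BD, symmetric] by simp
qed

text \<open>One coupling serves all features, so matching each function with a partner couples
  tuples of every length with the same error 2 * e.\<close>

lemma coupled_of_d_box:
  assumes A: "A : DD_K" and B: "B : DD_K" and d: "d_box A B < e"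
  obtains T where "ALL f:rclosure A. T f : features (rep B)"
    "ALL F N. (ALL i. F i : rclosure A) --> coupled N (2 * e) (rlaw A) F (rlaw B) (%i. T (F i))"
proof -
  note AD = DD_K_rep(1)[OF A] and BD = DD_K_rep(1)[OF B]
  have "ennreal (d_box A B) < ennreal e" using d by (simp add: ennreal_less_iff)
  hence "box_dist (rep A) (rep B) < ennreal e" by (simp add: ennreal_d_box[OF AD BD])
  then obtain \<pi> where \<pi>: "coupling_of (rlaw A) (rlaw B) \<pi>"
    "ALL k:K_tau (rep A). EX g:K_tau (rep B). cost \<pi> k g <= ennreal (2 * e)"
    "K_valued (rep A) & K_valued (rep B) --> (ALL k:rclosure A. EX g:features (rep B). cost \<pi> k g <= ennreal (2 * e))"
    "ALL g:K_tau (rep B). EX k:K_tau (rep A). cost \<pi> k g <= ennreal (2 * e)"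
    by (rule box_to_cost[OF geometric_rep(1)[OF AD] geometric_rep(1)[OF BD]])
  hence "ALL k:rclosure A. EX g. g : features (rep B) & cost \<pi> k g <= ennreal (2 * e)"
    using DD_K_rep(2)[OF A] DD_K_rep(2)[OF B] by blast
  then obtain T where T: "ALL k:rclosure A. T k : features (rep B) & cost \<pi> k (T k) <= ennreal (2 * e)"
    by (rule bchoice[THEN exE])
  show thesis by (rule that[of T]) (use T \<pi>(1) in \<open>auto simp: coupled_def cost_def\<close>)
qed

text \<open>Produces members of a pyramid near a given A: an enumeration of A is coupled with a
  tuple in the closure of C, and B is the quotient generated by the first N entries of that
  tuple.\<close>

lemma approx_below:
  assumes A: "A : DM_K N" "enum N A F" and C: "C : DD_K" and N: "N >= 1" and G: "!!i. G i : rclosure C"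
    and c: "coupled N e (rlaw A) F (rlaw C) G" and t: "t > 0" "0 <= e" "e < t * t"
  obtains B where "B : DM_K N" "class_le B C" "d_box A B <= (real N + 2) * t"
proof -
  let ?G = "%i. G (min i (N - 1))"
  note CD = DD_K_rep(1)[OF C] and AD = DM_K_DD[OF A(1)]
  have tl: "ALL i>=N. ?G i = ?G (N - 1)" by (auto simp: min_def intro!: arg_cong[of _ _ G])
  obtain B H where B: "B : DM_K N" "class_le B C" "enum N B H" "seq_law (rlaw B) H = seq_law (rlaw C) ?G"
    by (rule ex_quotient[OF C N _ tl]) (use G in auto)
  note BD = DM_K_DD[OF B(1)]
  have "min i (N - 1) = i" if "i < N" for i using that by simp
  hence c': "coupled N e (rlaw A) F (rlaw C) ?G" using c unfolding coupled_def by simp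
  have Hm: "H i : borel_measurable (rlaw B)" and Fm: "F i : borel_measurable (rlaw A)" for i
    using geom_data.frame_measurable[OF geom_data_rep[OF BD] enum_frame(1)[OF BD B(3) N]]
      geom_data.frame_measurable[OF geom_data_rep[OF AD] enum_frame(1)[OF AD A(2) N]] by auto
  have "coupled N (e + (t * t - e)) (rlaw A) F (rlaw B) H" by (rule coupled_law_right[OF c' B(4)[symmetric]])
      (use t Hm Fm rlaw_prob[OF BD] rclosure_measurable[OF CD G] in auto)
  hence "d_box A B <= (real N + 2) * t" by (intro d_box_le_enum[OF A B(1,3) N _ t(1)]) simp
  with B show thesis using that by blast
qed

text \<open>The enumeration of A moves to C by equality of laws and on to C' by taking partners,
  where \<open>approx_below\<close> applies. Thus quotients follow box limits.\<close>

lemma d_box_down: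
  assumes A: "A : DM_K N" and N: "N >= 1" and C: "C : DD_K" "C' : DD_K" and le: "class_le A C"
    and d: "d_box C C' < e" and t: "t > 0" "2 * e < t * t"
  obtains B where "B : DM_K N" "class_le B C'" "d_box A B <= (real N + 2) * t"
proof -
  note CD = DD_K_rep(1)[OF C(1)] and CD' = DD_K_rep(1)[OF C(2)] and AD = DM_K_DD[OF A]
  obtain F where F: "enum N A F" by (rule ex_enum[OF A N])
  have e: "e > 0" using d d_box_nonneg[of C C'] by linarith
  have Fc: "F i : rclosure A" for i by (rule geom_data.frame_closure[OF geom_data_rep[OF AD] enum_frame(1)[OF AD F N]])
  obtain T where T: "ALL f:rclosure A. T f : rclosure C"
    "ALL F. (ALL i. F i : rclosure A) --> seq_law (rlaw A) F = seq_law (rlaw C) (%i. T (F i))"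
    by (rule class_leD[OF AD CD le])
  obtain T' where T': "ALL f:rclosure C. T' f : features (rep C')"
    "ALL F N. (ALL i. F i : rclosure C) --> coupled N (2 * e) (rlaw C) F (rlaw C') (%i. T' (F i))"
    by (rule coupled_of_d_box[OF C d])
  let ?G = "%i. T (F i)" and ?G' = "%i. T' (T (F i))"
  have G: "?G i : rclosure C" for i using T(1) Fc by blast
  have G': "?G' i : rclosure C'" for i using T'(1) G geom_data.features_closure[OF geom_data_rep[OF CD']] by blast
  let ?s = "(t * t - 2 * e) / 2"
  have "coupled N (2 * e + ?s) (rlaw A) F (rlaw C') ?G'" by (rule coupled_law_left[where G = ?G])
      (use T(2) T'(2) Fc G t e rlaw_prob[OF AD] rclosure_measurable[OF CD G] rclosure_measurable[OF CD' G'] rclosure_measurable[OF AD Fc] in auto)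
  thus thesis by (rule approx_below[OF A F C(2) N G']) (use t e that in \<open>auto simp: field_simps\<close>)
qed

text \<open>The laws of enumerations live on the cube, where \<open>cube_laws_compact\<close>
  applies. The limit law is again bounded with constant tail almost surely, so it belongs to a class
  of the same level.\<close>

lemma DM_K_seq_compact:
  assumes A: "!!n. A n : DM_K N" and N: "N >= 1"
  obtains r B where "strict_mono (r :: nat => nat)" "B : DM_K N" "(%n. d_box (A (r n)) B) \<longlonglongrightarrow> 0"
proof -
  note AD = DM_K_DD[OF A]
  have "ALL n. EX F. enum N (A n) F" using ex_enum[OF A N] by blast
  then obtain F where F: "!!n. enum N (A n) (F n)" by metis
  have Fc: "F n i : rclosure (A n)" for n i by (rule geom_data.frame_closure[OF geom_data_rep[OF AD] enum_frame(1)[OF AD F N]])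
  note Fm = rclosure_measurable[OF AD Fc]
  define m where "m n = seq_law (rlaw (A n)) (F n)" for n
  have pm: "prob_space (m n)" for n unfolding m_def by (rule prob_seq_law[OF rlaw_prob[OF AD] Fm])
  have sm [simp]: "sets (m n) = sets borel" for n by (simp add: m_def)
  have Km: "AE x in m n. ALL i. \<bar>x i\<bar> <= 1/2" for n unfolding m_def by (rule AE_seq_law_bound[OF DM_K_DD_K[OF A] Fc])
  have tm: "AE x in m n. ALL i>=N. x i = x (N - 1)" for n unfolding m_def
  proof (rule AE_seq_law[where P = "%x. ALL i>=N. x i = x (N - 1)", OF Fm])
    show "ALL i>=N. F n i x = F n (N - 1) x" for x using F[of n] by (simp add: enum_def)
  qed (rule pred_const_tail)
  obtain r L where r: "strict_mono r" and L: "prob_space L" "sets L = sets borel" "AE x in L. ALL i. \<bar>x i\<bar> <= 1/2"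
    and cp': "ALL N. ALL e>0. \<forall>\<^sub>F n in sequentially. coupled N e (m (r n)) (%i x. x i) L (%i x. x i)"
    by (rule cube_laws_compact[OF pm sm Km])
  have cp: "\<forall>\<^sub>F n in sequentially. coupled N e (m (r n)) (%i x. x i) L (%i x. x i)" if "e > 0" for N e
    using cp' that by blast
  note [measurable_cong] = L(2)
  interpret L: prob_space L by fact
  have cm[measurable]: "(%x. x i) : borel_measurable L" "(%x. x i) : borel_measurable (m n)" for i n
    using coord_measurable[of i] unfolding measurable_cong_sets[OF L(2) refl] measurable_cong_sets[OF sm refl] by assumption+
  text \<open>Constancy of the tail passes to the limit because it holds in mean.\<close>
  let ?tl = "%i. if i < N then i else N - 1"
  have cm2: "(%x. x (?tl i)) : borel_measurable L" "(%x. x (?tl i)) : borel_measurable (m n)" for i n by (auto intro: cm)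
  have "seq_law L (%i x. x (?tl i)) = seq_law L (%i x. x i)"
  proof (rule seq_law_eqI[OF _ L(1) L(1)])
    fix N' and e :: real assume e: "e > 0"
    obtain n where n: "coupled (max N N') (e/3) (m (r n)) (%i x. x i) L (%i x. x i)"
      using cp[of "e/3" "max N N'"] e by (auto simp: eventually_sequentially)
    have n1: "coupled N' (e/3) (m (r n)) (%i x. x (?tl i)) L (%i x. x (?tl i))"
      using n N unfolding coupled_def by (elim exE conjE, intro exI conjI) (auto simp: )
    have n2: "coupled N' (e/3) (m (r n)) (%i x. x i) L (%i x. x i)" by (rule coupled_mono[OF n]) auto
    have "seq_law (m (r n)) (%i x. x (?tl i)) = seq_law (m (r n)) (%i x. x i)" unfolding seq_law_def using tm[of "r n"]
      by (intro distr_cong_AE refl; (intro seq_measurable cm cm2)?) (auto elim!: eventually_mono intro!: ext)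
    from coupled_trans[OF coupled_sym[OF n1 cm2(2) cm2(1)] n2 this, of "e/3"] e
    have "coupled N' (e/3 + e/3 + e/3) L (%i x. x (?tl i)) L (%i x. x i)" using cm cm2 by auto
    thus "coupled N' e L (%i x. x (?tl i)) L (%i x. x i)" by simp
  qed (use cm cm2 in auto)
  hence Leq: "seq_law L (%i x. x (?tl i)) = L" by (simp add: seq_law_coords L(2))
  have tL: "AE x in L. ALL i>=N. x i = x (N - 1)"
  proof (subst Leq[symmetric], rule AE_seq_law[where P = "%x. ALL i>=N. x i = x (N - 1)", OF cm2(1)])
    show "ALL i>=N. x (?tl i) = x (?tl (N - 1))" for x :: "nat => real" using N by simp
  qed (rule pred_const_tail)
  obtain B G where B: "B : DM_K N" "enum N B G" "seq_law (rlaw B) G = L" by (rule ex_DM_K_with_law[OF L(1,2) N L(3) tL])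
  note BD = DM_K_DD[OF B(1)]
  have Gm: "G i : borel_measurable (rlaw B)" for i
    by (rule geom_data.frame_measurable[OF geom_data_rep[OF BD] enum_frame(1)[OF BD B(2) N]])
  have "(%n. d_box (A (r n)) B) \<longlonglongrightarrow> 0" unfolding tendsto_iff dist_real_def
  proof (intro allI impI)
    fix e :: real assume e: "e > 0"
    define t where "t = e / (2 * (real N + 2))"
    have t: "t > 0" "(real N + 2) * t < e" using e by (auto simp: t_def field_simps intro!: add_nonneg_pos)
    \<comment> \<open>One third for the limit, and one for each of the two exchanges of a cube law
      for a class.\<close>
    have "\<forall>\<^sub>F n in sequentially. coupled N (t * t / 3) (m (r n)) (%i x. x i) L (%i x. x i)"
      using t by (intro cp) simp
    thus "\<forall>\<^sub>F n in sequentially. \<bar>d_box (A (r n)) B - 0\<bar> < e"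
    proof eventually_elim
      case (elim n)
      have 1: "coupled N (t * t / 3 + t * t / 3) (rlaw (A (r n))) (F (r n)) L (%i x. x i)" by (rule coupled_law_left[OF elim])
          (use t Fm cm rlaw_prob[OF AD] in \<open>auto simp: seq_law_coords simp flip: m_def\<close>)
      have "coupled N (t * t / 3 + t * t / 3 + t * t / 3) (rlaw (A (r n))) (F (r n)) (rlaw B) G"
        by (rule coupled_law_right[OF 1]) (use t Fm cm Gm rlaw_prob[OF BD] B(3) in \<open>auto simp: seq_law_coords L(2)\<close>)
      hence "d_box (A (r n)) B <= (real N + 2) * t" by (intro d_box_le_enum[OF A F B(1,2) N _ t(1)]) simp
      thus ?case using t(2) by simp
    qed
  qed
  with r B(1) show thesis using that by blast
qed

text \<open>Finitely many balls of radius r carry mass more than 1 - e. Up to rounding there are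
  finitely many patterns of values at their centres, and one feature per pattern approximates all
  features on these balls.\<close>

lemma ex_finite_approx:
  assumes C: "C : DD_K" and e: "e > 0"
  obtains N A where "N >= 1" "A : DM_K N" "class_le A C" "d_box A C <= e"
proof -
  note CD = DD_K_rep(1)[OF C]
  interpret X: geom_data "rep C" by (rule geom_data_rep[OF CD])
  \<comment> \<open>Rounding contributes r, and moving from x to a centre contributes r for each of
    the two features: 3 * r = e / 2, the half that the box distance doubles.\<close>
  define r where "r = e / 6"
  have r: "r > 0" using e by (simp add: r_def)
  obtain D where "X.dense_points D" by (rule X.dense_seq)
  note D = X.dense_pointsD[OF this]
  define S where "S n = (\<Union>j\<le>n. X.mcball (D j) r)" for n
  have Sm: "S n : sets (rlaw C)" for n unfolding S_def by auto
  have "(%n. measure (rlaw C) (S n)) \<longlonglongrightarrow> measure (rlaw C) (\<Union>n. S n)"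
  proof (rule X.law.finite_Lim_measure_incseq)
    show "range S <= sets (rlaw C)" using Sm by blast
    show "incseq S" unfolding incseq_def S_def by (intro allI impI UN_mono) auto
  qed
  moreover have "(\<Union>n. S n) = space (rlaw C)"
  proof (intro equalityI subsetI)
    fix x assume "x : space (rlaw C)"
    hence x: "x : points (rep C)" by simp
    then obtain j where "data_dist (rep C) x (D j) < r" using D(2)[OF x r] by blast
    hence "x : X.mcball (D j) r" using x D(1) X.commute[of x "D j"] by simp
    thus "x : (\<Union>n. S n)" unfolding S_def by blast
  next
    fix x assume "x : (\<Union>n. S n)"
    thus "x : space (rlaw C)" by (auto simp: S_def)
  qed
  ultimately have "(%n. measure (rlaw C) (S n)) \<longlonglongrightarrow> 1" using X.law.prob_space by simp
  hence "\<forall>\<^sub>F n in sequentially. measure (rlaw C) (S n) > 1 - e" using e by (intro order_tendstoD) auto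
  then obtain n where n: "measure (rlaw C) (S n) > 1 - e" by (auto simp: eventually_sequentially)
  define b where "b f = map (%j. \<lfloor>f (D j) / r\<rfloor>) [0..<Suc n]" for f :: "real => real"
  define M where "M = \<lceil>1 / (2 * r)\<rceil> + 1"
  have bF: "b ` features (rep C) <= {xs. set xs <= {-M..M} & length xs = Suc n}"
  proof clarify
    fix f assume f: "f : features (rep C)"
    have "\<lfloor>f (D j) / r\<rfloor> : {-M..M}" for j
    proof -
      have "\<bar>f (D j)\<bar> <= 1/2" by (rule rclosure_bound[OF C X.features_closure[OF f] D(1)])
      hence "\<bar>f (D j) / r\<bar> <= 1 / (2 * r)" using r by (simp add: field_simps)
      hence "- M <= \<lfloor>f (D j) / r\<rfloor>" "\<lfloor>f (D j) / r\<rfloor> <= M" unfolding M_def by linarith+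
      thus ?thesis by simp
    qed
    thus "set (b f) <= {-M..M} & length (b f) = Suc n" unfolding b_def by auto
  qed
  have finb: "finite (b ` features (rep C))" by (rule finite_subset[OF bF finite_lists_length_eq]) simp
  define pick where "pick v = (SOME f. f : features (rep C) & b f = v)" for v
  have pick: "pick (b f) : features (rep C) & b (pick (b f)) = b f" if "f : features (rep C)" for f
    unfolding pick_def by (rule someI[of _ f]) (use that in simp)
  define G where "G = pick ` b ` features (rep C)"
  have G: "finite G" "G ~= {}" "G <= features (rep C)" using finb X.features_ne pick unfolding G_def by auto
  have close: "\<bar>f x - pick (b f) x\<bar> <= e / 2" if f: "f : features (rep C)" and x: "x : S n" for f x
  proof -
    obtain j where j: "j <= n" "x : X.mcball (D j) r" using x unfolding S_def by blast
    have "b (pick (b f)) ! j = b f ! j" using pick[OF f] by simp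
    hence "\<lfloor>pick (b f) (D j) / r\<rfloor> = \<lfloor>f (D j) / r\<rfloor>" unfolding b_def using j by (simp del: upt_Suc)
    hence "\<bar>f (D j) / r - pick (b f) (D j) / r\<bar> <= 1" by linarith
    hence 1: "\<bar>f (D j) - pick (b f) (D j)\<bar> <= r" using r by (simp add: field_simps abs_le_iff flip: diff_divide_distrib)
    have xp: "x : points (rep C)" "data_dist (rep C) (D j) x <= r" using j by auto
    have 2: "\<bar>f (D j) - f x\<bar> <= r" "\<bar>pick (b f) (D j) - pick (b f) x\<bar> <= r"
      using X.feature_dist_le[OF f D(1)[of j] xp(1)] X.feature_dist_le[OF conjunct1[OF pick[OF f]] D(1)[of j] xp(1)] xp(2) by auto
    have "e / 2 = r + r + r" by (simp add: r_def)
    thus ?thesis using 1 2 by linarith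
  qed
  obtain g where g: "bij_betw g {0..<card G} G" using ex_bij_betw_nat_finite[OF G(1)] by blast
  define N where "N = card G"
  have N: "N >= 1" using G by (simp add: N_def Suc_le_eq card_gt_0_iff)
  define F where "F i = g (min i (N - 1))" for i
  have FG: "F i : G" for i unfolding F_def using g N by (auto simp: bij_betw_def N_def)
  have Fi: "EX i<N. h = F i" if h: "h : G" for h
  proof -
    have "h : g ` {0..<card G}" using g h by (simp add: bij_betw_def)
    then obtain i where "i < N" "h = g i" unfolding N_def by auto
    thus ?thesis by (intro exI[of _ i]) (simp add: F_def)
  qed
  have Fc: "F i : rclosure C" for i using FG G(3) X.features_closure by blast
  have tl: "ALL i>=N. F i = F (N - 1)" by (auto simp: F_def min_def intro!: arg_cong[of _ _ g])
  obtain A H where A: "A : DM_K N" "class_le A C" "enum N A H" "seq_law (rlaw A) H = seq_law (rlaw C) F"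
    by (rule ex_quotient[OF C N Fc tl])
  note AD = DM_K_DD[OF A(1)]
  interpret Y: geom_data "rep A" by (rule geom_data_rep[OF AD])
  obtain p where p: "p : measurable (rlaw C) (rlaw A)" "distr (rlaw C) (rlaw A) p = rlaw A"
    "ALL z:points (rep C). ALL i. H i (p z) = F i z"
    by (rule frame_map[OF Y.geometric X.geometric enum_frame(1)[OF AD A(3) N] Fc A(4)])
  let ?\<pi> = "distr (rlaw C) (rlaw C \<Otimes>\<^sub>M rlaw A) (%x. (x, p x))"
  have c: "coupling_of (rlaw C) (rlaw A) ?\<pi>"
    by (rule coupling_of_distr[OF X.law.prob_space_axioms _ p(1) _ p(2)]) (auto simp: distr_id2)
  let ?T = "prod_data (rep C) (rep A)"
  have clS: "closedin X.mtopology (S n)" unfolding S_def by (intro closedin_Union) auto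
  \<comment> \<open>Over S n, the graph of the quotient map p, described by closed conditions: the N
    chosen features agree.\<close>
  define W where "W = {z : topspace ?T. fst z : S n} Int (\<Inter>i\<in>{..<N}. {z : topspace ?T. \<bar>F i (fst z) - H i (snd z)\<bar> <= 0})"
  have "continuous_map ?T X.mtopology fst" using continuous_map_fst by (simp add: X.data_topology_eq)
  hence c1: "closedin ?T {z : topspace ?T. fst z : S n}" by (rule closedin_continuous_map_preimage[OF _ clS])
  have Hf: "H i : features (rep A)" for i by (rule enum_frame(2)[OF AD A(3) N])
  have cW: "closedin ?T W" unfolding W_def
    by (intro closedin_Int c1 closedin_INT closedin_near X.geometric Y.geometric X.feature_closure_lip Y.feature_closure_lip Fc Y.features_closure Hf) (use N in \<open>auto simp: lessThan_empty_iff\<close>)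
  have m: "(%x. (x, p x)) : measurable (rlaw C) (rlaw C \<Otimes>\<^sub>M rlaw A)" using p(1) by measurable
  have "(%x. (x, p x)) -` W Int space (rlaw C) = S n" using p(3) measurable_space[OF p(1)] sets.sets_into_space[OF Sm[of n]]
    by (auto simp: W_def X.data_topology_eq Y.data_topology_eq)
  hence mW: "measure ?\<pi> W = measure (rlaw C) (S n)"
    using closedin_sets_coupling[OF X.geometric Y.geometric c cW] by (subst measure_distr[OF m]) auto
  have "box_dist (rep C) (rep A) <= ennreal e"
  proof (rule box_dist_leI[OF X.geometric Y.geometric c cW])
    fix f assume f: "f : features (rep C)"
    have "pick (b f) : G" using f by (auto simp: G_def)
    then obtain i where i: "i < N" "pick (b f) = F i" using Fi by blast
    have "near_on W (e/2) f (H i)" unfolding near_on_def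
    proof
      fix z assume z: "z : W"
      hence "fst z : S n" "F i (fst z) = H i (snd z)" using i(1) by (auto simp: W_def)
      thus "\<bar>f (fst z) - H i (snd z)\<bar> <= e/2" using close[OF f, of "fst z"] by (simp add: i)
    qed
    thus "EX g:features (rep A). near_on W (e/2) f g" using Hf by blast
  next
    fix h assume "h : features (rep A)"
    then obtain i where i: "i < N" "h = H i" using A(3) unfolding enum_def by blast
    have "near_on W (e/2) (F i) h" unfolding near_on_def i(2) using i(1) e by (auto simp: W_def)
    thus "EX f:features (rep C). near_on W (e/2) f h" using FG G(3) by blast
  qed (use mW n e in auto)
  hence "d_box C A <= e" using e unfolding ennreal_d_box[OF CD AD, symmetric] by simp
  thus thesis using that[OF N A(1,2)] by (simp add: d_box_commute)
qed

section \<open>The metric space of pyramids\<close>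

interpretation box: Metric_space DD d_box by (rule Metric_space_d_box)

lemma pyramid_subset: "P : Pi_K ==> P <= DD_K"
  and pyramid_down: "P : Pi_K ==> A : P ==> B : DD_K ==> class_le B A ==> B : P"
  and pyramid_directed: "P : Pi_K ==> A : P ==> B : P ==> EX C:P. class_le A C & class_le B C"
  and pyramid_ne: "P : Pi_K ==> P ~= {}" by (auto simp: Pi_K_def K_pyramid_def)

lemma pyramid_closed:
  assumes P: "P : Pi_K" and C: "C : DD" and a: "!!e. e > 0 ==> EX A:P. d_box C A <= e"
  shows "C : P"
proof -
  have "ALL n. EX A:P. d_box C A <= 1 / real (Suc n)" by (intro allI a) simp
  then obtain \<sigma> where \<sigma>: "!!n. \<sigma> n : P" "!!n. d_box C (\<sigma> n) <= 1 / real (Suc n)" by metis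
  have "(%n. d_box (\<sigma> n) C) \<longlonglongrightarrow> 0"
  proof (rule tendsto_sandwich[OF always_eventually always_eventually tendsto_const])
    show "ALL n. d_box (\<sigma> n) C <= 1 / real (Suc n)" using \<sigma>(2) by (simp add: d_box_commute)
    show "(%n. 1 / real (Suc n)) \<longlonglongrightarrow> 0" using LIMSEQ_inverse_real_of_nat by (simp add: inverse_eq_divide)
  qed auto
  hence "limitin box.mtopology \<sigma> C sequentially"
    unfolding box.limitin_metric_dist_null using C \<sigma>(1) pyramid_subset[OF P] DD_K_rep(1) by (auto intro!: always_eventually)
  moreover have "closedin box.mtopology P" using P by (simp add: Pi_K_def K_pyramid_def)
  ultimately show ?thesis using \<sigma>(1) unfolding box.metric_closedin_iff_sequentially_closed by blast
qed

lemma DM_K_below_ne: assumes "C : DD_K" obtains A where "A : DM_K 1" "class_le A C"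
proof -
  interpret X: geom_data "rep C" by (rule geom_data_rep[OF DD_K_rep(1)[OF assms]])
  obtain f where f: "f : rclosure C" using X.feature_closure_ne by blast
  obtain A F where "A : DM_K 1" "class_le A C" "enum 1 A F" "seq_law (rlaw A) F = seq_law (rlaw C) (%_. f)"
    by (rule ex_quotient[OF assms, of 1 "%_. f"]) (use f in auto)
  thus thesis using that by blast
qed

lemma pyramid_DM_ne: assumes "P : Pi_K" "N >= 1" shows "P Int DM_K N ~= {}"
proof -
  obtain C where C: "C : P" using pyramid_ne[OF assms(1)] by blast
  then obtain A where "A : DM_K 1" "class_le A C" using DM_K_below_ne pyramid_subset[OF assms(1)] by blast
  thus ?thesis using pyramid_down[OF assms(1) C] DM_K_DD_K DM_K_mono[OF assms(2)] by blast
qed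

text \<open>Finite quotients of C lie arbitrarily near C, and pyramids are closed; hence a pyramid
  is determined by its levels.\<close>

lemma pyramid_eq:
  assumes P: "P : Pi_K" and C: "C : DD_K" and b: "!!N A. N >= 1 ==> A : DM_K N ==> class_le A C ==> A : P"
  shows "C : P"
proof (rule pyramid_closed[OF P DD_K_rep(1)[OF C]])
  fix e :: real assume "e > 0"
  then obtain N A where "N >= 1" "A : DM_K N" "class_le A C" "d_box A C <= e" by (rule ex_finite_approx[OF C])
  thus "EX A:P. d_box C A <= e" using b by (auto simp: d_box_commute)
qed

abbreviation box_H :: "nat => data_class set => data_class set => ennreal" where
  "box_H N P Q \<equiv> hausdorff (%A B. ennreal (d_box A B)) (P Int DM_K N) (Q Int DM_K N)"

lemma box_H_leI:
  assumes "!!A. A : P Int DM_K N ==> EX B:Q Int DM_K N. d_box A B <= e" "!!B. B : Q Int DM_K N ==> EX A:P Int DM_K N. d_box A B <= e"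
  shows "box_H N P Q <= ennreal e" by (rule hausdorff_leI) (use assms ennreal_leI in blast)+

lemma box_H_lessD:
  assumes "box_H N P Q < ennreal e"
  shows "A : P ==> A : DM_K N ==> EX B:Q Int DM_K N. d_box A B < e"
    "B : Q ==> B : DM_K N ==> EX A:P Int DM_K N. d_box A B < e"
  using hausdorff_lessD(1)[OF assms, of A] hausdorff_lessD(2)[OF assms, of B] by (auto simp: ennreal_less_iff)

lemma box_H_le_1: "P : Pi_K ==> Q : Pi_K ==> N >= 1 ==> box_H N P Q <= ennreal 1"
  using pyramid_DM_ne by (intro box_H_leI) (use d_box_le_1 in blast)+

lemma box_H_commute: "box_H N P Q = box_H N Q P" unfolding hausdorff_def by (simp add: d_box_commute max.commute)

lemma box_H_triangle:
  assumes "P : Pi_K" "Q : Pi_K" "R : Pi_K" "N >= 1"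
  shows "box_H N P R <= box_H N P Q + box_H N Q R"
proof (rule ennreal_le_epsilon)
  fix e :: real assume e: "e > 0"
  obtain a where a: "box_H N P Q = ennreal a" "a >= 0" using box_H_le_1[OF assms(1,2,4)] by (cases "box_H N P Q") (auto simp: top_unique)
  obtain b where b: "box_H N Q R = ennreal b" "b >= 0" using box_H_le_1[OF assms(2,3,4)] by (cases "box_H N Q R") (auto simp: top_unique)
  have lt: "box_H N P Q < ennreal (a + e/2)" "box_H N Q R < ennreal (b + e/2)" using a b e by (auto simp: ennreal_less_iff)
  have tri: "d_box A C <= a + b + e"
    if "A : DM_K N" "B : DM_K N" "C : DM_K N" "d_box A B < a + e/2" "d_box B C < b + e/2" for A B C
    using box.triangle[of A B C] that DM_K_DD by fastforce
  have "box_H N P R <= ennreal (a + b + e)"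
  proof (rule box_H_leI)
    fix A assume A: "A : P Int DM_K N"
    then obtain B where B: "B : Q Int DM_K N" "d_box A B < a + e/2" using box_H_lessD(1)[OF lt(1)] by blast
    then obtain C where C: "C : R Int DM_K N" "d_box B C < b + e/2" using box_H_lessD(1)[OF lt(2)] by blast
    thus "EX C:R Int DM_K N. d_box A C <= a + b + e" using tri[of A B C] A B by blast
  next
    fix C assume C: "C : R Int DM_K N"
    then obtain B where B: "B : Q Int DM_K N" "d_box B C < b + e/2" using box_H_lessD(2)[OF lt(2)] by blast
    then obtain A where A: "A : P Int DM_K N" "d_box A B < a + e/2" using box_H_lessD(2)[OF lt(1)] by blast
    thus "EX A:P Int DM_K N. d_box A C <= a + b + e" using tri[of A B C] C B by blast
  qed
  thus "box_H N P R <= box_H N P Q + box_H N Q R + ennreal e" using a b e by (simp add: ennreal_plus)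
qed

definition pyr_coeff :: "nat => real" where "pyr_coeff n = 1 / (2 * real (Suc n) * 2 ^ Suc n)"

definition pyr_sum :: "data_class set => data_class set => ennreal" where
  "pyr_sum P Q = (\<Sum>n. ennreal (pyr_coeff n) * box_H (Suc n) P Q)"

lemma d_Pi_alt: "d_Pi P Q = enn2real (pyr_sum P Q)" unfolding d_Pi_def pyr_sum_def pyr_coeff_def ..

lemma pyr_coeff: "0 < pyr_coeff n" "pyr_coeff n <= (1/2) ^ Suc n"
proof -
  show "0 < pyr_coeff n" unfolding pyr_coeff_def by simp
  have "(1 :: real) * 2 ^ Suc n <= 2 * real (Suc n) * 2 ^ Suc n" by (rule mult_right_mono) auto
  hence "1 / (2 * real (Suc n) * 2 ^ Suc n) <= 1 / (1 * 2 ^ Suc n)" by (intro divide_left_mono) auto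
  thus "pyr_coeff n <= (1/2) ^ Suc n" unfolding pyr_coeff_def by (simp add: power_divide)
qed

text \<open>Each level distance is at most 1, so the levels beyond N0 contribute no more than the
  geometric tail; up to a given error only finitely many levels matter.\<close>

lemma pyr_sum_bound:
  assumes PQ: "P : Pi_K" "Q : Pi_K" and h: "!!N. 1 <= N ==> N <= N0 ==> box_H N P Q <= ennreal e" and e: "e >= 0"
  shows "pyr_sum P Q <= ennreal (e + (1/2) ^ N0)"
proof -
  define b where "b n = (1/2) ^ Suc n * e + (if n < N0 then 0 else (1/2 :: real) ^ Suc n)" for n
  have b0: "b n >= 0" for n using e by (simp add: b_def)
  have g: "(%n. (1/2) ^ Suc n) sums (1::real)" by (rule power_half_series)
  have "(%n. if n < N0 then 0 else (1/2 :: real) ^ Suc n) sums (1/2) ^ N0"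
  proof (subst sums_zero_iff_shift[of N0, symmetric])
    have "(%n. (1/2) ^ N0 * (1/2 :: real) ^ Suc n) sums ((1/2) ^ N0 * 1)" by (rule sums_mult[OF g])
    moreover have "(if n + N0 < N0 then 0 else (1/2 :: real) ^ Suc (n + N0)) = (1/2) ^ N0 * (1/2) ^ Suc n" for n by (simp add: power_add)
    ultimately show "(%n. if n + N0 < N0 then 0 else (1/2 :: real) ^ Suc (n + N0)) sums (1/2) ^ N0" by simp
  qed simp
  hence bs: "b sums (1 * e + (1/2) ^ N0)" unfolding b_def by (intro sums_add sums_mult2 g)
  have "ennreal (pyr_coeff n) * box_H (Suc n) P Q <= ennreal (b n)" for n
  proof (cases "n < N0")
    case True
    have "ennreal (pyr_coeff n) * box_H (Suc n) P Q <= ennreal ((1/2) ^ Suc n) * ennreal e"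
      using True pyr_coeff[of n] by (intro mult_mono h ennreal_leI) auto
    also have "\<dots> = ennreal (b n)" using True e unfolding b_def by (subst ennreal_mult[symmetric]) auto
    finally show ?thesis .
  next
    case False
    have "ennreal (pyr_coeff n) * box_H (Suc n) P Q <= ennreal ((1/2) ^ Suc n) * ennreal 1"
      using pyr_coeff[of n] by (intro mult_mono box_H_le_1 PQ ennreal_leI) auto
    also have "\<dots> <= ennreal (b n)" using False e by (simp add: b_def ennreal_leI)
    finally show ?thesis .
  qed
  hence "pyr_sum P Q <= (\<Sum>n. ennreal (b n))" unfolding pyr_sum_def by (intro suminf_le) auto
  also have "\<dots> = ennreal (e + (1/2) ^ N0)" using suminf_ennreal_eq[OF b0 bs] by simp
  finally show ?thesis .
qed

lemma pyr_sum_finite: assumes "P : Pi_K" "Q : Pi_K" shows "pyr_sum P Q < top"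
proof -
  have "pyr_sum P Q <= ennreal (0 + (1/2) ^ 0)" by (rule pyr_sum_bound[OF assms]) auto
  thus ?thesis by (rule le_less_trans) simp
qed

lemma ennreal_d_Pi: "P : Pi_K ==> Q : Pi_K ==> ennreal (d_Pi P Q) = pyr_sum P Q"
  unfolding d_Pi_alt using pyr_sum_finite by (simp add: ennreal_enn2real)

lemma d_Pi_bound:
  assumes "P : Pi_K" "Q : Pi_K" "!!N. 1 <= N ==> N <= N0 ==> box_H N P Q <= ennreal e" "e >= 0"
  shows "d_Pi P Q <= e + (1/2) ^ N0" unfolding d_Pi_alt using pyr_sum_bound[OF assms] assms(4) by (intro enn2real_leI) auto

lemma box_H_le_d_Pi:
  assumes PQ: "P : Pi_K" "Q : Pi_K" and N: "N >= 1"
  shows "box_H N P Q <= ennreal (d_Pi P Q / pyr_coeff (N - 1))"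
proof -
  obtain h where h: "box_H N P Q = ennreal h" "h >= 0" using box_H_le_1[OF PQ N] by (cases "box_H N P Q") (auto simp: top_unique)
  have "ennreal (pyr_coeff (N - 1)) * box_H (Suc (N - 1)) P Q <= pyr_sum P Q"
    unfolding pyr_sum_def using sum_le_suminf[of "%n. ennreal (pyr_coeff n) * box_H (Suc n) P Q" "{N - 1}"] by simp
  hence "ennreal (pyr_coeff (N - 1) * h) <= ennreal (d_Pi P Q)"
    using N h pyr_coeff(1)[of "N - 1"] by (simp add: ennreal_d_Pi[OF PQ] ennreal_mult less_imp_le)
  hence "pyr_coeff (N - 1) * h <= d_Pi P Q" by (simp add: ennreal_le_iff d_Pi_alt)
  thus ?thesis using h pyr_coeff(1)[of "N - 1"] by (intro ord_eq_le_trans[OF h(1)] ennreal_leI) (simp add: field_simps)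
qed

theorem Metric_space_d_Pi: "Metric_space Pi_K d_Pi"
proof
  fix P Q :: "data_class set"
  show "0 <= d_Pi P Q" by (simp add: d_Pi_alt)
  show "d_Pi P Q = d_Pi Q P" unfolding d_Pi_alt pyr_sum_def using box_H_commute[where P=P and Q=Q] by simp
  assume PQ: "P : Pi_K" "Q : Pi_K"
  show "d_Pi P Q = 0 \<longleftrightarrow> P = Q"
  proof
    assume z: "d_Pi P Q = 0"
    \<comment> \<open>A level of P at Hausdorff distance 0 from that of Q lies in Q because Q is
      closed; the full inclusion then follows by \<open>pyramid_eq\<close>.\<close>
    have *: "P Int DM_K N <= Q" if PQ: "P : Pi_K" "Q : Pi_K" and z: "d_Pi P Q = 0" and N: "N >= 1" for P Q N
    proof
      fix A assume A: "A : P Int DM_K N"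
      show "A : Q"
      proof (rule pyramid_closed[OF PQ(2)])
        show "A : DD" using A DM_K_DD by blast
        fix e :: real assume e: "e > 0"
        have "box_H N P Q < ennreal e" using box_H_le_d_Pi[OF PQ N] z e by (simp add: z)
        thus "EX B:Q. d_box A B <= e" using box_H_lessD(1)[where N=N and P=P and Q=Q and e=e and A=A] A by (auto intro: less_imp_le)
      qed
    qed
    have "P <= Q" if PQ: "P : Pi_K" "Q : Pi_K" and z: "d_Pi P Q = 0" for P Q
    proof
      fix C assume C: "C : P"
      show "C : Q"
      proof (rule pyramid_eq[OF PQ(2)])
        show "C : DD_K" using C pyramid_subset[OF PQ(1)] by blast
        fix N A assume "1 <= N" "A : DM_K N" "class_le A C"
        thus "A : Q" using *[OF PQ z, of N] pyramid_down[OF PQ(1) C] DM_K_DD_K by blast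
      qed
    qed
    moreover have "d_Pi Q P = 0" using z unfolding d_Pi_alt pyr_sum_def using box_H_commute[where P=P and Q=Q] by simp
    ultimately show "P = Q" using PQ z by blast
  next
    assume "P = Q"
    hence "box_H N P Q <= ennreal 0" for N using DM_K_DD by (intro box_H_leI) (auto intro!: bexI simp: box.mdist_zero)
    hence "pyr_sum P Q = 0" unfolding pyr_sum_def by simp
    thus "d_Pi P Q = 0" by (simp add: d_Pi_alt)
  qed
  fix R assume R: "R : Pi_K"
  have "pyr_sum P R <= (\<Sum>n. ennreal (pyr_coeff n) * box_H (Suc n) P Q + ennreal (pyr_coeff n) * box_H (Suc n) Q R)"
    unfolding pyr_sum_def distrib_left[symmetric] using box_H_triangle[OF PQ R] by (intro suminf_le mult_left_mono) auto
  also have "\<dots> = pyr_sum P Q + pyr_sum Q R" unfolding pyr_sum_def by (rule suminf_add[symmetric]) auto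
  finally have "ennreal (d_Pi P R) <= ennreal (d_Pi P Q + d_Pi Q R)"
    using PQ R by (simp add: ennreal_d_Pi ennreal_plus d_Pi_alt[of P Q] d_Pi_alt[of Q R]) (simp flip: d_Pi_alt add: ennreal_d_Pi)
  thus "d_Pi P R <= d_Pi P Q + d_Pi Q R" by (subst (asm) ennreal_le_iff) (auto simp: d_Pi_alt)
qed

section \<open>Limits of pyramids\<close>

lemma compactin_DM_K: "N >= 1 ==> compactin box.mtopology (DM_K N)" unfolding box.compactin_sequentially
proof (intro conjI allI impI)
  show "DM_K N <= DD" using DM_K_DD by blast
  fix \<sigma> :: "nat => data_class" assume N: "N >= 1" and \<sigma>: "range \<sigma> <= DM_K N"
  hence s: "\<sigma> n : DM_K N" for n by blast
  obtain r B where "strict_mono r" "B : DM_K N" "(%n. d_box (\<sigma> (r n)) B) \<longlonglongrightarrow> 0" by (rule DM_K_seq_compact[OF s N])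
  thus "EX l r. l : DM_K N & strict_mono r & limitin box.mtopology (\<sigma> \<circ> r) l sequentially"
    unfolding box.limitin_metric_dist_null using s DM_K_DD by (intro exI[of _ B] exI[of _ r]) (auto intro!: always_eventually)
qed

lemma DM_K_net:
  assumes "N >= 1" "S <= DM_K N" "e > 0"
  obtains E where "finite E" "E <= S" "ALL A:S. EX B:E. d_box A B < e"
proof -
  have "box.mtotally_bounded S"
    by (rule box.mtotally_bounded_subset[OF box.compactin_imp_mtotally_bounded[OF compactin_DM_K[OF assms(1)]] assms(2)])
  then obtain E where E: "finite E" "E <= S" "S <= (\<Union>x\<in>E. box.mball x e)"
    using assms(3) unfolding box.mtotally_bounded_def by meson
  hence "ALL A:S. EX B:E. d_box A B < e" by (fastforce simp: d_box_commute)
  with E show thesis using that by blast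
qed

text \<open>Levels converge in the sense that these distances converge for each fixed class (Wijsman
  convergence); compactness makes this Hausdorff convergence in \<open>box_H_lim\<close>.\<close>

definition set_dist :: "data_class => data_class set => real" where
  "set_dist A S = (INF B\<in>S. d_box A B)"

lemma set_dist_le: "B : S ==> set_dist A S <= d_box A B"
  unfolding set_dist_def by (rule cINF_lower) (auto intro!: bdd_belowI[of _ 0])

lemma set_dist_less: "S ~= {} ==> set_dist A S < e ==> EX B:S. d_box A B < e"
  unfolding set_dist_def by (subst (asm) cINF_less_iff) (auto intro!: bdd_belowI[of _ 0])

lemma set_dist_nonneg: "S ~= {} ==> 0 <= set_dist A S" unfolding set_dist_def by (rule cINF_greatest) auto

lemma set_dist_le_1: "S ~= {} ==> set_dist A S <= 1" using set_dist_le d_box_le_1 order_trans by blast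

lemma set_dist_lip:
  assumes "A : DD" "B : DD" "S <= DD" "S ~= {}"
  shows "set_dist A S <= d_box A B + set_dist B S"
proof (rule field_le_epsilon)
  fix e :: real assume "e > 0"
  then obtain C where C: "C : S" "d_box B C < set_dist B S + e" using set_dist_less[OF assms(4), of B "set_dist B S + e"] by auto
  have "set_dist A S <= d_box A C" by (rule set_dist_le[OF C(1)])
  also have "\<dots> <= d_box A B + d_box B C" by (rule box.triangle) (use assms C in auto)
  finally show "set_dist A S <= d_box A B + set_dist B S + e" using C(2) by simp
qed

text \<open>The ball about x has positive mass, so it meets every S of mass close enough to 1. There
  f is close to a K-valued feature, and f varies little on the ball.\<close>

lemma DD_K_closed:
  assumes X: "X : DD" and a: "!!e. e > 0 ==> EX C:DD_K. d_box X C < e"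
  shows "X : DD_K"
proof -
  interpret X: geom_data "rep X" by (rule geom_data_rep[OF X])
  have "\<bar>f x\<bar> <= 1/2" if f: "f : features (rep X)" and x: "x : points (rep X)" for f x
  proof (rule field_le_epsilon)
    fix e :: real assume e: "e > 0"
    let ?B = "X.mball x (e/2)"
    have e2: "e/2 > 0" using e by simp
    have B: "measure (rlaw X) ?B > 0" using X.mball_pos[OF x e2] by (simp add: X.law.emeasure_eq_measure)
    define d where "d = min (e/2) (measure (rlaw X) ?B / 2)"
    have d: "d > 0" "d <= e/2" "d < measure (rlaw X) ?B" using e B unfolding d_def by auto
    obtain C where C: "C : DD_K" "d_box X C < d" using a[OF d(1)] by blast
    note CD = DD_K_rep(1)[OF C(1)]
    interpret C: geom_data "rep C" by (rule geom_data_rep[OF CD])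
    have "ennreal (d_box X C) < ennreal d" using C(2) by (simp add: ennreal_less_iff)
    hence lt: "box_dist (rep X) (rep C) < ennreal d" by (simp add: ennreal_d_box[OF X CD])
    obtain \<pi> S where \<pi>: "coupling_of (rlaw X) (rlaw C) \<pi>" "closedin (prod_data (rep X) (rep C)) S" "measure \<pi> S >= 1 - d"
      "ALL f:features (rep X). EX g:features (rep C). near_on S (d/2) f g" "ALL g:features (rep C). EX f:features (rep X). near_on S (d/2) f g"
      by (rule box_dist_lessE[OF X.geometric C.geometric lt])
    interpret P: prob_space \<pi> using coupling_ofD(1)[OF \<pi>(1)] .
    note Sm = closedin_sets_coupling[OF X.geometric C.geometric \<pi>(1,2)]
    have Bm: "fst -` ?B Int space \<pi> : sets \<pi>" using measurable_sets[OF coupling_ofD(5)[OF \<pi>(1)] X.mball_sets(1)] .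
    have mB: "measure \<pi> (fst -` ?B Int space \<pi>) = measure (rlaw X) ?B"
      using measure_distr[OF coupling_ofD(5)[OF \<pi>(1)] X.mball_sets(1)] coupling_ofD(3)[OF \<pi>(1)] by simp
    have "S Int (fst -` ?B Int space \<pi>) ~= {}"
    proof
      assume "S Int (fst -` ?B Int space \<pi>) = {}"
      hence "measure \<pi> (S \<union> (fst -` ?B Int space \<pi>)) = measure \<pi> S + measure \<pi> (fst -` ?B Int space \<pi>)"
        by (intro P.finite_measure_Union Sm Bm)
      moreover have "measure \<pi> (S \<union> (fst -` ?B Int space \<pi>)) <= 1" by (rule P.prob_le_1)
      ultimately show False using \<pi>(3) mB d(3) by linarith
    qed
    then obtain z where z: "z : S" "fst z : ?B" "z : space \<pi>" by blast
    obtain g where g: "g : features (rep C)" "near_on S (d/2) f g" using \<pi>(4) f by blast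
    have "\<bar>g (snd z)\<bar> <= 1/2"
      by (rule rclosure_bound[OF C(1) C.features_closure[OF g(1)]]) (use z(3) in \<open>simp add: coupling_ofD(7)[OF \<pi>(1)] mem_Times_iff C.space_law\<close>)
    moreover have "\<bar>f (fst z) - g (snd z)\<bar> <= d/2" using g(2) z(1) unfolding near_on_def by blast
    moreover have "\<bar>f x - f (fst z)\<bar> <= e/2" using X.feature_dist_le[OF f x, of "fst z"] z(2) by auto
    ultimately show "\<bar>f x\<bar> <= 1/2 + e" using d(1,2) by linarith
  qed
  hence "K_valued (rep X)" unfolding K_valued_def abs_le_half_iff by blast
  thus ?thesis using class_of_in_DD_K[OF X.geometric] geometric_rep(2)[OF X] by simp
qed

lemma coupled_reindex:
  "coupled I e M F M' G ==> (!!i. i < N ==> c i < I) ==> coupled N e M (%i. F (c i)) M' (%i. G (c i))"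
  unfolding coupled_def by blast

lemma seq_law_reindex:
  assumes "!!i. F i : borel_measurable M"
  shows "seq_law M (%i. F (c i)) = seq_law (seq_law M F) (%i x. x (c i))"
proof -
  have "seq_law (distr M borel (%x i. F i x)) (%i x. x (c i)) = seq_law M (%i x. F (c i) x)"
    by (rule seq_law_distr[OF seq_measurable[OF assms]]) auto
  thus ?thesis by (simp add: seq_law_def)
qed

section \<open>The limit of pyramids with convergent levels\<close>

locale pyramid_limit =
  fixes P :: "nat => data_class set"
  assumes pyr: "P n : Pi_K"
    and conv: "N >= 1 ==> A : DM_K N ==> convergent (%n. set_dist A (P n Int DM_K N))"
begin

definition lim_DM :: "nat => data_class set" where
  "lim_DM N = {A : DM_K N. (%n. set_dist A (P n Int DM_K N)) \<longlonglongrightarrow> 0}"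

text \<open>Defined through all finite quotients, which makes it downward closed at once; that its
  levels are the limits of the levels is \<open>lim_pyramid_DM\<close>.\<close>

definition lim_pyramid :: "data_class set" where
  "lim_pyramid = {X : DD_K. ALL N>=1. ALL A:DM_K N. class_le A X --> A : lim_DM N}"

lemma ne: "N >= 1 ==> P n Int DM_K N ~= {}" by (rule pyramid_DM_ne[OF pyr])

lemma sub: "P n Int DM_K N <= DD" using DM_K_DD by blast

text \<open>The distances converge by assumption, so it is enough that they are small for infinitely
  many n.\<close>

lemma lim_DM_I:
  assumes N: "N >= 1" and A: "A : DM_K N" and freq: "!!e m. e > 0 ==> EX n>=m. set_dist A (P n Int DM_K N) <= e"
  shows "A : lim_DM N"
proof -
  obtain l where l: "(%n. set_dist A (P n Int DM_K N)) \<longlonglongrightarrow> l" using conv[OF N A] unfolding convergent_def by blast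
  have "l >= 0" by (rule LIMSEQ_le_const[OF l]) (use set_dist_nonneg[OF ne[OF N]] in auto)
  moreover have "l <= 0"
  proof (rule ccontr)
    assume "\<not> l <= 0"
    hence "l/2 < l" "l/2 > 0" by auto
    hence "\<forall>\<^sub>F n in sequentially. l/2 < set_dist A (P n Int DM_K N)" by (intro order_tendstoD[OF l])
    then obtain m where "!!n. n >= m ==> l/2 < set_dist A (P n Int DM_K N)" by (auto simp: eventually_sequentially)
    thus False using freq[OF \<open>l/2 > 0\<close>, of m] by (meson not_less)
  qed
  ultimately show ?thesis using l A by (simp add: lim_DM_def)
qed

lemma lim_DM_near:
  assumes "N >= 1" "A : lim_DM N" "e > 0"
  shows "\<forall>\<^sub>F n in sequentially. EX B:P n Int DM_K N. d_box A B < e"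
proof -
  have "\<forall>\<^sub>F n in sequentially. set_dist A (P n Int DM_K N) < e"
    using assms by (intro order_tendstoD) (auto simp: lim_DM_def)
  thus ?thesis by eventually_elim (use set_dist_less[OF ne[OF assms(1)]] in blast)
qed

text \<open>Members of P n near X have quotients near A by \<open>d_box_down\<close>, and these lie
  in P n.\<close>

lemma lim_DM_down:
  assumes X: "X : DD_K" and near: "!!e. e > 0 ==> \<forall>\<^sub>F n in sequentially. EX B:P n. d_box X B < e"
    and N: "N >= 1" and A: "A : DM_K N" "class_le A X"
  shows "A : lim_DM N"
proof (rule lim_DM_I[OF N A(1)])
  fix e :: real and m assume e: "e > 0"
  define t where "t = e / (real N + 2)"
  have t: "t > 0" "(real N + 2) * t = e" using e by (auto simp: t_def field_simps)
  have "\<forall>\<^sub>F n in sequentially. EX B:P n. d_box X B < t * t / 4" using t(1) by (intro near) simp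
  then obtain n where n: "n >= m" "EX B:P n. d_box X B < t * t / 4" by (auto simp: eventually_sequentially) (meson nat_le_linear)
  then obtain B where B: "B : P n" "d_box X B < t * t / 4" by blast
  have BK: "B : DD_K" using B(1) pyramid_subset[OF pyr] by blast
  have t4: "2 * (t * t / 4) < t * t" using t(1) by simp
  obtain B' where B': "B' : DM_K N" "class_le B' B" "d_box A B' <= (real N + 2) * t"
    by (rule d_box_down[OF A(1) N X BK A(2) B(2) t(1) t4])
  have "B' : P n" by (rule pyramid_down[OF pyr B(1) DM_K_DD_K[OF B'(1)] B'(2)])
  hence "set_dist A (P n Int DM_K N) <= e" using set_dist_le[of B' "P n Int DM_K N" A] B' t(2) by simp
  thus "EX n>=m. set_dist A (P n Int DM_K N) <= e" using n(1) by blast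
qed

lemma lim_DM_subset: assumes N: "N >= 1" shows "lim_DM N <= lim_pyramid"
proof
  fix A assume A: "A : lim_DM N"
  hence AN: "A : DM_K N" by (simp add: lim_DM_def)
  have "A' : lim_DM N'" if "N' >= 1" "A' : DM_K N'" "class_le A' A" for A' N'
  proof (rule lim_DM_down[OF DM_K_DD_K[OF AN] _ that])
    fix e :: real assume "e > 0"
    from lim_DM_near[OF N A this] show "\<forall>\<^sub>F n in sequentially. EX B:P n. d_box A B < e" by eventually_elim blast
  qed
  thus "A : lim_pyramid" using DM_K_DD_K[OF AN] by (simp add: lim_pyramid_def)
qed

lemma lim_pyramid_DM: "N >= 1 ==> lim_pyramid Int DM_K N = lim_DM N"
  using lim_DM_subset[of N] class_le_refl DM_K_DD by (auto simp: lim_pyramid_def lim_DM_def)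

text \<open>Almost nearest points of the levels have a subsequence converging in the compact
  \<open>DM_K N\<close>; its limit is no farther from A than the limit of the distances.\<close>

lemma lim_DM_attained:
  assumes N: "N >= 1" and A: "A : DM_K N"
  obtains B where "B : lim_DM N" "d_box A B <= lim (%n. set_dist A (P n Int DM_K N))"
proof -
  let ?s = "%n. set_dist A (P n Int DM_K N)"
  have l: "?s \<longlonglongrightarrow> lim ?s" using conv[OF N A] by (simp add: convergent_LIMSEQ_iff)
  have "EX B:P n Int DM_K N. d_box A B < ?s n + 1 / Suc n" for n by (rule set_dist_less[OF ne[OF N]]) simp
  then obtain Z where Z: "!!n. Z n : P n Int DM_K N" "!!n. d_box A (Z n) < ?s n + 1 / Suc n" by metis
  have ZN: "Z n : DM_K N" for n using Z(1) by blast
  obtain r B where r: "strict_mono (r :: nat => nat)" "B : DM_K N" "(%n. d_box (Z (r n)) B) \<longlonglongrightarrow> 0"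
    by (rule DM_K_seq_compact[OF ZN N])
  have "B : lim_DM N"
  proof (rule lim_DM_I[OF N r(2)])
    fix e :: real and m assume "e > 0"
    hence "\<forall>\<^sub>F n in sequentially. d_box (Z (r n)) B < e" by (intro order_tendstoD[OF r(3)])
    then obtain n where n: "n >= m" "d_box (Z (r n)) B < e" by (auto simp: eventually_sequentially) (meson nat_le_linear)
    have "set_dist B (P (r n) Int DM_K N) <= e" using set_dist_le[OF Z(1)[of "r n"], of B] n(2) by (simp add: d_box_commute)
    moreover have "r n >= m" using seq_suble[OF r(1), of n] n(1) by simp
    ultimately show "EX n>=m. set_dist B (P n Int DM_K N) <= e" by blast
  qed
  moreover have "d_box A B <= lim ?s"
  proof (rule LIMSEQ_le_const)
    have 1: "(%n. 1 / real (Suc n)) \<longlonglongrightarrow> 0" using LIMSEQ_inverse_real_of_nat by (simp add: inverse_eq_divide)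
    have "(%n. (?s n + 1 / Suc n)) \<longlonglongrightarrow> lim ?s + 0" by (rule tendsto_add[OF l 1])
    from tendsto_add[OF LIMSEQ_subseq_LIMSEQ[OF this r(1)] r(3)]
    show "(%n. (?s (r n) + 1 / Suc (r n)) + d_box (Z (r n)) B) \<longlonglongrightarrow> lim ?s" by (simp add: comp_def)
    have "d_box A B <= (?s (r n) + 1 / Suc (r n)) + d_box (Z (r n)) B" for n
      using box.triangle[OF DM_K_DD[OF A] DM_K_DD[OF ZN] DM_K_DD[OF r(2)], of "r n"] Z(2)[of "r n"] by linarith
    thus "EX N. ALL n>=N. d_box A B <= (?s (r n) + 1 / Suc (r n)) + d_box (Z (r n)) B" by blast
  qed
  ultimately show thesis by (rule that)
qed

text \<open>The distances to the levels are 1-Lipschitz, so on the compact \<open>DM_K N\<close>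
  their pointwise convergence is uniform, controlled by a finite net.\<close>

lemma box_H_lim:
  assumes N: "N >= 1" and e: "e > 0"
  shows "\<forall>\<^sub>F n in sequentially. box_H N (P n) lim_pyramid <= ennreal e"
proof -
  let ?s = "%A n. set_dist A (P n Int DM_K N)"
  have e5: "e/5 > 0" using e by simp
  obtain E where E: "finite E" "E <= DM_K N" "ALL A:DM_K N. EX B:E. d_box A B < e/5" by (rule DM_K_net[OF N order_refl e5])
  have "\<forall>\<^sub>F n in sequentially. ALL B:E. \<bar>?s B n - lim (?s B)\<bar> < e/5"
  proof (rule eventually_ball_finite[OF E(1)], rule ballI)
    fix B assume "B : E"
    hence "?s B \<longlonglongrightarrow> lim (?s B)" using conv[OF N] E(2) by (auto simp: convergent_LIMSEQ_iff)
    thus "\<forall>\<^sub>F n in sequentially. \<bar>?s B n - lim (?s B)\<bar> < e/5" using e5 unfolding tendsto_iff dist_real_def by blast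
  qed
  thus ?thesis
  proof eventually_elim
    case (elim n)
    show ?case unfolding lim_pyramid_DM[OF N]
    proof (rule hausdorff_leI)
      fix A assume A: "A : P n Int DM_K N"
      then obtain B where B: "B : E" "d_box A B < e/5" using E(3) by blast
      have BN: "B : DM_K N" using B E(2) by blast
      have "?s B n <= d_box B A" by (rule set_dist_le[OF A])
      moreover have "\<bar>?s B n - lim (?s B)\<bar> < e/5" using elim B(1) by blast
      ultimately have "lim (?s B) <= 2 * (e/5)" using B(2) d_box_commute[of A B] by linarith
      moreover obtain C where C: "C : lim_DM N" "d_box B C <= lim (?s B)" by (rule lim_DM_attained[OF N BN])
      moreover have "d_box A C <= d_box A B + d_box B C"
        by (rule box.triangle) (use A BN C DM_K_DD in \<open>auto simp: lim_DM_def\<close>)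
      ultimately have "d_box A C <= e" using B(2) e by linarith
      thus "EX C:lim_DM N. ennreal (d_box A C) <= ennreal e" using C(1) ennreal_leI by blast
    next
      fix A assume A: "A : lim_DM N"
      hence AN: "A : DM_K N" and l0: "?s A \<longlonglongrightarrow> 0" by (auto simp: lim_DM_def)
      then obtain B where B: "B : E" "d_box A B < e/5" using E(3) by blast
      have BN: "B : DM_K N" using B E(2) by blast
      have lB: "?s B \<longlonglongrightarrow> lim (?s B)" using conv[OF N BN] by (simp add: convergent_LIMSEQ_iff)
      have sl: "?s C n <= d_box C D + ?s D n" if "C : DM_K N" "D : DM_K N" for C D n
        by (rule set_dist_lip[OF DM_K_DD[OF that(1)] DM_K_DD[OF that(2)] sub ne[OF N]])
      have "lim (?s B) <= d_box B A + 0" by (rule LIMSEQ_le[OF lB tendsto_add[OF tendsto_const l0]]) (use sl[OF BN AN] in auto)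
      moreover have "\<bar>?s B n - lim (?s B)\<bar> < e/5" using elim B(1) by blast
      ultimately have "?s A n < e" using sl[OF AN BN, of n] B(2) d_box_commute[of A B] e by linarith
      then obtain C where "C : P n Int DM_K N" "d_box A C < e" using set_dist_less[OF ne[OF N]] by blast
      thus "EX C:P n Int DM_K N. ennreal (d_box C A) <= ennreal e"
        by (intro bexI[of _ C]) (auto simp: d_box_commute intro: ennreal_leI)
    qed
  qed
qed

text \<open>The first k entries generate a quotient of X at level k, which is approximated by
  members of P n.\<close>

lemma lim_approx:
  assumes X: "X : lim_pyramid" and f: "!!i. f i : rclosure X" and k: "k >= 1" and e: "e > 0"
  shows "\<forall>\<^sub>F n in sequentially. EX A:P n. EX g. (ALL i. g i : rclosure A) & coupled k e (rlaw X) f (rlaw A) g"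
proof -
  have XK: "X : DD_K" using X by (simp add: lim_pyramid_def)
  note XD = DD_K_rep(1)[OF XK]
  let ?f = "%i. f (min i (k - 1))"
  have tl: "ALL i>=k. ?f i = ?f (k - 1)" by (auto simp: min_def intro!: arg_cong[of _ _ f])
  obtain A F where A: "A : DM_K k" "class_le A X" "enum k A F" "seq_law (rlaw A) F = seq_law (rlaw X) ?f"
    by (rule ex_quotient[OF XK k _ tl]) (use f in auto)
  note AD = DM_K_DD[OF A(1)]
  have Al: "A : lim_DM k" using X k A unfolding lim_pyramid_def by blast
  have Fc: "F i : rclosure A" for i by (rule geom_data.frame_closure[OF geom_data_rep[OF AD] enum_frame(1)[OF AD A(3) k]])
  have e3: "e/3 > 0" using e by simp
  from lim_DM_near[OF k Al e3] show ?thesis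
  proof eventually_elim
    case (elim n)
    then obtain B where B: "B : P n Int DM_K k" "d_box A B < e/3" by blast
    have BD: "B : DD" "B : DD_K" using B DM_K_DD DM_K_DD_K by blast+
    obtain T where T: "ALL f:rclosure A. T f : features (rep B)"
      "ALL F N. (ALL i. F i : rclosure A) --> coupled N (2 * (e/3)) (rlaw A) F (rlaw B) (%i. T (F i))"
      by (rule coupled_of_d_box[OF DM_K_DD_K[OF A(1)] BD(2) B(2)])
    have g: "T (F i) : rclosure B" for i using T(1) Fc geom_data.features_closure[OF geom_data_rep[OF BD(1)]] by blast
    have "coupled k (2 * (e/3) + e/3) (rlaw X) ?f (rlaw B) (%i. T (F i))"
      by (rule coupled_law_left[where G = F]) (use T(2) Fc A(4) e rlaw_prob[OF XD] rclosure_measurable[OF AD Fc]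
        rclosure_measurable[OF BD(1) g] rclosure_measurable[OF XD f] in auto)
    moreover have "min i (k - 1) = i" if "i < k" for i using that by simp
    ultimately have "coupled k e (rlaw X) f (rlaw B) (%i. T (F i))" unfolding coupled_def by simp
    hence "EX g. (ALL i. g i : rclosure B) & coupled k e (rlaw X) f (rlaw B) g" using g by (intro exI[of _ "%i. T (F i)"]) auto
    thus ?case using B by blast
  qed
qed

end

lemma coupled_law:
  assumes c: "coupled N e M F M' G" and eq: "seq_law M F = seq_law L F'" "seq_law M' G = seq_law L' G'"
    and e: "0 <= e" "e < e'" and p: "prob_space L" "prob_space L'"
    and m: "!!i. F i : borel_measurable M" "!!i. G i : borel_measurable M'"
      "!!i. F' i : borel_measurable L" "!!i. G' i : borel_measurable L'"
  shows "coupled N e' L F' L' G'"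
proof -
  define d where "d = (e' - e) / 2"
  have d: "d > 0" "0 <= e + d" "e + d + d = e'" using e by (auto simp: d_def field_simps)
  have "coupled N (e + d) M F L' G'" by (rule coupled_law_right[OF c eq(2) d(1) e(1) p(2) m(1,2,4)])
  from coupled_law_left[OF this eq(1)[symmetric] d(1,2) p(1) m(4,1,3)] show ?thesis using d(3) by simp
qed

lemma (in geom_data) L1_approx:
  fixes h :: "nat => 'a => real"
  assumes h: "range h <= extensional (points X)" "!!i. lip (h i)" "!!i x. x : points X ==> \<bar>h i x\<bar> <= 1/2"
    and f: "f : pointwise_closure (points X) (range h)" and e: "e > 0"
  shows "EX c. (L1 (law X) f (h c)) <= ennreal e"
proof -
  obtain r :: "nat => nat" where r: "!!x. x : points X ==> (%n. h (r n) x) \<longlonglongrightarrow> f x"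
    by (rule closure_range_seq[OF h(1,2) f]) blast
  have "lip f" by (rule closure_lip[OF h(1) _ f]) (use h(2) in blast)
  moreover have "\<bar>f x\<bar> <= 1/2" if "x : points X" for x
    by (rule pointwise_closure_bound1[OF f h(1) _ that]) (use h(3)[OF that] in blast)
  ultimately have "(%n. \<integral>\<^sup>+x. ennreal \<bar>f x - h (r n) x\<bar> \<partial>law X) \<longlonglongrightarrow> 0"
    using h r by (intro L1_limit law.prob_space_axioms lip_measurable) auto
  hence "\<forall>\<^sub>F n in sequentially. (L1 (law X) f (h (r n))) < ennreal e" by (rule order_tendstoD) (use e in simp)
  thus ?thesis using eventually_happens[of _ sequentially] by (auto intro: less_imp_le)
qed

lemma frame_L1_approx:
  assumes W: "W : DD_K" and f: "frame (rep W) f" and G: "G : rclosure W" and e: "e > 0"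
  shows "EX c. (L1 (rlaw W) G (f c)) <= ennreal e"
proof -
  interpret W: geom_data "rep W" by (rule geom_data_rep[OF DD_K_rep(1)[OF W]])
  show ?thesis by (rule W.L1_approx[OF W.frame_ext[OF f] W.frame_lip[OF f] rclosure_bound[OF W W.frame_closure[OF f]] _ e])
      (use G W.frame_feature_closure[OF f] in auto)
qed

text \<open>Provides the separability for the supremum distance that a law must have to come from a
  data set.\<close>

lemma seq_law_separated:
  fixes z :: "nat => nat => real"
  assumes g: "!!i. g i : borel_measurable M"
    and z: "!!x r. x : space M ==> r > 0 ==> EX a. ALL i. \<bar>g i x - z a i\<bar> <= r"
  shows "AE x in seq_law M g. ALL r>0. EX a. x : supball (z a) r"
proof -
  have "AE x in seq_law M g. ALL n. EX a. x : supball (z a) (1 / Suc n)"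
  proof (rule AE_seq_law[where P = "%x. ALL n. EX a. x : supball (z a) (1 / Suc n)", OF g])
    show "Measurable.pred borel (%x. ALL n. EX a. x : supball (z a) (1 / real (Suc n)))"
      by (intro pred_intros_countable) (simp add: pred_def)
    show "ALL n. EX a. (%i. g i x) : supball (z a) (1 / real (Suc n))" if "x : space M" for x
      unfolding supball_def mem_Collect_eq by (intro allI z[OF that]) simp
  qed
  thus ?thesis
  proof eventually_elim
    case (elim x)
    show ?case
    proof (intro allI impI)
      fix r :: real assume "r > 0"
      then obtain n where n: "1 / real (Suc n) < r" using nat_approx_posE by blast
      obtain a where "x : supball (z a) (1 / Suc n)" using elim by blast
      hence "x : supball (z a) r" using n unfolding supball_def mem_Collect_eq by (meson less_imp_le order_trans)
      thus "EX a. x : supball (z a) r" by blast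
    qed
  qed
qed

lemma frame_separated:
  assumes X: "geometric_dataset X" and g: "!!i. geom_data.lip X (g i)" and D: "geom_data.dense_points X D"
  shows "AE x in seq_law (law X) g. ALL r>0. EX a. x : supball (%i. g i (D a)) r"
proof -
  interpret X: geom_data X by standard (rule X)
  show ?thesis
  proof (rule seq_law_separated)
    show "g i : borel_measurable (law X)" for i by (rule X.lip_measurable[OF g])
    fix x and r :: real assume "x : space (law X)" and r: "r > 0"
    hence x: "x : points X" by simp
    obtain a where a: "data_dist X x (D a) < r" using X.dense_pointsD(2)[OF D x r] by blast
    have "\<bar>g i x - g i (D a)\<bar> <= r" for i using g[of i] x X.dense_pointsD(1)[OF D, of a] a unfolding X.lip_def by fastforce
    thus "EX a. ALL i. \<bar>g i x - g i (D a)\<bar> <= r" by blast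
  qed
qed

context pyramid_limit
begin

lemma lim_pyramid_ne: "lim_pyramid ~= {}"
proof -
  obtain A where "A : P 0 Int DM_K 1" using ne[of 1 0] by auto
  hence A: "A : DM_K 1" by blast
  obtain B where "B : lim_DM 1" by (rule lim_DM_attained[OF order_refl A])
  thus ?thesis using lim_DM_subset[of 1] by auto
qed

text \<open>Quotients of a limit X are near quotients of close members by \<open>d_box_down\<close>,
  and so remain limits of the levels.\<close>

lemma lim_pyramid_closed: "closedin box.mtopology lim_pyramid"
proof -
  have "X : lim_pyramid" if \<sigma>: "range \<sigma> <= lim_pyramid" and l: "limitin box.mtopology \<sigma> X sequentially" for \<sigma> X
  proof -
    have X: "X : DD" and d: "(%n. d_box (\<sigma> n) X) \<longlonglongrightarrow> 0" using l unfolding box.limitin_metric_dist_null by auto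
    have near: "EX C:lim_pyramid. d_box X C < e" if "e > 0" for e
    proof -
      have "\<forall>\<^sub>F n in sequentially. d_box (\<sigma> n) X < e" using that by (intro order_tendstoD[OF d])
      then obtain n where "d_box (\<sigma> n) X < e" by (auto simp: eventually_sequentially)
      thus ?thesis using \<sigma> d_box_commute[of X] by auto
    qed
    have XK: "X : DD_K" by (rule DD_K_closed[OF X]) (use near in \<open>unfold lim_pyramid_def, blast\<close>)
    have "A : lim_DM N" if N: "N >= 1" and A: "A : DM_K N" "class_le A X" for N A
    proof (rule lim_DM_I[OF N A(1)])
      fix e :: real and m assume e: "e > 0"
      define t where "t = e / (2 * (real N + 2))"
      have N2: "2 * (real N + 2) > 0" by simp
      have t: "t > 0" "(real N + 2) * t = e/2" using e N2 by (auto simp: t_def divide_simps intro!: add_nonneg_pos)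
      obtain C where C: "C : lim_pyramid" "d_box X C < t * t / 4" using near[of "t * t / 4"] t(1) by auto
      have CK: "C : DD_K" using C(1) by (simp add: lim_pyramid_def)
      have t4: "2 * (t * t / 4) < t * t" using t(1) by simp
      obtain B where B: "B : DM_K N" "class_le B C" "d_box A B <= (real N + 2) * t"
        by (rule d_box_down[OF A(1) N XK CK A(2) C(2) t(1) t4])
      have "B : lim_DM N" using C(1) N B unfolding lim_pyramid_def by blast
      hence "\<forall>\<^sub>F n in sequentially. set_dist B (P n Int DM_K N) < e/2"
        using e by (intro order_tendstoD) (auto simp: lim_DM_def)
      then obtain n where n: "n >= m" "set_dist B (P n Int DM_K N) < e/2"
        by (auto simp: eventually_sequentially) (meson nat_le_linear)
      have "set_dist A (P n Int DM_K N) <= e"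
        using set_dist_lip[OF DM_K_DD[OF A(1)] DM_K_DD[OF B(1)] sub ne[OF N], of n] B(3) t(2) n(2) by linarith
      thus "EX n>=m. set_dist A (P n Int DM_K N) <= e" using n(1) by blast
    qed
    thus ?thesis using XK by (simp add: lim_pyramid_def)
  qed
  moreover have "lim_pyramid <= DD" using DD_K_rep(1) by (auto simp: lim_pyramid_def)
  ultimately show ?thesis unfolding box.metric_closedin_iff_sequentially_closed by blast
qed

text \<open>In P n only finitely many entries of the two frames can be matched, with an error that
  shrinks with k. Directedness puts both matched tuples into one C, where they have a joint law; a
  limit L of these laws has the laws of the two frames on its even and odd coordinates and is
  realised by W. That W belongs to the limit is seen backwards: finitely many coordinates of L are
  close to tuples of members of P n.\<close>

lemma lim_pyramid_directed:
  assumes X: "X : lim_pyramid" and Y: "Y : lim_pyramid"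
  shows "EX W:lim_pyramid. class_le X W & class_le Y W"
proof -
  have XK: "X : DD_K" and YK: "Y : DD_K" using X Y by (auto simp: lim_pyramid_def)
  note XD = DD_K_rep(1)[OF XK] and YD = DD_K_rep(1)[OF YK]
  interpret X: geom_data "rep X" by (rule geom_data_rep[OF XD])
  interpret Y: geom_data "rep Y" by (rule geom_data_rep[OF YD])
  obtain f where f: "frame (rep X) f" by (rule X.ex_frame)
  obtain g where g: "frame (rep Y) g" by (rule Y.ex_frame)
  note fc = X.frame_closure[OF f] and gc = Y.frame_closure[OF g]
  note fm = X.frame_measurable[OF f] and gm = Y.frame_measurable[OF g]
  \<comment> \<open>Half of the error 1 / Suc k is used for matching, half for the exchange of laws
    that moves both tuples into C.\<close>
  let ?e = "%k. 1 / (2 * real (Suc k))"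
  have "EX n C h. k <= n & C : P n & (ALL i. h i : rclosure C)
    & coupled (Suc k) (2 * ?e k) (rlaw X) f (rlaw C) (%i. h (2 * i))
    & coupled (Suc k) (2 * ?e k) (rlaw Y) g (rlaw C) (%i. h (2 * i + 1))" for k
  proof -
    have e: "?e k > 0" and e2: "0 <= ?e k" "?e k < 2 * ?e k" by (auto simp: divide_strict_right_mono)
    have ev: "\<forall>\<^sub>F n in sequentially. k <= n &
      (EX A:P n. EX h. (ALL i. h i : rclosure A) & coupled (Suc k) (?e k) (rlaw X) f (rlaw A) h) &
      (EX A:P n. EX h. (ALL i. h i : rclosure A) & coupled (Suc k) (?e k) (rlaw Y) g (rlaw A) h)"
      by (intro eventually_conj eventually_ge_at_top lim_approx[OF X fc _ e] lim_approx[OF Y gc _ e]) auto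
    obtain n A B f' g' where n: "k <= n" and A: "A : P n" "ALL i. f' i : rclosure A" "coupled (Suc k) (?e k) (rlaw X) f (rlaw A) f'"
      and B: "B : P n" "ALL i. g' i : rclosure B" "coupled (Suc k) (?e k) (rlaw Y) g (rlaw B) g'"
      using eventually_happens'[OF sequentially_bot ev] by blast
    obtain C where C: "C : P n" "class_le A C" "class_le B C" using pyramid_directed[OF pyr A(1) B(1)] by blast
    have K: "C : DD" "A : DD" "B : DD" using A(1) B(1) C(1) pyramid_subset[OF pyr] DD_K_rep(1) by blast+
    obtain T where T: "ALL f:rclosure A. T f : rclosure C"
      "ALL F. (ALL i. F i : rclosure A) --> seq_law (rlaw A) F = seq_law (rlaw C) (%i. T (F i))" by (rule class_leD[OF K(2,1) C(2)])
    obtain S where S: "ALL f:rclosure B. S f : rclosure C"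
      "ALL F. (ALL i. F i : rclosure B) --> seq_law (rlaw B) F = seq_law (rlaw C) (%i. S (F i))" by (rule class_leD[OF K(3,1) C(3)])
    define h where "h i = (if even i then T (f' (i div 2)) else S (g' (i div 2)))" for i
    have h: "h i : rclosure C" for i using T(1) S(1) A(2) B(2) by (simp add: h_def)
    have hm: "h i : borel_measurable (rlaw C)" for i by (rule rclosure_measurable[OF K(1) h])
    have h2: "(%i. h (2 * i)) = (%i. T (f' i))" "(%i. h (2 * i + 1)) = (%i. S (g' i))" by (auto simp: h_def)
    have "coupled (Suc k) (2 * ?e k) (rlaw X) f (rlaw C) (%i. h (2 * i))"
    proof (rule coupled_law[OF A(3) refl _ e2])
      show "seq_law (rlaw A) f' = seq_law (rlaw C) (%i. h (2 * i))" unfolding h2 using T(2) A(2) by blast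
    qed (use fm hm K A(2) rclosure_measurable rlaw_prob XD in auto)
    moreover have "coupled (Suc k) (2 * ?e k) (rlaw Y) g (rlaw C) (%i. h (2 * i + 1))"
    proof (rule coupled_law[OF B(3) refl _ e2])
      show "seq_law (rlaw B) g' = seq_law (rlaw C) (%i. h (2 * i + 1))" unfolding h2 using S(2) B(2) by blast
    qed (use gm hm K B(2) rclosure_measurable rlaw_prob YD in auto)
    ultimately show ?thesis using n C(1) h by blast
  qed
  then obtain n C h where n: "!!k. k <= n k" and C: "!!k. C k : P (n k)" and h: "!!k i. h k i : rclosure (C k)"
    and hf: "!!k. coupled (Suc k) (2 * ?e k) (rlaw X) f (rlaw (C k)) (%i. h k (2 * i))"
    and hg: "!!k. coupled (Suc k) (2 * ?e k) (rlaw Y) g (rlaw (C k)) (%i. h k (2 * i + 1))" by metis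
  have CK: "C k : DD_K" for k using C pyramid_subset[OF pyr] by blast
  note CD = DD_K_rep(1)[OF CK]
  note hm = rclosure_measurable[OF CD h]
  define m where "m k = seq_law (rlaw (C k)) (h k)" for k
  have mp: "prob_space (m k)" for k unfolding m_def by (rule prob_seq_law[OF rlaw_prob[OF CD] hm])
  have ms: "sets (m k) = sets borel" for k by (simp add: m_def)
  have mK: "AE x in m k. ALL i. \<bar>x i\<bar> <= 1/2" for k unfolding m_def by (rule AE_seq_law_bound[OF CK h])
  obtain r L where r: "strict_mono r" and L: "prob_space L" "sets L = sets borel" "AE x in L. ALL i. \<bar>x i\<bar> <= 1/2"
    and cp: "ALL N. ALL e>0. \<forall>\<^sub>F n in sequentially. coupled N e (m (r n)) (%i x. x i) L (%i x. x i)"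
    by (rule cube_laws_compact[OF mp ms mK])
  have cm: "(%x. x i) : borel_measurable L" "(%x. x i) : borel_measurable (m k)" for i k
    using coord_measurable[of i] unfolding measurable_cong_sets[OF L(2) refl] measurable_cong_sets[OF ms refl] by assumption+
  have mc: "seq_law (rlaw (C k)) (%i. h k (c i)) = seq_law (m k) (%i x. x (c i))" for k c
    unfolding m_def by (rule seq_law_reindex[OF hm])
  \<comment> \<open>Used with c i = 2 * i and c i = 2 * i + 1: N entries of F involve the first 2 *
    N coordinates.\<close>
  have law_lim: "seq_law M F = seq_law L (%i x. x (c i))"
    if Fm: "!!i. F i : borel_measurable M" and p: "prob_space M" and c: "!!i N. i < N ==> c i < 2 * N"
      and hF: "!!k. coupled (Suc k) (2 * ?e k) M F (rlaw (C k)) (%i. h k (c i))" for M :: "real measure" and F c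
  proof (rule seq_law_eqI)
    fix N and e :: real assume e: "e > 0"
    have "\<forall>\<^sub>F k in sequentially. coupled (2 * N) (e/3) (m (r k)) (%i x. x i) L (%i x. x i)" using cp e by simp
    hence "\<forall>\<^sub>F k in sequentially. coupled (2 * N) (e/3) (m (r k)) (%i x. x i) L (%i x. x i) & N <= k & 3 / e <= real k"
      by (intro eventually_conj eventually_ge_at_top) (auto intro: eventually_sequentiallyI[of "nat \<lceil>3 / e\<rceil>"] simp: nat_le_iff ceiling_le_iff)
    then obtain k where k: "coupled (2 * N) (e/3) (m (r k)) (%i x. x i) L (%i x. x i)" "N <= k" "3 / e <= real k"
      using eventually_happens[of _ sequentially] by auto
    have "k <= r k" by (rule seq_suble[OF r])
    hence rk: "N <= Suc (r k)" "3 / e <= real (Suc (r k))" using k(2,3) by auto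
    have "2 * ?e (r k) <= e/3" using rk(2) e by (simp add: field_simps)
    hence 1: "coupled N (e/3) M F (rlaw (C (r k))) (%i. h (r k) (c i))" by (rule coupled_mono[OF hF rk(1)])
    have 2: "coupled N (e/3) (m (r k)) (%i x. x (c i)) L (%i x. x (c i))"
      by (rule coupled_reindex[where F = "%i x. x i" and G = "%i x. x i", OF k(1) c])
    have "coupled N (e/3 + e/3 + e/3) M F L (%i x. x (c i))" by (rule coupled_trans[OF 1 2 mc]) (use e Fm hm cm in auto)
    thus "coupled N e M F L (%i x. x (c i))" by simp
  qed (use Fm p L(1) cm in auto)
  have lX: "seq_law (rlaw X) f = seq_law L (%i x. x (2 * i))" by (rule law_lim[OF fm rlaw_prob[OF XD] _ hf]) simp
  have lY: "seq_law (rlaw Y) g = seq_law L (%i x. x (2 * i + 1))" by (rule law_lim[OF gm rlaw_prob[OF YD] _ hg]) simp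
  obtain D where D: "X.dense_points D" by (rule X.dense_seq)
  obtain E where E: "Y.dense_points E" by (rule Y.dense_seq)
  \<comment> \<open>A sequence is uniformly close to another as soon as its even and odd parts are,
    so pairs of dense points suffice for L.\<close>
  define z where "z = (%(a, b) i. if even i then f (i div 2) (D a) else g (i div 2) (E b))"
  have "AE x in L. ALL r>0. EX a. (%i. x (2 * i)) : supball (%i. f i (D a)) r"
  proof (rule AE_distrD[where P = "%x. ALL r>0. EX a. x : supball (%i. f i (D a)) r"])
    show "(%x i. x (2 * i)) : measurable L borel" by (rule seq_measurable) (rule cm)
    show "AE x in distr L borel (%x i. x (2 * i)). ALL r>0. EX a. x : supball (%i. f i (D a)) r"
      using frame_separated[OF X.geometric _ D, of f, OF X.frame_lip[OF f]] unfolding lX unfolding seq_law_def .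
  qed
  moreover have "AE x in L. ALL r>0. EX b. (%i. x (2 * i + 1)) : supball (%i. g i (E b)) r"
  proof (rule AE_distrD[where P = "%x. ALL r>0. EX a. x : supball (%i. g i (E a)) r"])
    show "(%x i. x (2 * i + 1)) : measurable L borel" by (rule seq_measurable) (rule cm)
    show "AE x in distr L borel (%x i. x (2 * i + 1)). ALL r>0. EX a. x : supball (%i. g i (E a)) r"
      using frame_separated[OF Y.geometric _ E, of g, OF Y.frame_lip[OF g]] unfolding lY unfolding seq_law_def .
  qed
  ultimately have sep: "AE x in L. ALL r>0. EX d:range z. x : supball d r"
  proof eventually_elim
    case (elim x)
    show ?case
    proof (intro allI impI)
      fix r :: real assume "r > 0"
      with elim obtain a b where ab: "(%i. x (2 * i)) : supball (%i. f i (D a)) r" "(%i. x (2 * i + 1)) : supball (%i. g i (E b)) r" by blast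
      have "\<bar>x i - z (a, b) i\<bar> <= r" for i
      proof (cases "even i")
        case True
        hence "2 * (i div 2) = i" by simp
        moreover have "\<bar>x (2 * (i div 2)) - f (i div 2) (D a)\<bar> <= r" using ab(1) unfolding supball_def by blast
        ultimately show ?thesis using True by (simp add: z_def)
      next
        case False
        hence "2 * (i div 2) + 1 = i" by (rule odd_two_times_div_two_succ)
        moreover have "\<bar>x (2 * (i div 2) + 1) - g (i div 2) (E b)\<bar> <= r" using ab(2) unfolding supball_def by blast
        ultimately show ?thesis using False by (simp add: z_def)
      qed
      thus "EX d:range z. x : supball d r" unfolding supball_def by blast
    qed
  qed
  have zb: "\<bar>z ab i\<bar> <= 1/2" for ab i
    using rclosure_bound[OF XK fc X.dense_pointsD(1)[OF D]] rclosure_bound[OF YK gc Y.dense_pointsD(1)[OF E]]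
    by (cases ab) (simp add: z_def)
  have fin: "EX c. ALL i. \<bar>d i - d' i\<bar> <= c" if d: "d : range z" "d' : range z" for d d'
  proof (intro exI[of _ 1] allI)
    fix i
    have "\<bar>d i\<bar> <= 1/2" "\<bar>d' i\<bar> <= 1/2" using d zb by blast+
    thus "\<bar>d i - d' i\<bar> <= 1" by linarith
  qed
  obtain W Fw where WD: "W : DD" and Fw: "frame (rep W) Fw" "seq_law (rlaw W) Fw = L"
    and WK': "(AE x in L. ALL i. \<bar>x i\<bar> <= 1/2) --> W : DD_K"
    by (rule ex_class_with_law[OF L(1,2) _ fin sep]) auto
  have WK: "W : DD_K" using WK' L(3) by blast
  interpret W: geom_data "rep W" by (rule geom_data_rep[OF WD])
  note Fc = W.frame_closure[OF Fw(1)] and Fm = W.frame_measurable[OF Fw(1)]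
  have Wc: "seq_law (rlaw W) (%i. Fw (c i)) = seq_law L (%i x. x (c i))" for c
    using seq_law_reindex[where F = Fw and c = c, OF Fm] unfolding Fw(2) .
  have "class_le X W" by (rule class_leI[OF XD WD f, of "%i. Fw (2 * i)"]) (use Fc lX Wc[of "%i. 2 * i"] in simp_all)
  moreover have "class_le Y W" by (rule class_leI[OF YD WD g, of "%i. Fw (2 * i + 1)"]) (use Fc lY Wc[of "%i. 2 * i + 1"] in simp_all)
  moreover have "A : lim_DM N" if N: "N >= 1" and A: "A : DM_K N" "class_le A W" for N A
  proof (rule lim_DM_I[OF N A(1)])
    fix e :: real and k0 assume e: "e > 0"
    define t where "t = e / (real N + 2)"
    have t: "t > 0" "(real N + 2) * t = e" using e by (auto simp: t_def field_simps intro!: add_nonneg_pos)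
    \<comment> \<open>The errors add up to 2 * d + d + d + d, from approximation by the frame, the
      limit and the exchanges of laws, and must stay below t * t.\<close>
    define d where "d = t * t / 8"
    have d: "d > 0" "0 <= d" "2 * d > 0" "5 * d < t * t" "d < 2 * d" using t(1) by (auto simp: d_def)
    note AD = DM_K_DD[OF A(1)]
    interpret A: geom_data "rep A" by (rule geom_data_rep[OF AD])
    obtain F where F: "enum N A F" by (rule ex_enum[OF A(1) N])
    note Ff = enum_frame(1)[OF AD F N]
    note AF = A.frame_closure[OF Ff] and AFm = A.frame_measurable[OF Ff]
    obtain T where T: "ALL f:rclosure A. T f : rclosure W"
      "ALL F. (ALL i. F i : rclosure A) --> seq_law (rlaw A) F = seq_law (rlaw W) (%i. T (F i))" by (rule class_leD[OF AD WD A(2)])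
    have TF: "T (F i) : rclosure W" for i using T(1) AF by blast
    note TFm = rclosure_measurable[OF WD TF]
    have "ALL i. EX c. (L1 (rlaw W) (T (F i)) (Fw c)) <= ennreal d" using frame_L1_approx[OF WK Fw(1) TF d(1)] by blast
    then obtain c where c: "!!i. (L1 (rlaw W) (T (F i)) (Fw (c i))) <= ennreal d" by metis
    have "coupled N d (rlaw W) (%i. T (F i)) (rlaw W) (%i. Fw (c i))"
      by (rule coupled_same[OF rlaw_prob[OF WD]]) (use TFm Fm c in auto)
    hence 1: "coupled N (2 * d) (rlaw A) F L (%i x. x (c i))"
      by (rule coupled_law) (use T(2) AF Wc TFm Fm AFm cm d rlaw_prob[OF AD] L(1) in auto)
    \<comment> \<open>One more than the largest frame index in use, since L is approached in
      finitely many coordinates at a time.\<close>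
    define I where "I = Suc (Max (c ` {..<N}))"
    have I: "c i < I" if "i < N" for i using that by (simp add: I_def le_imp_less_Suc)
    have "\<forall>\<^sub>F k in sequentially. coupled I d (m (r k)) (%i x. x i) L (%i x. x i)" using cp d(1) by blast
    hence "\<forall>\<^sub>F k in sequentially. coupled I d (m (r k)) (%i x. x i) L (%i x. x i) & k0 <= k"
      by (intro eventually_conj eventually_ge_at_top)
    then obtain k where k: "coupled I d (m (r k)) (%i x. x i) L (%i x. x i)" "k0 <= k"
      using eventually_happens[of _ sequentially] by auto
    have "coupled N d (m (r k)) (%i x. x (c i)) L (%i x. x (c i))"
      by (rule coupled_reindex[where F = "%i x. x i" and G = "%i x. x i", OF k(1) I])
    hence 2: "coupled N d L (%i x. x (c i)) (m (r k)) (%i x. x (c i))" by (rule coupled_sym) (rule cm)+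
    have "coupled N (2 * d + d + d) (rlaw A) F (m (r k)) (%i x. x (c i))"
      by (rule coupled_trans[OF 1 2 refl d(1)]) (use d AFm cm in auto)
    hence 3: "coupled N (2 * d + d + d + d) (rlaw A) F (rlaw (C (r k))) (%i. h (r k) (c i))"
      by (rule coupled_law_right[OF _ mc[symmetric] d(1)]) (use d AFm cm hm rlaw_prob[OF CD] in auto)
    have d5: "0 <= 2 * d + d + d + d" "2 * d + d + d + d < t * t" using d by auto
    obtain B where B: "B : DM_K N" "class_le B (C (r k))" "d_box A B <= (real N + 2) * t"
      by (rule approx_below[OF A(1) F CK N h 3 t(1) d5])
    have BP: "B : P (n (r k)) Int DM_K N" using pyramid_down[OF pyr C DM_K_DD_K[OF B(1)] B(2)] B(1) by blast
    have "set_dist A (P (n (r k)) Int DM_K N) <= e" using set_dist_le[OF BP, of A] B(3) t(2) by simp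
    moreover have "k0 <= n (r k)" using k(2) seq_suble[OF r, of k] n[of "r k"] by linarith
    ultimately show "EX n>=k0. set_dist A (P n Int DM_K N) <= e" by blast
  qed
  hence "W : lim_pyramid" using WK by (simp add: lim_pyramid_def)
  ultimately show ?thesis by blast
qed

lemma lim_pyramid_Pi_K: "lim_pyramid : Pi_K"
proof -
  have "B : lim_pyramid" if A: "A : lim_pyramid" and B: "B : DD_K" "class_le B A" for A B
  proof -
    have AD: "A : DD" using A DD_K_rep(1) by (simp add: lim_pyramid_def)
    have "class_le C A" if "C : DM_K N" "class_le C B" for C N
      by (rule class_le_trans[OF DM_K_DD[OF that(1)] DD_K_rep(1)[OF B(1)] AD that(2) B(2)])
    thus ?thesis using A B(1) unfolding lim_pyramid_def by blast
  qed
  thus ?thesis unfolding Pi_K_def K_pyramid_def using lim_pyramid_ne lim_pyramid_closed lim_pyramid_directed by (auto simp: lim_pyramid_def)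
qed

lemma lim_pyramid_limit: "(%n. d_Pi (P n) lim_pyramid) \<longlonglongrightarrow> 0"
proof (rule metric_LIMSEQ_I)
  fix e :: real assume e: "e > 0"
  obtain N0 where N0: "(1/2) ^ N0 < e/2" using real_arch_pow_inv[of "e/2" "1/2"] e by auto
  have e2: "e/2 > 0" using e by simp
  have "\<forall>\<^sub>F n in sequentially. ALL N:{1..N0}. box_H N (P n) lim_pyramid <= ennreal (e/2)"
    by (rule eventually_ball_finite) (use box_H_lim e2 in auto)
  hence "\<forall>\<^sub>F n in sequentially. dist (d_Pi (P n) lim_pyramid) 0 < e"
  proof eventually_elim
    case (elim n)
    have "d_Pi (P n) lim_pyramid <= e/2 + (1/2) ^ N0" by (rule d_Pi_bound[OF pyr lim_pyramid_Pi_K]) (use elim e in auto)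
    thus ?case using N0 by (simp add: dist_real_def d_Pi_alt)
  qed
  thus "EX no. ALL n>=no. dist (d_Pi (P n) lim_pyramid) 0 < e" by (simp add: eventually_sequentially)
qed

end

text \<open>Diagonal extraction over the countably many pairs of a level and a net element; the
  Lipschitz bound for \<open>set_dist\<close> extends convergence to every class of the
  level.\<close>

lemma pyramid_subsequence:
  assumes \<sigma>: "!!n. \<sigma> n : Pi_K"
  obtains r where "strict_mono (r :: nat => nat)" "pyramid_limit (%n. \<sigma> (r n))"
proof -
  have "ALL N. ALL k. EX E. N >= 1 --> finite E & E <= DM_K N & (ALL A:DM_K N. EX B:E. d_box A B < 1 / Suc k)"
  proof (intro allI)
    fix N k
    show "EX E. N >= 1 --> finite E & E <= DM_K N & (ALL A:DM_K N. EX B:E. d_box A B < 1 / Suc k)"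
    proof (cases "N >= 1")
      case True
      have k: "1 / real (Suc k) > 0" by simp
      obtain E where "finite E" "E <= DM_K N" "ALL A:DM_K N. EX B:E. d_box A B < 1 / Suc k" by (rule DM_K_net[OF True order_refl k])
      thus ?thesis by blast
    qed simp
  qed
  then obtain E where E: "!!N k. N >= 1 ==> finite (E N k)" "!!N k. N >= 1 ==> E N k <= DM_K N"
    "!!N k A. N >= 1 ==> A : DM_K N ==> EX B:E N k. d_box A B < 1 / Suc k" by metis
  define I where "I = (SIGMA N:{1..}. \<Union>k. E N k)"
  have cI: "countable I" unfolding I_def using E(1) by (intro countable_SIGMA countable_UN) (auto intro: countable_finite)
  have "DM_K 1 ~= {}" using pyramid_DM_ne[OF \<sigma>, where N = 1] by blast
  hence "E 1 0 ~= {}" using E(3)[of 1] by blast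
  hence "I ~= {}" unfolding I_def by auto
  then obtain q :: "nat => nat \<times> data_class" where q: "range q = I" using uncountable_def cI by metis
  define y where "y n = (%j. set_dist (snd (q j)) (\<sigma> n Int DM_K (fst (q j))))" for n
  have "compactin (product_topology (%_. euclideanreal) UNIV) (PiE (UNIV :: nat set) (%_. {0..1}))"
    by (subst compactin_PiE) auto
  hence "compact (PiE (UNIV :: nat set) (%_. {0..1::real}))" by (simp add: euclidean_product_topology)
  hence sc: "seq_compact (PiE (UNIV :: nat set) (%_. {0..1::real}))" by (rule compact_imp_seq_compact)
  have "y n : PiE UNIV (%_. {0..1})" for n
  proof (rule PiE_I)
    fix j
    have "fst (q j) >= 1" using rangeI[of q j] unfolding q I_def by auto
    hence "\<sigma> n Int DM_K (fst (q j)) ~= {}" by (rule pyramid_DM_ne[OF \<sigma>])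
    thus "y n j : {0..1}" unfolding y_def using set_dist_nonneg set_dist_le_1 by simp
  qed simp
  then obtain l r where r: "strict_mono r" "(y \<circ> r) \<longlonglongrightarrow> l" using seq_compactE[OF sc, of y] by blast
  have cv: "convergent (%n. set_dist B (\<sigma> (r n) Int DM_K N))" if NB: "(N, B) : I" for N B
  proof -
    obtain j where j: "q j = (N, B)" using NB unfolding q[symmetric] image_iff by metis
    have "(%n. (y \<circ> r) n j) \<longlonglongrightarrow> l j"
      by (rule continuous_on_tendsto_compose[OF continuous_on_product_coordinates r(2)]) auto
    thus ?thesis by (auto simp: y_def j convergent_def)
  qed
  have "convergent (%n. set_dist A (\<sigma> (r n) Int DM_K N))" if N: "N >= 1" and A: "A : DM_K N" for N A
  proof -
    have sd: "\<sigma> n Int DM_K N <= DD" for n using DM_K_DD by blast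
    have "Cauchy (%n. set_dist A (\<sigma> (r n) Int DM_K N))"
    proof (rule metric_CauchyI)
      fix e :: real assume e: "e > 0"
      obtain k where k: "1 / Suc k < e/3" using nat_approx_posE[of "e/3"] e by auto
      obtain B where B: "B : E N k" "d_box A B < 1 / Suc k" using E(3)[OF N A] by blast
      have BN: "B : DM_K N" using E(2)[OF N] B(1) by blast
      have NB: "(N, B) : I" using N B(1) unfolding I_def by blast
      obtain M where M: "!!i j. i >= M ==> j >= M ==> dist (set_dist B (\<sigma> (r i) Int DM_K N)) (set_dist B (\<sigma> (r j) Int DM_K N)) < e/3"
        using metric_CauchyD[OF convergent_Cauchy[OF cv[OF NB]], of "e/3"] e by auto
      have *: "\<bar>set_dist A (\<sigma> (r i) Int DM_K N) - set_dist B (\<sigma> (r i) Int DM_K N)\<bar> <= d_box A B" for i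
        using set_dist_lip[OF DM_K_DD[OF A] DM_K_DD[OF BN] sd[of "r i"] pyramid_DM_ne[OF \<sigma> N]]
          set_dist_lip[OF DM_K_DD[OF BN] DM_K_DD[OF A] sd[of "r i"] pyramid_DM_ne[OF \<sigma> N]] d_box_commute[of A B] by linarith
      have "dist (set_dist A (\<sigma> (r i) Int DM_K N)) (set_dist A (\<sigma> (r j) Int DM_K N)) < e" if "i >= M" "j >= M" for i j
        using M[OF that] *[of i] *[of j] B(2) k unfolding dist_real_def by linarith
      thus "EX M. ALL i>=M. ALL j>=M. dist (set_dist A (\<sigma> (r i) Int DM_K N)) (set_dist A (\<sigma> (r j) Int DM_K N)) < e" by blast
    qed
    thus ?thesis by (rule Cauchy_convergent)
  qed
  hence "pyramid_limit (%n. \<sigma> (r n))" using \<sigma> by unfold_locales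
  with r(1) show thesis by (rule that)
qed

interpretation pi: Metric_space Pi_K d_Pi by (rule Metric_space_d_Pi)

theorem compact_Pi_K: "compact_space pi.mtopology" unfolding pi.compact_space_sequentially
proof (intro allI impI)
  fix \<sigma> :: "nat => data_class set" assume \<sigma>: "range \<sigma> <= Pi_K"
  hence \<sigma>': "\<sigma> n : Pi_K" for n by blast
  obtain r where r: "strict_mono (r :: nat => nat)" "pyramid_limit (%n. \<sigma> (r n))" by (rule pyramid_subsequence[OF \<sigma>'])
  interpret L: pyramid_limit "%n. \<sigma> (r n)" by (rule r(2))
  have "limitin pi.mtopology (\<sigma> \<circ> r) L.lim_pyramid sequentially"
    unfolding pi.limitin_metric_dist_null using L.lim_pyramid_Pi_K L.lim_pyramid_limit \<sigma>' by (auto intro!: always_eventually)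
  thus "EX l r. l : Pi_K & strict_mono r & limitin pi.mtopology (\<sigma> \<circ> r) l sequentially"
    using r(1) L.lim_pyramid_Pi_K by blast
qed

section \<open>The compact screen\<close>

text \<open>The quotient of Cauchy sequences is compared with an arbitrary complete space m' in which
  M embeds isometrically and densely: a class corresponds to the common limit of its members.\<close>

lemma (in Metric_space) completion_model:
  obtains f :: "'a => 'a => real" and m' pt where "mcomplete_of m'" "bij_betw pt (completion M d) (mspace m')"
    "ALL A:completion M d. ALL B:completion M d. completion_dist M d A B = mdist m' (pt A) (pt B)"
    "ALL x:M. completion_map M d x : completion M d & pt (completion_map M d x) = f x"
    "ALL x:M. ALL y:M. mdist m' (f x) (f y) = d x y"
    "ALL x:mspace m'. EX s. range s <= M & (%n. mdist m' (f (s n)) x) \<longlonglongrightarrow> 0"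
proof -
  obtain f :: "'a => 'a => real" and m' where m': "mcomplete_of m'" and f: "f : M \<rightarrow> mspace m'"
    and cl: "mtopology_of m' closure_of f ` M = mspace m'" and iso: "!!x y. [|x : M; y : M|] ==> mdist m' (f x) (f y) = d x y"
    by (rule metric_completion) blast
  interpret N: Metric_space "mspace m'" "mdist m'" by simp
  have Nc: N.mcomplete using m' by (simp add: mcomplete_of_def)
  have NC: "N.MCauchy (%n. f (s n)) \<longleftrightarrow> MCauchy s" if "range s <= M" for s
    using that f iso unfolding N.MCauchy_def MCauchy_def by (auto simp: image_subset_iff Pi_iff)
  define lm where "lm s = (SOME x. x : mspace m' & (%n. mdist m' (f (s n)) x) \<longlonglongrightarrow> 0)" for s
  have lm: "lm s : mspace m'" "(%n. mdist m' (f (s n)) (lm s)) \<longlonglongrightarrow> 0" if s: "MCauchy s" for s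
  proof -
    have sM: "range s <= M" using s by (simp add: MCauchy_def)
    then obtain x where "limitin N.mtopology (%n. f (s n)) x sequentially" using NC[OF sM] s Nc unfolding N.mcomplete_def by blast
    hence "x : mspace m' & (%n. mdist m' (f (s n)) x) \<longlonglongrightarrow> 0" unfolding N.limitin_metric_dist_null by blast
    from someI[of "%x. x : mspace m' & (%n. mdist m' (f (s n)) x) \<longlonglongrightarrow> 0", OF this]
    show "lm s : mspace m'" "(%n. mdist m' (f (s n)) (lm s)) \<longlonglongrightarrow> 0" unfolding lm_def by blast+
  qed
  \<comment> \<open>Distances along two sequences converge to the distance of the limits; this
    yields both the equivalence relation and the metric of the completion.\<close>
  have ld: "(%n. d (s n) (t n)) \<longlonglongrightarrow> mdist m' x y"
    if s: "range s <= M" "x : mspace m'" "(%n. mdist m' (f (s n)) x) \<longlonglongrightarrow> 0"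
      and t: "range t <= M" "y : mspace m'" "(%n. mdist m' (f (t n)) y) \<longlonglongrightarrow> 0" for s t x y
  proof (rule LIMSEQ_I)
    fix e :: real assume "e > 0"
    hence "0 < e/2" by simp
    hence "\<forall>\<^sub>F n in sequentially. mdist m' (f (s n)) x < e/2" "\<forall>\<^sub>F n in sequentially. mdist m' (f (t n)) y < e/2"
      by (rule order_tendstoD(2)[OF s(3)], rule order_tendstoD(2)[OF t(3)])
    hence "\<forall>\<^sub>F n in sequentially. norm (d (s n) (t n) - mdist m' x y) < e"
    proof eventually_elim
      case (elim n)
      have m: "f (s n) : mspace m'" "f (t n) : mspace m'" "s n : M" "t n : M" using s(1) t(1) f by auto
      have i: "mdist m' (f (s n)) (f (t n)) = d (s n) (t n)" using m iso by blast
      have "mdist m' (f (s n)) (f (t n)) <= mdist m' (f (s n)) x + (mdist m' x y + mdist m' y (f (t n)))"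
        using N.triangle[of "f (s n)" x "f (t n)"] N.triangle[of x y "f (t n)"] m s(2) t(2) by linarith
      moreover have "mdist m' x y <= mdist m' x (f (s n)) + (mdist m' (f (s n)) (f (t n)) + mdist m' (f (t n)) y)"
        using N.triangle[of x "f (s n)" y] N.triangle[of "f (s n)" "f (t n)" y] m s(2) t(2) by linarith
      moreover have "mdist m' y (f (t n)) = mdist m' (f (t n)) y" "mdist m' x (f (s n)) = mdist m' (f (s n)) x" by (rule N.commute)+
      ultimately show ?case using elim i unfolding real_norm_def by linarith
    qed
    thus "EX no. ALL n>=no. norm (d (s n) (t n) - mdist m' x y) < e" by (simp add: eventually_sequentially)
  qed
  have uq: "lm s = x" if "MCauchy s" "x : mspace m'" "(%n. mdist m' (f (s n)) x) \<longlonglongrightarrow> 0" for s x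
  proof -
    have sM: "range s <= M" using that by (simp add: MCauchy_def)
    hence "d (s n) (s n) = 0" for n by (simp add: range_subsetD)
    hence "(%n. 0) \<longlonglongrightarrow> mdist m' (lm s) x" using ld[OF sM lm[OF that(1)] sM that(2,3)] by simp
    thus ?thesis using that lm(1)[OF that(1)] by (simp add: LIMSEQ_const_iff)
  qed
  have rel: "(s, t) : cauchy_rel M d \<longleftrightarrow> MCauchy s & MCauchy t & lm s = lm t" for s t
  proof -
    have "(%n. d (s n) (t n)) \<longlonglongrightarrow> 0 \<longleftrightarrow> lm s = lm t" if st: "MCauchy s" "MCauchy t"
    proof -
      have "range s <= M" "range t <= M" using st by (auto simp: MCauchy_def)
      hence l: "(%n. d (s n) (t n)) \<longlonglongrightarrow> mdist m' (lm s) (lm t)" using ld lm st by blast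
      show ?thesis using l LIMSEQ_unique[OF l, of 0] lm(1)[OF st(1)] lm(1)[OF st(2)] by auto
    qed
    thus ?thesis unfolding cauchy_rel_def by auto
  qed
  define pt where "pt A = lm (SOME s. s : A)" for A
  have cls: "cauchy_rel M d `` {s} : completion M d" "pt (cauchy_rel M d `` {s}) = lm s" if "MCauchy s" for s
  proof -
    show "cauchy_rel M d `` {s} : completion M d" unfolding completion_def using that by (intro quotientI) simp
    have "s : cauchy_rel M d `` {s}" using that rel by simp
    from someI[of "%t. t : cauchy_rel M d `` {s}", OF this] show "pt (cauchy_rel M d `` {s}) = lm s"
      unfolding pt_def using rel by auto
  qed
  have ex: "EX s. MCauchy s & A = cauchy_rel M d `` {s}" if "A : completion M d" for A
    using that unfolding completion_def by (auto elim!: quotientE)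
  have some: "MCauchy (SOME s. s : A)" if "A : completion M d" for A
  proof -
    obtain s where s: "MCauchy s" "A = cauchy_rel M d `` {s}" using ex[OF \<open>A : completion M d\<close>] by blast
    hence "s : A" using rel by simp
    from someI[of "%s. s : A", OF this] have "(SOME s. s : A) : A" .
    thus ?thesis using s(2) rel by auto
  qed
  show thesis
  proof (rule that[OF m', of pt f])
    have "A = B" if AB: "A : completion M d" "B : completion M d" "pt A = pt B" for A B
    proof -
      obtain s t where s: "MCauchy s" "A = cauchy_rel M d `` {s}" and t: "MCauchy t" "B = cauchy_rel M d `` {t}" using ex AB by blast
      hence "lm s = lm t" using AB(3) cls(2) by simp
      thus ?thesis using s t rel by auto
    qed
    hence inj: "inj_on pt (completion M d)" by (rule inj_onI)
    have dense: "EX s. range s <= M & (%n. mdist m' (f (s n)) x) \<longlonglongrightarrow> 0" if x: "x : mspace m'" for x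
    proof -
      have "x : N.mtopology closure_of f ` M" using cl x by (simp add: mtopology_of_def)
      then obtain \<sigma> where \<sigma>: "range \<sigma> <= f ` M" "limitin N.mtopology \<sigma> x sequentially"
        unfolding N.closure_of_sequentially by auto
      hence "ALL n. EX y:M. \<sigma> n = f y" by blast
      then obtain s where s: "!!n. s n : M" "!!n. \<sigma> n = f (s n)" by metis
      have "\<sigma> = (%n. f (s n))" using s(2) by blast
      hence "(%n. mdist m' (f (s n)) x) \<longlonglongrightarrow> 0" using \<sigma>(2) unfolding N.limitin_metric_dist_null by blast
      thus ?thesis using s(1) by (intro exI[of _ s]) auto
    qed
    thus "ALL x:mspace m'. EX s. range s <= M & (%n. mdist m' (f (s n)) x) \<longlonglongrightarrow> 0" by blast
    have "x : pt ` completion M d" if x: "x : mspace m'" for x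
    proof -
      obtain s where s: "range s <= M" "(%n. mdist m' (f (s n)) x) \<longlonglongrightarrow> 0" using dense[OF x] by blast
      have "limitin N.mtopology (%n. f (s n)) x sequentially"
        unfolding N.limitin_metric_dist_null using x s f by (auto intro!: always_eventually)
      hence "N.MCauchy (%n. f (s n))" by (rule N.convergent_imp_MCauchy[rotated]) (use s f in auto)
      hence Cs: "MCauchy s" using NC[OF s(1)] by simp
      hence "pt (cauchy_rel M d `` {s}) = x" using cls(2) uq[OF Cs x s(2)] by simp
      thus ?thesis using cls(1)[OF Cs] by blast
    qed
    moreover have "pt A : mspace m'" if "A : completion M d" for A unfolding pt_def by (rule lm(1)[OF some[OF that]])
    ultimately show "bij_betw pt (completion M d) (mspace m')" using inj unfolding bij_betw_def by blast
    show "ALL A:completion M d. ALL B:completion M d. completion_dist M d A B = mdist m' (pt A) (pt B)"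
    proof (intro ballI)
      fix A B assume AB: "A : completion M d" "B : completion M d"
      note sA = some[OF AB(1)] and sB = some[OF AB(2)]
      have "(%n. d ((SOME s. s : A) n) ((SOME t. t : B) n)) \<longlonglongrightarrow> mdist m' (pt A) (pt B)"
        unfolding pt_def by (rule ld) (use lm sA sB in \<open>auto simp: MCauchy_def\<close>)
      thus "completion_dist M d A B = mdist m' (pt A) (pt B)" unfolding completion_dist_def using AB limI by auto
    qed
    show "ALL x:M. completion_map M d x : completion M d & pt (completion_map M d x) = f x"
    proof
      fix x assume x: "x : M"
      hence c: "MCauchy (%_. x)" by simp
      have fx: "f x : mspace m'" using f x by blast
      have "lm (%_. x) = f x" by (rule uq[OF c fx]) (use fx in simp)
      thus "completion_map M d x : completion M d & pt (completion_map M d x) = f x"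
        using cls[OF c] unfolding completion_map_def by simp
    qed
  qed (use iso in blast)
qed

context Metric_space
begin

lemma Metric_space_completion: "Metric_space (completion M d) (completion_dist M d)" (is ?A)
  and mcomplete_completion: "Metric_space.mcomplete (completion M d) (completion_dist M d)" (is ?B)
  and completion_map: "x : M ==> completion_map M d x : completion M d"
  and completion_dist_map: "x : M ==> y : M ==>
    completion_dist M d (completion_map M d x) (completion_map M d y) = d x y"
  and completion_dense: "A : completion M d ==>
    EX s. range s <= M & (%n. completion_dist M d (completion_map M d (s n)) A) \<longlonglongrightarrow> 0"
proof -
  obtain f :: "'a => 'a => real" and m' pt where m': "mcomplete_of m'" and pt: "bij_betw pt (completion M d) (mspace m')"
    and cd: "ALL A:completion M d. ALL B:completion M d. completion_dist M d A B = mdist m' (pt A) (pt B)"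
    and e: "ALL x:M. completion_map M d x : completion M d & pt (completion_map M d x) = f x"
    and iso: "ALL x:M. ALL y:M. mdist m' (f x) (f y) = d x y"
    and dense: "ALL x:mspace m'. EX s. range s <= M & (%n. mdist m' (f (s n)) x) \<longlonglongrightarrow> 0"
    by (rule completion_model)
  interpret N: Metric_space "mspace m'" "mdist m'" by simp
  have Nc: N.mcomplete using m' by (simp add: mcomplete_of_def)
  have ptm: "A : completion M d ==> pt A : mspace m'" for A using pt by (auto simp: bij_betw_def)
  have pti: "A : completion M d ==> B : completion M d ==> pt A = pt B \<longleftrightarrow> A = B" for A B
    using pt by (auto simp: bij_betw_def inj_on_def)
  show A: ?A
  proof
    fix A B C
    show "0 <= completion_dist M d A B" using cd by (cases "A : completion M d & B : completion M d") (auto simp: completion_dist_def)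
    show "completion_dist M d A B = completion_dist M d B A"
      using cd N.commute by (cases "A : completion M d & B : completion M d") (auto simp: completion_dist_def)
    assume AB: "A : completion M d" "B : completion M d"
    thus "completion_dist M d A B = 0 \<longleftrightarrow> A = B" using cd ptm pti by simp
    assume C: "C : completion M d"
    show "completion_dist M d A C <= completion_dist M d A B + completion_dist M d B C"
      using cd AB C N.triangle[OF ptm[OF AB(1)] ptm[OF AB(2)] ptm[OF C]] by simp
  qed
  interpret C: Metric_space "completion M d" "completion_dist M d" by (rule A)
  show ?B unfolding C.mcomplete_def
  proof (intro allI impI)
    fix \<sigma> assume \<sigma>: "C.MCauchy \<sigma>"
    hence \<sigma>C: "!!n. \<sigma> n : completion M d" by (auto simp: C.MCauchy_def)
    have "N.MCauchy (%n. pt (\<sigma> n))" using \<sigma> cd \<sigma>C ptm unfolding C.MCauchy_def N.MCauchy_def by (auto simp: image_subset_iff)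
    then obtain x where x: "limitin N.mtopology (%n. pt (\<sigma> n)) x sequentially" using Nc unfolding N.mcomplete_def by blast
    hence "x : mspace m'" by (simp add: N.limitin_metric_dist_null)
    then obtain A where A: "A : completion M d" "x = pt A" using pt by (auto simp: bij_betw_def)
    have "limitin C.mtopology \<sigma> A sequentially"
      using x A cd \<sigma>C unfolding C.limitin_metric_dist_null N.limitin_metric_dist_null by simp
    thus "EX x. limitin C.mtopology \<sigma> x sequentially" by blast
  qed
  show "x : M ==> completion_map M d x : completion M d" using e by blast
  show "x : M ==> y : M ==> completion_dist M d (completion_map M d x) (completion_map M d y) = d x y"
    using e cd iso by simp
  show "EX s. range s <= M & (%n. completion_dist M d (completion_map M d (s n)) A) \<longlonglongrightarrow> 0" if A: "A : completion M d"
  proof -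
    obtain s where s: "range s <= M" "(%n. mdist m' (f (s n)) (pt A)) \<longlonglongrightarrow> 0" using dense ptm[OF A] by blast
    have "completion_dist M d (completion_map M d (s n)) A = mdist m' (f (s n)) (pt A)" for n using cd e s(1) A by (simp add: range_subsetD)
    thus ?thesis using s by (intro exI[of _ s]) simp
  qed
qed

end

section \<open>The screen as a geometric data set\<close>

context geom_data
begin

lemma tau_dist_eq: "x : points X ==> y : points X ==> tau_dist X x y = (SUP h\<in>tau_features X. \<bar>h x - h y\<bar>)"
  unfolding tau_dist_def feature_dist_def by simp

lemma tau_features_bdd: "x : points X ==> y : points X ==> bdd_above ((%h. \<bar>h x - h y\<bar>) ` tau_features X)"
  using tau_features_lip unfolding lip_def by (intro bdd_aboveI[of _ "data_dist X x y"]) auto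

lemma tau_dist_upper:
  "f : features X ==> x : points X ==> y : points X ==> \<bar>tau (f x) - tau (f y)\<bar> <= tau_dist X x y"
  using cSUP_upper[OF _ tau_features_bdd[of x y], of "compose (points X) tau f"] by (auto simp: tau_dist_eq tau_features_def compose_def)

lemma tau_dist_least:
  assumes "x : points X" "y : points X" "!!f. f : features X ==> \<bar>tau (f x) - tau (f y)\<bar> <= c"
  shows "tau_dist X x y <= c" unfolding tau_dist_eq[OF assms(1,2)]
  by (rule cSUP_least[OF tau_features_ne]) (use assms in \<open>auto simp: tau_features_def compose_def\<close>)

lemma tau_dist_le_data_dist:
  assumes x: "x : points X" "y : points X" shows "tau_dist X x y <= data_dist X x y"
proof (rule tau_dist_least[OF x])
  fix f assume f: "f : features X"
  have "\<bar>tau (f x) - tau (f y)\<bar> <= \<bar>f x - f y\<bar> / 2" by (rule tau_contract)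
  also have "\<dots> <= \<bar>f x - f y\<bar>" by simp
  also note feature_dist_le[OF f x]
  finally show "\<bar>tau (f x) - tau (f y)\<bar> <= data_dist X x y" .
qed

lemma tau_dist_outside: "\<not> (x : points X & y : points X) ==> tau_dist X x y = 0"
  unfolding tau_dist_def feature_dist_def by (simp only: if_False)

lemma tau_dist_nonneg: "0 <= tau_dist X x y"
proof (cases "x : points X & y : points X")
  case True
  obtain f where "f : features X" using features_ne by blast
  thus ?thesis using tau_dist_upper[of f x y] True by force
qed (simp add: tau_dist_outside)

lemma tau_dist_commute: "tau_dist X x y = tau_dist X y x" unfolding tau_dist_def feature_dist_def by (simp add: abs_minus_commute)

sublocale tau: Metric_space "points X" "tau_dist X"
proof
  fix x y z
  show "0 <= tau_dist X x y" by (rule tau_dist_nonneg)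
  show "tau_dist X x y = tau_dist X y x" by (rule tau_dist_commute)
  assume x: "x : points X" and y: "y : points X"
  show "tau_dist X x y = 0 \<longleftrightarrow> x = y"
  proof
    assume z: "tau_dist X x y = 0"
    have "\<bar>f x - f y\<bar> <= 0" if "f : features X" for f
    proof -
      have "tau (f x) = tau (f y)" using tau_dist_upper[OF that x y] z by simp
      thus ?thesis using tau_strict_mono by (simp add: strict_mono_eq)
    qed
    hence "data_dist X x y <= 0" by (rule data_dist_le[OF x y])
    thus "x = y" using x y nonneg[of x y] zero[OF x y] by linarith
  qed (use tau_dist_least[OF x y, of 0] tau_dist_nonneg[of x y] in \<open>auto intro: antisym\<close>)
  assume w: "z : points X"
  show "tau_dist X x z <= tau_dist X x y + tau_dist X y z"
  proof (rule tau_dist_least[OF x w])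
    fix f assume f: "f : features X"
    show "\<bar>tau (f x) - tau (f z)\<bar> <= tau_dist X x y + tau_dist X y z"
      using tau_dist_upper[OF f x y] tau_dist_upper[OF f y w] by linarith
  qed
qed

abbreviation "hat \<equiv> completion (points X) (tau_dist X)"
abbreviation "hat_dist \<equiv> completion_dist (points X) (tau_dist X)"

sublocale hat: Metric_space hat hat_dist by (rule tau.Metric_space_completion)

lemma hat_topology: "tau_completion_topology X = hat.mtopology" by (simp add: tau_completion_topology_def completion_topology_def)

lemma embedding_hat [simp]: "x : points X ==> tau_embedding X x : hat"
  and embedding_dist: "x : points X ==> y : points X ==> hat_dist (tau_embedding X x) (tau_embedding X y) = tau_dist X x y"
  and embedding_dense: "A : hat ==> EX s. range s <= points X & (%n. hat_dist (tau_embedding X (s n)) A) \<longlonglongrightarrow> 0"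
  unfolding tau_embedding_def using tau.completion_map tau.completion_dist_map tau.completion_dense by blast+

text \<open>Compactified features are 1-Lipschitz for \<open>tau_dist\<close>, so their limits along
  approximating sequences exist and are 1-Lipschitz on the completion.\<close>

lemma ex_extension:
  assumes f: "f : features X"
  obtains g where "g : extensional hat" "ALL A:hat. ALL B:hat. \<bar>g A - g B\<bar> <= hat_dist A B"
    "ALL x:points X. g (tau_embedding X x) = tau (f x)"
proof -
  have "ALL A:hat. EX s. range s <= points X & (%n. hat_dist (tau_embedding X (s n)) A) \<longlonglongrightarrow> 0" using embedding_dense by blast
  then obtain s where s: "!!A n. A : hat ==> s A n : points X"
    "!!A. A : hat ==> (%n. hat_dist (tau_embedding X (s A n)) A) \<longlonglongrightarrow> 0" unfolding bchoice_iff by (auto simp: image_subset_iff)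
  have td: "tau_dist X x y <= hat_dist (tau_embedding X x) A + hat_dist (tau_embedding X y) A" if "x : points X" "y : points X" "A : hat" for x y A
    using hat.triangle[of "tau_embedding X x" A "tau_embedding X y"] that embedding_dist hat.commute[of A] by simp
  have cv: "convergent (%n. tau (f (s A n)))" if A: "A : hat" for A
  proof (intro Cauchy_convergent metric_CauchyI)
    fix e :: real assume "e > 0"
    hence "\<forall>\<^sub>F n in sequentially. hat_dist (tau_embedding X (s A n)) A < e/2" by (intro order_tendstoD[OF s(2)[OF A]]) simp
    then obtain K where K: "!!n. n >= K ==> hat_dist (tau_embedding X (s A n)) A < e/2" by (auto simp: eventually_sequentially)
    have "dist (tau (f (s A m))) (tau (f (s A n))) < e" if "m >= K" "n >= K" for m n
      using tau_dist_upper[OF f s(1)[OF A] s(1)[OF A], of m n] td[OF s(1)[OF A] s(1)[OF A] A, of m n] K[OF that(1)] K[OF that(2)]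
      unfolding dist_real_def by linarith
    thus "EX M. ALL m>=M. ALL n>=M. dist (tau (f (s A m))) (tau (f (s A n))) < e" by blast
  qed
  define g where "g = restrict (%A. lim (%n. tau (f (s A n)))) hat"
  have g: "(%n. tau (f (s A n))) \<longlonglongrightarrow> g A" if "A : hat" for A using cv[OF that] that by (simp add: g_def convergent_LIMSEQ_iff)
  show thesis
  proof (rule that[of g])
    show "ALL A:hat. ALL B:hat. \<bar>g A - g B\<bar> <= hat_dist A B"
    proof (intro ballI)
      fix A B assume A: "A : hat" and B: "B : hat"
      have l: "(%n. \<bar>tau (f (s A n)) - tau (f (s B n))\<bar>) \<longlonglongrightarrow> \<bar>g A - g B\<bar>" by (intro tendsto_intros g A B)
      have u: "(%n. hat_dist (tau_embedding X (s A n)) A + hat_dist A B + hat_dist (tau_embedding X (s B n)) B) \<longlonglongrightarrow> 0 + hat_dist A B + 0"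
        by (intro tendsto_intros s A B)
      have "\<bar>tau (f (s A n)) - tau (f (s B n))\<bar> <= hat_dist (tau_embedding X (s A n)) A + hat_dist A B + hat_dist (tau_embedding X (s B n)) B" for n
      proof -
        let ?a = "tau_embedding X (s A n)" and ?b = "tau_embedding X (s B n)"
        have "hat_dist ?a ?b <= hat_dist ?a A + (hat_dist A B + hat_dist B ?b)"
          using hat.triangle[of ?a A ?b] hat.triangle[of A B ?b] A B s(1) by fastforce
        thus ?thesis using tau_dist_upper[OF f s(1)[OF A] s(1)[OF B], of n n] embedding_dist[OF s(1)[OF A] s(1)[OF B], of n n] hat.commute[of B ?b] by linarith
      qed
      thus "\<bar>g A - g B\<bar> <= hat_dist A B" using LIMSEQ_le[OF l u] by simp
    qed
    show "ALL x:points X. g (tau_embedding X x) = tau (f x)"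
    proof
      fix x assume x: "x : points X"
      note e = embedding_hat[OF x]
      have "(%n. \<bar>tau (f (s (tau_embedding X x) n)) - tau (f x)\<bar>) \<longlonglongrightarrow> 0"
      proof (rule tendsto_sandwich[OF always_eventually always_eventually tendsto_const s(2)[OF e]])
        show "ALL n. \<bar>tau (f (s (tau_embedding X x) n)) - tau (f x)\<bar> <= hat_dist (tau_embedding X (s (tau_embedding X x) n)) (tau_embedding X x)"
          using tau_dist_upper[OF f s(1)[OF e] x] embedding_dist[OF s(1)[OF e] x] by simp
      qed simp
      hence "(%n. tau (f (s (tau_embedding X x) n))) \<longlonglongrightarrow> tau (f x)" by (simp add: tendsto_rabs_zero_iff LIM_zero_iff)
      thus "g (tau_embedding X x) = tau (f x)" using g[OF e] LIMSEQ_unique by blast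
    qed
  qed (simp add: g_def)
qed

lemma hat_lip_continuous:
  assumes "ALL A:hat. ALL B:hat. \<bar>g A - g B\<bar> <= hat_dist A B"
  shows "continuous_map hat.mtopology euclideanreal g"
proof -
  have "continuous_map hat.mtopology Met_TC.mtopology g" unfolding hat.metric_continuous_map[OF Met_TC.Metric_space_axioms]
  proof (intro conjI ballI allI impI)
    fix A and e :: real assume A: "A : hat" "e > 0"
    show "\<exists>\<delta>>0. ALL x. x : hat & hat_dist A x < \<delta> --> dist (g A) (g x) < e"
      using A assms by (intro exI[of _ e]) (fastforce simp: dist_real_def)
  qed auto
  thus ?thesis by simp
qed

lemma tau_extension:
  assumes f: "f : features X"
  shows "tau_extension X f : extensional hat"
    "A : hat ==> B : hat ==> \<bar>tau_extension X f A - tau_extension X f B\<bar> <= hat_dist A B"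
    "x : points X ==> tau_extension X f (tau_embedding X x) = tau (f x)"
proof -
  obtain g where g: "g : extensional hat" "ALL A:hat. ALL B:hat. \<bar>g A - g B\<bar> <= hat_dist A B"
    "ALL x:points X. g (tau_embedding X x) = tau (f x)" by (rule ex_extension[OF f])
  have "tau_extension X f = g" unfolding tau_extension_def hat_topology hat.topspace_mtopology
  proof (rule the_equality)
    show "g : extensional hat & continuous_map hat.mtopology euclideanreal g & (ALL x:points X. g (tau_embedding X x) = tau (f x))"
      using g hat_lip_continuous[OF g(2)] by blast
    fix h assume h: "h : extensional hat & continuous_map hat.mtopology euclideanreal h & (ALL x:points X. h (tau_embedding X x) = tau (f x))"
    show "h = g"
    proof (rule extensionalityI[of _ hat])
      fix A assume A: "A : hat"
      obtain s where s: "range s <= points X" "(%n. hat_dist (tau_embedding X (s n)) A) \<longlonglongrightarrow> 0" using embedding_dense[OF A] by blast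
      have sp: "s n : points X" for n using s(1) by blast
      have l: "limitin hat.mtopology (%n. tau_embedding X (s n)) A sequentially"
        unfolding hat.limitin_metric_dist_null using A s sp by (auto intro!: always_eventually)
      have "(%n. tau (f (s n))) \<longlonglongrightarrow> k A"
        if "continuous_map hat.mtopology euclideanreal k" "ALL x:points X. k (tau_embedding X x) = tau (f x)" for k
        using continuous_map_limit[OF that(1) l] that(2) sp by (simp add: comp_def)
      from this[OF conjunct1[OF conjunct2[OF h]] conjunct2[OF conjunct2[OF h]]] this[OF hat_lip_continuous[OF g(2)] g(3)]
      show "h A = g A" by (rule LIMSEQ_unique)
    qed (use h g in auto)
  qed
  thus "tau_extension X f : extensional hat"
    "A : hat ==> B : hat ==> \<bar>tau_extension X f A - tau_extension X f B\<bar> <= hat_dist A B"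
    "x : points X ==> tau_extension X f (tau_embedding X x) = tau (f x)" using g by auto
qed

lemma tau_extension_bound: assumes f: "f : features X" and A: "A : hat" shows "\<bar>tau_extension X f A\<bar> <= 1/2"
proof (rule field_le_epsilon)
  fix e :: real assume e: "e > 0"
  obtain s where s: "range s <= points X" "(%n. hat_dist (tau_embedding X (s n)) A) \<longlonglongrightarrow> 0" using embedding_dense[OF A] by blast
  have sp: "s n : points X" for n using s(1) by blast
  have "\<forall>\<^sub>F n in sequentially. hat_dist (tau_embedding X (s n)) A < e" by (rule order_tendstoD(2)[OF s(2) e])
  then obtain n where n: "hat_dist (tau_embedding X (s n)) A < e" by (auto simp: eventually_sequentially)
  have "\<bar>tau_extension X f (tau_embedding X (s n)) - tau_extension X f A\<bar> <= hat_dist (tau_embedding X (s n)) A"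
    by (rule tau_extension(2)[OF f embedding_hat[OF sp] A])
  thus "\<bar>tau_extension X f A\<bar> <= 1/2 + e" using n tau_bound[of "f (s n)"] unfolding tau_extension(3)[OF f sp] by linarith
qed

text \<open>Together with \<open>tau_extension\<close> this identifies the metric of the completion
  as the feature metric of the extended functions.\<close>

lemma hat_dist_least:
  assumes A: "A : hat" and B: "B : hat" and c: "!!f. f : features X ==> \<bar>tau_extension X f A - tau_extension X f B\<bar> <= c"
  shows "hat_dist A B <= c"
proof (rule field_le_epsilon)
  fix e :: real assume e: "e > 0"
  obtain s where s: "range s <= points X" "(%n. hat_dist (tau_embedding X (s n)) A) \<longlonglongrightarrow> 0" using embedding_dense[OF A] by blast
  obtain t where t: "range t <= points X" "(%n. hat_dist (tau_embedding X (t n)) B) \<longlonglongrightarrow> 0" using embedding_dense[OF B] by blast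
  have "\<forall>\<^sub>F n in sequentially. hat_dist (tau_embedding X (s n)) A < e/4 & hat_dist (tau_embedding X (t n)) B < e/4"
    using e by (intro eventually_conj order_tendstoD[OF s(2)] order_tendstoD[OF t(2)]) auto
  then obtain n where n: "hat_dist (tau_embedding X (s n)) A < e/4" "hat_dist (tau_embedding X (t n)) B < e/4" by (auto simp: eventually_sequentially)
  let ?a = "tau_embedding X (s n)" and ?b = "tau_embedding X (t n)"
  have p: "s n : points X" "t n : points X" using s(1) t(1) by auto
  have ab: "?a : hat" "?b : hat" using p by auto
  have "tau_dist X (s n) (t n) <= c + e/2"
  proof (rule tau_dist_least[OF p])
    fix f assume f: "f : features X"
    show "\<bar>tau (f (s n)) - tau (f (t n))\<bar> <= c + e/2"
      using c[OF f] tau_extension(2)[OF f ab(1) A] tau_extension(2)[OF f ab(2) B] n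
      unfolding tau_extension(3)[OF f p(1)] tau_extension(3)[OF f p(2)] by linarith
  qed
  moreover have "hat_dist A B <= hat_dist A ?a + (hat_dist ?a ?b + hat_dist ?b B)"
    using hat.triangle[OF A ab(1) B] hat.triangle[OF ab B] by linarith
  ultimately show "hat_dist A B <= c + e" using n hat.commute[of A ?a] embedding_dist[OF p] by linarith
qed

lemma embedding_preimage: assumes "openin hat.mtopology U" shows "openin mtopology {x : points X. tau_embedding X x : U}"
  unfolding openin_mtopology
proof (intro conjI ballI allI impI)
  fix x assume "x : {x : points X. tau_embedding X x : U}"
  hence x: "x : points X" "tau_embedding X x : U" by auto
  then obtain r where r: "r > 0" "hat.mball (tau_embedding X x) r <= U" using assms unfolding hat.openin_mtopology by blast
  have "mball x r <= {x : points X. tau_embedding X x : U}"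
  proof
    fix y assume y: "y : mball x r"
    hence "tau_embedding X y : hat.mball (tau_embedding X x) r" using embedding_dist[of x y] tau_dist_le_data_dist[of x y] x(1) by simp
    thus "y : {x : points X. tau_embedding X x : U}" using r(2) y by auto
  qed
  thus "EX r>0. mball x r <= {x : points X. tau_embedding X x : U}" using r(1) by blast
qed auto

lemma embedding_measurable: "tau_embedding X : measurable (law X) (borel_of hat.mtopology)"
proof (rule measurable_borel_ofI)
  fix U assume "openin hat.mtopology U"
  from openin_borel_of[OF embedding_preimage[OF this]] show "tau_embedding X -` U Int space (law X) : sets (law X)"
    unfolding sets_law by (simp add: vimage_def Int_def conj_commute)
qed simp

lemma pushforward: "tau_pushforward X = distr (law X) (borel_of hat.mtopology) (tau_embedding X)"
  by (simp add: tau_pushforward_def hat_topology)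

text \<open>The image of X is dense and open sets pull back to open sets of X, which has full
  support; so the pushforward has full support too.\<close>

lemma screen_points_eq: "screen_points X = hat"
proof -
  have "emeasure (tau_pushforward X) U > 0" if U: "openin hat.mtopology U" and A: "A : U" for U A
  proof -
    have AC: "A : hat" using openin_subset[OF U] A by auto
    obtain s where s: "range s <= points X" "(%n. hat_dist (tau_embedding X (s n)) A) \<longlonglongrightarrow> 0" using embedding_dense[OF AC] by blast
    obtain r where r: "r > 0" "hat.mball A r <= U" using U A unfolding hat.openin_mtopology by blast
    have "\<forall>\<^sub>F n in sequentially. hat_dist (tau_embedding X (s n)) A < r" by (rule order_tendstoD(2)[OF s(2) r(1)])
    then obtain n where "hat_dist (tau_embedding X (s n)) A < r" by (auto simp: eventually_sequentially)
    hence n: "s n : {x : points X. tau_embedding X x : U}"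
      using r(2) s(1) AC hat.commute[of A] by (auto simp: subset_iff image_subset_iff)
    note O = embedding_preimage[OF U]
    obtain q where q: "q > 0" "mball (s n) q <= {x : points X. tau_embedding X x : U}" using O n unfolding openin_mtopology by blast
    have "0 < emeasure (law X) (mball (s n) q)" using n q(1) by (intro mball_pos) auto
    also have "\<dots> <= emeasure (law X) {x : points X. tau_embedding X x : U}"
      using q(2) openin_borel_of[OF O] by (intro emeasure_mono) (simp_all add: sets_law)
    also have "\<dots> = emeasure (tau_pushforward X) U"
      unfolding pushforward using emeasure_distr[OF embedding_measurable openin_borel_of[OF U]] by (simp add: vimage_def Int_def conj_commute)
    finally show ?thesis .
  qed
  thus ?thesis unfolding screen_points_def supp_def hat_topology by auto
qed

lemma screen_law: "law (compact_screen X) = tau_pushforward X"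
proof -
  have sp: "space (tau_pushforward X) = hat" by (simp add: pushforward)
  have "restrict_space (tau_pushforward X) hat = tau_pushforward X"
  proof (rule measure_eqI)
    have *: "hat Int space (tau_pushforward X) : sets (tau_pushforward X)" unfolding sp using sets.top[of "tau_pushforward X"] sp by simp
    show s: "sets (restrict_space (tau_pushforward X) hat) = sets (tau_pushforward X)"
      unfolding sets_restrict_space using sets.sets_into_space[of _ "tau_pushforward X"] sp by (auto simp: Int_absorb1 image_iff)
    show "emeasure (restrict_space (tau_pushforward X) hat) A = emeasure (tau_pushforward X) A"
      if "A : sets (restrict_space (tau_pushforward X) hat)" for A
      by (rule emeasure_restrict_space[OF *]) (use that s sets.sets_into_space[of A "tau_pushforward X"] sp in auto)
  qed
  thus ?thesis by (simp add: compact_screen_def screen_points_eq)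
qed

lemma screen_points: "points (compact_screen X) = hat" by (simp add: compact_screen_def screen_points_eq)

lemma screen_features: "features (compact_screen X) = tau_extension X ` features X"
  unfolding compact_screen_def screen_points_eq using tau_extension(1) by (auto simp: extensional_restrict)

lemma screen_dist: "data_dist (compact_screen X) = hat_dist"
proof (intro ext)
  fix A B
  show "data_dist (compact_screen X) A B = hat_dist A B"
  proof (cases "A : hat & B : hat")
    case True
    hence AB: "A : hat" "B : hat" by auto
    have b: "bdd_above ((%f. \<bar>f A - f B\<bar>) ` tau_extension X ` features X)"
      using tau_extension(2)[OF _ AB] by (intro bdd_aboveI[of _ "hat_dist A B"]) auto
    have "(SUP f\<in>tau_extension X ` features X. \<bar>f A - f B\<bar>) = hat_dist A B"
    proof (rule antisym)
      show "(SUP f\<in>tau_extension X ` features X. \<bar>f A - f B\<bar>) <= hat_dist A B"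
        using features_ne tau_extension(2)[OF _ AB] by (intro cSUP_least) auto
      show "hat_dist A B <= (SUP f\<in>tau_extension X ` features X. \<bar>f A - f B\<bar>)"
        by (rule hat_dist_least[OF AB]) (rule cSUP_upper[OF _ b], simp)
    qed
    thus ?thesis unfolding data_dist_def feature_dist_def screen_features screen_points using AB by simp
  next
    case False
    thus ?thesis unfolding data_dist_def feature_dist_def screen_features screen_points completion_dist_def by auto
  qed
qed

lemma screen_topology: "data_topology (compact_screen X) = hat.mtopology" by (simp add: data_topology_def screen_points screen_dist)

lemma hat_separable: "separable_space hat.mtopology"
proof -
  obtain D where D: "dense_points D" by (rule dense_seq)
  let ?D = "range (%n. tau_embedding X (D n))"
  have "A : hat.mtopology closure_of ?D" if A: "A : hat" for A unfolding hat.metric_closure_of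
  proof (clarsimp simp: A)
    fix r :: real assume r: "r > 0"
    obtain s where s: "range s <= points X" "(%n. hat_dist (tau_embedding X (s n)) A) \<longlonglongrightarrow> 0" using embedding_dense[OF A] by blast
    have "\<forall>\<^sub>F n in sequentially. hat_dist (tau_embedding X (s n)) A < r/2" using r by (intro order_tendstoD[OF s(2)]) simp
    then obtain n where n: "hat_dist (tau_embedding X (s n)) A < r/2" by (auto simp: eventually_sequentially)
    have sp: "s n : points X" using s(1) by blast
    obtain k where k: "data_dist X (s n) (D k) < r/2" using dense_pointsD(2)[OF D sp, of "r/2"] r by auto
    have Dk: "D k : points X" by (rule dense_pointsD(1)[OF D])
    have "hat_dist A (tau_embedding X (D k)) < r"
      using hat.triangle[OF A embedding_hat[OF sp] embedding_hat[OF Dk]] embedding_dist[OF sp Dk] tau_dist_le_data_dist[OF sp Dk]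
        k n hat.commute[of A "tau_embedding X (s n)"] by linarith
    thus "EX k. tau_embedding X (D k) : hat & hat_dist A (tau_embedding X (D k)) < r" using embedding_hat[OF Dk] by blast
  qed
  moreover have "?D <= hat" using dense_pointsD(1)[OF D] by auto
  ultimately show ?thesis unfolding separable_space_def
    by (intro exI[of _ ?D]) (auto intro: set_eqI simp: closure_of_subset_topspace[THEN subsetD, of _ hat.mtopology, simplified])
qed

lemma screen_geometric: "geometric_dataset (compact_screen X)"
  unfolding geometric_dataset_def screen_topology screen_dist screen_points screen_law screen_features
proof (intro conjI ballI)
  show "tau_extension X ` features X ~= {}" using features_ne by simp
  show "tau_extension X ` features X <= extensional hat" using tau_extension(1) by auto
  show "bdd_above ((%f. \<bar>f A - f B\<bar>) ` tau_extension X ` features X)" if "A : hat" "B : hat" for A B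
    using tau_extension(2)[OF _ that] by (intro bdd_aboveI[of _ "hat_dist A B"]) auto
  show "Metric_space hat hat_dist" by (rule tau.Metric_space_completion)
  show "hat.mcomplete" by (rule tau.mcomplete_completion)
  show "separable_space hat.mtopology" by (rule hat_separable)
  show "prob_space (tau_pushforward X)" unfolding pushforward by (rule law.prob_space_distr[OF embedding_measurable])
  show "supp hat.mtopology (tau_pushforward X) = hat" using screen_points_eq by (simp add: screen_points_def hat_topology)
qed (simp_all add: pushforward)

lemma screen_K_valued: "K_valued (compact_screen X)"
  unfolding K_valued_def abs_le_half_iff[symmetric] screen_features screen_points using tau_extension_bound by blast

text \<open>Equality, and not just inclusion, rests on compactness of the closure of a bounded
  family (\<open>pointwise_closure_compose_image\<close>).\<close>

lemma screen_closure: "(%g. compose (points X) g (tau_embedding X)) ` feature_closure (compact_screen X) = K_tau X"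
proof -
  have e: "tau_embedding X : points X \<rightarrow> hat" by simp
  have "(%g. compose (points X) g (tau_embedding X)) ` tau_extension X ` features X = tau_features X"
    unfolding image_image tau_features_def by (intro image_cong refl) (auto simp: compose_def tau_extension(3) intro!: restrict_ext)
  moreover have "pointwise_closure (points X) ((%g. compose (points X) g (tau_embedding X)) ` tau_extension X ` features X)
      = (%g. compose (points X) g (tau_embedding X)) ` pointwise_closure hat (tau_extension X ` features X)"
    by (rule pointwise_closure_compose_image[OF _ e, where c = "1/2"]) (use tau_extension(1) tau_extension_bound in auto)
  ultimately show ?thesis unfolding feature_closure_def screen_points screen_features K_tau_def by simp
qed

end

section \<open>The class of the screen\<close>

text \<open>The screen lives on sets of Cauchy sequences. Its frames are bounded, so
  \<open>ex_class_with_law\<close> provides an isomorphic data set on the reals; this makes its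
  class nonempty and the representative meaningful.\<close>

lemma ex_real_model:
  fixes Y :: "'a dataset"
  assumes Y: "geometric_dataset Y" "K_valued Y"
  obtains A where "A : DD_K" "class_of Y = A" "isomorphic_data Y (rep A)"
proof -
  interpret Y: geom_data Y by standard (rule Y(1))
  obtain f where f: "frame Y f" "range f <= features Y" by (rule Y.ex_frame)
  obtain D where D: "Y.dense_points D" by (rule Y.dense_seq)
  have fb: "\<bar>f i y\<bar> <= 1/2" if "y : points Y" for i y using K_valued_closure[OF Y Y.frame_closure[OF f(1)] that] .
  let ?m = "seq_law (law Y) f"
  have ae: "AE x in ?m. ALL r>0. EX d:range (%a i. f i (D a)). x : supball d r"
    using frame_separated[OF Y(1) _ D, of f, OF Y.frame_lip[OF f(1)]] by simp
  have fin: "EX c. ALL i. \<bar>d i - d' i\<bar> <= c" if d: "d : range (%a i. f i (D a))" "d' : range (%a i. f i (D a))" for d d'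
  proof (intro exI[of _ 1] allI)
    fix i
    have "\<bar>d i\<bar> <= 1/2" "\<bar>d' i\<bar> <= 1/2" using d fb[OF Y.dense_pointsD(1)[OF D]] by blast+
    thus "\<bar>d i - d' i\<bar> <= 1" by linarith
  qed
  obtain A F where A: "A : DD" and F: "frame (rep A) F" "seq_law (rlaw A) F = ?m"
    and K: "(AE x in ?m. ALL i. \<bar>x i\<bar> <= 1/2) --> A : DD_K"
    by (rule ex_class_with_law[OF prob_seq_law[OF Y.law.prob_space_axioms Y.frame_measurable[OF f(1)]] sets_seq_law _ fin ae]) auto
  have "AE x in ?m. ALL i. \<bar>x i\<bar> <= 1/2"
    by (rule AE_seq_law[where P = "%x. ALL i. \<bar>x i\<bar> <= 1/2", OF Y.frame_measurable[OF f(1)]]) (measurable, use fb in simp)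
  hence AK: "A : DD_K" using K by blast
  note g = geometric_rep[OF A]
  interpret A: geom_data "rep A" by standard (rule g(1))
  have le: "feature_le Y (rep A)" "feature_le (rep A) Y" using feature_leI[OF Y(1) g(1) f(1) A.frame_closure[OF F(1)] F(2)[symmetric]]
      feature_leI[OF g(1) Y(1) F(1) Y.frame_closure[OF f(1)] F(2)] by blast+
  have "class_of Y = A" using class_of_eqI[OF Y(1) g(1) le] g(2) by simp
  moreover have "isomorphic_data Y (rep A)" using isomorphic_iff_feature_le[OF Y(1) g(1)] le by blast
  ultimately show thesis using AK by (intro that)
qed

lemma screen_class:
  assumes A: "A : DD"
  shows "screen_class A : DD_K"
    "EX p:measurable (rlaw A) (rlaw (screen_class A)). distr (rlaw A) (rlaw (screen_class A)) p = rlaw (screen_class A) &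
      (%g. compose (points (rep A)) g p) ` rclosure (screen_class A) = K_tau (rep A)"
proof -
  interpret A: geom_data "rep A" by (rule geom_data_rep[OF A])
  let ?Y = "compact_screen (rep A)" and ?e = "tau_embedding (rep A)"
  obtain B where B: "B : DD_K" "class_of ?Y = B" "isomorphic_data ?Y (rep B)" by (rule ex_real_model[OF A.screen_geometric A.screen_K_valued])
  have sB: "screen_class A = B" using B(2) by (simp add: screen_class_def)
  show "screen_class A : DD_K" using B(1) sB by simp
  obtain \<phi> where \<phi>: "\<phi> : measurable (law ?Y) (rlaw B)" "distr (law ?Y) (rlaw B) \<phi> = rlaw B"
    "(%f. compose (points ?Y) f \<phi>) ` rclosure B = feature_closure ?Y" using B(3) unfolding isomorphic_data_def by blast
  have e: "?e : measurable (rlaw A) (law ?Y)" using A.embedding_measurable unfolding A.screen_law A.pushforward by simp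
  have ed: "distr (rlaw A) (law ?Y) ?e = law ?Y" unfolding A.screen_law A.pushforward by (rule distr_cong) simp_all
  have cc: "compose (points (rep A)) (compose (points ?Y) f \<phi>) ?e = compose (points (rep A)) f (\<phi> \<circ> ?e)" for f
    unfolding A.screen_points by (auto simp: compose_def fun_eq_iff)
  have "(%g. compose (points (rep A)) g (\<phi> \<circ> ?e)) ` rclosure B = (%g. compose (points (rep A)) g ?e) ` (%f. compose (points ?Y) f \<phi>) ` rclosure B"
    unfolding image_image cc ..
  also have "\<dots> = K_tau (rep A)" unfolding \<phi>(3) by (rule A.screen_closure)
  finally have "(%g. compose (points (rep A)) g (\<phi> \<circ> ?e)) ` rclosure B = K_tau (rep A)" .
  moreover have "distr (rlaw A) (rlaw B) (\<phi> \<circ> ?e) = rlaw B" using distr_distr[OF \<phi>(1) e] ed \<phi>(2) by simp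
  ultimately show "EX p:measurable (rlaw A) (rlaw (screen_class A)). distr (rlaw A) (rlaw (screen_class A)) p = rlaw (screen_class A) &
      (%g. compose (points (rep A)) g p) ` rclosure (screen_class A) = K_tau (rep A)"
    unfolding sB using measurable_comp[OF e \<phi>(1)] by (intro bexI[of _ "\<phi> \<circ> ?e"]) auto
qed

text \<open>The composition of the embedding with an isomorphism pairs the closure of the screen
  with \<open>K_tau\<close>; the later estimates see the screen only through these equalities of
  laws.\<close>

lemma screen_tuples:
  assumes A: "A : DD"
  shows "EX T. (ALL g:rclosure (screen_class A). T g : K_tau (rep A)) &
      (ALL G. (ALL i. G i : rclosure (screen_class A)) --> seq_law (rlaw (screen_class A)) G = seq_law (rlaw A) (%i. T (G i)))"
    and "EX S. (ALL k:K_tau (rep A). S k : rclosure (screen_class A)) &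
      (ALL F. (ALL i. F i : K_tau (rep A)) --> seq_law (rlaw A) F = seq_law (rlaw (screen_class A)) (%i. S (F i)))"
proof -
  let ?B = "screen_class A" and ?P = "points (rep A)"
  interpret A: geom_data "rep A" by (rule geom_data_rep[OF A])
  note BD = DD_K_rep(1)[OF screen_class(1)[OF A]]
  obtain p where p: "p : measurable (rlaw A) (rlaw ?B)" "distr (rlaw A) (rlaw ?B) p = rlaw ?B"
    "(%g. compose ?P g p) ` rclosure ?B = K_tau (rep A)" using screen_class(2)[OF A] by blast
  have law: "seq_law (rlaw ?B) G = seq_law (rlaw A) (%i. compose ?P (G i) p)" if "ALL i. G i : rclosure ?B" for G
    using seq_law_compose[OF p(1,2) rclosure_measurable[OF BD] A.space_law, of G] that by simp
  show "EX T. (ALL g:rclosure ?B. T g : K_tau (rep A)) &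
      (ALL G. (ALL i. G i : rclosure ?B) --> seq_law (rlaw ?B) G = seq_law (rlaw A) (%i. T (G i)))"
    using p(3) law by (intro exI[of _ "%g. compose ?P g p"]) auto
  have "ALL k:K_tau (rep A). EX g:rclosure ?B. k = compose ?P g p" using p(3) by blast
  then obtain S where S: "!!k. k : K_tau (rep A) ==> S k : rclosure ?B" "!!k. k : K_tau (rep A) ==> k = compose ?P (S k) p" by metis
  show "EX S. (ALL k:K_tau (rep A). S k : rclosure ?B) &
      (ALL F. (ALL i. F i : K_tau (rep A)) --> seq_law (rlaw A) F = seq_law (rlaw ?B) (%i. S (F i)))"
  proof (intro exI[of _ S] conjI ballI allI impI)
    fix F :: "nat => real => real" assume F: "ALL i. F i : K_tau (rep A)"
    hence "(%i. compose ?P (S (F i)) p) = F" using S(2) by (intro ext) metis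
    thus "seq_law (rlaw A) F = seq_law (rlaw ?B) (%i. S (F i))" using law[of "%i. S (F i)"] S(1) F by simp
  qed (use S(1) in blast)
qed

section \<open>Principal pyramids\<close>

text \<open>A frame of X is coupled ever better with tuples in the closure of Z. That closure is
  compact, and a limit tuple has exactly the law of the frame.\<close>

lemma principal_pyramid_closed:
  assumes Z: "Z : DD_K" and X: "X : DD" and near: "!!e. e > 0 ==> EX A:principal_pyramid Z. d_box X A < e"
  shows "X : principal_pyramid Z"
proof -
  note ZD = DD_K_rep(1)[OF Z]
  interpret Z: geom_data "rep Z" by (rule geom_data_rep[OF ZD])
  have XK: "X : DD_K" by (rule DD_K_closed[OF X]) (use near in \<open>unfold principal_pyramid_def, blast\<close>)
  interpret X: geom_data "rep X" by (rule geom_data_rep[OF X])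
  obtain f where f: "frame (rep X) f" by (rule X.ex_frame)
  note fc = X.frame_closure[OF f] and fm = X.frame_measurable[OF f]
  let ?e = "%k. 1 / real (Suc k)"
  \<comment> \<open>Of the error, two parts come from the box distance and one from the exchange of
    laws.\<close>
  have "EX g. (ALL i. g i : rclosure Z) & coupled k (3 * ?e k) (rlaw X) f (rlaw Z) g" for k
  proof -
    have e: "?e k > 0" by simp
    obtain A where A: "A : DD_K" "class_le A Z" "d_box X A < ?e k" using near[OF e] unfolding principal_pyramid_def by blast
    note AD = DD_K_rep(1)[OF A(1)]
    obtain T where T: "ALL f:rclosure X. T f : features (rep A)"
      "ALL F N. (ALL i. F i : rclosure X) --> coupled N (2 * ?e k) (rlaw X) F (rlaw A) (%i. T (F i))"
      by (rule coupled_of_d_box[OF XK A(1,3)])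
    have Tf: "T (f i) : rclosure A" for i using T(1) fc geom_data.features_closure[OF geom_data_rep[OF AD]] by blast
    obtain S where S: "ALL f:rclosure A. S f : rclosure Z"
      "ALL F. (ALL i. F i : rclosure A) --> seq_law (rlaw A) F = seq_law (rlaw Z) (%i. S (F i))" by (rule class_leD[OF AD ZD A(2)])
    have ST: "S (T (f i)) : rclosure Z" for i using S(1) Tf by blast
    have c: "coupled k (2 * ?e k) (rlaw X) f (rlaw A) (%i. T (f i))" using T(2) fc by blast
    have "seq_law (rlaw A) (%i. T (f i)) = seq_law (rlaw Z) (%i. S (T (f i)))" using S(2)[rule_format, of "%i. T (f i)", OF Tf] .
    from coupled_law_right[OF c this e _ rlaw_prob[OF ZD] fm rclosure_measurable[OF AD Tf] rclosure_measurable[OF ZD ST]]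
    have "coupled k (2 * ?e k + ?e k) (rlaw X) f (rlaw Z) (%i. S (T (f i)))" by simp
    thus ?thesis using ST by (intro exI[of _ "%i. S (T (f i))"]) auto
  qed
  then obtain g where g: "!!k i. g k i : rclosure Z" "!!k. coupled k (3 * ?e k) (rlaw X) f (rlaw Z) (g k)" by metis
  have gc: "g n i : pointwise_closure (points (rep Z)) (rclosure Z)" for n i using g(1) by (simp add: feature_closure_def)
  obtain r G where r: "strict_mono (r :: nat => nat)" and G: "!!i. G i : pointwise_closure (points (rep Z)) (rclosure Z)"
    and l: "!!i x. x : points (rep Z) ==> (%n. g (r n) i x) \<longlonglongrightarrow> G i x"
    by (rule Z.closure_seq_compact[where H = "rclosure Z" and c = "1/2" and F = g, OF _ Z.feature_closure_lip _ gc])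
      (use Z.feature_closure_ext rclosure_bound[OF Z] in blast)+
  have Gc: "G i : rclosure Z" for i using G by (simp add: feature_closure_def)
  note Gm = rclosure_measurable[OF ZD Gc] and gm = rclosure_measurable[OF ZD g(1)]
  have "seq_law (rlaw X) f = seq_law (rlaw Z) G"
  proof (rule seq_law_eqI[OF _ rlaw_prob[OF X] rlaw_prob[OF ZD] fm Gm])
    fix N and e :: real assume e: "e > 0"
    have "\<forall>\<^sub>F n in sequentially. (L1 (rlaw Z) (G i) (g (r n) i)) < ennreal (e/3)" for i
    proof (rule order_tendstoD)
      show "(%n. \<integral>\<^sup>+x. ennreal \<bar>G i x - g (r n) i x\<bar> \<partial>rlaw Z) \<longlonglongrightarrow> 0"
        using rclosure_bound[OF Z Gc] rclosure_bound[OF Z g(1)] l by (intro L1_limit rlaw_prob[OF ZD] gm Gm) auto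
    qed (use e in simp)
    hence "\<forall>\<^sub>F n in sequentially. ALL i:{..<N}. (L1 (rlaw Z) (G i) (g (r n) i)) < ennreal (e/3)"
      by (intro eventually_ball_finite) auto
    hence ev: "\<forall>\<^sub>F n in sequentially. (ALL i:{..<N}. (L1 (rlaw Z) (G i) (g (r n) i)) < ennreal (e/3)) & N <= n & 9 / e <= real n"
      by (intro eventually_conj eventually_ge_at_top) (auto intro: eventually_sequentiallyI[of "nat \<lceil>9 / e\<rceil>"] simp: nat_le_iff ceiling_le_iff)
    obtain n where n: "ALL i:{..<N}. (L1 (rlaw Z) (G i) (g (r n) i)) < ennreal (e/3)" "N <= n" "9 / e <= real n"
      using eventually_happens'[OF sequentially_bot ev] by blast
    have "n <= r n" by (rule seq_suble[OF r])
    hence rn: "N <= r n" "9 / e <= real (Suc (r n))" using n(2,3) by auto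
    have "3 * ?e (r n) <= e/3" using rn(2) e by (simp add: field_simps)
    hence 1: "coupled N (e/3) (rlaw X) f (rlaw Z) (g (r n))" by (rule coupled_mono[OF g(2) rn(1)])
    have 2: "coupled N (e/3) (rlaw Z) (g (r n)) (rlaw Z) G"
      by (rule coupled_sym[OF coupled_same[OF rlaw_prob[OF ZD] Gm gm]]) (use n(1) Gm gm in \<open>auto intro: less_imp_le\<close>)
    have "coupled N (e/3 + e/3 + e/3) (rlaw X) f (rlaw Z) G" by (rule coupled_trans[OF 1 2 refl]) (use e fm gm Gm in auto)
    thus "coupled N e (rlaw X) f (rlaw Z) G" by simp
  qed
  hence "class_le X Z" by (rule class_leI[OF X ZD f Gc])
  thus ?thesis using XK by (simp add: principal_pyramid_def)
qed

lemma principal_pyramid: assumes Z: "Z : DD_K" shows "principal_pyramid Z : Pi_K"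
proof -
  note ZD = DD_K_rep(1)[OF Z]
  have sub: "principal_pyramid Z <= DD" using DD_K_rep(1) by (auto simp: principal_pyramid_def)
  have ZZ: "Z : principal_pyramid Z" using Z class_le_refl[OF ZD] by (simp add: principal_pyramid_def)
  have "X : principal_pyramid Z" if \<sigma>: "range \<sigma> <= principal_pyramid Z" and l: "limitin box.mtopology \<sigma> X sequentially" for \<sigma> X
  proof (rule principal_pyramid_closed[OF Z])
    show "X : DD" using l unfolding box.limitin_metric_dist_null by blast
    fix e :: real assume e: "e > 0"
    have "(%n. d_box (\<sigma> n) X) \<longlonglongrightarrow> 0" using l unfolding box.limitin_metric_dist_null by blast
    hence "\<forall>\<^sub>F n in sequentially. d_box (\<sigma> n) X < e" using e by (rule order_tendstoD)
    then obtain n where "d_box (\<sigma> n) X < e" by (auto simp: eventually_sequentially)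
    thus "EX A:principal_pyramid Z. d_box X A < e" using \<sigma> d_box_commute[of X] by auto
  qed
  hence "closedin box.mtopology (principal_pyramid Z)" unfolding box.metric_closedin_iff_sequentially_closed using sub by blast
  moreover have "B : principal_pyramid Z" if "A : principal_pyramid Z" "B : DD_K" "class_le B A" for A B
    using that class_le_trans[OF DD_K_rep(1)[OF that(2)] _ ZD that(3)] DD_K_rep(1)[of A] by (simp add: principal_pyramid_def)
  moreover have "principal_pyramid Z <= DD_K" by (auto simp: principal_pyramid_def)
  moreover have "class_le A Z" if "A : principal_pyramid Z" for A using that by (simp add: principal_pyramid_def)
  ultimately show ?thesis unfolding Pi_K_def K_pyramid_def mem_Collect_eq using ZZ by blast
qed

section \<open>Comparing families of functions through laws of their tuples\<close>

text \<open>One-sided and at the level of whole families, so that screens, compactified features and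
  approximating families can be chained. The partner tuple may depend on N.\<close>

definition fam_near :: "real => 'a measure => ('a => real) set => 'b measure => ('b => real) set => bool" where
  "fam_near e M H M' H' \<longleftrightarrow> (ALL F N. (ALL i. F i : H) --> (EX G. (ALL i. G i : H') & coupled N e M F M' G))"

lemma fam_near_trans:
  assumes n: "fam_near a M H M1 H1" "fam_near b M1 H1 M2 H2" and ab: "0 <= a" "0 <= b" "a + b < c"
    and m: "H <= borel_measurable M" "H1 <= borel_measurable M1" "H2 <= borel_measurable M2"
  shows "fam_near c M H M2 H2" unfolding fam_near_def
proof (intro allI impI)
  fix F :: "nat => _" and N assume F: "ALL i. F i : H"
  then obtain G where G: "ALL i. G i : H1" "coupled N a M F M1 G" using n(1) unfolding fam_near_def by blast
  then obtain K where K: "ALL i. K i : H2" "coupled N b M1 G M2 K" using n(2) unfolding fam_near_def by blast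
  have "coupled N (a + b + (c - a - b)) M F M2 K" by (rule coupled_trans[OF G(2) K(2) refl]) (use ab F G(1) K(1) m in auto)
  thus "EX G. (ALL i. G i : H2) & coupled N c M F M2 G" using K(1) by (intro exI[of _ K]) simp
qed

lemma fam_near_law:
  assumes T: "ALL f:H. T f : H'" "ALL F. (ALL i. F i : H) --> seq_law M F = seq_law M' (%i. T (F i))"
    and p: "prob_space M" "prob_space M'" and m: "H <= borel_measurable M" "H' <= borel_measurable M'" and e: "e > 0"
  shows "fam_near e M H M' H'" unfolding fam_near_def
proof (intro allI impI)
  fix F :: "nat => _" and N assume F: "ALL i. F i : H"
  have Fm: "F i : borel_measurable M" "T (F i) : borel_measurable M'" for i using F T(1) m by auto
  have "coupled N 0 M F M F" by (rule coupled_same[OF p(1)]) (use Fm in auto)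
  from coupled_law_right[OF this T(2)[rule_format, OF F[rule_format]] e order_refl p(2) Fm(1) Fm(1) Fm(2)]
  have "coupled N e M F M' (%i. T (F i))" by simp
  thus "EX G. (ALL i. G i : H') & coupled N e M F M' G" using F T(1) by (intro exI[of _ "%i. T (F i)"]) auto
qed

lemma fam_near_same:
  assumes p: "prob_space M" and m: "H <= borel_measurable M" "H' <= borel_measurable M"
    and c: "ALL f:H. EX g:H'. (L1 M f g) <= ennreal e"
  shows "fam_near e M H M H'" unfolding fam_near_def
proof (intro allI impI)
  fix F :: "nat => _" and N assume F: "ALL i. F i : H"
  hence "ALL i. EX g. g : H' & (L1 M (F i) g) <= ennreal e" using c by blast
  then obtain G where G: "!!i. G i : H'" "!!i. (L1 M (F i) (G i)) <= ennreal e" by metis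
  have "coupled N e M F M G" by (rule coupled_same[OF p]) (use F G m in auto)
  thus "EX G. (ALL i. G i : H') & coupled N e M F M G" using G(1) by blast
qed

lemma rclosure_borel: "A : DD ==> rclosure A <= borel_measurable (rlaw A)" using rclosure_measurable by blast

lemma K_tau_borel: "A : DD ==> K_tau (rep A) <= borel_measurable (rlaw A)"
  using geom_data.K_tau_measurable[OF geom_data_rep] by blast

lemma fam_near_screen:
  assumes A: "A : DD" and e: "e > 0"
  shows "fam_near e (rlaw (screen_class A)) (rclosure (screen_class A)) (rlaw A) (K_tau (rep A))"
    "fam_near e (rlaw A) (K_tau (rep A)) (rlaw (screen_class A)) (rclosure (screen_class A))"
proof -
  note BD = DD_K_rep(1)[OF screen_class(1)[OF A]]
  note * = rlaw_prob[OF BD] rlaw_prob[OF A] rclosure_borel[OF BD] K_tau_borel[OF A]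
  show "fam_near e (rlaw (screen_class A)) (rclosure (screen_class A)) (rlaw A) (K_tau (rep A))"
    using screen_tuples(1)[OF A] by (elim exE conjE) (rule fam_near_law[OF _ _ *(1,2,3,4) e])
  show "fam_near e (rlaw A) (K_tau (rep A)) (rlaw (screen_class A)) (rclosure (screen_class A))"
    using screen_tuples(2)[OF A] by (elim exE conjE) (rule fam_near_law[OF _ _ *(2,1,4,3) e])
qed

text \<open>Turns a comparison of families into one of principal pyramids: an enumeration of a
  quotient of X has the law of a tuple in the closure of X.\<close>

lemma fam_near_below:
  assumes X: "X : DD_K" and Z: "Z : DD_K" and n: "fam_near e (rlaw X) (rclosure X) (rlaw Z) (rclosure Z)"
    and e: "0 <= e" "e < t * t" and t: "t > 0" and N: "N >= 1" and C: "C : DM_K N" "class_le C X"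
  obtains B where "B : DM_K N" "class_le B Z" "d_box C B <= (real N + 2) * t"
proof -
  note XD = DD_K_rep(1)[OF X] and ZD = DD_K_rep(1)[OF Z] and CD = DM_K_DD[OF C(1)]
  interpret C: geom_data "rep C" by (rule geom_data_rep[OF CD])
  obtain F where F: "enum N C F" by (rule ex_enum[OF C(1) N])
  note Ff = enum_frame(1)[OF CD F N]
  note Fc = C.frame_closure[OF Ff] and Fm = C.frame_measurable[OF Ff]
  obtain T where T: "ALL f:rclosure C. T f : rclosure X"
    "ALL F. (ALL i. F i : rclosure C) --> seq_law (rlaw C) F = seq_law (rlaw X) (%i. T (F i))" by (rule class_leD[OF CD XD C(2)])
  have TF: "T (F i) : rclosure X" for i using T(1) Fc by blast
  obtain G where G: "ALL i. G i : rclosure Z" "coupled N e (rlaw X) (%i. T (F i)) (rlaw Z) G"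
    using n[unfolded fam_near_def, rule_format, of "%i. T (F i)" N] TF by blast
  have Gc: "G i : rclosure Z" for i using G(1) by blast
  have law: "seq_law (rlaw C) F = seq_law (rlaw X) (%i. T (F i))" using T(2) Fc by blast
  define d where "d = (t * t - e) / 2"
  have d: "d > 0" "0 <= e + d" "e + d < t * t" using e by (auto simp: d_def field_simps)
  have "coupled N (e + d) (rlaw C) F (rlaw Z) G"
    by (rule coupled_law_left[OF G(2) law d(1) e(1) rlaw_prob[OF CD] rclosure_measurable[OF ZD Gc] rclosure_measurable[OF XD TF] Fm])
  thus thesis by (rule approx_below[OF C(1) F Z N Gc _ t d(2,3)]) (rule that)
qed

lemma fam_near_principal:
  assumes X: "X : DD_K" and Z: "Z : DD_K" and n: "fam_near e (rlaw X) (rclosure X) (rlaw Z) (rclosure Z)"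
      "fam_near e (rlaw Z) (rclosure Z) (rlaw X) (rclosure X)"
    and e: "0 <= e" "e < t * t" and t: "t > 0" and N: "N >= 1"
  shows "box_H N (principal_pyramid X) (principal_pyramid Z) <= ennreal ((real N + 2) * t)"
proof (rule box_H_leI)
  fix A assume "A : principal_pyramid X Int DM_K N"
  hence A: "A : DM_K N" "class_le A X" by (auto simp: principal_pyramid_def)
  obtain B where "B : DM_K N" "class_le B Z" "d_box A B <= (real N + 2) * t" by (rule fam_near_below[OF X Z n(1) e t N A])
  thus "EX B:principal_pyramid Z Int DM_K N. d_box A B <= (real N + 2) * t" using DM_K_DD_K by (auto simp: principal_pyramid_def)
next
  fix A assume "A : principal_pyramid Z Int DM_K N"
  hence A: "A : DM_K N" "class_le A Z" by (auto simp: principal_pyramid_def)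
  obtain B where "B : DM_K N" "class_le B X" "d_box A B <= (real N + 2) * t" by (rule fam_near_below[OF Z X n(2) e t N A])
  thus "EX B:principal_pyramid X Int DM_K N. d_box B A <= (real N + 2) * t" using DM_K_DD_K d_box_commute[of A] by (auto simp: principal_pyramid_def)
qed

section \<open>The embedding\<close>

abbreviation psi :: "data_class => data_class set" where "psi A \<equiv> principal_pyramid (screen_class A)"

lemma psi: "A : DD ==> psi A : Pi_K" by (rule principal_pyramid[OF screen_class(1)])

lemma fam_near_d_tau:
  assumes A: "A : DD" and B: "B : DD" and d: "d_tau A B < e"
  shows "fam_near e (rlaw A) (K_tau (rep A)) (rlaw B) (K_tau (rep B))"
proof -
  note g = geometric_rep(1)[OF A] geometric_rep(1)[OF B]
  have "0 <= d_tau A B" using Metric_space.nonneg[OF Metric_space_d_tau] .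
  hence "obs_dist (rep A) (rep B) < ennreal e" unfolding ennreal_d_tau[OF A B, symmetric] using d by (simp add: ennreal_less_iff)
  then obtain \<pi> where \<pi>: "coupling_of (rlaw A) (rlaw B) \<pi>" "ALL f:K_tau (rep A). EX g:K_tau (rep B). cost \<pi> f g < ennreal e"
    by (rule obs_dist_lessE[OF g])
  show ?thesis unfolding fam_near_def
  proof (intro allI impI)
    fix F :: "nat => real => real" and N assume F: "ALL i. F i : K_tau (rep A)"
    hence "ALL i. EX g. g : K_tau (rep B) & cost \<pi> (F i) g < ennreal e" using \<pi>(2) by blast
    then obtain G where "!!i. G i : K_tau (rep B)" "!!i. cost \<pi> (F i) (G i) < ennreal e" by metis
    thus "EX G. (ALL i. G i : K_tau (rep B)) & coupled N e (rlaw A) F (rlaw B) G"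
      unfolding coupled_def using \<pi>(1) by (intro exI[of _ G]) (auto simp: cost_def intro!: exI[of _ \<pi>] less_imp_le)
  qed
qed

lemma psi_continuous:
  assumes e: "e > 0"
  shows "\<exists>\<delta>>0. ALL A:DD. ALL B:DD. d_tau A B < \<delta> --> d_Pi (psi A) (psi B) < e"
proof -
  obtain N0 where N0: "(1/2) ^ N0 < e/2" using real_arch_pow_inv[of "e/2" "1/2"] e by auto
  define t where "t = e / (2 * (real N0 + 2))"
  have t: "t > 0" "(real N0 + 2) * t = e/2" using e by (auto simp: t_def divide_simps intro!: add_nonneg_pos)
  \<comment> \<open>The chain from the screen of A over A and B to the screen of B has three links,
    and each of the two compositions takes another \<open>\<delta>\<close> of room: five in all,
    below t * t.\<close>
  define \<delta> where "\<delta> = t * t / 8"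
  have \<delta>: "\<delta> > 0" "5 * \<delta> < t * t" using t(1) by (auto simp: \<delta>_def)
  have near: "fam_near (5 * \<delta>) (rlaw (screen_class A)) (rclosure (screen_class A)) (rlaw (screen_class B)) (rclosure (screen_class B))"
    if A: "A : DD" and B: "B : DD" and d: "d_tau A B < \<delta>" for A B
  proof -
    note SA = DD_K_rep(1)[OF screen_class(1)[OF A]] and SB = DD_K_rep(1)[OF screen_class(1)[OF B]]
    have "fam_near (3 * \<delta>) (rlaw (screen_class A)) (rclosure (screen_class A)) (rlaw B) (K_tau (rep B))"
      by (rule fam_near_trans[OF fam_near_screen(1)[OF A \<delta>(1)] fam_near_d_tau[OF A B d] _ _ _
          rclosure_borel[OF SA] K_tau_borel[OF A] K_tau_borel[OF B]]) (use \<delta>(1) in auto)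
    from fam_near_trans[OF this fam_near_screen(2)[OF B \<delta>(1)] _ _ _ rclosure_borel[OF SA] K_tau_borel[OF B] rclosure_borel[OF SB]]
    show ?thesis using \<delta>(1) by simp
  qed
  have "d_Pi (psi A) (psi B) < e" if AB: "A : DD" "B : DD" and d: "d_tau A B < \<delta>" for A B
  proof -
    have d': "d_tau B A < \<delta>" using d Metric_space.commute[OF Metric_space_d_tau, of A B] by simp
    have "d_Pi (psi A) (psi B) <= e/2 + (1/2) ^ N0"
    proof (rule d_Pi_bound[OF psi[OF AB(1)] psi[OF AB(2)]])
      fix N :: nat assume N: "1 <= N" "N <= N0"
      have "box_H N (psi A) (psi B) <= ennreal ((real N + 2) * t)"
        by (rule fam_near_principal[OF screen_class(1)[OF AB(1)] screen_class(1)[OF AB(2)] near[OF AB d] near[OF AB(2,1) d'] _ \<delta>(2) t(1) N(1)])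
          (use \<delta>(1) in simp)
      also have "(real N + 2) * t <= e/2" unfolding t(2)[symmetric] using N(2) t(1) by (intro mult_right_mono) auto
      finally show "box_H N (psi A) (psi B) <= ennreal (e/2)" by (simp add: ennreal_leI)
    qed (use e in simp)
    thus ?thesis using N0 by linarith
  qed
  thus ?thesis using \<delta>(1) by blast
qed

section \<open>Continuity of the inverse\<close>

text \<open>The first N entries generate a quotient at level N, which has a near neighbour below Y.
  Of the error, 2 * e comes from the box distance and e from exchanging laws.\<close>

lemma pyramid_match:
  assumes X: "X : DD_K" and Y: "Y : DD_K" and N: "N >= 1" and e: "e > 0"
    and h: "box_H N (principal_pyramid X) (principal_pyramid Y) < ennreal e" and f: "!!i. f i : rclosure X"
  shows "EX g. (ALL i. g i : rclosure Y) & coupled N (3 * e) (rlaw X) f (rlaw Y) g"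
proof -
  note XD = DD_K_rep(1)[OF X] and YD = DD_K_rep(1)[OF Y]
  let ?f = "%i. f (min i (N - 1))"
  have tl: "ALL i>=N. ?f i = ?f (N - 1)" by (auto simp: min_def intro!: arg_cong[of _ _ f])
  obtain A F where A: "A : DM_K N" "class_le A X" "enum N A F" "seq_law (rlaw A) F = seq_law (rlaw X) ?f"
    by (rule ex_quotient[OF X N _ tl]) (use f in auto)
  note AD = DM_K_DD[OF A(1)]
  have Fc: "F i : rclosure A" for i by (rule geom_data.frame_closure[OF geom_data_rep[OF AD] enum_frame(1)[OF AD A(3) N]])
  have "A : principal_pyramid X" using A DM_K_DD_K by (simp add: principal_pyramid_def)
  then obtain B where B: "B : principal_pyramid Y Int DM_K N" "d_box A B < e" using box_H_lessD(1)[OF h _ A(1)] by blast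
  hence BD: "B : DD" "B : DD_K" "class_le B Y" using DM_K_DD DM_K_DD_K by (auto simp: principal_pyramid_def)
  obtain T where T: "ALL f:rclosure A. T f : features (rep B)"
    "ALL F N. (ALL i. F i : rclosure A) --> coupled N (2 * e) (rlaw A) F (rlaw B) (%i. T (F i))"
    by (rule coupled_of_d_box[OF DM_K_DD_K[OF A(1)] BD(2) B(2)])
  have g: "T (F i) : rclosure B" for i using T(1) Fc geom_data.features_closure[OF geom_data_rep[OF BD(1)]] by blast
  obtain S where S: "ALL f:rclosure B. S f : rclosure Y"
    "ALL F. (ALL i. F i : rclosure B) --> seq_law (rlaw B) F = seq_law (rlaw Y) (%i. S (F i))" by (rule class_leD[OF BD(1) YD BD(3)])
  have Sg: "S (T (F i)) : rclosure Y" for i using S(1) g by blast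
  have "coupled N (2 * e) (rlaw A) F (rlaw B) (%i. T (F i))" using T(2) Fc by blast
  hence "coupled N (3 * e) (rlaw X) ?f (rlaw Y) (%i. S (T (F i)))"
  proof (rule coupled_law[OF _ A(4)])
    show "seq_law (rlaw B) (%i. T (F i)) = seq_law (rlaw Y) (%i. S (T (F i)))" using S(2)[rule_format, of "%i. T (F i)", OF g] .
  qed (use e rlaw_prob[OF XD] rlaw_prob[OF YD] rclosure_measurable[OF AD Fc] rclosure_measurable[OF BD(1) g]
      rclosure_measurable[OF XD f] rclosure_measurable[OF YD Sg] in auto)
  moreover have "min i (N - 1) = i" if "i < N" for i using that by simp
  ultimately have "coupled N (3 * e) (rlaw X) f (rlaw Y) (%i. S (T (F i)))" unfolding coupled_def by simp
  thus ?thesis using Sg by (intro exI[of _ "%i. S (T (F i))"]) auto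
qed

lemma tau_match:
  assumes A: "A : DD" and B: "B : DD" and N: "N >= 1" and e: "e > 0"
    and h: "box_H N (psi A) (psi B) < ennreal e" and f: "!!i. f i : K_tau (rep A)"
  shows "EX g. (ALL i. g i : K_tau (rep B)) & coupled N (4 * e) (rlaw A) f (rlaw B) g"
proof -
  note SA = screen_class(1)[OF A] and SB = screen_class(1)[OF B]
  note SAD = DD_K_rep(1)[OF SA] and SBD = DD_K_rep(1)[OF SB]
  obtain S where S: "!!k. k : K_tau (rep A) ==> S k : rclosure (screen_class A)"
    "!!F. ALL i. F i : K_tau (rep A) ==> seq_law (rlaw A) F = seq_law (rlaw (screen_class A)) (%i. S (F i))"
    using screen_tuples(2)[OF A] by blast
  have Sf: "S (f i) : rclosure (screen_class A)" for i by (rule S(1)[OF f])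
  obtain g where g: "ALL i. g i : rclosure (screen_class B)"
    "coupled N (3 * e) (rlaw (screen_class A)) (%i. S (f i)) (rlaw (screen_class B)) g"
    using pyramid_match[OF SA SB N e h, of "%i. S (f i)"] Sf by blast
  obtain T where T: "!!g. g : rclosure (screen_class B) ==> T g : K_tau (rep B)"
    "!!G. ALL i. G i : rclosure (screen_class B) ==> seq_law (rlaw (screen_class B)) G = seq_law (rlaw B) (%i. T (G i))"
    using screen_tuples(1)[OF B] by blast
  have Tg: "T (g i) : K_tau (rep B)" for i using T(1) g(1) by blast
  have "coupled N (4 * e) (rlaw A) f (rlaw B) (%i. T (g i))"
  proof (rule coupled_law[OF g(2) S(2)[symmetric] T(2)[OF g(1)]])
    show "ALL i. f i : K_tau (rep A)" using f by blast
  qed (use e f Tg g(1) rlaw_prob[OF A] rlaw_prob[OF B] rclosure_measurable[OF SAD Sf] rclosure_borel[OF SBD] K_tau_borel[OF A] K_tau_borel[OF B] in auto)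
  thus ?thesis using Tg by (intro exI[of _ "%i. T (g i)"]) auto
qed

definition L1_dist :: "'a measure => ('a => real) => ('a => real) => real" where
  "L1_dist M f g = enn2real (L1 M f g)"

lemma L1_dist_commute: "L1_dist M f g = L1_dist M g f" by (simp add: L1_dist_def abs_minus_commute)

context geom_data
begin

lemma L1_dist: assumes "f : K_tau X" "g : K_tau X" shows "(L1 (law X) f g) = ennreal (L1_dist (law X) f g)"
proof -
  have "\<bar>f x - g x\<bar> <= 1" if "x : points X" for x
    using K_tau_bound[OF assms(1) that] K_tau_bound[OF assms(2) that] by linarith
  hence "(L1 (law X) f g) <= (\<integral>\<^sup>+x. 1 \<partial>law X)" by (intro nn_integral_mono) (simp add: ennreal_le_1)
  hence "(L1 (law X) f g) < top" using law.emeasure_space_1 by (simp add: le_less_trans)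
  thus ?thesis by (simp add: L1_dist_def)
qed

lemma L1_dist_triangle:
  assumes "f : K_tau X" "g : K_tau X" "h : K_tau X"
  shows "L1_dist (law X) f h <= L1_dist (law X) f g + L1_dist (law X) g h"
proof -
  note [measurable] = K_tau_measurable[OF assms(1)] K_tau_measurable[OF assms(2)] K_tau_measurable[OF assms(3)]
  have "(L1 (law X) f h) <= (\<integral>\<^sup>+x. ennreal \<bar>f x - g x\<bar> + ennreal \<bar>g x - h x\<bar> \<partial>law X)"
    by (intro nn_integral_mono) (auto simp: ennreal_plus[symmetric] simp del: ennreal_plus intro!: ennreal_leI)
  also have "\<dots> = (L1 (law X) f g) + (L1 (law X) g h)" by (rule nn_integral_add) auto
  finally have "ennreal (L1_dist (law X) f h) <= ennreal (L1_dist (law X) f g + L1_dist (law X) g h)"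
    unfolding L1_dist[OF assms(1,3)] L1_dist[OF assms(1,2)] L1_dist[OF assms(2,3)]
    by (simp add: ennreal_plus[symmetric] L1_dist_def del: ennreal_plus)
  thus ?thesis by (subst (asm) ennreal_le_iff) (auto simp: L1_dist_def)
qed

text \<open>Total boundedness in mean, with the net taken from a dense sequence: functions avoiding
  ever longer initial pieces of h would accumulate in \<open>K_tau\<close> at a function that some h
  n approximates.\<close>

lemma K_tau_net:
  assumes e: "e > 0"
  obtains h and M :: nat where "ALL n. h n : K_tau X" "ALL k:K_tau X. EX n<M. L1_dist (law X) k (h n) <= e"
proof -
  have Ke: "K_tau X <= extensional (points X)" using K_tau_ext by blast
  obtain h :: "nat => 'a => real" where h: "range h <= K_tau X" "K_tau X <= pointwise_closure (points X) (range h)"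
    by (rule countable_dense_family[OF Ke K_tau_ne K_tau_lip])
  have hK: "h n : K_tau X" for n using h(1) by blast
  have ap: "EX n. L1_dist (law X) k (h n) <= e/2" if k: "k : K_tau X" for k
  proof -
    have "EX c. (L1 (law X) k (h c)) <= ennreal (e/2)"
      by (rule L1_approx) (use Ke h hK k e K_tau_lip K_tau_bound in \<open>auto simp: subset_iff\<close>)
    thus ?thesis using L1_dist[OF k hK] e by (auto simp: ennreal_le_iff)
  qed
  have "EX M. ALL k:K_tau X. EX n<M. L1_dist (law X) k (h n) <= e"
  proof (rule ccontr)
    assume "\<not> ?thesis"
    hence "ALL M. EX k:K_tau X. ALL n<M. \<not> L1_dist (law X) k (h n) <= e" by blast
    then obtain k where k: "!!M. k M : K_tau X" "!!M n. n < M ==> \<not> L1_dist (law X) (k M) (h n) <= e" by metis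
    have kc: "k n : pointwise_closure (points X) (K_tau X)" for n using k(1) by (simp add: K_tau_def)
    obtain r G where r: "strict_mono (r :: nat => nat)" and G: "!!i. G i : pointwise_closure (points X) (K_tau X)"
      and l: "!!(i :: nat) x. x : points X ==> (%n. k (r n) x) \<longlonglongrightarrow> G i x"
      by (rule closure_seq_compact[where H = "K_tau X" and c = "1/2" and F = "%n i. k n", OF Ke K_tau_lip _ kc])
        (use K_tau_bound in blast)+
    have GK: "G 0 : K_tau X" using G[of 0] by (simp add: K_tau_def)
    obtain n where n: "L1_dist (law X) (G 0) (h n) <= e/2" using ap[OF GK] by blast
    have "(%n. \<integral>\<^sup>+x. ennreal \<bar>G 0 x - k (r n) x\<bar> \<partial>law X) \<longlonglongrightarrow> 0"
      using l K_tau_bound[OF GK] K_tau_bound[OF k(1)] by (intro L1_limit law.prob_space_axioms K_tau_measurable GK k(1)) auto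
    hence "\<forall>\<^sub>F m in sequentially. (L1 (law X) (G 0) (k (r m))) < ennreal (e/2)" by (rule order_tendstoD) (use e in simp)
    hence ev: "\<forall>\<^sub>F m in sequentially. (L1 (law X) (G 0) (k (r m))) < ennreal (e/2) & n < m"
      by (intro eventually_conj eventually_gt_at_top)
    obtain m where m: "(L1 (law X) (G 0) (k (r m))) < ennreal (e/2)" "n < m" using eventually_happens'[OF sequentially_bot ev] by blast
    have "L1_dist (law X) (G 0) (k (r m)) < e/2" using m(1) e unfolding L1_dist[OF GK k(1)] by (simp add: ennreal_less_iff L1_dist_def)
    hence "L1_dist (law X) (k (r m)) (h n) <= e"
      using L1_dist_triangle[OF k(1) GK hK, of "r m" n] n L1_dist_commute[of "law X" "G 0"] by simp
    moreover have "n < r m" using m(2) seq_suble[OF r, of m] by linarith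
    ultimately show False using k(2) by blast
  qed
  thus thesis using that hK by blast
qed

end

text \<open>Coupled tuples have almost the same mutual mean distances, so separation survives a
  transfer.\<close>

lemma coupled_L1_dist:
  assumes X: "geometric_dataset X" and Y: "geometric_dataset Y" and c: "coupled N e (law X) F (law Y) G" and e: "e >= 0"
    and ij: "i < N" "j < N" and F: "F i : K_tau X" "F j : K_tau X" and G: "G i : K_tau Y" "G j : K_tau Y"
  shows "L1_dist (law X) (F i) (F j) <= L1_dist (law Y) (G i) (G j) + 2 * e"
proof -
  interpret X: geom_data X by standard (rule X)
  interpret Y: geom_data Y by standard (rule Y)
  obtain q where q: "coupling_of (law X) (law Y) q" and c: "!!i. i < N ==> (L1c q (F i) (G i)) <= ennreal e"
    using c unfolding coupled_def by blast
  note [measurable] = coupling_ofD(5,6)[OF q] X.K_tau_measurable[OF F(1)] X.K_tau_measurable[OF F(2)] Y.K_tau_measurable[OF G(1)] Y.K_tau_measurable[OF G(2)]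
  have "ennreal (L1_dist (law X) (F i) (F j)) = (L1 (distr q (law X) fst) (F i) (F j))" unfolding coupling_ofD(3)[OF q] X.L1_dist[OF F] ..
  also have "\<dots> = (\<integral>\<^sup>+z. ennreal \<bar>F i (fst z) - F j (fst z)\<bar> \<partial>q)" by (rule nn_integral_distr) auto
  also have "\<dots> <= (\<integral>\<^sup>+z. ennreal \<bar>F i (fst z) - G i (snd z)\<bar> + (ennreal \<bar>G i (snd z) - G j (snd z)\<bar> + ennreal \<bar>F j (fst z) - G j (snd z)\<bar>) \<partial>q)"
    by (intro nn_integral_mono) (auto simp: ennreal_plus[symmetric] simp del: ennreal_plus intro!: ennreal_leI)
  also have "\<dots> = (L1c q (F i) (G i)) +
      ((\<integral>\<^sup>+z. ennreal \<bar>G i (snd z) - G j (snd z)\<bar> \<partial>q) + (L1c q (F j) (G j)))"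
    by (subst nn_integral_add; (subst nn_integral_add)?) auto
  also have "(\<integral>\<^sup>+z. ennreal \<bar>G i (snd z) - G j (snd z)\<bar> \<partial>q) = (L1 (distr q (law Y) snd) (G i) (G j))"
    by (rule nn_integral_distr[symmetric]) auto
  also have "\<dots> = ennreal (L1_dist (law Y) (G i) (G j))" unfolding coupling_ofD(4)[OF q] Y.L1_dist[OF G] ..
  also have "(L1c q (F i) (G i)) +
      (ennreal (L1_dist (law Y) (G i) (G j)) + (L1c q (F j) (G j)))
      <= ennreal e + (ennreal (L1_dist (law Y) (G i) (G j)) + ennreal e)" by (intro add_mono c ij order_refl)
  also have "\<dots> = ennreal (L1_dist (law Y) (G i) (G j) + 2 * e)" using e by (simp add: ennreal_plus[symmetric] L1_dist_def del: ennreal_plus)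
  finally show ?thesis by (subst (asm) ennreal_le_iff) (use e in \<open>auto simp: L1_dist_def\<close>)
qed

text \<open>Used to give the strict separation of a finite tuple a margin that absorbs the transfer
  errors.\<close>

lemma finite_strict_margin:
  fixes v :: "'a => real"
  assumes "finite S" "ALL p:S. e < v p"
  shows "EX d>0. ALL p:S. e + d < v p" using assms
proof (induction S)
  case (insert p S)
  then obtain d where d: "d > 0" "ALL p:S. e + d < v p" by auto
  have "e < v p" using insert by simp
  thus ?case using d by (intro exI[of _ "min d ((v p - e) / 2)"]) (auto simp: min_def field_simps)
qed (auto intro: exI[of _ 1])

text \<open>A maximal e-separated tuple of features of A stays separated after transfer to a nearby B, and an
  additional separated feature of B would transfer back to a longer separated tuple of A; so
  the transferred tuple is a net on both sides.\<close>

lemma psi_inverse_continuous: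
  assumes A: "A : DD" and e0: "e0 > 0"
  shows "\<exists>\<delta>>0. ALL B:DD. d_Pi (psi A) (psi B) < \<delta> --> d_tau A B < e0"
proof -
  \<comment> \<open>The final bound is e + 3 * t with t <= e, which is below 5 * e.\<close>
  define e where "e = e0 / 5"
  have e: "e > 0" using e0 by (simp add: e_def)
  note gA = geometric_rep(1)[OF A]
  interpret A: geom_data "rep A" by standard (rule gA)
  let ?K = "K_tau (rep A)" and ?d = "L1_dist (rlaw A)"
  define sep where "sep N k \<longleftrightarrow> (ALL i. k i : ?K) & (ALL i<N. ALL j<i. e < ?d (k i) (k j))" for N :: nat and k
  obtain h and M :: nat where h: "ALL n. h n : ?K" "ALL k:?K. EX n<M. ?d k (h n) <= e/2" by (rule A.K_tau_net[of "e/2"]) (use e in auto)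
  \<comment> \<open>Separated tuples have bounded length, since two entries near the same net
    element would be too close; so a longest one exists.\<close>
  have bd: "N <= M" if s: "EX k. sep N k" for N
  proof -
    obtain k where k: "sep N k" using s by blast
    hence kK: "k i : ?K" for i by (simp add: sep_def)
    have "ALL i. EX n. n < M & ?d (k i) (h n) <= e/2" using h(2) kK by blast
    then obtain c where c: "!!i. c i < M" "!!i. ?d (k i) (h (c i)) <= e/2" by metis
    have "c i ~= c j" if ij: "i < N" "j < i" for i j
    proof
      assume eq: "c i = c j"
      have "?d (k i) (k j) <= ?d (k i) (h (c i)) + ?d (h (c i)) (k j)" by (rule A.L1_dist_triangle) (use kK h(1) in auto)
      also have "\<dots> <= e" using c(2)[of i] c(2)[of j] eq L1_dist_commute[of "rlaw A" "k j"] by simp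
      finally show False using k ij unfolding sep_def by force
    qed
    hence "inj_on c {..<N}" unfolding inj_on_def by (metis lessThan_iff nat_neq_iff)
    hence "card {..<N} <= card {..<M}" by (rule card_inj_on_le) (use c(1) in auto)
    thus ?thesis by simp
  qed
  obtain k0 where k0: "k0 : ?K" using A.K_tau_ne by blast
  define N where "N = (GREATEST N. EX k. sep N k)"
  have s1: "EX k. sep 1 k" using k0 by (intro exI[of _ "%_. k0"]) (simp add: sep_def)
  have Nm: "EX k. sep N k" unfolding N_def by (rule GreatestI_nat[of "%N. EX k. sep N k", OF s1]) (use bd in blast)
  have Nmax: "n <= N" if "EX k. sep n k" for n unfolding N_def by (rule Greatest_le_nat[of "%N. EX k. sep N k", OF that]) (use bd in blast)
  have N1: "N >= 1" by (rule Nmax[OF s1])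
  obtain k where k: "sep N k" using Nm by blast
  hence kK: "k i : ?K" for i by (simp add: sep_def)
  have net: "EX i<N. ?d f (k i) <= e" if f: "f : ?K" for f
  proof (rule ccontr)
    assume "\<not> ?thesis"
    hence "sep (Suc N) (k(N := f))" using k f unfolding sep_def by (auto simp: less_Suc_eq)
    thus False using Nmax[of "Suc N"] by auto
  qed
  have "EX d>0. ALL p:{(i, j). i < N & j < i}. e + d < (%(i, j). ?d (k i) (k j)) p"
  proof (rule finite_strict_margin)
    have "{(i, j). i < N & j < i} <= {..<N} \<times> {..<N}" by auto
    thus "finite {(i, j). i < N & j < i}" by (rule finite_subset) simp
  qed (use k in \<open>auto simp: sep_def\<close>)
  then obtain d where d: "d > 0" "!!i j. i < N ==> j < i ==> e + d < ?d (k i) (k j)" by auto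
  \<comment> \<open>Two transfers, each losing 2 * t of separation, must not use up the margin
    d.\<close>
  define t where "t = min (d/4) e"
  have t: "t > 0" "4 * t <= d" "t <= e" using d(1) e by (auto simp: t_def)
  \<comment> \<open>Makes the levels N and Suc N both t/4-close, and \<open>tau_match\<close>
    multiplies by 4. The weights are indexed from 0, so those of the two levels have indices N - 1
    and N.\<close>
  define \<delta> where "\<delta> = t/4 * min (pyr_coeff (N - 1)) (pyr_coeff N)"
  have \<delta>: "\<delta> > 0" using t(1) pyr_coeff(1) by (simp add: \<delta>_def)
  have "d_tau A B < e0" if B: "B : DD" and dB: "d_Pi (psi A) (psi B) < \<delta>" for B
  proof -
    note gB = geometric_rep(1)[OF B]
    interpret B: geom_data "rep B" by standard (rule gB)
    have H: "box_H n (psi A) (psi B) < ennreal (t/4)" if n: "n = N \<or> n = Suc N" for n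
    proof -
      have n1: "n >= 1" using n N1 by auto
      have "\<delta> <= t/4 * pyr_coeff (n - 1)" unfolding \<delta>_def using n t(1) by (intro mult_left_mono) auto
      hence "d_Pi (psi A) (psi B) < t/4 * pyr_coeff (n - 1)" using dB by linarith
      hence "d_Pi (psi A) (psi B) / pyr_coeff (n - 1) < t/4" using pyr_coeff(1)[of "n - 1"] by (simp add: divide_less_eq)
      hence "ennreal (d_Pi (psi A) (psi B) / pyr_coeff (n - 1)) < ennreal (t/4)" using t(1) by (intro ennreal_lessI) auto
      with box_H_le_d_Pi[OF psi[OF A] psi[OF B] n1] show ?thesis by (rule le_less_trans)
    qed
    have t4: "t/4 > 0" using t(1) by simp
    have H': "box_H (Suc N) (psi B) (psi A) < ennreal (t/4)" using H[of "Suc N"] box_H_commute[where P = "psi A" and Q = "psi B"] by simp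
    obtain l where l: "ALL i. l i : K_tau (rep B)" "coupled N (4 * (t/4)) (rlaw A) k (rlaw B) l"
      using tau_match[OF A B N1 t4 H[OF disjI1[OF refl]], of k, OF kK] by (elim exE conjE)
    have cl: "coupled N t (rlaw A) k (rlaw B) l" using l(2) by simp
    obtain \<pi> where \<pi>: "coupling_of (rlaw A) (rlaw B) \<pi>" "!!i. i < N ==> cost \<pi> (k i) (l i) <= ennreal t"
      using cl unfolding coupled_def cost_def by blast
    have netB: "EX i<N. L1_dist (rlaw B) g (l i) <= e + 2 * t" if g: "g : K_tau (rep B)" for g
    proof (rule ccontr)
      assume far: "\<not> ?thesis"
      define l' where "l' = l(N := g)"
      have l': "l' i : K_tau (rep B)" for i using l(1) g by (simp add: l'_def)
      obtain k' where k': "ALL i. k' i : ?K" "coupled (Suc N) (4 * (t/4)) (rlaw B) l' (rlaw A) k'"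
        using tau_match[OF B A _ t4 H', of l', OF _ l'] by auto
      have ck: "coupled (Suc N) t (rlaw B) l' (rlaw A) k'" using k'(2) by simp
      have "e < ?d (k' i) (k' j)" if ij: "i < Suc N" "j < i" for i j
      proof -
        have 1: "L1_dist (rlaw B) (l' i) (l' j) <= ?d (k' i) (k' j) + 2 * t"
          by (rule coupled_L1_dist[OF gB gA ck]) (use ij t(1) l' k' in auto)
        \<comment> \<open>Pairs with the new entry are e + 2 * t apart by the choice of g; old pairs
          rely on the margin d of the original tuple.\<close>
        show ?thesis
        proof (cases "i = N")
          case True
          hence "L1_dist (rlaw B) g (l j) > e + 2 * t" using far ij by (auto simp: not_le)
          thus ?thesis using 1 True ij by (simp add: l'_def)
        next
          case False
          hence i: "i < N" "j < N" using ij by auto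
          have "?d (k i) (k j) <= L1_dist (rlaw B) (l i) (l j) + 2 * t"
            by (rule coupled_L1_dist[OF gA gB cl]) (use i t(1) kK l(1) in auto)
          moreover have "l' i = l i" "l' j = l j" using i by (auto simp: l'_def)
          ultimately show ?thesis using 1 d(2)[OF i(1) ij(2)] t(2) by simp
        qed
      qed
      hence "sep (Suc N) k'" using k'(1) by (simp add: sep_def)
      thus False using Nmax[of "Suc N"] by auto
    qed
    have "obs_dist (rep A) (rep B) <= ennreal (e + 3 * t)"
    proof (rule obs_dist_leI[OF gA gB \<pi>(1)])
      fix f assume f: "f : ?K"
      then obtain i where i: "i < N" "?d f (k i) <= e" using net by blast
      have "cost \<pi> f (l i) <= (L1 (rlaw A) f (k i)) + cost \<pi> (k i) (l i)"
        by (rule cost_shift_left[OF \<pi>(1)]) (use A.K_tau_measurable f kK B.K_tau_measurable l(1) in auto)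
      also have "\<dots> <= ennreal e + ennreal t" unfolding A.L1_dist[OF f kK] using i \<pi>(2) by (intro add_mono ennreal_leI) auto
      also have "\<dots> <= ennreal (e + 3 * t)" using e t(1) by (simp add: ennreal_plus[symmetric] ennreal_leI del: ennreal_plus)
      finally show "EX g:K_tau (rep B). cost \<pi> f g <= ennreal (e + 3 * t)" using l(1) by blast
    next
      fix g assume g: "g : K_tau (rep B)"
      then obtain i where i: "i < N" "L1_dist (rlaw B) g (l i) <= e + 2 * t" using netB by blast
      have li: "l i : K_tau (rep B)" using l(1) by blast
      have "cost \<pi> (k i) g <= cost \<pi> (k i) (l i) + (L1 (rlaw B) (l i) g)"
        by (rule cost_shift[OF \<pi>(1)]) (use A.K_tau_measurable kK B.K_tau_measurable li g in auto)
      also have "\<dots> <= ennreal t + ennreal (e + 2 * t)" unfolding B.L1_dist[OF li g]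
        using i \<pi>(2) L1_dist_commute[of "rlaw B" g] by (intro add_mono ennreal_leI) auto
      also have "\<dots> = ennreal (e + 3 * t)" using e t(1) by (simp add: ennreal_plus[symmetric] algebra_simps del: ennreal_plus)
      finally show "EX f:?K. cost \<pi> f g <= ennreal (e + 3 * t)" using kK by blast
    qed
    hence "ennreal (d_tau A B) <= ennreal (e + 3 * t)" unfolding ennreal_d_tau[OF A B] .
    hence "d_tau A B <= e + 3 * t" by (subst (asm) ennreal_le_iff) (use e t(1) in auto)
    thus ?thesis using t(3) e by (simp add: e_def)
  qed
  thus ?thesis using \<delta> by blast
qed

section \<open>Density\<close>

lemma pyramid_upper:
  assumes P: "P : Pi_K" and U: "finite U" "U <= P"
  shows "EX Z:P. ALL B:U. class_le B Z" using U
proof (induction U)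
  case empty
  thus ?case using pyramid_ne[OF P] by blast
next
  case (insert B U)
  then obtain Z where Z: "Z : P" "ALL C:U. class_le C Z" by blast
  obtain W where W: "W : P" "class_le B W" "class_le Z W" using pyramid_directed[OF P _ Z(1), of B] insert by blast
  have DD: "C : DD" if "C : P" for C using that pyramid_subset[OF P] DD_K_rep(1) by blast
  have "class_le C W" if C: "C : U" for C
  proof (rule class_le_trans[OF DD DD DD])
    show "class_le C Z" "class_le Z W" using C Z W by auto
  qed (use C insert Z W in auto)
  thus ?case using W by blast
qed

lemma seq_law_cong: "(!!i x. x : space M ==> F i x = G i x) ==> seq_law M F = seq_law M G"
  unfolding seq_law_def by (intro distr_cong refl) auto

text \<open>Tuples with entries from a countable family are reindexings of the sequence, so one
  equality of laws covers them all.\<close>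

lemma fam_near_range:
  assumes eq: "seq_law M F = seq_law M' G" and p: "prob_space M" "prob_space M'"
    and m: "!!i. F i : borel_measurable M" "!!i. G i : borel_measurable M'" and e: "e > 0"
  shows "fam_near e M (range F) M' (range G)"
proof (rule fam_near_law[where T = "%h. G (inv_into UNIV F h)", OF _ _ p _ _ e])
  show "ALL K. (ALL i. K i : range F) --> seq_law M K = seq_law M' (%i. G (inv_into UNIV F (K i)))"
  proof (intro allI impI)
    fix K :: "nat => _" assume K: "ALL i. K i : range F"
    let ?c = "%i. inv_into UNIV F (K i)"
    have "(%i. F (?c i)) = K" using K by (simp add: f_inv_into_f)
    thus "seq_law M K = seq_law M' (%i. G (?c i))"
      using seq_law_reindex[where F = F and c = ?c, OF m(1)] seq_law_reindex[where F = G and c = ?c, OF m(2)] eq by simp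
  qed
qed (use m in auto)

lemma fam_near_mono: "fam_near e M H M' H' ==> H' <= H'' ==> fam_near e M H M' H''"
  unfolding fam_near_def by (meson subsetD)

text \<open>Shrinking the features of Z by a factor s < 1 keeps them away from the ends of the range of tau,
  so that they can be written as tau of genuine real features.\<close>

lemma ex_tau_model:
  assumes Z: "Z : DD_K" and e: "e > 0"
  shows "EX A:DD. fam_near e (rlaw Z) (rclosure Z) (rlaw (screen_class A)) (rclosure (screen_class A)) &
    fam_near e (rlaw (screen_class A)) (rclosure (screen_class A)) (rlaw Z) (rclosure Z)"
proof -
  note ZD = DD_K_rep(1)[OF Z]
  interpret Z: geom_data "rep Z" by (rule geom_data_rep[OF ZD])
  \<comment> \<open>Each composition of comparisons takes some room; both chains below end with 5 *
    d + d < 8 * d.\<close>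
  define d where "d = e / 8"
  have d: "d > 0" "e = 8 * d" using e by (auto simp: d_def)
  \<comment> \<open>The bound 1/2 keeps s positive, and 1 - s <= d makes shrinking cheap in
    mean.\<close>
  define s where "s = 1 - min (1/2) d"
  have s: "0 < s" "s < 1" "1 - s <= d" using d(1) by (auto simp: s_def min_def)
  obtain f where f: "frame (rep Z) f" by (rule Z.ex_frame)
  note fc = Z.frame_closure[OF f] and fm = Z.frame_measurable[OF f]
  have fb: "\<bar>f i x\<bar> <= 1/2" if "x : points (rep Z)" for i x by (rule rclosure_bound[OF Z fc that])
  let ?sf = "%i x. s * f i x"
  have sfb: "?sf i x : {-s/2..s/2}" if "x : points (rep Z)" for i x
  proof -
    have "\<bar>?sf i x\<bar> <= s * (1/2)" unfolding abs_mult using s(1) fb[OF that, of i] by (intro mult_mono) auto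
    hence "\<bar>?sf i x\<bar> <= s/2" by simp
    from abs_le_D1[OF this] abs_le_D2[OF this] show ?thesis unfolding atLeastAtMost_iff by linarith
  qed
  \<comment> \<open>On this compact interval \<open>tau_inv\<close> is bounded and uniformly
    continuous, with bound and modulus common to all i. This gives the finiteness and separability
    in the supremum distance that \<open>ex_class_with_law\<close> demands.\<close>
  have cont: "continuous_on {-s/2..s/2} tau_inv"
    using s(2) isCont_tau_inv by (intro continuous_at_imp_continuous_on) (auto simp: abs_less_iff)
  have uc: "uniformly_continuous_on {-s/2..s/2} tau_inv" by (rule compact_uniformly_continuous[OF cont]) simp
  have "bounded (tau_inv ` {-s/2..s/2})" by (rule compact_imp_bounded[OF compact_continuous_image[OF cont]]) simp
  then obtain c where "ALL y:tau_inv ` {-s/2..s/2}. norm y <= c" unfolding bounded_iff by blast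
  hence c: "\<bar>tau_inv y\<bar> <= c" if "y : {-s/2..s/2}" for y using that unfolding real_norm_def by blast
  define g where "g i x = tau_inv (s * f i x)" for i x
  have gm: "g i : borel_measurable (rlaw Z)" for i unfolding g_def using fm[of i] by measurable
  obtain D where D: "Z.dense_points D" by (rule Z.dense_seq)
  note Dp = Z.dense_pointsD(1)[OF D]
  define z where "z a i = g i (D a)" for a i
  have "AE x in seq_law (rlaw Z) g. ALL r>0. EX a. x : supball (z a) r"
  proof (rule seq_law_separated[OF gm])
    fix x and r :: real assume "x : space (rlaw Z)" and r: "r > 0"
    hence x: "x : points (rep Z)" by simp
    obtain q where q: "q > 0" "!!u v. u : {-s/2..s/2} ==> v : {-s/2..s/2} ==> dist v u < q ==> dist (tau_inv v) (tau_inv u) < r"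
      using uc r unfolding uniformly_continuous_on_def by meson
    obtain a where a: "data_dist (rep Z) x (D a) < q" using Z.dense_pointsD(2)[OF D x q(1)] by blast
    have "\<bar>g i x - z a i\<bar> <= r" for i
    proof -
      have "\<bar>f i x - f i (D a)\<bar> <= data_dist (rep Z) x (D a)" using Z.frame_lip[OF f] x Dp unfolding Z.lip_def by blast
      hence fq: "\<bar>f i x - f i (D a)\<bar> < q" using a by (rule le_less_trans)
      have "\<bar>?sf i x - ?sf i (D a)\<bar> <= 1 * \<bar>f i x - f i (D a)\<bar>"
        unfolding right_diff_distrib[symmetric] abs_mult using s by (intro mult_right_mono) auto
      hence "dist (?sf i x) (?sf i (D a)) < q" unfolding dist_real_def mult_1 using fq by (rule le_less_trans)
      from q(2)[OF sfb[OF Dp] sfb[OF x] this] show ?thesis by (simp add: g_def z_def dist_real_def)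
    qed
    thus "EX a. ALL i. \<bar>g i x - z a i\<bar> <= r" by blast
  qed
  hence ae: "AE x in seq_law (rlaw Z) g. ALL r>0. EX y:range z. x : supball y r" by simp
  have fin: "EX c. ALL i. \<bar>y i - y' i\<bar> <= c" if y: "y : range z" "y' : range z" for y y'
  proof (intro exI[of _ "2 * c"] allI)
    fix i
    have "\<bar>z a i\<bar> <= c" for a unfolding z_def g_def by (rule c[OF sfb[OF Dp]])
    hence "\<bar>y i\<bar> <= c" "\<bar>y' i\<bar> <= c" using y by auto
    thus "\<bar>y i - y' i\<bar> <= 2 * c" by linarith
  qed
  obtain A F where A: "A : DD" and F: "frame (rep A) F" "seq_law (rlaw A) F = seq_law (rlaw Z) g"
    by (rule ex_class_with_law[OF prob_seq_law[OF rlaw_prob[OF ZD] gm] sets_seq_law _ fin ae]) auto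
  interpret A: geom_data "rep A" by (rule geom_data_rep[OF A])
  define K where "K i = compose (points (rep A)) tau (F i)" for i
  have KK: "K i : K_tau (rep A)" for i unfolding K_def by (rule A.tau_closure[OF A.frame_closure[OF F(1)]])
  note Km = A.K_tau_measurable[OF KK]
  have tm: "tau : borel_measurable borel" using continuous_tau by (rule borel_measurable_continuous_onI)
  have tauc: "(%x :: nat => real. tau (x i)) : borel_measurable borel" for i using tm by measurable
  have pull: "seq_law M (%i x. tau (G i x)) = seq_law (seq_law M G) (%i x. tau (x i))" if "!!i. G i : borel_measurable M" for G and M :: "real measure"
    unfolding seq_law_def[of M G] by (rule seq_law_distr[OF seq_measurable[OF that] tauc, symmetric])
  have "seq_law (rlaw A) K = seq_law (rlaw A) (%i x. tau (F i x))" by (rule seq_law_cong) (simp add: K_def compose_def)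
  also have "\<dots> = seq_law (rlaw Z) (%i x. tau (g i x))" using pull[of F, OF A.frame_measurable[OF F(1)]] pull[of g, OF gm] F(2) by simp
  also have "\<dots> = seq_law (rlaw Z) ?sf"
  proof (rule seq_law_cong)
    fix i x assume "x : space (rlaw Z)"
    hence "?sf i x : {-s/2..s/2}" using sfb by simp
    hence "\<bar>?sf i x\<bar> < 1/2" using s(2) by (auto simp: abs_less_iff)
    thus "tau (g i x) = ?sf i x" unfolding g_def by (rule tau_tau_inv)
  qed
  finally have law: "seq_law (rlaw A) K = seq_law (rlaw Z) ?sf" .
  have sfm: "?sf i : borel_measurable (rlaw Z)" for i using fm[of i] by measurable
  have fs: "(L1 (rlaw Z) (f i) (?sf i)) <= ennreal d" "(L1 (rlaw Z) (?sf i) (f i)) <= ennreal d" for i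
  proof -
    have "\<bar>f i x - ?sf i x\<bar> <= d" if "x : points (rep Z)" for x
    proof -
      have "\<bar>f i x - ?sf i x\<bar> = (1 - s) * \<bar>f i x\<bar>" using s(2) abs_mult[of "1 - s" "f i x"] by (simp add: algebra_simps)
      also have "\<dots> <= d * 1" using s(2,3) fb[OF that, of i] d(1) by (intro mult_mono) auto
      finally show ?thesis by simp
    qed
    hence "(L1 (rlaw Z) (f i) (?sf i)) <= (\<integral>\<^sup>+x. ennreal d \<partial>rlaw Z)" by (intro nn_integral_mono ennreal_leI) simp
    also have "\<dots> = ennreal d" using Z.law.emeasure_space_1 by simp
    finally show "(L1 (rlaw Z) (f i) (?sf i)) <= ennreal d" .
    thus "(L1 (rlaw Z) (?sf i) (f i)) <= ennreal d" by (simp add: abs_minus_commute)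
  qed
  let ?S = "screen_class A"
  note SD = DD_K_rep(1)[OF screen_class(1)[OF A]]
  have R: "range f <= borel_measurable (rlaw Z)" "range ?sf <= borel_measurable (rlaw Z)" "range K <= borel_measurable (rlaw A)"
    using fm sfm Km by auto
  note pZ = rlaw_prob[OF ZD] and pA = rlaw_prob[OF A] and RZ = rclosure_borel[OF ZD] and RS = rclosure_borel[OF SD] and RK = K_tau_borel[OF A]
  have "fam_near d (rlaw Z) (rclosure Z) (rlaw Z) (range f)"
    by (rule fam_near_same[OF pZ RZ R(1)]) (use frame_L1_approx[OF Z f _ d(1)] in auto)
  moreover have "fam_near d (rlaw Z) (range f) (rlaw Z) (range ?sf)" by (rule fam_near_same[OF pZ R(1,2)]) (use fs(1) in auto)
  ultimately have "fam_near (3 * d) (rlaw Z) (rclosure Z) (rlaw Z) (range ?sf)"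
    by (rule fam_near_trans[OF _ _ _ _ _ RZ R(1,2)]) (use d(1) in auto)
  moreover have "fam_near d (rlaw Z) (range ?sf) (rlaw A) (K_tau (rep A))"
    by (rule fam_near_mono[OF fam_near_range[OF law[symmetric] pZ pA sfm Km d(1)]]) (use KK in auto)
  ultimately have "fam_near (5 * d) (rlaw Z) (rclosure Z) (rlaw A) (K_tau (rep A))"
    by (rule fam_near_trans[OF _ _ _ _ _ RZ R(2) RK]) (use d(1) in auto)
  hence 1: "fam_near e (rlaw Z) (rclosure Z) (rlaw ?S) (rclosure ?S)"
    by (rule fam_near_trans[OF _ fam_near_screen(2)[OF A d(1)] _ _ _ RZ RK RS]) (use d in auto)
  have Kext: "range K <= extensional (points (rep A))" by (auto simp: K_def compose_def)
  have "tau_features (rep A) <= pointwise_closure (points (rep A)) (range K)"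
  proof -
    have "compose (points (rep A)) tau h : pointwise_closure (points (rep A)) (range K)" if h: "h : features (rep A)" for h
    proof -
      have "h : pointwise_closure (points (rep A)) (range F)" using F(1) h unfolding frame_def by blast
      from pointwise_closure_postcompose[OF this continuous_tau] show ?thesis unfolding K_def by (simp add: image_image)
    qed
    thus ?thesis unfolding tau_features_def by blast
  qed
  hence Kcl: "K_tau (rep A) <= pointwise_closure (points (rep A)) (range K)" unfolding K_tau_def by (rule pointwise_closure_minimal)
  have "fam_near d (rlaw A) (K_tau (rep A)) (rlaw A) (range K)"
  proof (rule fam_near_same[OF pA RK R(3)], rule ballI)
    fix k assume "k : K_tau (rep A)"
    hence "EX c. (L1 (rlaw A) k (K c)) <= ennreal d"
      by (intro A.L1_approx[OF Kext A.K_tau_lip[OF KK] A.K_tau_bound[OF KK] _ d(1)]) (use Kcl in auto)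
    thus "EX h:range K. (L1 (rlaw A) k h) <= ennreal d" by blast
  qed
  hence "fam_near (3 * d) (rlaw ?S) (rclosure ?S) (rlaw A) (range K)"
    by (rule fam_near_trans[OF fam_near_screen(1)[OF A d(1)] _ _ _ _ RS RK R(3)]) (use d(1) in auto)
  moreover have "fam_near d (rlaw A) (range K) (rlaw Z) (range ?sf)" by (rule fam_near_range[OF law pA pZ Km sfm d(1)])
  ultimately have "fam_near (5 * d) (rlaw ?S) (rclosure ?S) (rlaw Z) (range ?sf)"
    by (rule fam_near_trans[OF _ _ _ _ _ RS R(3,2)]) (use d(1) in auto)
  moreover have "fam_near d (rlaw Z) (range ?sf) (rlaw Z) (rclosure Z)"
    by (rule fam_near_mono[OF fam_near_same[OF pZ R(2,1)]]) (use fs(2) fc in auto)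
  ultimately have 2: "fam_near e (rlaw ?S) (rclosure ?S) (rlaw Z) (rclosure Z)"
    by (rule fam_near_trans[OF _ _ _ _ _ RS R(2) RZ]) (use d in auto)
  show ?thesis using A 1 2 by blast
qed

text \<open>The principal pyramid of Z lies inside P and contains finite nets of its first N0
  levels, so it is near P; Z is then replaced by the screen of a data set from
  \<open>ex_tau_model\<close>. Each of the two steps takes e/4.\<close>

lemma psi_dense:
  assumes P: "P : Pi_K" and e: "e > 0"
  shows "EX A:DD. d_Pi P (psi A) < e"
proof -
  obtain N0 where N0: "(1/2) ^ N0 < e/2" using real_arch_pow_inv[of "e/2" "1/2"] e by auto
  have e4: "e/4 > 0" using e by simp
  have "ALL N. EX E. N >= 1 --> finite E & E <= P Int DM_K N & (ALL A:P Int DM_K N. EX B:E. d_box A B < e/4)"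
  proof
    fix N
    show "EX E. N >= 1 --> finite E & E <= P Int DM_K N & (ALL A:P Int DM_K N. EX B:E. d_box A B < e/4)"
    proof (cases "N >= 1")
      case True
      obtain E where "finite E" "E <= P Int DM_K N" "ALL A:P Int DM_K N. EX B:E. d_box A B < e/4" by (rule DM_K_net[OF True Int_lower2 e4])
      thus ?thesis by blast
    qed simp
  qed
  then obtain E where E: "!!N. N >= 1 ==> finite (E N)" "!!N. N >= 1 ==> E N <= P Int DM_K N"
    "!!N A. N >= 1 ==> A : P Int DM_K N ==> EX B:E N. d_box A B < e/4" by metis
  have "finite (\<Union>N\<in>{1..N0}. E N)" "(\<Union>N\<in>{1..N0}. E N) <= P" using E(1,2) by fastforce+
  then obtain Z where Z: "Z : P" "ALL B:(\<Union>N\<in>{1..N0}. E N). class_le B Z" using pyramid_upper[OF P] by blast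
  have ZK: "Z : DD_K" using Z(1) pyramid_subset[OF P] by blast
  define t where "t = e / (4 * (real N0 + 2))"
  have t: "t > 0" "(real N0 + 2) * t = e/4" using e by (auto simp: t_def divide_simps intro!: add_nonneg_pos)
  have tt: "t * t / 2 > 0" "0 <= t * t / 2" "t * t / 2 < t * t" using t(1) by auto
  have Nt: "(real N + 2) * t <= e/4" if "N <= N0" for N unfolding t(2)[symmetric] using that t(1) by (intro mult_right_mono) auto
  obtain A where A: "A : DD" and near: "fam_near (t * t / 2) (rlaw Z) (rclosure Z) (rlaw (screen_class A)) (rclosure (screen_class A))"
    "fam_near (t * t / 2) (rlaw (screen_class A)) (rclosure (screen_class A)) (rlaw Z) (rclosure Z)"
    using ex_tau_model[OF ZK tt(1)] by blast
  note SK = screen_class(1)[OF A]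
  have "d_Pi P (psi A) <= e/2 + (1/2) ^ N0"
  proof (rule d_Pi_bound[OF P psi[OF A]])
    fix N :: nat assume N: "1 <= N" "N <= N0"
    show "box_H N P (psi A) <= ennreal (e/2)"
    proof (rule box_H_leI)
      fix C assume C: "C : P Int DM_K N"
      then obtain B where B: "B : E N" "d_box C B < e/4" using E(3)[OF N(1)] by blast
      have BN: "B : DM_K N" "class_le B Z" using B(1) E(2)[OF N(1)] Z(2) N by auto
      obtain B' where B': "B' : DM_K N" "class_le B' (screen_class A)" "d_box B B' <= (real N + 2) * t"
        by (rule fam_near_below[OF ZK SK near(1) tt(2,3) t(1) N(1) BN])
      have "d_box C B' <= d_box C B + d_box B B'" by (rule box.triangle) (use C BN B' DM_K_DD in auto)
      hence "d_box C B' <= e/2" using B(2) B'(3) Nt[OF N(2)] by linarith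
      thus "EX B:psi A Int DM_K N. d_box C B <= e/2" using B'(1,2) DM_K_DD_K by (auto simp: principal_pyramid_def)
    next
      fix C assume "C : psi A Int DM_K N"
      hence C: "C : DM_K N" "class_le C (screen_class A)" by (auto simp: principal_pyramid_def)
      obtain B where B: "B : DM_K N" "class_le B Z" "d_box C B <= (real N + 2) * t"
        by (rule fam_near_below[OF SK ZK near(2) tt(2,3) t(1) N(1) C])
      have "B : P" by (rule pyramid_down[OF P Z(1) DM_K_DD_K[OF B(1)] B(2)])
      moreover have "d_box B C <= e/2" using B(3) Nt[OF N(2)] e by (simp add: d_box_commute)
      ultimately show "EX B:P Int DM_K N. d_box B C <= e/2" using B(1) by blast
    qed
  qed (use e in simp)
  thus ?thesis using N0 A by (intro bexI[of _ A]) auto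
qed

section \<open>A metric criterion for embeddings, and the conclusion\<close>

text \<open>Both moduli may depend on the point. The second gives injectivity as well as openness
  onto the image.\<close>

lemma metric_embedding_mapI:
  assumes M: "Metric_space M d" and N: "Metric_space N d'" and f: "f : M \<rightarrow> N"
    and c: "!!x e. x : M ==> e > 0 ==> \<exists>\<delta>>0. ALL y:M. d x y < \<delta> --> d' (f x) (f y) < e"
    and i: "!!x e. x : M ==> e > 0 ==> \<exists>\<delta>>0. ALL y:M. d' (f x) (f y) < \<delta> --> d x y < e"
  shows "embedding_map (Metric_space.mtopology M d) (Metric_space.mtopology N d') f"
proof -
  interpret M: Metric_space M d by (rule M)
  interpret N: Metric_space N d' by (rule N)
  have cont: "continuous_map M.mtopology N.mtopology f" unfolding M.metric_continuous_map[OF N] 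
  proof (intro conjI ballI allI impI)
    fix x and e :: real assume x: "x : M" "e > 0"
    show "\<exists>\<delta>>0. ALL y. y : M & d x y < \<delta> --> d' (f x) (f y) < e" using c[OF x] by blast
  qed (use f in auto)
  have inj: "inj_on f M"
  proof (rule inj_onI)
    fix x y assume xy: "x : M" "y : M" "f x = f y"
    have "f y : N" using f xy(2) by blast
    hence z: "d' (f x) (f y) = 0" using xy(3) by simp
    have "d x y < e" if "e > 0" for e using i[OF xy(1) that] xy(2) z by auto
    hence "\<not> d x y > 0" by blast
    thus "x = y" using xy M.zero[OF xy(1,2)] M.nonneg[of x y] by linarith
  qed
  have "openin (subtopology N.mtopology (f ` M)) (f ` U)" if U: "openin M.mtopology U" for U
  proof -
    have UM: "U <= M" using openin_subset[OF U] by simp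
    have "\<exists>\<delta>>0. ALL y:M. d' (f x) (f y) < \<delta> --> y : U" if x: "x : U" for x
    proof -
      obtain r where r: "r > 0" "M.mball x r <= U" using U x unfolding M.openin_mtopology by blast
      obtain \<delta> where "\<delta> > 0" "ALL y:M. d' (f x) (f y) < \<delta> --> d x y < r" using i[OF subsetD[OF UM x] r(1)] by blast
      moreover have "y : U" if "y : M" "d x y < r" for y using subsetD[OF r(2), of y] that x UM by auto
      ultimately show ?thesis by blast
    qed
    then obtain \<delta> where \<delta>: "!!x. x : U ==> \<delta> x > 0" "!!x y. x : U ==> y : M ==> d' (f x) (f y) < \<delta> x ==> y : U" by metis
    have "openin N.mtopology (\<Union>x\<in>U. N.mball (f x) (\<delta> x))" by (rule openin_Union) auto
    moreover have "f ` U = (\<Union>x\<in>U. N.mball (f x) (\<delta> x)) Int f ` M"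
    proof (intro equalityI subsetI)
      fix y assume "y : f ` U"
      then obtain x where x: "x : U" "y = f x" by blast
      moreover from this have "f x : N" using f UM by blast
      ultimately have "y : N.mball (f x) (\<delta> x)" using \<delta>(1) by simp
      thus "y : (\<Union>x\<in>U. N.mball (f x) (\<delta> x)) Int f ` M" using x UM by blast
    next
      fix y assume "y : (\<Union>x\<in>U. N.mball (f x) (\<delta> x)) Int f ` M"
      then obtain x z where "x : U" "d' (f x) y < \<delta> x" "z : M" "y = f z" by auto
      thus "y : f ` U" using \<delta>(2) by blast
    qed
    ultimately show ?thesis unfolding openin_subtopology by blast
  qed
  hence "open_map M.mtopology (subtopology N.mtopology (f ` M)) f" unfolding open_map_def by blast
  moreover have "continuous_map M.mtopology (subtopology N.mtopology (f ` M)) f" using cont by (simp add: continuous_map_in_subtopology)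
  moreover have "f ` M = topspace (subtopology N.mtopology (f ` M))" using f by auto
  ultimately have "homeomorphic_map M.mtopology (subtopology N.mtopology (f ` M)) f"
    by (intro bijective_open_imp_homeomorphic_map) (simp_all only: M.topspace_mtopology inj)
  thus ?thesis unfolding embedding_map_def M.topspace_mtopology .
qed

theorem theorem1p1:
  shows "Metric_space Pi_K d_Pi
    \<and> compact_space (Metric_space.mtopology Pi_K d_Pi)
    \<and> Metric_space DD d_tau
    \<and> embedding_map (Metric_space.mtopology DD d_tau) (Metric_space.mtopology Pi_K d_Pi)
         (\<lambda>A. principal_pyramid (screen_class A))
    \<and> (Metric_space.mtopology Pi_K d_Pi) closure_of
         ((\<lambda>A. principal_pyramid (screen_class A)) ` DD) = Pi_K"
proof (intro conjI)
  show "embedding_map (Metric_space.mtopology DD d_tau) pi.mtopology psi"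
  proof (rule metric_embedding_mapI[OF Metric_space_d_tau Metric_space_d_Pi])
    show "psi \<in> DD \<rightarrow> Pi_K" using psi by blast
    show "\<exists>\<delta>>0. \<forall>B\<in>DD. d_tau A B < \<delta> \<longrightarrow> d_Pi (psi A) (psi B) < e" if "A \<in> DD" "e > 0" for A e
      using psi_continuous[OF that(2)] that(1) by blast
  qed (rule psi_inverse_continuous)
  have "P \<in> pi.mtopology closure_of psi ` DD" if P: "P \<in> Pi_K" for P
  proof -
    have "\<exists>Q\<in>psi ` DD. Q \<in> pi.mball P r" if r: "r > 0" for r
    proof -
      obtain A where A: "A \<in> DD" "d_Pi P (psi A) < r" using psi_dense[OF P r] by blast
      hence "psi A \<in> pi.mball P r" using P psi[OF A(1)] by simp
      thus ?thesis using A(1) by blast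
    qed
    thus ?thesis unfolding pi.metric_closure_of using P by blast
  qed
  thus "pi.mtopology closure_of psi ` DD = Pi_K" using closure_of_subset_topspace[of pi.mtopology "psi ` DD"] by auto
qed (fact Metric_space_d_Pi compact_Pi_K Metric_space_d_tau)+

end
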